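(* Let $\alpha\in(0,1)$, $\overline{\delta}>\underline{\delta}>0$, let $C:[0,1]\to\mathbb{R}^{D\times D}$ be $\alpha$-H\"older continuous with $\overline{\delta}|y|^2\ge y^TC(t)C(t)^Ty\ge\underline{\delta}|y|^2$ for all $y\in\mathbb{R}^D$, $t\in[0,1]$, and let $g^{(1)},\dots,g^{(I)}\in C^{2+\alpha}(\mathbb{R}^D)$. Then there exists $T_0\in(0,1]$ such that for every $T<T_0$ the nonlinear PDE system, for $i=1,\dots,I$, $$\partial_tu^{(i)}+\tfrac1{2a_i}|\lambda|^2-\lambda^T\bar C^T\partial_yu^{(i)}+\tfrac{a_i}2\big(|\bar C^T\partial_yu^{(i)}|^2-|C^T\partial_yu^{(i)}|^2\big)+\tfrac12\mathrm{tr}\big(\partial_{yy}u^{(i)}CC^T\big)=0,\qquad u^{(i)}(T,y)=g^{(i)}(y),$$ with coupling function $$\lambda(t,y):=\frac1{\tau_\Sigma}\bar C(t)^T\sum_{j=1}^I\partial_yu^{(j)}(t,y),$$ has a unique solution $(u^{(i)})_{i=1}^I\subset C^{2+\alpha}([0,T]\times\mathbb{R}^D)$.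
   Context: $1\le N\le D$, $I\ge1$; $\bar C(t)$ is the $D\times N$ matrix formed by the first $N$ columns of $C(t)$; $a_1,\dots,a_I>0$ and $\tau_\Sigma:=\sum_{i=1}^I 1/a_i$. $C^{2+\alpha}(\mathbb{R}^D)$ is the set of $C^2$ functions $g$ with $|g|_0+|\partial_yg|_0+|\partial_{yy}g|_0+[\partial_{yy}g]_\alpha<\infty$ ($|\cdot|_0$ sup norm, $[h]_\alpha=\sup_{x\ne y}|h(x)-h(y)|/|x-y|^\alpha$). $C^{2+\alpha}([0,T]\times\mathbb{R}^D)$ is the set of $C^{1,2}$ functions $u$ with $|\partial_tu|_0+[\partial_tu]_\alpha+|u|_0+|\partial_yu|_0+|\partial_{yy}u|_0+[\partial_{yy}u]_\alpha<\infty$, where $[h]_\alpha=\sup_{(t,x)\ne(s,y)}|h(t,x)-h(s,y)|/(\sqrt{|t-s|}+|x-y|)^\alpha$. *)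

theory Defs
  imports "HOL-Analysis.Analysis"
begin

text \<open>Space variable y ranges over real^'d, D = CARD('d). The index type is linearly
ordered so that "the first N columns" makes sense: column j is among the first N
iff fewer than N indices precede it.\<close>

definition firstcols :: "nat \<Rightarrow> ('d::{finite,linorder}) set" where
  "firstcols N = {j. card {k. k < j} < N}"

text \<open>Cbar(M)^T p, an element of R^N, embedded in real^'d by padding with zeros
(the components outside the first N columns are 0); norms and inner products
of R^N are preserved by this embedding.\<close>
definition cbarT :: "nat \<Rightarrow> real^('d::{finite,linorder})^('d::{finite,linorder}) \<Rightarrow> real^('d::{finite,linorder}) \<Rightarrow> real^('d::{finite,linorder})" where
  "cbarT N M p = (\<chi> j. if j \<in> firstcols N then (transpose M *v p) $ j else 0)"

definition holder_01 :: "real \<Rightarrow> (real \<Rightarrow> real^'d^'d) \<Rightarrow> bool" where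
  "holder_01 \<alpha> C \<longleftrightarrow> (\<exists>K. \<forall>s\<in>{0..1}. \<forall>t\<in>{0..1}. norm (C s - C t) \<le> K * \<bar>s - t\<bar> powr \<alpha>)"

definition C2a_space :: "real \<Rightarrow> (real^'d \<Rightarrow> real) set" where
  "C2a_space \<alpha> = {g. \<exists>(Dg :: real^'d \<Rightarrow> real^'d) (Hg :: real^'d \<Rightarrow> real^'d^'d).
      (\<forall>y. (g has_derivative (\<lambda>h. Dg y \<bullet> h)) (at y)) \<and>
      (\<forall>y. (Dg has_derivative (\<lambda>h. Hg y *v h)) (at y)) \<and>
      continuous_on UNIV Hg \<and>
      bounded (range g) \<and> bounded (range Dg) \<and> bounded (range Hg) \<and>
      (\<exists>K. \<forall>x y. norm (Hg x - Hg y) \<le> K * dist x y powr \<alpha>)}"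

definition is_C2a_par :: "real \<Rightarrow> real \<Rightarrow> (real \<Rightarrow> real^'d \<Rightarrow> real) \<Rightarrow>
    (real \<Rightarrow> real^'d \<Rightarrow> real) \<Rightarrow> (real \<Rightarrow> real^'d \<Rightarrow> real^'d) \<Rightarrow>
    (real \<Rightarrow> real^'d \<Rightarrow> real^'d^'d) \<Rightarrow> bool" where
  "is_C2a_par \<alpha> T u ut uy uyy \<longleftrightarrow>
     (\<forall>t\<in>{0..T}. \<forall>y. ((\<lambda>s. u s y) has_real_derivative ut t y) (at t within {0..T})) \<and>
     (\<forall>t\<in>{0..T}. \<forall>y. (u t has_derivative (\<lambda>h. uy t y \<bullet> h)) (at y)) \<and>
     (\<forall>t\<in>{0..T}. \<forall>y. (uy t has_derivative (\<lambda>h. uyy t y *v h)) (at y)) \<and>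
     continuous_on ({0..T} \<times> UNIV) (\<lambda>(t,y). u t y) \<and>
     continuous_on ({0..T} \<times> UNIV) (\<lambda>(t,y). ut t y) \<and>
     continuous_on ({0..T} \<times> UNIV) (\<lambda>(t,y). uy t y) \<and>
     continuous_on ({0..T} \<times> UNIV) (\<lambda>(t,y). uyy t y) \<and>
     bounded ((\<lambda>(t,y). u t y) ` ({0..T} \<times> UNIV)) \<and>
     bounded ((\<lambda>(t,y). ut t y) ` ({0..T} \<times> UNIV)) \<and>
     bounded ((\<lambda>(t,y). uy t y) ` ({0..T} \<times> UNIV)) \<and>
     bounded ((\<lambda>(t,y). uyy t y) ` ({0..T} \<times> UNIV)) \<and>
     (\<exists>K. \<forall>t\<in>{0..T}. \<forall>s\<in>{0..T}. \<forall>x y.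
        \<bar>ut t x - ut s y\<bar> \<le> K * (sqrt \<bar>t - s\<bar> + dist x y) powr \<alpha>) \<and>
     (\<exists>K. \<forall>t\<in>{0..T}. \<forall>s\<in>{0..T}. \<forall>x y.
        norm (uyy t x - uyy s y) \<le> K * (sqrt \<bar>t - s\<bar> + dist x y) powr \<alpha>)"

definition C2a_par :: "real \<Rightarrow> real \<Rightarrow> (real \<Rightarrow> real^'d \<Rightarrow> real) set" where
  "C2a_par \<alpha> T = {u. \<exists>ut uy uyy. is_C2a_par \<alpha> T u ut uy uyy}"

definition tauSigma :: "(nat \<Rightarrow> real) \<Rightarrow> nat \<Rightarrow> real" where
  "tauSigma a I = (\<Sum>i<I. 1 / a i)"

definition solves_system :: "real \<Rightarrow> real \<Rightarrow> (real \<Rightarrow> real^('d::{finite,linorder})^('d::{finite,linorder})) \<Rightarrow> (nat \<Rightarrow> real) \<Rightarrow>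
    nat \<Rightarrow> nat \<Rightarrow> (nat \<Rightarrow> real^('d::{finite,linorder}) \<Rightarrow> real) \<Rightarrow>
    (nat \<Rightarrow> real \<Rightarrow> real^('d::{finite,linorder}) \<Rightarrow> real) \<Rightarrow> bool" where
  "solves_system \<alpha> T C a I N g u \<longleftrightarrow>
    (\<exists>ut uy uyy.
      (\<forall>i<I. is_C2a_par \<alpha> T (u i) (ut i) (uy i) (uyy i)) \<and>
      (\<forall>i<I. \<forall>y. u i T y = g i y) \<and>
      (\<forall>i<I. \<forall>t\<in>{0..T}. \<forall>y.
         (let lam = (1 / tauSigma a I) *\<^sub>R cbarT N (C t) (\<Sum>j<I. uy j t y)
          in ut i t y + 1 / (2 * a i) * (norm lam)\<^sup>2
             - lam \<bullet> cbarT N (C t) (uy i t y)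
             + a i / 2 * ((norm (cbarT N (C t) (uy i t y)))\<^sup>2
                          - (norm (transpose (C t) *v uy i t y))\<^sup>2)
             + 1 / 2 * trace (uyy i t y ** C t ** transpose (C t)) = 0)))"

end

theory Submission
  imports Defs "HOL-Probability.Probability"
begin

text \<open>
  For small times the matrix \<open>C(t) C(t)\<^sup>T\<close> is a combination, with nonnegative Hoelder continuous
  weights, of the squares \<open>v v\<^sup>T\<close> of finitely many fixed directions: the columns \<open>v\<^sub>i\<close> of
  \<open>C(0)\<close> and the vectors \<open>v\<^sub>i + v\<^sub>j\<close>, \<open>v\<^sub>i - v\<^sub>j\<close>. Hence the evolution operators
  of the linear part are compositions of commuting one-dimensional Gaussian averages, and no fundamental
  solution has to be constructed. The directions \<open>v\<^sub>i\<close> keep weights bounded below and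
  provide the smoothing.

  The nonlinearity depends on the gradients only, so that the source in Duhamel's formula is Lipschitz
  in \<open>y\<close> and the second derivatives only meet the integrable singularity
  \<open>(s - t) powr (- (1 + \<alpha>) / 2)\<close>. The gradient is therefore the fixed point of a contraction in the
  supremum norm, and its Lipschitz bound is part of the invariant set. Hoelder continuity in time of the
  second derivatives follows by interpolation between the time modulus of the solution and the space
  modulus of its second derivatives. Conversely every classical solution satisfies Duhamel's formula,
  and two such solutions agree by contraction on short intervals, going backwards from \<open>T\<close>.
\<close>

section \<open>Gaussian averages and evolution operators\<close>

text \<open>The coefficients depend on time only, so every average commutes with translations;
  bounds on differences f(y + h) - f(y) therefore survive all evolution operators. The obstacle to
  composing Gaussian averages is that off-diagonal coefficients carry a sign and cannot be
  variances. Writing C(t) = C(0) E(t) turns the diffusion matrix into C(0) M(t) C(0)^T with M(0) =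
  1. Giving the same extra weight \<epsilon> to v_i + v_j and to v_i - v_j makes all weights
  nonnegative, while the added mixed terms cancel; the diagonal weights pay for it and stay above
  1/2 up to a time T1 \<le> 1. The horizon T0 is limited by T1 and by the contraction. The exponent
  (1 + \<alpha>) / 2 interpolates between two bounds for increments of second derivatives of a
  smoothed Lipschitz source: (s - t)^(-1/2) and |h| (s - t)^(-1). It is below 1 because \<alpha> <
  1. Hoelder continuity of the source in time is not imposed on the candidates of the fixed point
  argument: it holds for the fixed point itself, whose gradients have a square root modulus in time,
  and it then yields the pointwise equation.\<close>

instance bcontfun :: (metric_space, banach) banach ..

lemma apply_Bcontfun:
  fixes f :: "'a::topological_space \<Rightarrow> 'b::real_normed_vector"
  assumes "continuous_on UNIV f" "\<And>x. norm (f x) \<le> b"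
  shows "apply_bcontfun (Bcontfun f) = f"
  using bcontfun_normI[OF assms] by (simp add: Bcontfun_inverse)

lemma bounded_linear_apply_bcontfun: "bounded_linear (\<lambda>f. apply_bcontfun f x)"
  by (rule bounded_linear_intro[where K=1]) (auto simp: norm_bounded)

lemma continuous_compose_bcontfun [continuous_intros]:
  "continuous_on S g \<Longrightarrow> continuous_on S (\<lambda>x. apply_bcontfun f (g x))"
  by (rule continuous_on_compose2[OF continuous_on_apply_bcontfun[of UNIV]]) auto

lemma measurable_compose_bcontfun [measurable (raw)]:
  fixes f :: "'a::topological_space \<Rightarrow>\<^sub>C 'b::metric_space"
  assumes "g \<in> borel_measurable M"
  shows "(\<lambda>x. apply_bcontfun f (g x)) \<in> borel_measurable M"
  by (rule measurable_compose[OF assms borel_measurable_continuous_onI]) simp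

text \<open>Translation is made an operator on the function space: since averages commute with it, a
  bound on f(y + h) - f(y) passes to the averaged function by averaging
  \<open>shift_bc h f - f\<close>.\<close>

definition shift_bc :: "'a::real_normed_vector \<Rightarrow> ('a \<Rightarrow>\<^sub>C 'b::real_normed_vector) \<Rightarrow> 'a \<Rightarrow>\<^sub>C 'b" where
  "shift_bc h f = Bcontfun (\<lambda>y. f (y + h))"

lemma shift_bc_apply [simp]: "shift_bc h f y = f (y + h)"
  unfolding shift_bc_def
  by (subst apply_Bcontfun[where b="norm f"]) (auto intro!: continuous_intros norm_bounded)

definition map_bc :: "('b::real_normed_vector \<Rightarrow> 'c::real_normed_vector) \<Rightarrow> ('a::topological_space \<Rightarrow>\<^sub>C 'b) \<Rightarrow> 'a \<Rightarrow>\<^sub>C 'c" where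
  "map_bc L f = Bcontfun (\<lambda>y. L (f y))"

lemma map_bc_apply: "bounded_linear L \<Longrightarrow> map_bc L f y = L (f y)"
proof -
  assume L: "bounded_linear L"
  obtain K where K: "\<And>x. norm (L x) \<le> norm x * K" "K \<ge> 0" using bounded_linear.nonneg_bounded[OF L] by blast
  show ?thesis unfolding map_bc_def
    by (subst apply_Bcontfun[where b="norm f * K"])
       (auto intro!: bounded_linear.continuous_on[OF L] order_trans[OF K(1)] mult_right_mono norm_bounded K)
qed

section \<open>Averages over one Gaussian direction\<close>

abbreviation "gaussM \<equiv> std_normal_distribution"

interpretation gauss: prob_space gaussM
  by (rule prob_space_normal_density) simp

lemma gauss_integrable_bc [simp, intro]:
  fixes f :: "'a::topological_space \<Rightarrow>\<^sub>C 'b::euclidean_space"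
  assumes "continuous_on UNIV g"
  shows "integrable gaussM (\<lambda>z. apply_bcontfun f (g z))"
proof (rule gauss.integrable_const_bound[where B="norm f"])
  have [measurable]: "g \<in> borel_measurable borel" using assms by (rule borel_measurable_continuous_onI)
  show "(\<lambda>z. apply_bcontfun f (g z)) \<in> borel_measurable gaussM" by measurable
qed (auto simp: norm_bounded)

text \<open>The heat semigroup along the line spanned by \<open>v\<close>: the expectation of f(y +
  sqrt(s) Z v) for a standard normal Z. Its generator is half the second derivative in direction
  \<open>v\<close>, so that \<open>s\<close> is a variance.\<close>

definition gauss_op :: "'a::real_normed_vector \<Rightarrow> real \<Rightarrow> ('a \<Rightarrow>\<^sub>C 'b::euclidean_space) \<Rightarrow> 'a \<Rightarrow>\<^sub>C 'b" where
  "gauss_op v s f = Bcontfun (\<lambda>y. \<integral>z. f (y + (sqrt s * z) *\<^sub>R v) \<partial>gaussM)"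

lemma gauss_norm_integral_le:
  fixes g :: "real \<Rightarrow> 'b::euclidean_space"
  assumes "\<And>z. norm (g z) \<le> b"
  shows "norm (\<integral>z. g z \<partial>gaussM) \<le> b"
proof (cases "integrable gaussM g")
  case True
  have "norm (\<integral>z. g z \<partial>gaussM) \<le> (\<integral>z. norm (g z) \<partial>gaussM)" by (rule integral_norm_bound)
  also have "\<dots> \<le> (\<integral>z. b \<partial>gaussM)" by (rule integral_mono) (use True assms in auto)
  also have "\<dots> = b" using gauss.prob_space by simp
  finally show ?thesis .
next
  \<comment> \<open>The integral has the default value 0 here, and b \<ge> 0 suffices.\<close>
  case False
  have "0 \<le> b" using assms[of 0] norm_ge_zero order_trans by blast
  then show ?thesis using False by (simp add: not_integrable_integral_eq)
qed

text \<open>Dominated convergence with majorant |w| |f|. The weight 1 gives continuity of the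
  average, the weight z that of its directional derivative.\<close>

lemma continuous_gauss_weighted:
  fixes f :: "'a::real_normed_vector \<Rightarrow>\<^sub>C 'b::euclidean_space"
  assumes w: "integrable gaussM w"
  shows "continuous_on UNIV (\<lambda>y. \<integral>z. w z *\<^sub>R f (y + (c * z) *\<^sub>R v) \<partial>gaussM)"
proof (rule continuous_at_imp_continuous_on, clarify)
  fix y
  show "isCont (\<lambda>y. \<integral>z. w z *\<^sub>R f (y + (c * z) *\<^sub>R v) \<partial>gaussM) y"
  proof (rule continuous_at_sequentiallyI)
    fix u assume u: "u \<longlonglongrightarrow> y"
    show "(\<lambda>n. \<integral>z. w z *\<^sub>R f (u n + (c * z) *\<^sub>R v) \<partial>gaussM) \<longlonglongrightarrow> (\<integral>z. w z *\<^sub>R f (y + (c * z) *\<^sub>R v) \<partial>gaussM)"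
    proof (rule integral_dominated_convergence[where w="\<lambda>z. norm (w z) * norm f"])
      have m: "\<And>u. (\<lambda>z. f (u + (c * z) *\<^sub>R v)) \<in> borel_measurable gaussM"
        by (rule borel_measurable_integrable) (intro gauss_integrable_bc continuous_intros)
      show "\<And>n. (\<lambda>z. w z *\<^sub>R f (u n + (c * z) *\<^sub>R v)) \<in> borel_measurable gaussM"
           "(\<lambda>z. w z *\<^sub>R f (y + (c * z) *\<^sub>R v)) \<in> borel_measurable gaussM"
        using m borel_measurable_integrable[OF w] by (auto intro!: borel_measurable_scaleR)
      show "AE z in gaussM. (\<lambda>n. w z *\<^sub>R f (u n + (c * z) *\<^sub>R v)) \<longlonglongrightarrow> w z *\<^sub>R f (y + (c * z) *\<^sub>R v)"
      proof (rule AE_I2)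
        fix z
        have "(\<lambda>n. f (u n + (c * z) *\<^sub>R v)) \<longlonglongrightarrow> f (y + (c * z) *\<^sub>R v)"
          by (rule continuous_on_tendsto_compose[OF continuous_on_apply_bcontfun[of UNIV]])
             (auto intro!: tendsto_intros u)
        then show "(\<lambda>n. w z *\<^sub>R f (u n + (c * z) *\<^sub>R v)) \<longlonglongrightarrow> w z *\<^sub>R f (y + (c * z) *\<^sub>R v)"
          by (rule tendsto_scaleR[OF tendsto_const])
      qed
      show "integrable gaussM (\<lambda>z. norm (w z) * norm f)" using w by auto
    qed (auto simp: norm_bounded mult_left_mono)
  qed
qed

lemma gauss_op_apply: "gauss_op v s f y = (\<integral>z. f (y + (sqrt s * z) *\<^sub>R v) \<partial>gaussM)"
  unfolding gauss_op_def using continuous_gauss_weighted[of "\<lambda>_. 1" f "sqrt s" v]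
  by (subst apply_Bcontfun[where b="norm f"]) (auto intro!: gauss_norm_integral_le norm_bounded)

lemma gauss_op_intble [simp, intro]: "integrable gaussM (\<lambda>z. apply_bcontfun f (y + (c * z) *\<^sub>R v))"
  for f :: "'a::real_normed_vector \<Rightarrow>\<^sub>C 'b::euclidean_space"
  by (intro gauss_integrable_bc continuous_intros)

lemma gauss_op_norm: "norm (gauss_op v s f) \<le> norm f"
  by (rule norm_bound) (auto simp: gauss_op_apply intro!: gauss_norm_integral_le norm_bounded)

lemma gauss_op_add: "gauss_op v s (f + g) = gauss_op v s f + gauss_op v s g"
  by (rule bcontfun_eqI) (simp add: gauss_op_apply)

lemma gauss_op_scale: "gauss_op v s (c *\<^sub>R f) = c *\<^sub>R gauss_op v s f"
  by (rule bcontfun_eqI) (simp add: gauss_op_apply)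

lemma gauss_op_shift: "gauss_op v s (shift_bc h f) = shift_bc h (gauss_op v s f)"
  by (rule bcontfun_eqI) (simp add: gauss_op_apply algebra_simps)

lemma gauss_op_map:
  fixes L :: "'b::euclidean_space \<Rightarrow> 'c::euclidean_space"
  assumes "bounded_linear L"
  shows "gauss_op v s (map_bc L f) = map_bc L (gauss_op v s f)"
  by (rule bcontfun_eqI) (simp add: gauss_op_apply map_bc_apply[OF assms] integral_bounded_linear[OF assms])

lemma gauss_op_0: "gauss_op v 0 f = f"
  by (rule bcontfun_eqI) (use gauss.prob_space in \<open>simp add: gauss_op_apply\<close>)

interpretation gauss2: pair_prob_space gaussM gaussM ..

lemma gauss2_integrable:
  fixes f :: "'a::real_normed_vector \<Rightarrow>\<^sub>C 'b::euclidean_space"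
  shows "integrable (gaussM \<Otimes>\<^sub>M gaussM) (\<lambda>(z,z'). f (y + (a * z) *\<^sub>R v + (b * z') *\<^sub>R w))"
proof (rule gauss2.integrable_const_bound[where B="norm f"])
  have "(\<lambda>(z,z'). f (y + (a * z) *\<^sub>R v + (b * z') *\<^sub>R w)) \<in> borel_measurable borel"
    unfolding split_beta by (intro borel_measurable_continuous_onI continuous_intros)
  then show "(\<lambda>(z,z'). f (y + (a * z) *\<^sub>R v + (b * z') *\<^sub>R w)) \<in> borel_measurable (gaussM \<Otimes>\<^sub>M gaussM)"
    by (simp add: borel_prod[symmetric] cong: measurable_cong_sets)
qed (auto simp: norm_bounded split_beta)

text \<open>Fubini for two independent Gaussians. This is what lets any chosen direction be moved to
  the front of a composition.\<close>

lemma gauss_op_commute: "gauss_op v s (gauss_op w r f) = gauss_op w r (gauss_op v s f)"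
proof (rule bcontfun_eqI)
  fix y
  have "gauss_op v s (gauss_op w r f) y = (\<integral>z. \<integral>z'. f (y + (sqrt s * z) *\<^sub>R v + (sqrt r * z') *\<^sub>R w) \<partial>gaussM \<partial>gaussM)"
    by (simp add: gauss_op_apply)
  also have "\<dots> = (\<integral>z'. \<integral>z. f (y + (sqrt s * z) *\<^sub>R v + (sqrt r * z') *\<^sub>R w) \<partial>gaussM \<partial>gaussM)"
    by (rule gauss2.Fubini_integral[symmetric]) (rule gauss2_integrable)
  also have "\<dots> = gauss_op w r (gauss_op v s f) y"
    by (simp add: gauss_op_apply add.commute add.left_commute)
  finally show "gauss_op v s (gauss_op w r f) y = gauss_op w r (gauss_op v s f) y" .
qed

lemma distr_gauss_scale:
  assumes "a > 0"
  shows "distr gaussM borel (\<lambda>z. a * z) = density lborel (normal_density 0 a)"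
proof -
  have "distributed gaussM lborel (\<lambda>x. x) (normal_density 0 1)"
    unfolding distributed_def by (auto simp: distr_id2)
  from gauss.normal_density_affine[OF this, of a 0] assms
  have "distributed gaussM lborel (\<lambda>z. a * z) (normal_density 0 a)" by simp
  then show ?thesis by (auto simp: distributed_def cong: distr_cong)
qed

text \<open>The law of a Z + b Z' is the convolution of two centred normal densities, hence again
  normal, and variances add. The semigroup law in one direction rests on this.\<close>

lemma gauss_pair_sum:
  fixes F :: "real \<Rightarrow> 'b::euclidean_space"
  assumes "a > 0" "b > 0" and [measurable]: "F \<in> borel_measurable borel"
  shows "(\<integral>x. F (a * fst x + b * snd x) \<partial>(gaussM \<Otimes>\<^sub>M gaussM)) = (\<integral>z. F (sqrt (a\<^sup>2 + b\<^sup>2) * z) \<partial>gaussM)"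
proof -
  let ?M = "gaussM \<Otimes>\<^sub>M gaussM"
  let ?Na = "density lborel (normal_density 0 a)" and ?Nb = "density lborel (normal_density 0 b)"
  have pr: "prob_space ?Na" "prob_space ?Nb" using assms by (auto intro!: prob_space_normal_density)
  then have fin: "finite_measure ?Na" "finite_measure ?Nb" "sigma_finite_measure ?Nb"
    by (auto simp: prob_space_def prob_space_imp_sigma_finite)
  have "distr ?M borel (\<lambda>x. a * fst x + b * snd x)
      = distr (distr ?M (borel \<Otimes>\<^sub>M borel) (\<lambda>(x,y). (a * x, b * y))) borel (\<lambda>(x,y). x + y)"
    by (subst distr_distr) (auto simp: comp_def split_beta)
  also have "\<dots> = convolution ?Na ?Nb"
    unfolding convolution_def distr_gauss_scale[OF assms(1), symmetric] distr_gauss_scale[OF assms(2), symmetric]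
    by (subst pair_measure_distr) (use fin distr_gauss_scale[OF assms(2)] in auto)
  also have "\<dots> = density lborel (\<lambda>x. \<integral>\<^sup>+y. ennreal (normal_density 0 a (x - y) * normal_density 0 b y) \<partial>lborel)"
    using fin by (subst convolution_density) (auto simp: ennreal_mult')
  also have "\<dots> = density lborel (normal_density 0 (sqrt (a\<^sup>2 + b\<^sup>2)))"
    using assms by (subst conv_normal_density_zero_mean) auto
  also have "\<dots> = distr gaussM borel (\<lambda>z. sqrt (a\<^sup>2 + b\<^sup>2) * z)"
    using assms by (subst distr_gauss_scale) (auto simp: add_pos_pos)
  finally have "distr ?M borel (\<lambda>x. a * fst x + b * snd x) = distr gaussM borel (\<lambda>z. sqrt (a\<^sup>2 + b\<^sup>2) * z)" .
  then have "(\<integral>z. F z \<partial>distr ?M borel (\<lambda>x. a * fst x + b * snd x)) = (\<integral>z. F z \<partial>distr gaussM borel (\<lambda>z. sqrt (a\<^sup>2 + b\<^sup>2) * z))"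
    by simp
  then show ?thesis by (simp add: integral_distr)
qed

lemma gauss_op_semigroup:
  assumes "0 \<le> s" "0 \<le> r"
  shows "gauss_op v s (gauss_op v r f) = gauss_op v (s + r) f"
\<comment> \<open>Zero variance is treated apart, because \<open>gauss_pair_sum\<close> works with
  genuine densities.\<close>
proof (cases "s = 0 \<or> r = 0")
  case True then show ?thesis by (auto simp: gauss_op_0)
next
  case False
  with assms have p: "s > 0" "r > 0" by auto
  show ?thesis
  proof (rule bcontfun_eqI)
    fix y
    have "gauss_op v s (gauss_op v r f) y = (\<integral>z. \<integral>z'. f (y + (sqrt s * z) *\<^sub>R v + (sqrt r * z') *\<^sub>R v) \<partial>gaussM \<partial>gaussM)"
      by (simp add: gauss_op_apply)
    also have "\<dots> = (\<integral>x. f (y + (sqrt s * fst x) *\<^sub>R v + (sqrt r * snd x) *\<^sub>R v) \<partial>(gaussM \<Otimes>\<^sub>M gaussM))"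
      using gauss2.integral_fst[OF gauss2_integrable[of f y "sqrt s" v "sqrt r" v]] by (simp add: case_prod_beta')
    also have "\<dots> = (\<integral>x. f (y + (sqrt s * fst x + sqrt r * snd x) *\<^sub>R v) \<partial>(gaussM \<Otimes>\<^sub>M gaussM))"
      by (simp add: scaleR_add_left add.assoc)
    also have "\<dots> = (\<integral>z. f (y + (sqrt ((sqrt s)\<^sup>2 + (sqrt r)\<^sup>2) * z) *\<^sub>R v) \<partial>gaussM)"
      by (rule gauss_pair_sum[where F="\<lambda>x. f (y + x *\<^sub>R v)"])
         (use p in \<open>auto intro!: borel_measurable_continuous_onI continuous_intros\<close>)
    also have "\<dots> = gauss_op v (s + r) f y" using p by (simp add: gauss_op_apply)
    finally show "gauss_op v s (gauss_op v r f) y = gauss_op v (s + r) f y" .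
  qed
qed

lemma gauss_integral: "F \<in> borel_measurable borel \<Longrightarrow> (\<integral>z. F z \<partial>gaussM) = (\<integral>z. std_normal_density z *\<^sub>R F z \<partial>lborel)"
  for F :: "real \<Rightarrow> 'b::euclidean_space"
  by (rule integral_density) auto

lemma gauss_integrable_iff: "F \<in> borel_measurable borel \<Longrightarrow> integrable gaussM F \<longleftrightarrow> integrable lborel (\<lambda>z. std_normal_density z *\<^sub>R F z)"
  for F :: "real \<Rightarrow> 'b::euclidean_space"
  by (rule integrable_density) auto

lemma gauss_moments:
  shows "integrable gaussM (\<lambda>z. z ^ k)" "integrable gaussM (\<lambda>z. \<bar>z\<bar> ^ k)"
    "(\<integral>z. z \<partial>gaussM) = 0" "(\<integral>z. z\<^sup>2 \<partial>gaussM) = 1"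
  using integrable_std_normal_moment[of k] integrable_std_normal_moment_abs[of k]
    integral_std_normal_moment_odd[of 0] integral_std_normal_moment_even[of 1]
  by (auto simp: gauss_integrable_iff gauss_integral)

lemma gauss_integrable_id [simp]: "integrable gaussM (\<lambda>z. z)" "integrable gaussM (\<lambda>z. \<bar>z\<bar>)"
  using gauss_moments(1,2)[of 1] by auto

lemma gauss_abs_moment: "(\<integral>z. \<bar>z\<bar> \<partial>gaussM) \<le> 1"
proof -
  have "(\<integral>z. \<bar>z\<bar> \<partial>gaussM) \<le> (\<integral>z. (1 + z\<^sup>2) / 2 \<partial>gaussM)"
  proof (rule integral_mono)
    fix z :: real
    have "0 \<le> (\<bar>z\<bar> - 1)\<^sup>2" by simp
    then show "\<bar>z\<bar> \<le> (1 + z\<^sup>2) / 2" by (simp add: power2_diff)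
  qed (use gauss_moments(1)[of 2] in auto)
  also have "\<dots> = 1" using gauss_moments(1)[of 2] gauss_moments(4) gauss.prob_space by simp
  finally show ?thesis .
qed

text \<open>The Cameron-Martin formula: a shift by c multiplies the Gaussian density by exp(c z -
  c^2/2). It moves a translation from the function to the weight, where differentiation is possible
  although the function is merely measurable.\<close>

lemma gauss_tilt:
  fixes F :: "real \<Rightarrow> 'b::euclidean_space"
  assumes [measurable]: "F \<in> borel_measurable borel"
  shows "(\<integral>z. F (z + c) \<partial>gaussM) = (\<integral>z. exp (c * z - c\<^sup>2 / 2) *\<^sub>R F z \<partial>gaussM)"
    and "integrable gaussM (\<lambda>z. F (z + c)) \<longleftrightarrow> integrable gaussM (\<lambda>z. exp (c * z - c\<^sup>2 / 2) *\<^sub>R F z)"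
proof -
  have eq: "std_normal_density (z - c) = std_normal_density z * exp (c * z - c\<^sup>2 / 2)" for z
  proof -
    have "-(z - c)\<^sup>2 / 2 = - z\<^sup>2 / 2 + (c * z - c\<^sup>2 / 2)" by (simp add: power2_eq_square algebra_simps add_divide_distrib diff_divide_distrib)
    then show ?thesis unfolding std_normal_density_def by (simp add: exp_add[symmetric])
  qed
  have "(\<integral>z. F (z + c) \<partial>gaussM) = (\<integral>z. std_normal_density z *\<^sub>R F (z + c) \<partial>lborel)" by (rule gauss_integral) simp
  also have "\<dots> = (\<integral>z. std_normal_density (z - c) *\<^sub>R F z \<partial>lborel)"
    using lborel_integral_real_affine[of 1 "\<lambda>z. std_normal_density z *\<^sub>R F (z + c)" "-c"] by (simp add: add.commute)
  also have "\<dots> = (\<integral>z. exp (c * z - c\<^sup>2 / 2) *\<^sub>R F z \<partial>gaussM)"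
    by (subst gauss_integral) (auto simp: eq)
  finally show "(\<integral>z. F (z + c) \<partial>gaussM) = (\<integral>z. exp (c * z - c\<^sup>2 / 2) *\<^sub>R F z \<partial>gaussM)" .
  have "integrable gaussM (\<lambda>z. F (z + c)) \<longleftrightarrow> integrable lborel (\<lambda>z. std_normal_density z *\<^sub>R F (z + c))" by (rule gauss_integrable_iff) simp
  also have "\<dots> \<longleftrightarrow> integrable lborel (\<lambda>z. std_normal_density (z - c) *\<^sub>R F z)"
    using lborel_integrable_real_affine_iff[of 1 "\<lambda>z. std_normal_density z *\<^sub>R F (z + c)" "-c"] by (simp add: add.commute)
  also have "\<dots> \<longleftrightarrow> integrable gaussM (\<lambda>z. exp (c * z - c\<^sup>2 / 2) *\<^sub>R F z)"
    by (subst gauss_integrable_iff) (auto simp: eq)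
  finally show "integrable gaussM (\<lambda>z. F (z + c)) \<longleftrightarrow> integrable gaussM (\<lambda>z. exp (c * z - c\<^sup>2 / 2) *\<^sub>R F z)" .
qed

lemma gauss_exp:
  shows "integrable gaussM (\<lambda>z. exp (c * z))" "integrable gaussM (\<lambda>z. exp (c * z - c\<^sup>2 / 2))"
    "(\<integral>z. exp (c * z - c\<^sup>2 / 2) \<partial>gaussM) = 1"
proof -
  show i: "integrable gaussM (\<lambda>z. exp (c * z - c\<^sup>2 / 2))" using gauss_tilt(2)[of "\<lambda>_. 1::real" c] by simp
  show "(\<integral>z. exp (c * z - c\<^sup>2 / 2) \<partial>gaussM) = 1" using gauss_tilt(1)[of "\<lambda>_. 1::real" c] gauss.prob_space by simp
  have "integrable gaussM (\<lambda>z. exp (c\<^sup>2 / 2) * exp (c * z - c\<^sup>2 / 2))" using i by auto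
  then show "integrable gaussM (\<lambda>z. exp (c * z))" by (simp add: exp_add[symmetric])
qed

text \<open>Taylor's formula with an integrable majorant for |c| \<le> 1, the triangle inequality
  for larger c. The bound in the mean, uniform in c, is what turns into a Taylor remainder uniform
  in the base point.\<close>

lemma gauss_tilt_remainder:
  obtains K where "K \<ge> 0" "\<And>c. (\<integral>z. \<bar>exp (c * z - c\<^sup>2 / 2) - 1 - c * z\<bar> \<partial>gaussM) \<le> K * c\<^sup>2"
proof -
  \<comment> \<open>\<open>G\<close> dominates the remainder divided by c^2 for |c| \<le> 1: with w
    = |z| + 1/2 the exponent x = c z - c^2/2 satisfies |x| \<le> |c| w, and w^2 exp w \<le> 2 exp(2
    w) produces the exponentials. The summand 1/2 pays for replacing x by c z.\<close>
  define G where "G z = 1/2 + 2 * exp 1 * (exp (2 * z) + exp (-2 * z))" for z :: real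
  have G: "integrable gaussM G" unfolding G_def using gauss_exp(1)[of 2] gauss_exp(1)[of "-2"] by auto
  have i: "integrable gaussM (\<lambda>z. \<bar>exp (c * z - c\<^sup>2 / 2) - 1 - c * z\<bar>)" for c
    using gauss_exp(2)[of c] by auto
  \<comment> \<open>The 3 is for |c| > 1, where 2 + |c| \<le> 3 c^2.\<close>
  define K where "K = max 3 (\<integral>z. G z \<partial>gaussM)"
  have "(\<integral>z. \<bar>exp (c * z - c\<^sup>2 / 2) - 1 - c * z\<bar> \<partial>gaussM) \<le> K * c\<^sup>2" for c
  proof (cases "\<bar>c\<bar> \<le> 1")
    case True
    have "(\<integral>z. \<bar>exp (c * z - c\<^sup>2 / 2) - 1 - c * z\<bar> \<partial>gaussM) \<le> (\<integral>z. c\<^sup>2 * G z \<partial>gaussM)"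
    proof (rule integral_mono[OF i])
      show "integrable gaussM (\<lambda>z. c\<^sup>2 * G z)" using G by auto
      fix z :: real
      define x where "x = c * z - c\<^sup>2 / 2"
      define w where "w = \<bar>z\<bar> + 1/2"
      have w0: "w \<ge> 0" by (simp add: w_def)
      have x: "\<bar>x\<bar> \<le> \<bar>c\<bar> * w"
      proof -
        have "\<bar>x\<bar> \<le> \<bar>c * z\<bar> + \<bar>c\<^sup>2 / 2\<bar>" unfolding x_def by linarith
        also have "\<dots> = \<bar>c\<bar> * \<bar>z\<bar> + \<bar>c\<bar> * (\<bar>c\<bar>/2)" by (simp add: abs_mult power2_eq_square)
        also have "\<dots> \<le> \<bar>c\<bar> * \<bar>z\<bar> + \<bar>c\<bar> * (1/2)" using True by (intro add_left_mono mult_left_mono) auto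
        finally show ?thesis by (simp add: w_def algebra_simps)
      qed
      then have xw: "\<bar>x\<bar> \<le> w" using True w0 mult_right_mono[of "\<bar>c\<bar>" 1 w] by linarith
      have tay: "\<bar>exp x - 1 - x\<bar> \<le> x\<^sup>2 * exp \<bar>x\<bar>"
      proof -
        obtain t where t: "\<bar>t\<bar> \<le> \<bar>x\<bar>" "exp x = (\<Sum>m<2. x ^ m / fact m) + exp t / fact 2 * x ^ 2"
          using Maclaurin_exp_le[of x 2] by blast
        then have "exp x - 1 - x = exp t / 2 * x\<^sup>2" by (simp add: numeral_2_eq_2)
        then have "\<bar>exp x - 1 - x\<bar> = exp t / 2 * x\<^sup>2" unfolding \<open>exp x - 1 - x = exp t / 2 * x\<^sup>2\<close> by (simp add: abs_mult)
        also have "\<dots> \<le> exp \<bar>x\<bar> * x\<^sup>2"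
        proof (intro mult_right_mono)
          have "exp t \<le> exp \<bar>x\<bar>" using t(1) by simp
          then show "exp t / 2 \<le> exp \<bar>x\<bar>" using exp_gt_zero[of t] by linarith
        qed simp
        finally show ?thesis by (simp add: mult.commute)
      qed
      have sq: "x\<^sup>2 \<le> c\<^sup>2 * w\<^sup>2" using x abs_le_square_iff[of x "c * w"] w0 by (simp add: abs_mult power_mult_distrib)
      have "w\<^sup>2 \<le> 2 * exp w" using exp_lower_Taylor_quadratic[OF w0] w0 by simp
      then have "w\<^sup>2 * exp w \<le> 2 * exp w * exp w" by (intro mult_right_mono) auto
      also have "\<dots> = 2 * exp (2 * w)" by (simp add: exp_add[symmetric])
      also have "exp (2 * w) = exp 1 * exp (2 * \<bar>z\<bar>)" by (simp add: w_def exp_add[symmetric] algebra_simps)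
      also have "exp (2 * \<bar>z\<bar>) \<le> exp (2 * z) + exp (-2 * z)" by (cases "z \<ge> 0") auto
      finally have 1: "w\<^sup>2 * exp w \<le> 2 * (exp 1 * (exp (2 * z) + exp (-2 * z)))" by simp
      have "\<bar>exp x - 1 - c * z\<bar> \<le> \<bar>exp x - 1 - x\<bar> + c\<^sup>2 / 2"
      proof -
        have "c * z = x + c\<^sup>2 / 2" "0 \<le> c\<^sup>2 / 2" by (auto simp: x_def)
        then show ?thesis by linarith
      qed
      also have "\<dots> \<le> x\<^sup>2 * exp \<bar>x\<bar> + c\<^sup>2 / 2" using tay by simp
      also have "\<dots> \<le> (c\<^sup>2 * w\<^sup>2) * exp w + c\<^sup>2 / 2" using sq xw by (intro add_right_mono mult_mono) auto
      also have "\<dots> = c\<^sup>2 * (w\<^sup>2 * exp w) + c\<^sup>2 / 2" by simp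
      also have "\<dots> \<le> c\<^sup>2 * (2 * (exp 1 * (exp (2 * z) + exp (-2 * z)))) + c\<^sup>2 / 2" using 1 by (intro add_right_mono mult_left_mono) auto
      also have "\<dots> = c\<^sup>2 * G z" by (simp add: G_def algebra_simps)
      finally show "\<bar>exp (c * z - c\<^sup>2 / 2) - 1 - c * z\<bar> \<le> c\<^sup>2 * G z" by (simp add: x_def)
    qed
    also have "\<dots> \<le> K * c\<^sup>2" by (simp add: K_def mult.commute[of _ "c\<^sup>2"] mult_left_mono)
    finally show ?thesis .
  next
    case False
    then have c: "1 \<le> \<bar>c\<bar>" "\<bar>c\<bar> \<le> c\<^sup>2" "1 \<le> c\<^sup>2"
      using mult_mono[of 1 "\<bar>c\<bar>" "\<bar>c\<bar>" "\<bar>c\<bar>"] by (auto simp: power2_eq_square)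
    have "(\<integral>z. \<bar>exp (c * z - c\<^sup>2 / 2) - 1 - c * z\<bar> \<partial>gaussM) \<le> (\<integral>z. exp (c * z - c\<^sup>2 / 2) + 1 + \<bar>c\<bar> * \<bar>z\<bar> \<partial>gaussM)"
    proof (rule integral_mono[OF i])
      show "integrable gaussM (\<lambda>z. exp (c * z - c\<^sup>2 / 2) + 1 + \<bar>c\<bar> * \<bar>z\<bar>)" using gauss_exp(2)[of c] by auto
      fix z
      have "\<bar>E - 1 - x\<bar> \<le> E + 1 + \<bar>x\<bar>" if "E \<ge> 0" for E x :: real using that by linarith
      from this[of "exp (c * z - c\<^sup>2 / 2)" "c * z"]
      show "\<bar>exp (c * z - c\<^sup>2 / 2) - 1 - c * z\<bar> \<le> exp (c * z - c\<^sup>2 / 2) + 1 + \<bar>c\<bar> * \<bar>z\<bar>" by (simp add: abs_mult)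
    qed
    also have "\<dots> = 2 + \<bar>c\<bar> * (\<integral>z. \<bar>z\<bar> \<partial>gaussM)" using gauss_exp(2,3)[of c] gauss.prob_space by simp
    also have "\<dots> \<le> 2 + \<bar>c\<bar>" using gauss_abs_moment mult_left_mono[of "(\<integral>z. \<bar>z\<bar> \<partial>gaussM)" 1 "\<bar>c\<bar>"] by simp
    also have "\<dots> \<le> 3 * c\<^sup>2" using c by simp
    also have "\<dots> \<le> K * c\<^sup>2" by (intro mult_right_mono) (auto simp: K_def)
    finally show ?thesis .
  qed
  moreover have "K \<ge> 0" by (simp add: K_def)
  ultimately show ?thesis using that by blast
qed

text \<open>Gaussian integration by parts: the derivative is the average of f with weight z / sqrt
  s, bounded by |f| / sqrt s because the mean of |z| is at most 1. With c = r / sqrt s,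
  \<open>gauss_tilt\<close> turns the Taylor remainder of step r into the average of f against the
  remainder of the weight. \<open>K\<close> is chosen before f, v and s.\<close>

lemma gauss_op_directional_derivative:
  obtains K where "K \<ge> 0" "\<And>(f :: 'a::real_normed_vector \<Rightarrow>\<^sub>C real) v s. s > 0 \<Longrightarrow>
    \<exists>H. norm H \<le> norm f / sqrt s \<and> (\<forall>y r. \<bar>gauss_op v s f (y + r *\<^sub>R v) - gauss_op v s f y - r * apply_bcontfun H y\<bar> \<le> K * norm f / s * r\<^sup>2)"
proof -
  obtain K where K: "K \<ge> 0" "\<And>c. (\<integral>z. \<bar>exp (c * z - c\<^sup>2 / 2) - 1 - c * z\<bar> \<partial>gaussM) \<le> K * c\<^sup>2"
    by (rule gauss_tilt_remainder) blast
  show ?thesis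
  proof (rule that[OF K(1)])
    fix f :: "'a \<Rightarrow>\<^sub>C real" and v s assume s: "(s::real) > 0"
    have cont: "continuous_on UNIV (\<lambda>y. \<integral>z. z * f (y + (sqrt s * z) *\<^sub>R v) \<partial>gaussM)"
      using continuous_gauss_weighted[of "\<lambda>z. z" f "sqrt s" v] by simp
    have m: "(\<lambda>z. f (y + (c * z) *\<^sub>R v)) \<in> borel_measurable borel" for y c
      by (intro borel_measurable_continuous_onI continuous_intros)
    have int: "integrable gaussM (\<lambda>z. w z * f (y + (sqrt s * z) *\<^sub>R v))" if "integrable gaussM w" for w y
    proof (rule Bochner_Integration.integrable_bound)
      show "integrable gaussM (\<lambda>z. norm f * w z)" using that by auto
      show "(\<lambda>z. w z * f (y + (sqrt s * z) *\<^sub>R v)) \<in> borel_measurable gaussM"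
        using m[of y "sqrt s"] borel_measurable_integrable[OF that] by auto
      show "AE z in gaussM. norm (w z * f (y + (sqrt s * z) *\<^sub>R v)) \<le> norm (norm f * w z)"
      proof (rule AE_I2)
        fix z
        have "\<bar>f (y + (sqrt s * z) *\<^sub>R v)\<bar> \<le> norm f" using norm_bounded[of f] by simp
        then show "norm (w z * f (y + (sqrt s * z) *\<^sub>R v)) \<le> norm (norm f * w z)"
          using mult_left_mono[of "\<bar>f (y + (sqrt s * z) *\<^sub>R v)\<bar>" "norm f" "\<bar>w z\<bar>"] by (simp add: abs_mult mult.commute)
      qed
    qed
    have bnd: "\<bar>\<integral>z. w z * f (y + (sqrt s * z) *\<^sub>R v) \<partial>gaussM\<bar> \<le> norm f * (\<integral>z. \<bar>w z\<bar> \<partial>gaussM)" if "integrable gaussM w" for w y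
    proof -
      have "\<bar>\<integral>z. w z * f (y + (sqrt s * z) *\<^sub>R v) \<partial>gaussM\<bar> \<le> (\<integral>z. \<bar>w z * f (y + (sqrt s * z) *\<^sub>R v)\<bar> \<partial>gaussM)"
        by (rule integral_abs_bound)
      also have "\<dots> \<le> (\<integral>z. norm f * \<bar>w z\<bar> \<partial>gaussM)"
      proof (rule integral_mono)
        show "integrable gaussM (\<lambda>z. \<bar>w z * f (y + (sqrt s * z) *\<^sub>R v)\<bar>)" using int[OF that] by auto
        show "integrable gaussM (\<lambda>z. norm f * \<bar>w z\<bar>)" using that by auto
        fix z
        have "\<bar>f (y + (sqrt s * z) *\<^sub>R v)\<bar> \<le> norm f" using norm_bounded[of f] by simp
        then show "\<bar>w z * f (y + (sqrt s * z) *\<^sub>R v)\<bar> \<le> norm f * \<bar>w z\<bar>"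
          using mult_left_mono[of "\<bar>f (y + (sqrt s * z) *\<^sub>R v)\<bar>" "norm f" "\<bar>w z\<bar>"] by (simp add: abs_mult mult.commute)
      qed
      finally show ?thesis by simp
    qed
    define h where "h y = (\<integral>z. z * f (y + (sqrt s * z) *\<^sub>R v) \<partial>gaussM) / sqrt s" for y
    have hb: "norm (h y) \<le> norm f / sqrt s" for y
    proof -
      have "\<bar>\<integral>z. z * f (y + (sqrt s * z) *\<^sub>R v) \<partial>gaussM\<bar> \<le> norm f * (\<integral>z. \<bar>z\<bar> \<partial>gaussM)" by (rule bnd) simp
      also have "\<dots> \<le> norm f * 1" using gauss_abs_moment by (intro mult_left_mono) auto
      finally show ?thesis using s by (simp add: h_def abs_divide divide_right_mono)
    qed
    have H: "apply_bcontfun (Bcontfun h) = h"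
      by (rule apply_Bcontfun[OF _ hb]) (use s in \<open>auto simp: h_def intro!: continuous_intros cont\<close>)
    have "\<bar>gauss_op v s f (y + r *\<^sub>R v) - gauss_op v s f y - r * h y\<bar> \<le> K * norm f / s * r\<^sup>2" for y r
    proof -
      define c where "c = r / sqrt s"
      have "gauss_op v s f (y + r *\<^sub>R v) = (\<integral>z. f (y + (sqrt s * (z + c)) *\<^sub>R v) \<partial>gaussM)"
        using s by (simp add: gauss_op_apply c_def algebra_simps)
      also have "\<dots> = (\<integral>z. exp (c * z - c\<^sup>2 / 2) * f (y + (sqrt s * z) *\<^sub>R v) \<partial>gaussM)"
        using gauss_tilt(1)[OF m[of y "sqrt s"], of c] by simp
      finally have 1: "gauss_op v s f (y + r *\<^sub>R v) = \<dots>" .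
      have 2: "r * h y = (\<integral>z. (c * z) * f (y + (sqrt s * z) *\<^sub>R v) \<partial>gaussM)"
        by (simp add: h_def c_def mult.assoc)
      have w: "integrable gaussM (\<lambda>z. exp (c * z - c\<^sup>2 / 2) - 1 - c * z)" using gauss_exp(2)[of c] by auto
      have "gauss_op v s f (y + r *\<^sub>R v) - gauss_op v s f y - r * h y = (\<integral>z. (exp (c * z - c\<^sup>2 / 2) - 1 - c * z) * f (y + (sqrt s * z) *\<^sub>R v) \<partial>gaussM)"
        unfolding 1 2 gauss_op_apply[of v s f y] using int[OF gauss_exp(2)[of c], of y] int[of "\<lambda>_. 1" y] int[of "\<lambda>z. c * z" y]
        by (simp add: left_diff_distrib)
      also have "\<bar>\<dots>\<bar> \<le> norm f * (K * c\<^sup>2)" using bnd[OF w, of y] K(2)[of c] by (meson mult_left_mono norm_ge_zero order_trans)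
      also have "\<dots> = K * norm f / s * r\<^sup>2" using s by (simp add: c_def power_divide)
      finally show ?thesis .
    qed
    then show "\<exists>H. norm H \<le> norm f / sqrt s \<and> (\<forall>y r. \<bar>gauss_op v s f (y + r *\<^sub>R v) - gauss_op v s f y - r * apply_bcontfun H y\<bar> \<le> K * norm f / s * r\<^sup>2)"
      using H hb by (intro exI[of _ "Bcontfun h"]) (auto intro!: norm_bound)
  qed
qed

section \<open>Lipschitz bounds and evolution operators\<close>

definition lipschitz_by :: "real \<Rightarrow> ('a::real_normed_vector \<Rightarrow> 'b::real_normed_vector) \<Rightarrow> bool" where
  "lipschitz_by L f \<longleftrightarrow> (\<forall>x h. norm (f (x + h) - f x) \<le> L * norm h)"

lemma lipschitz_byD: "lipschitz_by L f \<Longrightarrow> norm (f (x + h) - f x) \<le> L * norm h" by (auto simp: lipschitz_by_def)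

lemma lipschitz_byD2: "lipschitz_by L f \<Longrightarrow> norm (f x - f y) \<le> L * norm (x - y)" using lipschitz_byD[of L f y "x - y"] by simp

lemma lipschitz_by_mono: "lipschitz_by L f \<Longrightarrow> L \<le> M \<Longrightarrow> lipschitz_by M f"
  unfolding lipschitz_by_def by (meson mult_right_mono norm_ge_zero order_trans)

lemma gauss_op_diff: "gauss_op v s (f - g) = gauss_op v s f - gauss_op v s g"
  by (rule bcontfun_eqI) (simp add: gauss_op_apply)

lemma gauss_op_small:
  assumes "lipschitz_by L (apply_bcontfun f)" "0 \<le> s" "0 \<le> L"
  shows "norm (gauss_op v s f - f) \<le> L * norm v * sqrt s"
proof (rule norm_bound)
  fix y
  have "(gauss_op v s f - f) y = (\<integral>z. f (y + (sqrt s * z) *\<^sub>R v) - f y \<partial>gaussM)"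
    using gauss.prob_space by (simp add: gauss_op_apply)
  also have "norm \<dots> \<le> (\<integral>z. norm (f (y + (sqrt s * z) *\<^sub>R v) - f y) \<partial>gaussM)" by (rule integral_norm_bound)
  also have "\<dots> \<le> (\<integral>z. (L * norm v * sqrt s) * \<bar>z\<bar> \<partial>gaussM)"
  proof (rule integral_mono)
    fix z
    show "norm (f (y + (sqrt s * z) *\<^sub>R v) - f y) \<le> (L * norm v * sqrt s) * \<bar>z\<bar>"
      using lipschitz_byD[OF assms(1), of y "(sqrt s * z) *\<^sub>R v"] assms(2) by (simp add: abs_mult mult_ac)
  qed auto
  also have "\<dots> = (L * norm v * sqrt s) * (\<integral>z. \<bar>z\<bar> \<partial>gaussM)" by simp
  also have "\<dots> \<le> (L * norm v * sqrt s) * 1" using assms by (intro mult_left_mono gauss_abs_moment) auto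
  finally show "norm ((gauss_op v s f - f) y) \<le> L * norm v * sqrt s" by simp
qed

text \<open>The backward evolution from time s to time t generated by half the weighted second
  derivatives in the listed directions. As the weights depend on time only, each direction enters
  through its accumulated variance. A list counts repeated pairs, which do occur in the
  decomposition of the diffusion matrix.\<close>

fun evol :: "('a::real_normed_vector \<times> (real \<Rightarrow> real)) list \<Rightarrow> real \<Rightarrow> real \<Rightarrow> ('a \<Rightarrow>\<^sub>C 'b::euclidean_space) \<Rightarrow> 'a \<Rightarrow>\<^sub>C 'b" where
  "evol [] t s f = f"
| "evol ((v,b) # ks) t s f = gauss_op v (integral {t..s} b) (evol ks t s f)"

lemma evol_norm: "norm (evol ks t s f) \<le> norm f"
  by (induction ks) (auto intro: order_trans[OF gauss_op_norm])

lemma evol_add: "evol ks t s (f + g) = evol ks t s f + evol ks t s g"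
  by (induction ks) (auto simp: gauss_op_add)

lemma evol_diff: "evol ks t s (f - g) = evol ks t s f - evol ks t s g"
  by (induction ks) (auto simp: gauss_op_diff)

lemma evol_scale: "evol ks t s (c *\<^sub>R f) = c *\<^sub>R evol ks t s f"
  by (induction ks) (auto simp: gauss_op_scale)

lemma bounded_linear_evol: "bounded_linear (evol ks t s)"
  by (rule bounded_linear_intro[where K=1]) (auto simp: evol_add evol_scale evol_norm)

lemma evol_shift: "evol ks t s (shift_bc h f) = shift_bc h (evol ks t s f)"
  by (induction ks) (auto simp: gauss_op_shift)

lemma evol_map:
  fixes L :: "'b::euclidean_space \<Rightarrow> 'c::euclidean_space"
  assumes "bounded_linear L"
  shows "evol ks t s (map_bc L f) = map_bc L (evol ks t s f)"
  by (induction ks) (auto simp: gauss_op_map[OF assms])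

lemma evol_gs: "evol ks t s (gauss_op v r f) = gauss_op v r (evol ks t s f)"
  by (induction ks) (auto intro: gauss_op_commute)

lemma evol_refl: "evol ks t t f = f"
  by (induction ks) (auto simp: gauss_op_0)

text \<open>Commutation brings one chosen direction outside, so that its smoothing acts on the
  composition of all the others.\<close>

lemma evol_remove1:
  "(v,b) \<in> set ks \<Longrightarrow> evol ks t s f = gauss_op v (integral {t..s} b) (evol (remove1 (v,b) ks) t s f)"
proof (induction ks)
  case (Cons k ks)
  obtain w c where k: "k = (w,c)" by (cases k)
  show ?case
  proof (cases "k = (v,b)")
    case False
    then have "evol ks t s f = gauss_op v (integral {t..s} b) (evol (remove1 (v,b) ks) t s f)" using Cons by auto
    then show ?thesis using False by (auto simp: k intro: gauss_op_commute)
  qed simp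
qed simp

lemma evol_bound: "(\<And>y. norm (apply_bcontfun f y) \<le> b) \<Longrightarrow> norm (evol ks t s f y) \<le> b"
  by (rule order_trans[OF norm_bounded order_trans[OF evol_norm norm_bound]])

lemma evol_lipb: "lipschitz_by L (apply_bcontfun f) \<Longrightarrow> lipschitz_by L (apply_bcontfun (evol ks t s f))"
  unfolding lipschitz_by_def
proof clarify
  fix x h assume "\<forall>x h. norm (f (x + h) - f x) \<le> L * norm h"
  then have "norm (evol ks t s (shift_bc h f - f) x) \<le> L * norm h" by (intro evol_bound) auto
  then show "norm (evol ks t s f (x + h) - evol ks t s f x) \<le> L * norm h" by (simp add: evol_diff evol_shift)
qed

lemma evol_semigroup:
  assumes "\<And>v b. (v,b) \<in> set ks \<Longrightarrow> b integrable_on {t..r} \<and> (\<forall>x\<in>{t..r}. 0 \<le> b x)" "t \<le> s" "s \<le> r"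
  shows "evol ks t s (evol ks s r f) = evol ks t r f"
  using assms(1)
proof (induction ks)
  case (Cons k ks)
  obtain v b where k: "k = (v,b)" by (cases k)
  have b: "b integrable_on {t..r}" "\<forall>x\<in>{t..r}. 0 \<le> b x" using Cons.prems[of v b] k by auto
  have i: "b integrable_on {t..s}" "b integrable_on {s..r}"
    using b assms(2,3) by (auto intro: integrable_subinterval_real)
  have "0 \<le> integral {t..s} b" "0 \<le> integral {s..r} b" using i b(2) assms(2,3) by (auto intro!: integral_nonneg)
  moreover have "integral {t..s} b + integral {s..r} b = integral {t..r} b"
    using b assms(2,3) by (auto intro: Henstock_Kurzweil_Integration.integral_combine)
  ultimately have "gauss_op v (integral {t..s} b) (gauss_op v (integral {s..r} b) (evol ks t r f)) = gauss_op v (integral {t..r} b) (evol ks t r f)"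
    by (simp add: gauss_op_semigroup)
  moreover have "evol ks t s (evol ks s r f) = evol ks t r f" by (rule Cons.IH) (use Cons.prems in auto)
  ultimately show ?case unfolding k evol.simps evol_gs by (simp add: gauss_op_commute[of v "integral {s..r} b" v "integral {t..s} b"])
qed simp

text \<open>Telescoping over the list: each average moves a function of Lipschitz constant L by at
  most L |v| sqrt B and preserves that constant.\<close>

lemma evol_small:
  assumes "\<And>v b. (v,b) \<in> set ks \<Longrightarrow> 0 \<le> integral {t..s} b \<and> integral {t..s} b \<le> B" "lipschitz_by L (apply_bcontfun f)" "0 \<le> L"
  shows "norm (evol ks t s f - f) \<le> L * (\<Sum>(v,b)\<leftarrow>ks. norm v) * sqrt B"
  using assms(1)
proof (induction ks)
  case (Cons k ks)
  obtain v b where k: "k = (v,b)" by (cases k)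
  let ?e = "evol ks t s f" and ?s = "integral {t..s} b"
  have s: "0 \<le> ?s" "?s \<le> B" using Cons.prems[of v b] k by auto
  have "norm (gauss_op v ?s ?e - f) \<le> norm (gauss_op v ?s ?e - ?e) + norm (?e - f)" 
    using norm_triangle_ineq[of "gauss_op v ?s ?e - ?e" "?e - f"] by simp
  also have "\<dots> \<le> L * norm v * sqrt ?s + L * (\<Sum>(v,b)\<leftarrow>ks. norm v) * sqrt B"
    using Cons s assms by (intro add_mono gauss_op_small evol_lipb) auto
  also have "\<dots> \<le> L * norm v * sqrt B + L * (\<Sum>(v,b)\<leftarrow>ks. norm v) * sqrt B"
    using s assms(3) by (intro add_right_mono mult_left_mono) auto
  finally show ?case by (simp add: k algebra_simps)
qed auto

text \<open>Derivatives are encoded by bounds on Taylor remainders, uniformly in the base point: such bounds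
  pass through averages and time integrals without any exchange of limits.\<close>

definition has_dir_deriv :: "'a::real_normed_vector \<Rightarrow> ('a \<Rightarrow>\<^sub>C real) \<Rightarrow> ('a \<Rightarrow>\<^sub>C real) \<Rightarrow> bool" where
  "has_dir_deriv v f H \<longleftrightarrow> (\<exists>c. \<forall>y r. \<bar>f (y + r *\<^sub>R v) - f y - r * H y\<bar> \<le> c * r\<^sup>2)"

text \<open>By \<open>has_dir_deriv_unique\<close> the choice is forced whenever a derivative
  exists; identities between derivatives then reduce to exhibiting one Taylor bound.\<close>

definition dir_deriv :: "'a::real_normed_vector \<Rightarrow> ('a \<Rightarrow>\<^sub>C real) \<Rightarrow> ('a \<Rightarrow>\<^sub>C real)" where
  "dir_deriv v f = (SOME H. has_dir_deriv v f H)"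

lemma has_dir_deriv_deriv:
  assumes "has_dir_deriv v f H"
  shows "((\<lambda>r. f (y + r *\<^sub>R v)) has_real_derivative H (y + r *\<^sub>R v)) (at r)"
proof -
  obtain c where c: "\<And>y r. \<bar>f (y + r *\<^sub>R v) - f y - r * H y\<bar> \<le> c * r\<^sup>2" using assms unfolding has_dir_deriv_def by blast
  have "((\<lambda>h. (f (y + (r + h) *\<^sub>R v) - f (y + r *\<^sub>R v)) / h) \<longlongrightarrow> H (y + r *\<^sub>R v)) (at 0)"
  proof (rule Lim_null[THEN iffD2], rule Lim_null_comparison)
    show "((\<lambda>h. c * \<bar>h\<bar>) \<longlongrightarrow> 0) (at 0)" by (auto intro!: tendsto_eq_intros)
    show "\<forall>\<^sub>F h in at 0. norm ((f (y + (r + h) *\<^sub>R v) - f (y + r *\<^sub>R v)) / h - H (y + r *\<^sub>R v)) \<le> c * \<bar>h\<bar>"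
      unfolding eventually_at
    proof (intro exI[of _ 1] conjI ballI impI, simp)
      fix h :: real assume "h \<noteq> 0 \<and> dist h 0 < 1"
      then have h: "h \<noteq> 0" by auto
      have "f (y + (r + h) *\<^sub>R v) - f (y + r *\<^sub>R v) - h * H (y + r *\<^sub>R v) = f ((y + r *\<^sub>R v) + h *\<^sub>R v) - f (y + r *\<^sub>R v) - h * H (y + r *\<^sub>R v)"
        by (simp add: algebra_simps)
      then have "\<bar>f (y + (r + h) *\<^sub>R v) - f (y + r *\<^sub>R v) - h * H (y + r *\<^sub>R v)\<bar> \<le> c * h\<^sup>2" using c by simp
      then have "\<bar>f (y + (r + h) *\<^sub>R v) - f (y + r *\<^sub>R v) - h * H (y + r *\<^sub>R v)\<bar> / \<bar>h\<bar> \<le> c * \<bar>h\<bar>"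
        using h by (simp add: field_simps power2_eq_square)
      moreover have "(f (y + (r + h) *\<^sub>R v) - f (y + r *\<^sub>R v)) / h - H (y + r *\<^sub>R v) = (f (y + (r + h) *\<^sub>R v) - f (y + r *\<^sub>R v) - h * H (y + r *\<^sub>R v)) / h"
        using h by (simp add: field_simps)
      ultimately show "norm ((f (y + (r + h) *\<^sub>R v) - f (y + r *\<^sub>R v)) / h - H (y + r *\<^sub>R v)) \<le> c * \<bar>h\<bar>"
        by (simp add: abs_divide)
    qed
  qed
  then show ?thesis by (simp add: DERIV_def)
qed

lemma has_dir_deriv_unique:
  assumes "has_dir_deriv v f H" "has_dir_deriv v f H'" shows "H = H'"
proof (rule bcontfun_eqI)
  fix y
  show "H y = H' y" using DERIV_unique[OF has_dir_deriv_deriv[OF assms(1), of y 0] has_dir_deriv_deriv[OF assms(2), of y 0]] by simp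
qed

lemma dir_deriv_eq: "has_dir_deriv v f H \<Longrightarrow> dir_deriv v f = H"
  unfolding dir_deriv_def by (meson has_dir_deriv_unique someI)

lemma has_dir_deriv_diff:
  assumes "has_dir_deriv v f H" "has_dir_deriv v f' H'" shows "has_dir_deriv v (f - f') (H - H')"
proof -
  obtain c where c: "\<And>y r. \<bar>f (y + r *\<^sub>R v) - f y - r * H y\<bar> \<le> c * r\<^sup>2" using assms(1) unfolding has_dir_deriv_def by blast
  obtain c' where c': "\<And>y r. \<bar>f' (y + r *\<^sub>R v) - f' y - r * H' y\<bar> \<le> c' * r\<^sup>2" using assms(2) unfolding has_dir_deriv_def by blast
  have "\<bar>(f - f') (y + r *\<^sub>R v) - (f - f') y - r * (H - H') y\<bar> \<le> (c + c') * r\<^sup>2" for y r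
    using c[of y r] c'[of y r] unfolding minus_bcontfun.rep_eq distrib_right right_diff_distrib by linarith
  then show ?thesis unfolding has_dir_deriv_def by blast
qed

lemma has_dir_deriv_shift: "has_dir_deriv v f H \<Longrightarrow> has_dir_deriv v (shift_bc h f) (shift_bc h H)"
  unfolding has_dir_deriv_def shift_bc_apply
proof (elim exE, intro exI allI)
  fix c y r assume "\<forall>y r. \<bar>f (y + r *\<^sub>R v) - f y - r * H y\<bar> \<le> c * r\<^sup>2"
  from this[rule_format, of "y + h" r] show "\<bar>f (y + r *\<^sub>R v + h) - f (y + h) - r * H (y + h)\<bar> \<le> c * r\<^sup>2"
    by (simp add: add.assoc add.commute[of h])
qed

text \<open>The Taylor remainder for a fixed step r is one bounded function of the base point; it is
  averaged as a whole and keeps its sup bound.\<close>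

lemma has_dir_deriv_evol:
  assumes "has_dir_deriv v f H" shows "has_dir_deriv v (evol ks t s f) (evol ks t s H)"
proof -
  obtain c where c: "\<And>y r. \<bar>f (y + r *\<^sub>R v) - f y - r * H y\<bar> \<le> c * r\<^sup>2" using assms(1) unfolding has_dir_deriv_def by blast
  have "\<bar>evol ks t s (shift_bc (r *\<^sub>R v) f - f - r *\<^sub>R H) y\<bar> \<le> c * r\<^sup>2" for y r
    using evol_bound[of "shift_bc (r *\<^sub>R v) f - f - r *\<^sub>R H" "c * r\<^sup>2" ks t s y] c by simp
  then show ?thesis unfolding has_dir_deriv_def by (auto simp: evol_diff evol_scale evol_shift)
qed

lemma has_dir_deriv_bound:
  assumes "has_dir_deriv v f H" "lipschitz_by L (apply_bcontfun f)"
  shows "\<bar>H y\<bar> \<le> L * norm v"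
proof -
  have D: "((\<lambda>r. f (y + r *\<^sub>R v)) has_real_derivative H y) (at 0)" using has_dir_deriv_deriv[OF assms(1), of y 0] by simp
  have "((\<lambda>h. \<bar>(f (y + (0 + h) *\<^sub>R v) - f (y + 0 *\<^sub>R v)) / h\<bar>) \<longlongrightarrow> \<bar>H y\<bar>) (at 0)"
    using D unfolding DERIV_def by (rule tendsto_rabs)
  then show ?thesis
  proof (rule tendsto_upperbound)
    show "\<forall>\<^sub>F h in at 0. \<bar>(f (y + (0 + h) *\<^sub>R v) - f (y + 0 *\<^sub>R v)) / h\<bar> \<le> L * norm v"
      unfolding eventually_at
    proof (intro exI[of _ 1] conjI ballI impI, simp)
      fix h :: real assume "h \<noteq> 0 \<and> dist h 0 < 1"
      then show "\<bar>(f (y + (0 + h) *\<^sub>R v) - f (y + 0 *\<^sub>R v)) / h\<bar> \<le> L * norm v"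
        using lipschitz_byD[OF assms(2), of y "h *\<^sub>R v"] by (simp add: abs_divide field_simps)
    qed
  qed simp
qed

lemma holder_continuous_on:
  fixes f :: "'a::metric_space \<Rightarrow> 'b::metric_space"
  assumes "\<And>s t. s \<in> S \<Longrightarrow> t \<in> S \<Longrightarrow> dist (f s) (f t) \<le> K * dist s t powr a" "a > 0"
  shows "continuous_on S f"
  unfolding continuous_on_def
proof
  fix t assume t: "t \<in> S"
  show "(f \<longlongrightarrow> f t) (at t within S)"
  proof (rule tendsto_dist_iff[THEN iffD2], rule Lim_null_comparison)
    show "\<forall>\<^sub>F s in at t within S. norm (dist (f s) (f t)) \<le> K * dist s t powr a"
      unfolding eventually_at using assms(1) t by (intro exI[of _ 1]) auto
    have "((\<lambda>s. dist s t) \<longlongrightarrow> 0) (at t within S)" using tendsto_dist_iff[THEN iffD1, OF tendsto_ident_at] by blast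
    then have "((\<lambda>s. dist s t powr a) \<longlongrightarrow> 0) (at t within S)"
      by (rule tendsto_zero_powrI[OF _ tendsto_const]) (use assms(2) in simp_all)
    then show "((\<lambda>s. K * dist s t powr a) \<longlongrightarrow> 0) (at t within S)" by (rule tendsto_mult_right_zero)
  qed
qed

lemma powr_sum_bound: "S \<ge> 0 \<Longrightarrow> x \<ge> 0 \<Longrightarrow> 0 \<le> \<beta> \<Longrightarrow> \<beta> \<le> 1 \<Longrightarrow> (S * x) powr \<beta> \<le> max 1 S * x powr \<beta>"
  for S x \<beta> :: real
proof -
  assume a: "S \<ge> 0" "x \<ge> 0" "0 \<le> \<beta>" "\<beta> \<le> 1"
  have "S powr \<beta> \<le> max 1 S powr \<beta>" using a by (intro powr_mono2) auto
  also have "\<dots> \<le> max 1 S powr 1" using a by (intro powr_mono) auto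
  finally have "S powr \<beta> \<le> max 1 S" by simp
  then show ?thesis using a by (simp add: powr_mult mult_right_mono)
qed

lemma min_interpolation:
  fixes z a b \<theta> :: real
  assumes "0 \<le> z" "z \<le> a" "z \<le> b" "0 \<le> \<theta>" "\<theta> \<le> 1"
  shows "z \<le> a powr (1 - \<theta>) * b powr \<theta>"
proof (cases "z = 0")
  case False
  then have "z = z powr (1 - \<theta>) * z powr \<theta>" using assms by (simp add: powr_add[symmetric])
  also have "\<dots> \<le> a powr (1 - \<theta>) * b powr \<theta>" using assms by (intro mult_mono powr_mono2) auto
  finally show ?thesis .
qed simp

text \<open>Origin of the singularity: with Y = s - t and H = |h|, the bounds Y^(-1/2) and Y^(-1) H,
  taken with exponents 1 - \<alpha> and \<alpha>, combine to Y^(-(1 + \<alpha>)/2)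
  H^\<alpha>.\<close>

lemma interpolation_exponents:
  fixes X Y H \<alpha> :: real
  assumes "0 \<le> X" "0 < Y" "0 \<le> H"
  shows "(X * Y powr (-1/2)) powr (1 - \<alpha>) * (X * (Y powr (-1) * H)) powr \<alpha> = X * Y powr (-(1 + \<alpha>) / 2) * H powr \<alpha>"
proof -
  have X: "X powr (1 - \<alpha>) * X powr \<alpha> = X" using assms by (cases "X = 0") (auto simp: powr_add[symmetric])
  have E: "(-1/2) * (1 - \<alpha>) + (-1) * \<alpha> = -(1 + \<alpha>) / 2" by (simp add: field_simps)
  have Y: "Y powr ((-1/2) * (1 - \<alpha>)) * Y powr ((-1) * \<alpha>) = Y powr (-(1 + \<alpha>) / 2)" unfolding powr_add[symmetric] E ..
  have "(X * Y powr (-1/2)) powr (1 - \<alpha>) = X powr (1 - \<alpha>) * Y powr ((-1/2) * (1 - \<alpha>))"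
    using assms by (simp only: powr_mult powr_powr powr_ge_zero)
  moreover have "(X * (Y powr (-1) * H)) powr \<alpha> = X powr \<alpha> * (Y powr ((-1) * \<alpha>) * H powr \<alpha>)"
    using assms by (simp only: powr_mult powr_powr powr_ge_zero mult_nonneg_nonneg)
  ultimately have "(X * Y powr (-1/2)) powr (1 - \<alpha>) * (X * (Y powr (-1) * H)) powr \<alpha>
    = (X powr (1 - \<alpha>) * X powr \<alpha>) * (Y powr ((-1/2) * (1 - \<alpha>)) * Y powr ((-1) * \<alpha>)) * H powr \<alpha>"
    by (simp only: mult_ac)
  then show ?thesis unfolding X Y .
qed

text \<open>Membership in the Hoelder space with one explicit constant, written as sup bounds on
  remainders that are linear in (f, q, Q). In this form it passes through averages
  (\<open>C2_evol\<close>) and time integrals (\<open>C2_integral\<close>); actual differentiability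
  is recovered in \<open>C2_deriv\<close>.\<close>

definition C2 :: "real \<Rightarrow> real \<Rightarrow> (real^'d \<Rightarrow> real) \<Rightarrow> (real^'d \<Rightarrow> real^'d) \<Rightarrow> (real^'d \<Rightarrow> real^'d^'d) \<Rightarrow> bool" where
  "C2 \<alpha> K f q Q \<longleftrightarrow>
     (\<forall>y. \<bar>f y\<bar> \<le> K \<and> norm (q y) \<le> K \<and> norm (Q y) \<le> K) \<and>
     (\<forall>y h. \<bar>f (y + h) - f y - q y \<bullet> h\<bar> \<le> K * (norm h)\<^sup>2 \<and>
            norm (q (y + h) - q y - Q y *v h) \<le> K * norm h powr (1 + \<alpha>) \<and>
            norm (Q (y + h) - Q y) \<le> K * norm h powr \<alpha>)"

definition outer :: "real^'d \<Rightarrow> real^'d \<Rightarrow> real^'d^'d" where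
  "outer x y = (\<chi> k l. x $ k * y $ l)"

lemma outer_mult: "outer x y *v h = (y \<bullet> h) *\<^sub>R x"
  by (simp add: outer_def matrix_vector_mult_def vec_eq_iff inner_vec_def sum_distrib_left mult_ac)

lemma sqrt_half: "0 < x \<Longrightarrow> 1 / sqrt (x / 2) \<le> 2 / sqrt x"
proof -
  assume x: "0 < x"
  have "sqrt x / 2 = sqrt (x / 4)" by (simp add: real_sqrt_divide)
  also have "\<dots> \<le> sqrt (x / 2)" using x by (intro real_sqrt_le_mono) auto
  finally have "1 / sqrt (x / 2) \<le> 1 / (sqrt x / 2)" using x by (intro divide_left_mono) auto
  then show ?thesis by simp
qed

section \<open>Smoothing estimates\<close>

text \<open>\<open>ks\<close> lists the directions and weights of the diffusion. The
  \<open>v i\<close> are the directions whose weights are bounded below, and \<open>w\<close> is the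
  dual basis, so that the coefficients of h along the frame are \<open>w i \<bullet> h\<close>. The
  time exponent \<alpha>/2 matches the space exponent \<alpha> under parabolic scaling.\<close>

locale diffusion =
  fixes ks :: "((real^'d) \<times> (real \<Rightarrow> real)) list" and v w :: "'d::finite \<Rightarrow> real^'d" and T1 K0 \<alpha> :: real
  assumes T1: "0 < T1" "T1 \<le> 1" and alpha: "0 < \<alpha>" "\<alpha> < 1"
    and b_nonneg: "\<And>x b t. (x,b) \<in> set ks \<Longrightarrow> t \<in> {0..T1} \<Longrightarrow> 0 \<le> b t"
    and b_bound: "\<And>x b t. (x,b) \<in> set ks \<Longrightarrow> t \<in> {0..T1} \<Longrightarrow> b t \<le> K0"
    and b_holder: "\<And>x b s t. (x,b) \<in> set ks \<Longrightarrow> s \<in> {0..T1} \<Longrightarrow> t \<in> {0..T1} \<Longrightarrow> \<bar>b s - b t\<bar> \<le> K0 * \<bar>s - t\<bar> powr (\<alpha> / 2)"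
    and dual: "\<And>h. (\<Sum>i\<in>UNIV. (w i \<bullet> h) *\<^sub>R v i) = h"
    and smooth: "\<And>i. \<exists>b. (v i, b) \<in> set ks \<and> (\<forall>t\<in>{0..T1}. 1/2 \<le> b t)"
begin

abbreviation P :: "real \<Rightarrow> real \<Rightarrow> ((real^'d) \<Rightarrow>\<^sub>C 'b::euclidean_space) \<Rightarrow> (real^'d) \<Rightarrow>\<^sub>C 'b" where
  "P \<equiv> evol ks"

definition R :: "'d \<Rightarrow> real \<Rightarrow> real \<Rightarrow> ((real^'d) \<Rightarrow>\<^sub>C real) \<Rightarrow> (real^'d) \<Rightarrow>\<^sub>C real" where
  "R i t s f = dir_deriv (v i) (P t s f)"

definition cS :: real where "cS = (\<Sum>(v,b)\<leftarrow>ks. norm v) * sqrt K0"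

lemma b_integrable: "(x,b) \<in> set ks \<Longrightarrow> 0 \<le> t \<Longrightarrow> s \<le> T1 \<Longrightarrow> b integrable_on {t..s}"
proof -
  assume a: "(x,b) \<in> set ks" "0 \<le> t" "s \<le> T1"
  have "continuous_on {0..T1} b"
    by (rule holder_continuous_on[where K=K0 and a="\<alpha>/2"]) (use b_holder[OF a(1)] alpha in \<open>auto simp: dist_real_def\<close>)
  then show ?thesis by (rule integrable_continuous_real[OF continuous_on_subset]) (use a in auto)
qed

text \<open>The third estimate freezes the weight at the later end point: its oscillation, at most
  K0 (s - t)^(\<alpha>/2), is integrated over length s - t.\<close>

lemma b_integral:
  assumes "(x,b) \<in> set ks" "0 \<le> t" "t \<le> s" "s \<le> T1"
  shows "0 \<le> integral {t..s} b" "integral {t..s} b \<le> K0 * (s - t)"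
    "\<bar>integral {t..s} b - (s - t) * b s\<bar> \<le> K0 * (s - t) powr (1 + \<alpha> / 2)"
    "(\<forall>r\<in>{0..T1}. c \<le> b r) \<Longrightarrow> c * (s - t) \<le> integral {t..s} b"
proof -
  have i: "b integrable_on {t..s}" using assms b_integrable by auto
  show "0 \<le> integral {t..s} b" using i b_nonneg[OF assms(1)] assms by (intro integral_nonneg) auto
  have "integral {t..s} b \<le> integral {t..s} (\<lambda>_. K0)"
    using i b_bound[OF assms(1)] assms by (intro integral_le) auto
  then show "integral {t..s} b \<le> K0 * (s - t)" using assms by (simp add: mult.commute)
  show "c * (s - t) \<le> integral {t..s} b" if "\<forall>r\<in>{0..T1}. c \<le> b r"
  proof -
    have "integral {t..s} (\<lambda>_. c) \<le> integral {t..s} b" using i that assms by (intro integral_le) auto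
    then show ?thesis using assms by (simp add: mult.commute)
  qed
  have "0 \<le> K0" using b_nonneg[OF assms(1), of 0] b_bound[OF assms(1), of 0] T1 by auto
  have "norm (integral {t..s} (\<lambda>r. b r - b s)) \<le> integral {t..s} (\<lambda>_. K0 * (s - t) powr (\<alpha> / 2))"
  proof (rule integral_norm_bound_integral)
    show "(\<lambda>r. b r - b s) integrable_on {t..s}" using i by (intro integrable_diff) auto
    fix r assume r: "r \<in> {t..s}"
    have "\<bar>b r - b s\<bar> \<le> K0 * \<bar>r - s\<bar> powr (\<alpha> / 2)" by (intro b_holder[OF assms(1)]) (use r assms in auto)
    also have "\<dots> \<le> K0 * (s - t) powr (\<alpha> / 2)" using r alpha \<open>0 \<le> K0\<close> by (intro mult_left_mono powr_mono2) auto
    finally show "norm (b r - b s) \<le> K0 * (s - t) powr (\<alpha> / 2)" by simp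
  qed (rule integrable_const_ivl)
  moreover have "integral {t..s} (\<lambda>r. b r - b s) = integral {t..s} b - (s - t) * b s"
    using i assms by (subst integral_diff) auto
  ultimately have 1: "\<bar>integral {t..s} b - (s - t) * b s\<bar> \<le> K0 * ((s - t) * (s - t) powr (\<alpha> / 2))"
    using assms by (simp add: mult_ac)
  have 2: "(s - t) * (s - t) powr (\<alpha> / 2) = (s - t) powr (1 + \<alpha> / 2)"
    using assms by (simp add: powr_add)
  show "\<bar>integral {t..s} b - (s - t) * b s\<bar> \<le> K0 * (s - t) powr (1 + \<alpha> / 2)" using 1 unfolding 2 .
qed

lemma P_semi: "0 \<le> t \<Longrightarrow> t \<le> s \<Longrightarrow> s \<le> r \<Longrightarrow> r \<le> T1 \<Longrightarrow> P t s (P s r f) = P t r f"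
  by (rule evol_semigroup) (auto simp: b_integrable b_nonneg)

lemma cS_nonneg: "0 \<le> cS"
  and K0_nonneg: "0 \<le> K0"
proof -
  obtain b where b: "(v undefined, b) \<in> set ks" using smooth by blast
  show "0 \<le> K0" using b_nonneg[OF b, of 0] b_bound[OF b, of 0] T1 by auto
  then show "0 \<le> cS" unfolding cS_def by (auto intro!: mult_nonneg_nonneg sum_list_nonneg)
qed

lemma P_small:
  assumes "lipschitz_by L (apply_bcontfun f)" "0 \<le> L" "0 \<le> t" "t \<le> s" "s \<le> T1"
  shows "norm (P t s f - f) \<le> L * cS * sqrt (s - t)"
proof -
  have "norm (P t s f - f) \<le> L * (\<Sum>(v,b)\<leftarrow>ks. norm v) * sqrt (K0 * (s - t))"
    using assms b_integral by (intro evol_small) auto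
  then show ?thesis by (simp add: cS_def real_sqrt_mult mult_ac)
qed

text \<open>The direction \<open>v i\<close> is taken out of the composition. Its accumulated
  variance is at least (s - t)/2, which gives the smoothing of one Gaussian average; the remaining
  averages are contractions.\<close>

lemma R_dd:
  assumes "0 \<le> t" "t < s" "s \<le> T1"
  shows R_has: "has_dir_deriv (v i) (P t s f) (R i t s f)" and R_norm: "norm (R i t s f) \<le> 2 / sqrt (s - t) * norm f"
proof -
  obtain b where b: "(v i, b) \<in> set ks" "\<forall>t\<in>{0..T1}. 1/2 \<le> b t" using smooth by blast
  let ?s = "integral {t..s} b" and ?g = "evol (remove1 (v i, b) ks) t s f"
  have s: "1/2 * (s - t) \<le> ?s" using assms b by (intro b_integral(4)[OF b(1)]) auto
  then have s0: "?s > 0" using assms by auto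
  obtain K where K: "\<And>(f :: (real^'d) \<Rightarrow>\<^sub>C real) v s. s > 0 \<Longrightarrow>
    \<exists>H. norm H \<le> norm f / sqrt s \<and> (\<forall>y r. \<bar>gauss_op v s f (y + r *\<^sub>R v) - gauss_op v s f y - r * apply_bcontfun H y\<bar> \<le> K * norm f / s * r\<^sup>2)"
    by (rule gauss_op_directional_derivative[where 'a="real^'d"]) blast
  obtain H where H: "norm H \<le> norm ?g / sqrt ?s"
    "\<forall>y r. \<bar>gauss_op (v i) ?s ?g (y + r *\<^sub>R v i) - gauss_op (v i) ?s ?g y - r * apply_bcontfun H y\<bar> \<le> K * norm ?g / ?s * r\<^sup>2"
    using K[OF s0, of ?g "v i"] by blast
  have "has_dir_deriv (v i) (P t s f) H" unfolding has_dir_deriv_def evol_remove1[OF b(1)] using H(2) by blast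
  then show 1: "has_dir_deriv (v i) (P t s f) (R i t s f)" unfolding R_def by (metis dir_deriv_eq)
  then have "R i t s f = H" using \<open>has_dir_deriv (v i) (P t s f) H\<close> has_dir_deriv_unique by blast
  then have "norm (R i t s f) \<le> norm ?g / sqrt ?s" using H(1) by simp
  also have "\<dots> \<le> norm f / sqrt ?s" by (intro divide_right_mono evol_norm) (use s0 in auto)
  also have "\<dots> \<le> norm f / (sqrt (s - t) / 2)"
  proof (intro divide_left_mono)
    have "sqrt (s - t) / 2 = sqrt ((s - t) / 4)" by (simp add: real_sqrt_divide)
    also have "\<dots> \<le> sqrt ?s" using s assms by (intro real_sqrt_le_mono) auto
    finally show "sqrt (s - t) / 2 \<le> sqrt ?s" .
  qed (use s0 assms in auto)
  finally show "norm (R i t s f) \<le> 2 / sqrt (s - t) * norm f" by (simp add: mult.commute)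
qed

lemma R_P: "0 \<le> t \<Longrightarrow> t < s \<Longrightarrow> s \<le> r \<Longrightarrow> r \<le> T1 \<Longrightarrow> R i t s (P s r f) = R i t r f"
  by (simp add: R_def P_semi)

lemma P_R: "0 \<le> t \<Longrightarrow> t \<le> s \<Longrightarrow> s < r \<Longrightarrow> r \<le> T1 \<Longrightarrow> P t s (R i s r f) = R i t r f"
  using has_dir_deriv_evol[OF R_has[of s r i f], of ks t s] by (simp add: P_semi R_def dir_deriv_eq)

lemma R_diff: "0 \<le> t \<Longrightarrow> t < s \<Longrightarrow> s \<le> T1 \<Longrightarrow> R i t s (f - g) = R i t s f - R i t s g"
  using has_dir_deriv_diff[OF R_has[of t s i f] R_has[of t s i g]] by (simp add: R_def evol_diff dir_deriv_eq)

lemma R_shift: "0 \<le> t \<Longrightarrow> t < s \<Longrightarrow> s \<le> T1 \<Longrightarrow> R i t s (shift_bc h f) = shift_bc h (R i t s f)"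
  using has_dir_deriv_shift[OF R_has[of t s i f]] by (simp add: R_def evol_shift dir_deriv_eq)

definition cV :: real where "cV = (\<Sum>i\<in>UNIV. norm (v i))"
definition cW :: real where "cW = (\<Sum>i\<in>UNIV. norm (w i))"
text \<open>The constant of \<open>frame_taylor\<close>: \<open>cW\<close> bounds the coefficients
  of h in the frame, the maximum bounds the length of the path along the frame. Taking it with 1
  serves all exponents between 0 and 1 at once.\<close>

definition cF :: real where "cF = cW * max 1 (\<Sum>i\<in>UNIV. norm (w i) * norm (v i))"

lemma c_nonneg: "0 \<le> cV" "0 \<le> cW" "0 \<le> cF" "norm (v i) \<le> cV" "norm (w i) \<le> cW"
  unfolding cV_def cW_def cF_def by (auto intro!: sum_nonneg mult_nonneg_nonneg member_le_sum)

lemma R_lip: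
  assumes "lipschitz_by L (apply_bcontfun f)" "0 \<le> L" "0 \<le> t" "t < s" "s \<le> T1"
  shows "norm (R i t s f) \<le> L * cV"
proof (rule norm_bound)
  fix y
  have "\<bar>R i t s f y\<bar> \<le> L * norm (v i)"
    using assms by (intro has_dir_deriv_bound[OF R_has] evol_lipb) auto
  also have "\<dots> \<le> L * cV" using assms c_nonneg by (intro mult_left_mono) auto
  finally show "norm (R i t s f y) \<le> L * cV" by simp
qed

text \<open>The step h is walked along the frame, one direction at a time. On each leg the mean
  value bound applies to f minus the linear function of slope H i y, and every point met lies within
  \<open>D\<close> of y. Directional derivatives thus control the full remainder.\<close>

lemma frame_taylor:
  assumes dd: "\<And>i. has_dir_deriv (v i) f (H i)"
    and H: "\<And>i x h. \<bar>H i (x + h) - H i x\<bar> \<le> L * norm h powr \<beta>" and "0 \<le> L" "0 \<le> \<beta>" "\<beta> \<le> 1"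
  shows "\<bar>f (y + h) - f y - (\<Sum>i\<in>UNIV. (w i \<bullet> h) * H i y)\<bar> \<le> cF * L * norm h powr (1 + \<beta>)"
proof -
  define r where "r i = w i \<bullet> h" for i
  define D where "D = (\<Sum>i\<in>UNIV. \<bar>r i\<bar> * norm (v i))"
  have "\<bar>f (y + (\<Sum>i\<in>J. r i *\<^sub>R v i)) - f y - (\<Sum>i\<in>J. r i * H i y)\<bar> \<le> (\<Sum>i\<in>J. \<bar>r i\<bar>) * (L * D powr \<beta>)" for J
    using finite[of J]
  proof (induction J)
    case (insert i J)
    define z where "z = y + (\<Sum>i\<in>J. r i *\<^sub>R v i)"
    have "norm ((f (z + r i *\<^sub>R v i) - r i * H i y) - (f (z + 0 *\<^sub>R v i) - 0 * H i y)) \<le> (L * D powr \<beta>) * norm (r i - 0)"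
    proof (rule field_differentiable_bound[where S="{-\<bar>r i\<bar>..\<bar>r i\<bar>}" and f="\<lambda>\<theta>. f (z + \<theta> *\<^sub>R v i) - \<theta> * H i y"
            and f'="\<lambda>\<theta>. H i (z + \<theta> *\<^sub>R v i) - H i y"])
      fix \<theta> assume \<theta>: "\<theta> \<in> {-\<bar>r i\<bar>..\<bar>r i\<bar>}"
      show "((\<lambda>\<theta>. f (z + \<theta> *\<^sub>R v i) - \<theta> * H i y) has_field_derivative H i (z + \<theta> *\<^sub>R v i) - H i y) (at \<theta> within {-\<bar>r i\<bar>..\<bar>r i\<bar>})"
        by (rule has_field_derivative_at_within) (auto intro!: derivative_eq_intros has_dir_deriv_deriv[OF dd])
      have "norm ((\<Sum>i\<in>J. r i *\<^sub>R v i) + \<theta> *\<^sub>R v i) \<le> (\<Sum>i\<in>J. \<bar>r i\<bar> * norm (v i)) + \<bar>r i\<bar> * norm (v i)"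
      proof (rule norm_triangle_mono)
        show "norm (\<Sum>i\<in>J. r i *\<^sub>R v i) \<le> (\<Sum>i\<in>J. \<bar>r i\<bar> * norm (v i))" by (rule order_trans[OF norm_sum]) auto
        show "norm (\<theta> *\<^sub>R v i) \<le> \<bar>r i\<bar> * norm (v i)" using \<theta> by (auto intro!: mult_right_mono)
      qed
      also have "\<dots> = (\<Sum>i\<in>insert i J. \<bar>r i\<bar> * norm (v i))" using insert by simp
      also have "\<dots> \<le> D" unfolding D_def by (rule sum_mono2) auto
      finally have nD: "norm ((\<Sum>i\<in>J. r i *\<^sub>R v i) + \<theta> *\<^sub>R v i) \<le> D" .
      have "\<bar>H i (y + ((\<Sum>i\<in>J. r i *\<^sub>R v i) + \<theta> *\<^sub>R v i)) - H i y\<bar> \<le> L * norm ((\<Sum>i\<in>J. r i *\<^sub>R v i) + \<theta> *\<^sub>R v i) powr \<beta>" by (rule H)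
      also have "\<dots> \<le> L * D powr \<beta>" using nD assms by (intro mult_left_mono powr_mono2) auto
      finally show "norm (H i (z + \<theta> *\<^sub>R v i) - H i y) \<le> L * D powr \<beta>" by (simp add: z_def add.assoc)
    qed auto
    then have "\<bar>f (z + r i *\<^sub>R v i) - f z - r i * H i y\<bar> \<le> \<bar>r i\<bar> * (L * D powr \<beta>)" by (simp add: mult.commute algebra_simps)
    with insert show ?case by (simp add: z_def algebra_simps)
  qed simp
  from this[of UNIV] have 1: "\<bar>f (y + h) - f y - (\<Sum>i\<in>UNIV. (w i \<bullet> h) * H i y)\<bar> \<le> (\<Sum>i\<in>UNIV. \<bar>r i\<bar>) * (L * D powr \<beta>)"
    by (simp add: r_def dual)
  have r: "\<bar>r i\<bar> \<le> norm (w i) * norm h" for i unfolding r_def by (rule Cauchy_Schwarz_ineq2)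
  have a: "(\<Sum>i\<in>UNIV. \<bar>r i\<bar>) \<le> cW * norm h" unfolding cW_def sum_distrib_right by (rule sum_mono) (rule r)
  define S where "S = (\<Sum>i\<in>UNIV. norm (w i) * norm (v i))"
  have S: "S \<ge> 0" unfolding S_def by (auto intro!: sum_nonneg)
  have "D \<le> S * norm h" unfolding D_def S_def sum_distrib_right
  proof (rule sum_mono)
    fix i show "\<bar>r i\<bar> * norm (v i) \<le> norm (w i) * norm (v i) * norm h"
      using mult_right_mono[OF r[of i] norm_ge_zero[of "v i"]] by (simp add: mult_ac)
  qed
  then have "D powr \<beta> \<le> (S * norm h) powr \<beta>" using assms by (intro powr_mono2) (auto simp: D_def intro!: sum_nonneg)
  also have "\<dots> \<le> max 1 S * norm h powr \<beta>" using S assms by (intro powr_sum_bound) auto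
  finally have "(\<Sum>i\<in>UNIV. \<bar>r i\<bar>) * (L * D powr \<beta>) \<le> (cW * norm h) * (L * (max 1 S * norm h powr \<beta>))"
    using assms a c_nonneg by (intro mult_mono mult_left_mono) (auto intro!: mult_nonneg_nonneg)
  also have "\<dots> = cF * L * norm h powr (1 + \<beta>)" by (simp add: cF_def S_def powr_add powr_one mult_ac)
  finally show ?thesis using 1 by simp
qed

text \<open>This is \<open>frame_taylor\<close> with exponent 0: bounded directional derivatives
  oscillate by at most 2 M.\<close>

lemma frame_lip:
  assumes dd: "\<And>i. has_dir_deriv (v i) f (H i)" and H: "\<And>i. norm (H i) \<le> M"
  shows "lipschitz_by ((2 * cF + cW) * M) (apply_bcontfun f)"
  unfolding lipschitz_by_def
proof clarify
  fix x h
  have M: "0 \<le> M" using H[of undefined] norm_ge_zero order_trans by blast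
  have Hb: "\<bar>H i y\<bar> \<le> M" for i y using norm_bounded[of "H i" y] H[of i] by simp
  \<comment> \<open>\<open>0 powr 0\<close> is 0, so h = 0 is split off.\<close>
  have "\<bar>H i (x + h) - H i x\<bar> \<le> (2 * M) * norm h powr 0" for i x h
    using Hb[of i "x + h"] Hb[of i x] by (cases "h = 0") auto
  from frame_taylor[OF dd this, of x h] M
  have "\<bar>f (x + h) - f x - (\<Sum>i\<in>UNIV. (w i \<bullet> h) * H i x)\<bar> \<le> cF * (2 * M) * norm h" by simp
  moreover have "\<bar>\<Sum>i\<in>UNIV. (w i \<bullet> h) * H i x\<bar> \<le> (\<Sum>i\<in>UNIV. norm (w i) * norm h * M)"
  proof (rule order_trans[OF sum_abs sum_mono])
    fix i show "\<bar>(w i \<bullet> h) * H i x\<bar> \<le> norm (w i) * norm h * M"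
      unfolding abs_mult by (intro mult_mono Cauchy_Schwarz_ineq2 Hb) auto
  qed
  moreover have "(\<Sum>i\<in>UNIV. norm (w i) * norm h * M) = cW * M * norm h"
    by (simp add: cW_def sum_distrib_left sum_distrib_right mult_ac)
  ultimately show "norm (f (x + h) - f x) \<le> (2 * cF + cW) * M * norm h" by (simp add: algebra_simps)
qed

definition cP :: real where "cP = 2 * (2 * cF + cW) + 1"

lemma cP_pos: "0 < cP" using c_nonneg by (auto simp: cP_def)

lemma P_smooth:
  fixes f :: "(real^'d) \<Rightarrow>\<^sub>C real"
  assumes "0 \<le> t" "t < s" "s \<le> T1"
  shows "lipschitz_by (cP / sqrt (s - t) * norm f) (apply_bcontfun (P t s f))"
proof -
  have "lipschitz_by ((2 * cF + cW) * (2 / sqrt (s - t) * norm f)) (apply_bcontfun (P t s f))"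
  proof (rule frame_lip[where H="\<lambda>i. R i t s f"])
    show "has_dir_deriv (v i) (P t s f) (R i t s f)" for i using assms by (intro R_has) auto
    show "norm (R i t s f) \<le> 2 / sqrt (s - t) * norm f" for i using assms by (intro R_norm) auto
  qed
  then show ?thesis
    by (rule lipschitz_by_mono) (use assms in \<open>auto simp: cP_def field_simps\<close>)
qed

text \<open>Each derivative gets half of the time interval for smoothing: the semigroup law puts
  \<open>R j\<close> on the later half and \<open>R i\<close> on the earlier one.\<close>

definition R2 :: "'d \<Rightarrow> 'd \<Rightarrow> real \<Rightarrow> real \<Rightarrow> ((real^'d) \<Rightarrow>\<^sub>C real) \<Rightarrow> (real^'d) \<Rightarrow>\<^sub>C real" where
  "R2 i j t s f = R i t ((t + s) / 2) (R j ((t + s) / 2) s f)"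

text \<open>Two intermediate times are compared through an earlier one: the evolution between them
  may be absorbed either by the outer derivative (\<open>R_P\<close>) or by the inner one
  (\<open>P_R\<close>).\<close>

lemma R2_split:
  assumes "0 \<le> t" "t < m" "m < s" "s \<le> T1"
  shows "R i t m (R j m s f) = R2 i j t s f"
proof -
  have *: "R i t m (R j m s f) = R i t m' (R j m' s f)" if "0 \<le> t" "t < m'" "m' \<le> m" "m < s" "s \<le> T1" for m m'
    using that by (subst R_P[of t m' m, symmetric]) (auto simp: P_R)
  show ?thesis unfolding R2_def
    using *[of "min m ((t + s)/2)" m] *[of "min m ((t + s)/2)" "(t + s)/2"] assms by (auto simp: min_def split: if_splits)
qed

lemma R2_has: "0 \<le> t \<Longrightarrow> t < s \<Longrightarrow> s \<le> T1 \<Longrightarrow> has_dir_deriv (v i) (R j t s f) (R2 i j t s f)"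
  using R_has[of t "(t + s)/2" i "R j ((t + s) / 2) s f"] by (simp add: R2_def P_R)

text \<open>For Lipschitz f the derivative over the later half is bounded by L cV without any
  singularity; the earlier half smooths it at the price of one factor (s - t)^(-1/2).\<close>

lemma R_lipb:
  assumes "lipschitz_by L (apply_bcontfun f)" "0 \<le> L" "0 \<le> t" "t < s" "s \<le> T1"
  shows "lipschitz_by (2 * cP * cV * L / sqrt (s - t)) (apply_bcontfun (R j t s f))"
proof -
  define m where "m = (t + s) / 2"
  have m: "t < m" "m < s" "m - t = (s - t) / 2" using assms by (auto simp: m_def field_simps)
  have "lipschitz_by (cP / sqrt (m - t) * norm (R j m s f)) (apply_bcontfun (P t m (R j m s f)))" using assms m by (intro P_smooth) auto
  then have *: "lipschitz_by (cP / sqrt (m - t) * norm (R j m s f)) (apply_bcontfun (R j t s f))" using assms m(1,2) by (simp add: P_R)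
  show ?thesis
  proof (rule lipschitz_by_mono[OF *])
    have "cP * (1 / sqrt ((s - t) / 2)) * norm (R j m s f) \<le> cP * (2 / sqrt (s - t)) * (L * cV)"
      using assms m cP_pos c_nonneg by (intro mult_mono mult_left_mono sqrt_half R_lip) auto
    then show "cP / sqrt (m - t) * norm (R j m s f) \<le> 2 * cP * cV * L / sqrt (s - t)" by (simp add: m mult_ac)
  qed
qed

text \<open>The summand 4 cV is for the sup bound of second derivatives, 16 cP cV for the bound of
  their increments by |h| / (s - t).\<close>

definition c2 :: real where "c2 = 4 * cV * (1 + 4 * cP)"

text \<open>One derivative always falls on the Lipschitz bound of f, so second derivatives cost (s -
  t)^(-1/2) and their increments |h| / (s - t). Increments are also at most twice the sup bound;
  interpolating the two estimates yields an integrable singularity.\<close>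

lemma R2_bounds:
  assumes "lipschitz_by L (apply_bcontfun f)" "0 \<le> L" "0 \<le> t" "t < s" "s \<le> T1"
  shows R2_norm: "norm (R2 i j t s f) \<le> c2 * L / sqrt (s - t)"
    and R2_holder: "\<bar>R2 i j t s f (x + h) - R2 i j t s f x\<bar> \<le> 2 * c2 * L * (s - t) powr (-(1 + \<alpha>) / 2) * norm h powr \<alpha>"
proof -
  define m where "m = (t + s) / 2"
  have m: "t < m" "m < s" "m - t = (s - t) / 2" "s - m = (s - t) / 2" using assms by (auto simp: m_def field_simps)
  have p: "s - t > 0" using assms by simp
  have "norm (R i t m (R j m s f)) \<le> 2 * (1 / sqrt (m - t)) * norm (R j m s f)" using R_norm[of t m i "R j m s f"] m(1,2) assms by auto
  also have "\<dots> \<le> 2 * (2 / sqrt (s - t)) * (L * cV)" unfolding m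
    using assms m c_nonneg by (intro mult_mono mult_left_mono sqrt_half R_lip) auto
  also have "\<dots> = (4 * cV * L) / sqrt (s - t)" by simp
  also have "\<dots> \<le> c2 * L / sqrt (s - t)"
    unfolding c2_def using assms c_nonneg cP_pos by (intro divide_right_mono mult_right_mono) (auto simp: algebra_simps)
  finally show 1: "norm (R2 i j t s f) \<le> c2 * L / sqrt (s - t)" using R2_split[OF assms(3) m(1,2) assms(5)] by simp
  have 2: "\<bar>R2 i j t s f (x + h) - R2 i j t s f x\<bar> \<le> c2 * L * norm h / (s - t)" for x h
  proof -
    let ?g = "R j m s f"
    have e: "R2 i j t s f (x + h) - R2 i j t s f x = R i t m (shift_bc h ?g - ?g) x"
      using R2_split[OF assms(3) m(1,2) assms(5), symmetric] assms m by (simp add: R_diff R_shift)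
    have g: "norm (shift_bc h ?g - ?g) \<le> 2 * cP * cV * L * (2 / sqrt (s - t)) * norm h"
    proof (rule norm_bound)
      fix z
      have "norm (?g (z + h) - ?g z) \<le> 2 * cP * cV * L / sqrt (s - m) * norm h"
        by (rule lipschitz_byD[OF R_lipb[OF assms(1,2)]]) (use m(1,2) assms in auto)
      also have "\<dots> = 2 * cP * cV * L * (1 / sqrt ((s - t) / 2)) * norm h" unfolding m by simp
      also have "\<dots> \<le> 2 * cP * cV * L * (2 / sqrt (s - t)) * norm h"
        using p c_nonneg cP_pos assms by (intro mult_right_mono mult_left_mono sqrt_half) auto
      finally show "norm ((shift_bc h ?g - ?g) z) \<le> 2 * cP * cV * L * (2 / sqrt (s - t)) * norm h" by simp
    qed
    have "\<bar>R i t m (shift_bc h ?g - ?g) x\<bar> \<le> norm (R i t m (shift_bc h ?g - ?g))" using norm_bounded[of "R i t m (shift_bc h ?g - ?g)" x] by simp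
    also have "\<dots> \<le> 2 / sqrt (m - t) * norm (shift_bc h ?g - ?g)" using m(1,2) assms by (intro R_norm) auto
    also have "\<dots> = 2 * (1 / sqrt ((s - t) / 2)) * norm (shift_bc h ?g - ?g)" unfolding m by simp
    also have "\<dots> \<le> 2 * (2 / sqrt (s - t)) * (2 * cP * cV * L * (2 / sqrt (s - t)) * norm h)"
      using p assms by (intro mult_mono g mult_left_mono sqrt_half) auto
    also have "\<dots> = 16 * cP * cV * L * norm h / (s - t)" using p by simp
    also have "\<dots> \<le> c2 * L * norm h / (s - t)"
      unfolding c2_def using p c_nonneg cP_pos assms by (intro divide_right_mono mult_right_mono) (auto simp: algebra_simps)
    finally show ?thesis using e by simp
  qed
  have c2: "0 \<le> c2" unfolding c2_def using c_nonneg cP_pos by auto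
  let ?z = "\<bar>R2 i j t s f (x + h) - R2 i j t s f x\<bar>"
  have "?z \<le> 2 * (c2 * L / sqrt (s - t))"
    using norm_bounded[of "R2 i j t s f" "x + h"] norm_bounded[of "R2 i j t s f" x] 1 by (simp add: abs_if split: if_splits)
  then have za: "?z \<le> (2 * c2 * L) * (s - t) powr (-1/2)" using p by (simp add: powr_minus powr_half_sqrt field_simps)
  have "0 \<le> c2 * L * norm h / (s - t)" using c2 p assms by auto
  then have zb: "?z \<le> (2 * c2 * L) * ((s - t) powr (-1) * norm h)"
    using 2[of x h] p by (simp add: powr_minus divide_inverse mult_ac)
  have "?z \<le> ((2 * c2 * L) * (s - t) powr (-1/2)) powr (1 - \<alpha>) * ((2 * c2 * L) * ((s - t) powr (-1) * norm h)) powr \<alpha>"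
    by (rule min_interpolation[OF abs_ge_zero za zb]) (use alpha in auto)
  also have "\<dots> = (2 * c2 * L) * (s - t) powr (-(1 + \<alpha>) / 2) * norm h powr \<alpha>"
    by (rule interpolation_exponents) (use c2 p assms in auto)
  finally show "?z \<le> 2 * c2 * L * (s - t) powr (-(1 + \<alpha>) / 2) * norm h powr \<alpha>" .
qed

end

section \<open>Stability of the class \<open>C2\<close>\<close>

lemma norm_matrix_vector_le: "norm (A *v x) \<le> norm A * norm x" for A :: "real^'n^'m"
proof -
  have "\<bar>(A *v x) $ i\<bar> \<le> norm (A $ i) * norm x" for i
    using Cauchy_Schwarz_ineq2[of "A $ i" x] by (simp add: matrix_vector_mul_component)
  then have "norm (A *v x) \<le> L2_set (\<lambda>i. norm (A $ i) * norm x) UNIV"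
    unfolding norm_vec_def by (intro L2_set_mono) (auto simp: real_norm_def)
  also have "\<dots> = norm A * norm x" unfolding norm_vec_def[of A] by (simp add: L2_set_left_distrib)
  finally show ?thesis .
qed

lemma bounded_linear_mult_vector: "bounded_linear (\<lambda>M :: real^'n^'m. M *v h)"
  by (rule bounded_linear_intro[where K="norm h"])
     (auto simp: matrix_vector_mult_add_rdistrib scaleR_matrix_vector_assoc norm_matrix_vector_le)

lemma C2_mono: "C2 \<alpha> K f q Q \<Longrightarrow> K \<le> K' \<Longrightarrow> C2 \<alpha> K' f q Q"
  unfolding C2_def by (meson mult_right_mono order_trans powr_ge_zero zero_le_power2)

lemma C2_nonneg: "C2 \<alpha> K f q Q \<Longrightarrow> 0 \<le> K"
  unfolding C2_def by (meson abs_ge_zero order_trans)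

lemma C2_bounds:
  assumes "C2 \<alpha> K f q Q"
  shows "\<bar>f y\<bar> \<le> K" "norm (q y) \<le> K" "norm (Q y) \<le> K"
    "\<bar>f (y + h) - f y - q y \<bullet> h\<bar> \<le> K * (norm h)\<^sup>2"
    "norm (q (y + h) - q y - Q y *v h) \<le> K * norm h powr (1 + \<alpha>)"
    "norm (Q (y + h) - Q y) \<le> K * norm h powr \<alpha>"
  using assms unfolding C2_def by auto

lemma has_derivative_of_remainder:
  fixes f :: "'a::real_normed_vector \<Rightarrow> 'b::real_normed_vector"
  assumes "bounded_linear f'" "\<And>h. norm (f (y + h) - f y - f' h) \<le> K * norm h powr (1 + a)" "a > 0"
  shows "(f has_derivative f') (at y)"
  unfolding has_derivative_at
proof (intro conjI assms(1), rule Lim_null_comparison)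
  show "\<forall>\<^sub>F h in at 0. norm (norm (f (y + h) - f y - f' h) / norm h) \<le> K * norm h powr a"
    unfolding eventually_at
  proof (intro exI[of _ 1] conjI ballI impI, simp)
    fix h :: 'a assume "h \<noteq> 0 \<and> dist h 0 < 1"
    then have h: "norm h > 0" by auto
    have "norm (f (y + h) - f y - f' h) / norm h \<le> (K * norm h powr (1 + a)) / norm h"
      using assms(2) h by (intro divide_right_mono) auto
    also have "\<dots> = K * norm h powr a" using h by (simp add: powr_add)
    finally show "norm (norm (f (y + h) - f y - f' h) / norm h) \<le> K * norm h powr a" by simp
  qed
  have "((\<lambda>h::'a. norm h) \<longlongrightarrow> 0) (at 0)" by (simp add: tendsto_norm_zero)
  then have "((\<lambda>h::'a. norm h powr a) \<longlongrightarrow> 0) (at 0)"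
    by (rule tendsto_zero_powrI[OF _ tendsto_const]) (use assms(3) in simp_all)
  from tendsto_mult_left[OF this, of K] show "((\<lambda>h::'a. K * norm h powr a) \<longlongrightarrow> 0) (at 0)" by simp
qed

lemma C2_deriv:
  assumes "C2 \<alpha> K f q Q" "0 < \<alpha>"
  shows "(f has_derivative (\<lambda>h. q y \<bullet> h)) (at y)" "(q has_derivative (\<lambda>h. Q y *v h)) (at y)"
proof -
  show "(f has_derivative (\<lambda>h. q y \<bullet> h)) (at y)"
    by (rule has_derivative_of_remainder[where K=K and a=1])
       (use C2_bounds(4)[OF assms(1)] in \<open>auto intro: bounded_linear_inner_right\<close>)
  show "(q has_derivative (\<lambda>h. Q y *v h)) (at y)"
    by (rule has_derivative_of_remainder[where K=K and a=\<alpha>]) (use C2_bounds(5)[OF assms(1)] assms(2) in auto)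
qed

lemma C2_lip:
  assumes "C2 \<alpha> K f q Q" "0 < \<alpha>"
  shows "lipschitz_by K f" "lipschitz_by K q"
proof -
  show "lipschitz_by K f" unfolding lipschitz_by_def
  proof clarify
    fix x h
    have "norm (f (x + h) - f x) \<le> K * norm (x + h - x)"
    proof (rule differentiable_bound[where S=UNIV and f'="\<lambda>y h. q y \<bullet> h"])
      show "(f has_derivative (\<lambda>h. q y \<bullet> h)) (at y within UNIV)" for y using C2_deriv[OF assms] by simp
      show "onorm (\<lambda>h. q y \<bullet> h) \<le> K" for y
        by (rule order_trans[OF onorm_bound[where b="norm (q y)"]])
           (use C2_bounds[OF assms(1)] Cauchy_Schwarz_ineq2 in auto)
    qed auto
    then show "norm (f (x + h) - f x) \<le> K * norm h" by simp
  qed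
  show "lipschitz_by K q" unfolding lipschitz_by_def
  proof clarify
    fix x h
    have "norm (q (x + h) - q x) \<le> K * norm (x + h - x)"
    proof (rule differentiable_bound[where S=UNIV and f'="\<lambda>y h. Q y *v h"])
      show "(q has_derivative (\<lambda>h. Q y *v h)) (at y within UNIV)" for y using C2_deriv[OF assms] by simp
      show "onorm (\<lambda>h. Q y *v h) \<le> K" for y
        by (rule order_trans[OF onorm_bound[where b="norm (Q y)"]])
           (use C2_bounds[OF assms(1)] norm_matrix_vector_le in auto)
    qed auto
    then show "norm (q (x + h) - q x) \<le> K * norm h" by simp
  qed
qed

lemma C2_cont:
  assumes "C2 \<alpha> K f q Q" "0 < \<alpha>"
  shows "continuous_on UNIV f" "continuous_on UNIV q" "continuous_on UNIV Q"
proof -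
  show "continuous_on UNIV f"
    by (intro continuous_at_imp_continuous_on ballI has_derivative_continuous) (rule C2_deriv(1)[OF assms])
  show "continuous_on UNIV q"
    by (intro continuous_at_imp_continuous_on ballI has_derivative_continuous) (rule C2_deriv(2)[OF assms])
  show "continuous_on UNIV Q"
  proof (rule holder_continuous_on[OF _ assms(2)])
    fix s t
    show "dist (Q s) (Q t) \<le> K * dist s t powr \<alpha>" using C2_bounds(6)[OF assms(1), of t "s - t"] by (simp add: dist_norm)
  qed
qed

lemma C2_bc:
  assumes "C2 \<alpha> K f q Q" "0 < \<alpha>"
  shows "apply_bcontfun (Bcontfun f) = f" "apply_bcontfun (Bcontfun q) = q" "apply_bcontfun (Bcontfun Q) = Q"
proof -
  show "apply_bcontfun (Bcontfun f) = f"
    by (rule apply_Bcontfun[OF C2_cont(1)[OF assms], of K]) (simp add: C2_bounds(1)[OF assms(1)])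
  show "apply_bcontfun (Bcontfun q) = q"
    by (rule apply_Bcontfun[OF C2_cont(2)[OF assms] C2_bounds(2)[OF assms(1)]])
  show "apply_bcontfun (Bcontfun Q) = Q"
    by (rule apply_Bcontfun[OF C2_cont(3)[OF assms] C2_bounds(3)[OF assms(1)]])
qed

lemma C2_add:
  assumes "C2 \<alpha> K f q Q" "C2 \<alpha> K' f' q' Q'"
  shows "C2 \<alpha> (K + K') (\<lambda>y. f y + f' y) (\<lambda>y. q y + q' y) (\<lambda>y. Q y + Q' y)"
  unfolding C2_def
proof (intro conjI allI)
  note a = C2_bounds[OF assms(1)] and b = C2_bounds[OF assms(2)]
  fix y h
  show "\<bar>f y + f' y\<bar> \<le> K + K'" using a(1)[of y] b(1)[of y] by linarith
  show "norm (q y + q' y) \<le> K + K'" "norm (Q y + Q' y) \<le> K + K'" by (intro norm_triangle_mono a b)+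
  have "norm ((f (y + h) - f y - q y \<bullet> h) + (f' (y + h) - f' y - q' y \<bullet> h)) \<le> K * (norm h)\<^sup>2 + K' * (norm h)\<^sup>2"
    by (rule norm_triangle_mono) (use a(4) b(4) in auto)
  then show "\<bar>f (y + h) + f' (y + h) - (f y + f' y) - (q y + q' y) \<bullet> h\<bar> \<le> (K + K') * (norm h)\<^sup>2"
    by (simp add: algebra_simps)
  have "norm ((q (y + h) - q y - Q y *v h) + (q' (y + h) - q' y - Q' y *v h)) \<le> K * norm h powr (1 + \<alpha>) + K' * norm h powr (1 + \<alpha>)"
    by (intro norm_triangle_mono a b)
  then show "norm (q (y + h) + q' (y + h) - (q y + q' y) - (Q y + Q' y) *v h) \<le> (K + K') * norm h powr (1 + \<alpha>)"
    by (simp add: algebra_simps)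
  have "norm ((Q (y + h) - Q y) + (Q' (y + h) - Q' y)) \<le> K * norm h powr \<alpha> + K' * norm h powr \<alpha>"
    by (intro norm_triangle_mono a b)
  then show "norm (Q (y + h) + Q' (y + h) - (Q y + Q' y)) \<le> (K + K') * norm h powr \<alpha>"
    by (simp add: algebra_simps)
qed

text \<open>Every clause of \<open>C2\<close> bounds the sup norm of an expression built linearly
  from f, q, Q, their translates and pointwise linear maps; the evolution commutes with all of these
  and is a contraction, so the constant is unchanged.\<close>

lemma C2_evol:
  fixes f :: "(real^'d) \<Rightarrow>\<^sub>C real"
  assumes "C2 \<alpha> K (apply_bcontfun f) (apply_bcontfun q) (apply_bcontfun Q)"
  shows "C2 \<alpha> K (apply_bcontfun (evol ks t s f)) (apply_bcontfun (evol ks t s q)) (apply_bcontfun (evol ks t s Q))"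
  unfolding C2_def
proof (intro conjI allI)
  note a = C2_bounds[OF assms(1)]
  fix y h
  show "\<bar>evol ks t s f y\<bar> \<le> K" using evol_bound[of f K ks t s y] a by simp
  show "norm (evol ks t s q y) \<le> K" "norm (evol ks t s Q y) \<le> K" using a by (auto intro: evol_bound)
  let ?i = "map_bc (\<lambda>x. x \<bullet> h) q" and ?m = "map_bc (\<lambda>M. M *v h) Q"
  note i = map_bc_apply[OF bounded_linear_inner_left] and m = map_bc_apply[OF bounded_linear_mult_vector]
  have "norm (evol ks t s (shift_bc h f - f - ?i) y) \<le> K * (norm h)\<^sup>2"
    by (rule evol_bound) (use a in \<open>simp add: i\<close>)
  then show "\<bar>evol ks t s f (y + h) - evol ks t s f y - evol ks t s q y \<bullet> h\<bar> \<le> K * (norm h)\<^sup>2"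
    by (simp add: evol_diff evol_shift evol_map[OF bounded_linear_inner_left] i)
  have "norm (evol ks t s (shift_bc h q - q - ?m) y) \<le> K * norm h powr (1 + \<alpha>)"
    by (rule evol_bound) (use a in \<open>simp add: m\<close>)
  then show "norm (evol ks t s q (y + h) - evol ks t s q y - evol ks t s Q y *v h) \<le> K * norm h powr (1 + \<alpha>)"
    by (simp add: evol_diff evol_shift evol_map[OF bounded_linear_mult_vector] m)
  have "norm (evol ks t s (shift_bc h Q - Q) y) \<le> K * norm h powr \<alpha>"
    by (rule evol_bound) (use a in simp)
  then show "norm (evol ks t s Q (y + h) - evol ks t s Q y) \<le> K * norm h powr \<alpha>"
    by (simp add: evol_diff evol_shift)
qed

text \<open>The constants are integrated along with the functions. Since \<open>k\<close> only has
  to be integrable, it may blow up at the end of the time interval.\<close>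

lemma C2_integral:
  fixes f :: "real \<Rightarrow> real^'d \<Rightarrow> real"
  assumes C: "\<And>s. s \<in> S \<Longrightarrow> C2 \<alpha> (k s) (f s) (q s) (Q s)" and k: "k integrable_on S" "integral S k \<le> K"
    and i: "\<And>y. (\<lambda>s. f s y) integrable_on S" "\<And>y. (\<lambda>s. q s y) integrable_on S" "\<And>y. (\<lambda>s. Q s y) integrable_on S"
  shows "C2 \<alpha> K (\<lambda>y. integral S (\<lambda>s. f s y)) (\<lambda>y. integral S (\<lambda>s. q s y)) (\<lambda>y. integral S (\<lambda>s. Q s y))"
proof -
  have I: "norm (integral S g) \<le> K * c" if "g integrable_on S" "\<And>s. s \<in> S \<Longrightarrow> norm (g s) \<le> k s * c" "0 \<le> c"
    for g :: "real \<Rightarrow> 'z::euclidean_space" and c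
  proof -
    have "norm (integral S g) \<le> integral S (\<lambda>s. k s * c)"
      by (rule integral_norm_bound_integral) (use that k in \<open>auto intro: integrable_on_mult_left\<close>)
    also have "\<dots> = integral S k * c" by simp
    also have "\<dots> \<le> K * c" using k that by (intro mult_right_mono) auto
    finally show ?thesis .
  qed
  show ?thesis unfolding C2_def
  proof (intro conjI allI)
    fix y h
    note a = C2_bounds[OF C]
    show "\<bar>integral S (\<lambda>s. f s y)\<bar> \<le> K" using I[OF i(1)[of y], of 1] a(1) by simp
    show "norm (integral S (\<lambda>s. q s y)) \<le> K" using I[OF i(2)[of y], of 1] a(2) by simp
    show "norm (integral S (\<lambda>s. Q s y)) \<le> K" using I[OF i(3)[of y], of 1] a(3) by simp
    have j: "(\<lambda>s. q s y \<bullet> h) integrable_on S" "integral S (\<lambda>s. q s y \<bullet> h) = integral S (\<lambda>s. q s y) \<bullet> h"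
      using integrable_linear[OF i(2)[of y] bounded_linear_inner_left[of h]] integral_linear[OF i(2)[of y] bounded_linear_inner_left[of h]]
      by (auto simp: o_def)
    have j2: "(\<lambda>s. Q s y *v h) integrable_on S" "integral S (\<lambda>s. Q s y *v h) = integral S (\<lambda>s. Q s y) *v h"
      using integrable_linear[OF i(3)[of y] bounded_linear_mult_vector[of h]] integral_linear[OF i(3)[of y] bounded_linear_mult_vector[of h]]
      by (auto simp: o_def)
    have "norm (integral S (\<lambda>s. f s (y + h) - f s y - q s y \<bullet> h)) \<le> K * (norm h)\<^sup>2"
      by (rule I) (use a(4) i j in \<open>auto intro!: integrable_diff\<close>)
    then show "\<bar>integral S (\<lambda>s. f s (y + h)) - integral S (\<lambda>s. f s y) - integral S (\<lambda>s. q s y) \<bullet> h\<bar> \<le> K * (norm h)\<^sup>2"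
      using i j by (simp add: integral_diff integrable_diff)
    have "norm (integral S (\<lambda>s. q s (y + h) - q s y - Q s y *v h)) \<le> K * norm h powr (1 + \<alpha>)"
      by (rule I) (use a(5) i j2 in \<open>auto intro!: integrable_diff\<close>)
    then show "norm (integral S (\<lambda>s. q s (y + h)) - integral S (\<lambda>s. q s y) - integral S (\<lambda>s. Q s y) *v h) \<le> K * norm h powr (1 + \<alpha>)"
      using i j2 by (simp add: integral_diff integrable_diff)
    have "norm (integral S (\<lambda>s. Q s (y + h) - Q s y)) \<le> K * norm h powr \<alpha>"
      by (rule I) (use a(6) i in \<open>auto intro!: integrable_diff\<close>)
    then show "norm (integral S (\<lambda>s. Q s (y + h)) - integral S (\<lambda>s. Q s y)) \<le> K * norm h powr \<alpha>"
      using i by (simp add: integral_diff)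
  qed
qed

text \<open>The antiderivative is continuous up to t although the integrand is singular there. The
  open interval keeps out s = t, where the gradient and Hessian kernels have no meaning.\<close>

lemma singular_has_integral:
  fixes t T \<beta> :: real
  assumes "t \<le> T" "\<beta> < 1"
  shows "((\<lambda>s. (s - t) powr (-\<beta>)) has_integral (T - t) powr (1 - \<beta>) / (1 - \<beta>)) {t<..<T}"
proof -
  have "((\<lambda>s. (s - t) powr (-\<beta>)) has_integral (T - t) powr (1 - \<beta>) / (1 - \<beta>) - (t - t) powr (1 - \<beta>) / (1 - \<beta>)) {t..T}"
  proof (rule fundamental_theorem_of_calculus_interior[OF assms(1)])
    show "continuous_on {t..T} (\<lambda>s. (s - t) powr (1 - \<beta>) / (1 - \<beta>))"
      using assms by (intro continuous_intros continuous_on_powr') auto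
    fix s assume "s \<in> {t<..<T}"
    then have "((\<lambda>s. (s - t) powr (1 - \<beta>)) has_real_derivative ((1 - \<beta>) * (s - t) powr (1 - \<beta> - 1)) * 1) (at s)"
      by (intro DERIV_chain2[OF has_real_derivative_powr]) (auto intro!: derivative_eq_intros)
    from DERIV_cdivide[OF this, of "1 - \<beta>"]
    have "((\<lambda>s. (s - t) powr (1 - \<beta>) / (1 - \<beta>)) has_real_derivative (s - t) powr (-\<beta>)) (at s)" using assms by simp
    then show "((\<lambda>s. (s - t) powr (1 - \<beta>) / (1 - \<beta>)) has_vector_derivative (s - t) powr (-\<beta>)) (at s)"
      by (simp add: has_real_derivative_iff_has_vector_derivative)
  qed
  then show ?thesis using assms by (simp add: has_integral_Icc_iff_Ioo)
qed

text \<open>Measurability comes from continuity away from t, integrability from domination by the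
  power.\<close>

lemma singular_integrable:
  fixes g :: "real \<Rightarrow> 'b::euclidean_space"
  assumes "continuous_on {t<..T} g" "\<And>s. s \<in> {t<..<T} \<Longrightarrow> norm (g s) \<le> c * (s - t) powr (-\<beta>)" "\<beta> < 1" "t \<le> T"
  shows "g integrable_on {t<..<T}" "norm (integral {t<..<T} g) \<le> c * ((T - t) powr (1 - \<beta>) / (1 - \<beta>))"
proof -
  have h: "((\<lambda>s. c * (s - t) powr (-\<beta>)) has_integral c * ((T - t) powr (1 - \<beta>) / (1 - \<beta>))) {t<..<T}"
    by (rule has_integral_mult_right[OF singular_has_integral]) (use assms in auto)
  show i: "g integrable_on {t<..<T}"
  proof (rule measurable_bounded_by_integrable_imp_integrable[OF _ has_integral_integrable[OF h] assms(2)])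
    show "g \<in> borel_measurable (lebesgue_on {t<..<T})"
      by (rule continuous_imp_measurable_on_sets_lebesgue[OF continuous_on_subset[OF assms(1)]]) auto
  qed auto
  show "norm (integral {t<..<T} g) \<le> c * ((T - t) powr (1 - \<beta>) / (1 - \<beta>))"
    using integral_norm_bound_integral[OF i has_integral_integrable[OF h] assms(2)] integral_unique[OF h] by auto
qed

section \<open>Gradient and Hessian kernels\<close>

context diffusion
begin

text \<open>The gradient of \<open>P t s f\<close> reassembled from its derivatives along
  \<open>v i\<close> by means of the dual basis.\<close>

definition grd :: "real \<Rightarrow> real \<Rightarrow> ((real^'d) \<Rightarrow>\<^sub>C real) \<Rightarrow> real^'d \<Rightarrow> real^'d" where
  "grd t s f y = (\<Sum>i\<in>UNIV. R i t s f y *\<^sub>R w i)"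

text \<open>Here j is the gradient component and i the direction of the second differentiation, as
  \<open>hes_mult\<close> makes visible.\<close>

definition hes :: "real \<Rightarrow> real \<Rightarrow> ((real^'d) \<Rightarrow>\<^sub>C real) \<Rightarrow> real^'d \<Rightarrow> real^'d^'d" where
  "hes t s f y = (\<Sum>j\<in>UNIV. \<Sum>i\<in>UNIV. R2 i j t s f y *\<^sub>R outer (w j) (w i))"

lemma hes_mult: "hes t s f y *v h = (\<Sum>j\<in>UNIV. (\<Sum>i\<in>UNIV. (w i \<bullet> h) * R2 i j t s f y) *\<^sub>R w j)"
proof -
  interpret l: bounded_linear "\<lambda>M :: real^'d^'d. M *v h" by (rule bounded_linear_mult_vector)
  show ?thesis unfolding hes_def by (simp add: l.sum l.scaleR outer_mult scaleR_sum_left mult.commute)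
qed

definition cO :: real where "cO = (\<Sum>j\<in>UNIV. \<Sum>i\<in>UNIV. norm (outer (w j) (w i)))"
text \<open>One summand for each clause of \<open>C2\<close> in \<open>C2_P\<close>: value,
  gradient, Hessian, remainder of the value, remainder of the gradient, Hoelder bound of the
  Hessian.\<close>

definition cC :: real where "cC = 1 + cV * cW + c2 * cO + 2 * cF * cP * cV + 2 * cW * cF * c2 + 2 * cO * c2"

lemma c2_nonneg: "0 \<le> c2" and cO_nonneg: "0 \<le> cO" and cC_pos: "0 < cC"
proof -
  show c2: "0 \<le> c2" using c_nonneg cP_pos by (auto simp: c2_def)
  show cO: "0 \<le> cO" unfolding cO_def by (auto intro!: sum_nonneg)
  have "0 \<le> cV * cW" "0 \<le> c2 * cO" "0 \<le> cF * (cP * cV)" "0 \<le> cW * (cF * c2)" "0 \<le> cO * c2"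
    using c_nonneg cP_pos c2 cO by auto
  then have "0 < 1 + cV * cW + c2 * cO + 2 * (cF * (cP * cV)) + 2 * (cW * (cF * c2)) + 2 * (cO * c2)" by linarith
  then show "0 < cC" by (simp add: cC_def mult.assoc)
qed

lemma norm_wsum: "(\<And>i. \<bar>a i\<bar> \<le> M) \<Longrightarrow> norm (\<Sum>i\<in>UNIV. a i *\<^sub>R w i) \<le> M * cW"
  unfolding cW_def sum_distrib_left
  by (rule order_trans[OF norm_sum sum_mono]) (auto intro!: mult_right_mono)

lemma norm_osum: "(\<And>i j. \<bar>a i j\<bar> \<le> M) \<Longrightarrow> norm (\<Sum>j\<in>UNIV. \<Sum>i\<in>UNIV. a i j *\<^sub>R outer (w j) (w i)) \<le> M * cO"
  unfolding cO_def sum_distrib_left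
  by (rule order_trans[OF norm_sum sum_mono], rule order_trans[OF norm_sum sum_mono]) (auto intro!: mult_right_mono)

lemma grd_norm:
  assumes "0 \<le> t" "t < s" "s \<le> T1"
  shows "norm (grd t s f y) \<le> 2 * cW * norm f / sqrt (s - t)"
proof -
  have "norm (grd t s f y) \<le> (2 / sqrt (s - t) * norm f) * cW" unfolding grd_def
  proof (rule norm_wsum)
    fix i show "\<bar>R i t s f y\<bar> \<le> 2 / sqrt (s - t) * norm f"
      using norm_bounded[of "R i t s f" y] R_norm[OF assms, of i f] by simp
  qed
  then show ?thesis by (simp add: mult_ac)
qed

lemma grd_lip:
  assumes "lipschitz_by L (apply_bcontfun f)" "0 \<le> L" "0 \<le> t" "t < s" "s \<le> T1"
  shows "lipschitz_by (2 * cP * cV * cW * L / sqrt (s - t)) (grd t s f)"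
  unfolding lipschitz_by_def
proof clarify
  fix x h
  have "norm (grd t s f (x + h) - grd t s f x) = norm (\<Sum>i\<in>UNIV. (R i t s f (x + h) - R i t s f x) *\<^sub>R w i)"
    by (simp add: grd_def scaleR_diff_left sum_subtractf)
  also have "\<dots> \<le> (2 * cP * cV * L / sqrt (s - t) * norm h) * cW"
    by (rule norm_wsum) (use lipschitz_byD[OF R_lipb[OF assms]] in auto)
  finally show "norm (grd t s f (x + h) - grd t s f x) \<le> 2 * cP * cV * cW * L / sqrt (s - t) * norm h" by (simp add: mult_ac)
qed

text \<open>As s - t \<le> 1, the powers 0 and -1/2 of s - t are below the power -(1 + \<alpha>)/2,
  so one singular factor serves all clauses. The remainders follow from \<open>frame_taylor\<close>,
  applied to the evolved function with exponent 1 and to each derivative \<open>R j\<close> with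
  exponent \<alpha>.\<close>

lemma C2_P:
  assumes "norm f \<le> L" "lipschitz_by L (apply_bcontfun f)" "0 \<le> t" "t < s" "s \<le> T1"
  shows "C2 \<alpha> (cC * L * (s - t) powr (-(1 + \<alpha>) / 2)) (apply_bcontfun (P t s f)) (grd t s f) (hes t s f)"
proof -
  have L: "0 \<le> L" using assms(1) norm_ge_zero order_trans by blast
  define k where "k = (s - t) powr (-(1 + \<alpha>) / 2)"
  have st: "0 < s - t" "s - t \<le> 1" using assms T1 by auto
  have k2: "1 / sqrt (s - t) \<le> k"
  proof -
    have "1 / sqrt (s - t) = (s - t) powr (-1/2)" using st by (simp add: powr_minus powr_half_sqrt field_simps)
    also have "\<dots> \<le> k" unfolding k_def using st alpha by (intro powr_mono') auto
    finally show ?thesis .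
  qed
  have k1: "1 \<le> k" using powr_mono'[of "-(1 + \<alpha>) / 2" 0 "s - t"] st alpha by (auto simp: k_def)
  have le: "a \<le> cC * L * k" if "a \<le> c * L * k" "c \<le> cC" for a c
  proof -
    have "c * L * k \<le> cC * L * k" using that L k1 by (intro mult_right_mono) auto
    then show ?thesis using that by linarith
  qed
  have leh: "a \<le> (cC * L * k) * H" if "a \<le> (c * L * k) * H" "c \<le> cC" "0 \<le> H" for a c H
  proof -
    have "(c * L * k) * H \<le> (cC * L * k) * H" using that L k1 by (intro mult_right_mono) auto
    then show ?thesis using that by linarith
  qed
  have nn: "0 \<le> cV * cW" "0 \<le> c2 * cO" "0 \<le> cF * cP * cV" "0 \<le> cW * cF * c2" "0 \<le> cO * c2"
    using c_nonneg cP_pos c2_nonneg cO_nonneg by auto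
  show ?thesis unfolding k_def[symmetric] C2_def
  proof (intro conjI allI)
    fix y h
    have "\<bar>P t s f y\<bar> \<le> L" using evol_bound[of f L ks t s y] norm_bounded[of f] assms(1) by (auto intro: order_trans)
    also have "\<dots> \<le> 1 * L * k" using k1 L mult_left_mono[of 1 k L] by simp
    finally show "\<bar>P t s f y\<bar> \<le> cC * L * k" by (rule le) (use nn in \<open>simp add: cC_def\<close>)
    have "norm (grd t s f y) \<le> (L * cV) * cW" unfolding grd_def
    proof (rule norm_wsum)
      fix i show "\<bar>R i t s f y\<bar> \<le> L * cV" using norm_bounded[of "R i t s f" y] R_lip[OF assms(2) L assms(3-5), of i] by simp
    qed
    also have "\<dots> \<le> (cV * cW) * L * k" using k1 L nn mult_left_mono[of 1 k "L * (cV * cW)"] by (simp add: mult_ac)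
    finally show "norm (grd t s f y) \<le> cC * L * k" by (rule le) (use nn in \<open>simp add: cC_def\<close>)
    have "norm (hes t s f y) \<le> (c2 * L / sqrt (s - t)) * cO" unfolding hes_def
    proof (rule norm_osum)
      fix i j show "\<bar>R2 i j t s f y\<bar> \<le> c2 * L / sqrt (s - t)"
        using norm_bounded[of "R2 i j t s f" y] R2_norm[OF assms(2) L assms(3-5), of i j] by simp
    qed
    also have "\<dots> = (c2 * cO * L) * (1 / sqrt (s - t))" by simp
    also have "\<dots> \<le> (c2 * cO) * L * k" using nn L k2 by (intro mult_left_mono) auto
    finally show "norm (hes t s f y) \<le> cC * L * k" by (rule le) (use nn in \<open>simp add: cC_def\<close>)
    have g: "grd t s f y \<bullet> h = (\<Sum>i\<in>UNIV. (w i \<bullet> h) * R i t s f y)" by (simp add: grd_def inner_sum_left mult.commute)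
    have "\<bar>P t s f (y + h) - P t s f y - grd t s f y \<bullet> h\<bar> \<le> cF * (2 * cP * cV * L / sqrt (s - t)) * norm h powr (1 + 1)"
      unfolding g
    proof (rule frame_taylor)
      show "has_dir_deriv (v i) (P t s f) (R i t s f)" for i using assms by (intro R_has) auto
      show "\<bar>R i t s f (x + h) - R i t s f x\<bar> \<le> 2 * cP * cV * L / sqrt (s - t) * norm h powr 1" for i x h
        using lipschitz_byD[OF R_lipb[OF assms(2) L assms(3-5), of i], of x h] by simp
    qed (use L c_nonneg cP_pos st in auto)
    also have "\<dots> = (2 * cF * cP * cV * L) * (1 / sqrt (s - t)) * (norm h)\<^sup>2" by (simp add: powr_numeral)
    also have "\<dots> \<le> ((2 * cF * cP * cV) * L * k) * (norm h)\<^sup>2"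
      by (intro mult_right_mono mult_left_mono k2 mult_nonneg_nonneg) (use c_nonneg cP_pos L in auto)
    finally show "\<bar>P t s f (y + h) - P t s f y - grd t s f y \<bullet> h\<bar> \<le> cC * L * k * (norm h)\<^sup>2"
      by (rule leh) (use nn in \<open>simp_all add: cC_def\<close>)
    have "grd t s f (y + h) - grd t s f y - hes t s f y *v h
        = (\<Sum>j\<in>UNIV. (R j t s f (y + h) - R j t s f y - (\<Sum>i\<in>UNIV. (w i \<bullet> h) * R2 i j t s f y)) *\<^sub>R w j)"
      unfolding hes_mult grd_def by (simp add: scaleR_diff_left sum_subtractf)
    also have "norm \<dots> \<le> (cF * (2 * c2 * L * k) * norm h powr (1 + \<alpha>)) * cW"
    proof (rule norm_wsum, rule frame_taylor)
      show "has_dir_deriv (v i) (R j t s f) (R2 i j t s f)" for i j using assms by (intro R2_has) auto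
      show "\<bar>R2 i j t s f (x + h) - R2 i j t s f x\<bar> \<le> 2 * c2 * L * k * norm h powr \<alpha>" for i j x h
        using R2_holder[OF assms(2) L assms(3-5), of i j x h] by (simp add: k_def)
    qed (use L c2_nonneg k1 alpha in auto)
    also have "\<dots> = ((2 * cW * cF * c2) * L * k) * norm h powr (1 + \<alpha>)" by (simp add: mult_ac)
    finally show "norm (grd t s f (y + h) - grd t s f y - hes t s f y *v h) \<le> cC * L * k * norm h powr (1 + \<alpha>)"
      by (rule leh) (use nn in \<open>simp_all add: cC_def\<close>)
    have "hes t s f (y + h) - hes t s f y = (\<Sum>j\<in>UNIV. \<Sum>i\<in>UNIV. (R2 i j t s f (y + h) - R2 i j t s f y) *\<^sub>R outer (w j) (w i))"
      unfolding hes_def by (simp add: scaleR_diff_left sum_subtractf)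
    also have "norm \<dots> \<le> (2 * c2 * L * k * norm h powr \<alpha>) * cO"
      by (rule norm_osum) (use R2_holder[OF assms(2) L assms(3-5)] in \<open>simp add: k_def\<close>)
    also have "\<dots> = ((2 * cO * c2) * L * k) * norm h powr \<alpha>" by (simp add: mult_ac)
    finally show "norm (hes t s f (y + h) - hes t s f y) \<le> cC * L * k * norm h powr \<alpha>"
      by (rule leh) (use nn in \<open>simp_all add: cC_def\<close>)
  qed
qed

end

section \<open>Taylor expansion and interpolation between moduli\<close>

lemma line_derivative:
  fixes f :: "'a::real_inner \<Rightarrow> real"
  assumes "(f has_derivative (\<lambda>k. q \<bullet> k)) (at (y + \<theta> *\<^sub>R h))"
  shows "((\<lambda>\<theta>. f (y + \<theta> *\<^sub>R h)) has_real_derivative q \<bullet> h) (at \<theta> within S)"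
proof -
  have "((\<lambda>\<theta>. y + \<theta> *\<^sub>R h) has_derivative (\<lambda>k. k *\<^sub>R h)) (at \<theta>)" by (auto intro!: derivative_eq_intros)
  from has_derivative_compose[OF this assms]
  have "((\<lambda>\<theta>. f (y + \<theta> *\<^sub>R h)) has_derivative (\<lambda>k. q \<bullet> (k *\<^sub>R h))) (at \<theta>)" by (simp add: o_def)
  then have "((\<lambda>\<theta>. f (y + \<theta> *\<^sub>R h)) has_real_derivative q \<bullet> h) (at \<theta>)"
    unfolding has_field_derivative_def by (rule has_derivative_eq_rhs) (auto simp: mult.commute)
  then show ?thesis by (rule has_field_derivative_at_within)
qed

text \<open>The mean value bound on the segment from y to y + h: after subtracting the quadratic
  polynomial, the derivative is the remainder of the gradient paired with h.\<close>

lemma C2_taylor: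
  assumes "C2 \<alpha> K f q Q" "0 < \<alpha>"
  shows "\<bar>f (y + h) - f y - q y \<bullet> h - (h \<bullet> (Q y *v h)) / 2\<bar> \<le> K * norm h powr (2 + \<alpha>)"
proof -
  have K: "0 \<le> K" by (rule C2_nonneg[OF assms(1)])
  define \<psi> where "\<psi> \<theta> = f (y + \<theta> *\<^sub>R h) - \<theta> * (q y \<bullet> h) - \<theta>\<^sup>2 / 2 * (h \<bullet> (Q y *v h))" for \<theta>
  have "norm (\<psi> 1 - \<psi> 0) \<le> (K * norm h powr (2 + \<alpha>)) * norm (1 - 0 :: real)"
  proof (rule field_differentiable_bound[where S="{0..1}" and f=\<psi> and f'="\<lambda>\<theta>. (q (y + \<theta> *\<^sub>R h) - q y - Q y *v (\<theta> *\<^sub>R h)) \<bullet> h"])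
    fix \<theta> :: real assume \<theta>: "\<theta> \<in> {0..1}"
    show "(\<psi> has_field_derivative (q (y + \<theta> *\<^sub>R h) - q y - Q y *v (\<theta> *\<^sub>R h)) \<bullet> h) (at \<theta> within {0..1})"
      unfolding \<psi>_def
      by (rule derivative_eq_intros line_derivative C2_deriv[OF assms] refl | simp)+
         (simp add: inner_diff_right matrix_vector_mult_scaleR inner_commute[of _ h])
    have "\<bar>(q (y + \<theta> *\<^sub>R h) - q y - Q y *v (\<theta> *\<^sub>R h)) \<bullet> h\<bar> \<le> norm (q (y + \<theta> *\<^sub>R h) - q y - Q y *v (\<theta> *\<^sub>R h)) * norm h"
      by (rule Cauchy_Schwarz_ineq2)
    also have "\<dots> \<le> (K * norm (\<theta> *\<^sub>R h) powr (1 + \<alpha>)) * norm h" by (intro mult_right_mono C2_bounds[OF assms(1)]) auto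
    also have "\<dots> \<le> (K * norm h powr (1 + \<alpha>)) * norm h"
      using \<theta> K assms(2) by (intro mult_right_mono mult_left_mono powr_mono2) (auto simp: mult_left_le_one_le)
    also have "\<dots> = K * norm h powr (2 + \<alpha>)"
    proof -
      have "norm h powr (2 + \<alpha>) = norm h powr (1 + (1 + \<alpha>))" by simp
      also have "\<dots> = norm h * norm h powr (1 + \<alpha>)" by (subst powr_add) simp
      finally show ?thesis by (simp add: mult_ac)
    qed
    finally show "norm ((q (y + \<theta> *\<^sub>R h) - q y - Q y *v (\<theta> *\<^sub>R h)) \<bullet> h) \<le> K * norm h powr (2 + \<alpha>)" by simp
  qed auto
  then show ?thesis by (simp add: \<psi>_def algebra_simps)
qed

text \<open>Mixed differences determine the whole matrix \<open>Q y\<close> without knowing that it is symmetric.\<close>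

lemma C2_mixed_difference:
  assumes "C2 \<alpha> K f q Q" "0 < \<alpha>"
  shows "\<bar>f (y + h + k) - f (y + h) - f (y + k) + f y - k \<bullet> (Q y *v h)\<bar> \<le> K * (norm h powr (1 + \<alpha>) + norm k powr \<alpha> * norm h) * norm k"
proof -
  have K: "0 \<le> K" by (rule C2_nonneg[OF assms(1)])
  define \<psi> where "\<psi> \<theta> = f ((y + h) + \<theta> *\<^sub>R k) - f (y + \<theta> *\<^sub>R k) - \<theta> * (k \<bullet> (Q y *v h))" for \<theta>
  have "norm (\<psi> 1 - \<psi> 0) \<le> (K * (norm h powr (1 + \<alpha>) + norm k powr \<alpha> * norm h) * norm k) * norm (1 - 0 :: real)"
  proof (rule field_differentiable_bound[where S="{0..1}" and f=\<psi> and f'="\<lambda>\<theta>. (q ((y + h) + \<theta> *\<^sub>R k) - q (y + \<theta> *\<^sub>R k) - Q y *v h) \<bullet> k"])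
    fix \<theta> :: real assume \<theta>: "\<theta> \<in> {0..1}"
    show "(\<psi> has_field_derivative (q ((y + h) + \<theta> *\<^sub>R k) - q (y + \<theta> *\<^sub>R k) - Q y *v h) \<bullet> k) (at \<theta> within {0..1})"
      unfolding \<psi>_def
      by (rule derivative_eq_intros line_derivative C2_deriv[OF assms] refl | simp)+
         (simp add: inner_diff_right inner_commute[of _ k])
    let ?z = "y + \<theta> *\<^sub>R k"
    have "(y + h) + \<theta> *\<^sub>R k = ?z + h" by simp
    then have "q ((y + h) + \<theta> *\<^sub>R k) - q ?z - Q y *v h = (q (?z + h) - q ?z - Q ?z *v h) + (Q ?z - Q y) *v h"
      by (simp add: matrix_vector_mult_diff_rdistrib add_ac)
    also have "norm \<dots> \<le> K * norm h powr (1 + \<alpha>) + (K * norm k powr \<alpha>) * norm h"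
    proof (rule norm_triangle_mono)
      show "norm (q (?z + h) - q ?z - Q ?z *v h) \<le> K * norm h powr (1 + \<alpha>)" by (rule C2_bounds[OF assms(1)])
      have "norm ((Q ?z - Q y) *v h) \<le> norm (Q ?z - Q y) * norm h" by (rule norm_matrix_vector_le)
      also have "\<dots> \<le> (K * norm (\<theta> *\<^sub>R k) powr \<alpha>) * norm h" by (intro mult_right_mono C2_bounds[OF assms(1)]) auto
      also have "\<dots> \<le> (K * norm k powr \<alpha>) * norm h"
        using \<theta> K assms(2) by (intro mult_right_mono mult_left_mono powr_mono2) (auto simp: mult_left_le_one_le)
      finally show "norm ((Q ?z - Q y) *v h) \<le> (K * norm k powr \<alpha>) * norm h" .
    qed
    finally have "norm (q ((y + h) + \<theta> *\<^sub>R k) - q ?z - Q y *v h) * norm k \<le> (K * (norm h powr (1 + \<alpha>) + norm k powr \<alpha> * norm h)) * norm k"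
      by (intro mult_right_mono) (auto simp: algebra_simps)
    then show "norm ((q ((y + h) + \<theta> *\<^sub>R k) - q ?z - Q y *v h) \<bullet> k) \<le> K * (norm h powr (1 + \<alpha>) + norm k powr \<alpha> * norm h) * norm k"
      using Cauchy_Schwarz_ineq2[of "q ((y + h) + \<theta> *\<^sub>R k) - q ?z - Q y *v h" k] by simp
  qed auto
  moreover have "\<psi> 1 - \<psi> 0 = f (y + h + k) - f (y + h) - f (y + k) + f y - k \<bullet> (Q y *v h)" by (simp add: \<psi>_def)
  ultimately show ?thesis by simp
qed

text \<open>A step of length sqrt \<delta> in the direction of q y - q' y is tested. The two values
  and the two quadratic remainders contribute K \<delta> each, whence the 4.\<close>

lemma gradient_interpolation:
  assumes c: "C2 \<alpha> K u q Q" "C2 \<alpha> K u' q' Q'" and d: "\<And>y. \<bar>u y - u' y\<bar> \<le> K * \<delta>" and \<delta>: "0 < \<delta>"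
  shows "norm (q y - q' y) \<le> 4 * K * sqrt \<delta>"
proof (cases "q y = q' y")
  case True then show ?thesis using C2_nonneg[OF c(1)] \<delta> by simp
next
  case False
  define d where "d = q y - q' y"
  define h where "h = (sqrt \<delta> / norm d) *\<^sub>R d"
  have n: "norm d > 0" using False by (simp add: d_def)
  have h: "norm h = sqrt \<delta>" "(norm h)\<^sup>2 = \<delta>" using n \<delta> by (auto simp: h_def)
  have "d \<bullet> h = sqrt \<delta> * norm d" using n by (simp add: h_def dot_square_norm power2_eq_square)
  moreover have "\<bar>d \<bullet> h\<bar> \<le> 4 * K * \<delta>"
    using C2_bounds(4)[OF c(1), of y h] C2_bounds(4)[OF c(2), of y h] assms(3)[of y] assms(3)[of "y + h"]
    unfolding h(2) d_def inner_diff_left by linarith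
  ultimately have "sqrt \<delta> * norm d \<le> 4 * K * \<delta>" by linarith
  also have "\<dots> = 4 * K * (sqrt \<delta> * sqrt \<delta>)" using \<delta> by simp
  also have "\<dots> = sqrt \<delta> * (4 * K * sqrt \<delta>)" by (simp only: mult_ac)
  finally have "sqrt \<delta> * norm d \<le> sqrt \<delta> * (4 * K * sqrt \<delta>)" .
  then show ?thesis using \<delta> by (simp add: d_def)
qed

lemma norm_matrix_le_sum: "norm M \<le> (\<Sum>i\<in>UNIV. \<Sum>j\<in>UNIV. \<bar>M $ i $ j\<bar>)" for M :: "real^'n^'m"
proof -
  have "norm M \<le> (\<Sum>i\<in>UNIV. norm (M $ i))" unfolding norm_vec_def[of M] by (rule L2_set_le_sum) auto
  also have "\<dots> \<le> (\<Sum>i\<in>UNIV. \<Sum>j\<in>UNIV. \<bar>M $ i $ j\<bar>)" by (intro sum_mono norm_le_l1_cart)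
  finally show ?thesis .
qed

lemma abs_four_differences:
  fixes a1 :: real
  assumes "\<bar>a1 - b1 - c1\<bar> \<le> e" "\<bar>a2 - b2 - c2\<bar> \<le> e" "\<bar>a3 - b3 - c3\<bar> \<le> e" "\<bar>a4 - b4 - c4\<bar> \<le> e"
  shows "\<bar>(a1 - a2 - a3 + a4) - (b1 - b2 - b3 + b4) - (c1 - c2 - c3 + c4)\<bar> \<le> 4 * e"
  using assms by linarith

lemma abs_three_terms:
  fixes a :: real
  assumes "\<bar>a - b - c\<bar> \<le> 4 * e" "\<bar>a - x\<bar> \<le> 2 * e" "\<bar>b - x'\<bar> \<le> 2 * e" "\<bar>c\<bar> \<le> 2 * e"
  shows "\<bar>x - x'\<bar> \<le> 10 * e"
  using assms by linarith

text \<open>Mixed differences with steps sqrt \<delta> along two axes isolate \<delta> times an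
  entry of Q y - Q' y. The function X is the time derivative at leading order: its Hoelder bound
  makes the mixed difference of \<delta> X as small as the other errors. The 10 collects four values
  of u - u' - \<delta> X and three further errors of size 2; the square of the dimension comes from
  adding up the entries.\<close>

lemma hessian_interpolation:
  fixes Q Q' :: "real^'d \<Rightarrow> real^'d^'d"
  assumes c: "C2 \<alpha> K u q Q" "C2 \<alpha> K u' q' Q'" and d: "\<And>y. \<bar>u y - u' y - \<delta> * X y\<bar> \<le> K * \<delta> powr (1 + \<alpha> / 2)"
    and X: "\<And>y h. \<bar>X (y + h) - X y\<bar> \<le> K * norm h powr \<alpha>" and \<delta>: "0 < \<delta>" and \<alpha>: "0 < \<alpha>"
  shows "norm (Q y - Q' y) \<le> real (CARD('d) * CARD('d)) * (10 * K * \<delta> powr (\<alpha> / 2))"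
proof -
  have K: "0 \<le> K" by (rule C2_nonneg[OF c(1)])
  have sq: "sqrt \<delta> powr a = \<delta> powr (a / 2)" for a using \<delta> by (simp add: powr_half_sqrt[symmetric] powr_powr)
  have "\<bar>(Q y - Q' y) $ i $ j\<bar> \<le> 10 * K * \<delta> powr (\<alpha> / 2)" for i j
  proof -
    define h k :: "real^'d" where "h = sqrt \<delta> *\<^sub>R axis j 1" and "k = sqrt \<delta> *\<^sub>R axis i 1"
    have n: "norm h = sqrt \<delta>" "norm k = sqrt \<delta>" using \<delta> by (auto simp: h_def k_def)
    have e: "k \<bullet> (M *v h) = \<delta> * M $ i $ j" for M :: "real^'d^'d"
    proof -
      have "k \<bullet> (M *v h) = (sqrt \<delta> * sqrt \<delta>) * ((M *v axis j 1) $ i)"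
        by (simp add: h_def k_def matrix_vector_mult_scaleR inner_axis' )
      also have "(M *v axis j 1) $ i = M $ i $ j" by (simp add: matrix_vector_mult_basis column_def)
      finally show ?thesis using \<delta> by simp
    qed
    have p: "\<delta> powr (1 + \<alpha> / 2) = \<delta> * \<delta> powr (\<alpha> / 2)" using \<delta> by (simp add: powr_add)
    have m: "K * (norm h powr (1 + \<alpha>) + norm k powr \<alpha> * norm h) * norm k = 2 * (K * (\<delta> * \<delta> powr (\<alpha> / 2)))"
    proof -
      have "sqrt \<delta> powr (1 + \<alpha>) = sqrt \<delta> * \<delta> powr (\<alpha> / 2)" using \<delta> sq[of \<alpha>] by (simp add: powr_add)
      then show ?thesis unfolding n using \<delta> by (simp add: sq algebra_simps)
    qed
    let ?D = "\<lambda>f. f (y + h + k) - f (y + h) - f (y + k) + f y"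
    have 1: "\<bar>?D u - \<delta> * Q y $ i $ j\<bar> \<le> 2 * (K * (\<delta> * \<delta> powr (\<alpha> / 2)))"
      using C2_mixed_difference[OF c(1) \<alpha>, of y h k] unfolding m e .
    have 2: "\<bar>?D u' - \<delta> * Q' y $ i $ j\<bar> \<le> 2 * (K * (\<delta> * \<delta> powr (\<alpha> / 2)))"
      using C2_mixed_difference[OF c(2) \<alpha>, of y h k] unfolding m e .
    have "\<bar>?D X\<bar> \<le> 2 * (K * \<delta> powr (\<alpha> / 2))"
      using X[of "y + h" k] X[of y k] unfolding n sq by linarith
    then have "\<delta> * \<bar>?D X\<bar> \<le> \<delta> * (2 * (K * \<delta> powr (\<alpha> / 2)))" using \<delta> by (intro mult_left_mono) auto
    then have 3: "\<bar>\<delta> * ?D X\<bar> \<le> 2 * (K * (\<delta> * \<delta> powr (\<alpha> / 2)))" using \<delta> by (simp add: abs_mult mult_ac)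
    have "\<delta> * ?D X = \<delta> * X (y + h + k) - \<delta> * X (y + h) - \<delta> * X (y + k) + \<delta> * X y" by (simp add: algebra_simps)
    then have "\<bar>\<delta> * Q y $ i $ j - \<delta> * Q' y $ i $ j\<bar> \<le> 10 * (K * (\<delta> * \<delta> powr (\<alpha> / 2)))"
      using abs_four_differences[OF d[of "y + h + k"] d[of "y + h"] d[of "y + k"] d[of y]] 1 2 3 unfolding p
      by (intro abs_three_terms[where a="?D u" and b="?D u'" and c="\<delta> * ?D X" and e="K * (\<delta> * \<delta> powr (\<alpha> / 2))"]) (simp_all only:)
    moreover have "\<delta> * Q y $ i $ j - \<delta> * Q' y $ i $ j = \<delta> * (Q y - Q' y) $ i $ j" by (simp add: right_diff_distrib)
    moreover have "\<bar>\<delta> * (Q y - Q' y) $ i $ j\<bar> = \<delta> * \<bar>(Q y - Q' y) $ i $ j\<bar>" using \<delta> by (simp only: abs_mult abs_of_pos)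
    moreover have "10 * (K * (\<delta> * \<delta> powr (\<alpha> / 2))) = \<delta> * (10 * K * \<delta> powr (\<alpha> / 2))" by (simp only: mult_ac)
    ultimately have "\<delta> * \<bar>(Q y - Q' y) $ i $ j\<bar> \<le> \<delta> * (10 * K * \<delta> powr (\<alpha> / 2))" by metis
    then show ?thesis using \<delta> by simp
  qed
  then have "(\<Sum>i\<in>UNIV. \<Sum>j\<in>UNIV. \<bar>(Q y - Q' y) $ i $ j\<bar>) \<le> (\<Sum>i\<in>(UNIV::'d set). \<Sum>j\<in>(UNIV::'d set). 10 * K * \<delta> powr (\<alpha> / 2))"
    by (intro sum_mono)
  then show ?thesis using norm_matrix_le_sum[of "Q y - Q' y"] by simp
qed

lemma derivative_of_remainder_within:
  fixes g :: "real \<Rightarrow> real"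
  assumes "\<And>s. s \<in> S \<Longrightarrow> \<bar>g s - g r - (s - r) * D\<bar> \<le> c * \<bar>s - r\<bar> powr (1 + \<beta>)" "0 < \<beta>"
  shows "(g has_real_derivative D) (at r within S)"
  unfolding has_field_derivative_iff
proof (rule Lim_null[THEN iffD2], rule Lim_null_comparison)
  show "\<forall>\<^sub>F s in at r within S. norm ((g s - g r) / (s - r) - D) \<le> c * \<bar>s - r\<bar> powr \<beta>"
    unfolding eventually_at
  proof (intro exI[of _ 1] conjI ballI impI, simp)
    fix s assume s: "s \<in> S" "s \<noteq> r \<and> dist s r < 1"
    then have p: "\<bar>s - r\<bar> > 0" by simp
    have "(g s - g r) / (s - r) - D = (g s - g r - (s - r) * D) / (s - r)" using p by (simp add: field_simps)
    then have "norm ((g s - g r) / (s - r) - D) = \<bar>g s - g r - (s - r) * D\<bar> / \<bar>s - r\<bar>" by (simp add: abs_divide)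
    also have "\<dots> \<le> (c * \<bar>s - r\<bar> powr (1 + \<beta>)) / \<bar>s - r\<bar>" using assms(1)[OF s(1)] p by (intro divide_right_mono) auto
    also have "\<dots> = c * \<bar>s - r\<bar> powr \<beta>" using p by (simp add: powr_add)
    finally show "norm ((g s - g r) / (s - r) - D) \<le> c * \<bar>s - r\<bar> powr \<beta>" .
  qed
  have "((\<lambda>s. \<bar>s - r\<bar>) \<longlongrightarrow> \<bar>r - r\<bar>) (at r within S)" by (intro tendsto_intros)
  then have "((\<lambda>s. \<bar>s - r\<bar> powr \<beta>) \<longlongrightarrow> 0) (at r within S)"
    by (intro tendsto_zero_powrI[OF _ tendsto_const]) (use assms(2) in simp_all)
  from tendsto_mult_left[OF this, of c] show "((\<lambda>s. c * \<bar>s - r\<bar> powr \<beta>) \<longlongrightarrow> 0) (at r within S)" by simp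
qed

text \<open>An exponent above 1 forces a vanishing derivative. For the path joining the two sides of
  Duhamel's formula, this replaces differentiation in the intermediate time.\<close>

lemma constant_of_holder:
  fixes g :: "real \<Rightarrow> real"
  assumes "\<And>s r. a \<le> s \<Longrightarrow> s \<le> r \<Longrightarrow> r \<le> b \<Longrightarrow> \<bar>g r - g s\<bar> \<le> c * (r - s) powr (1 + \<beta>)" "0 < \<beta>" "a \<le> b"
  shows "g a = g b"
proof -
  have "(g has_real_derivative 0) (at r within {a..b})" if "r \<in> {a..b}" for r
  proof (rule derivative_of_remainder_within[OF _ assms(2)])
    fix s assume "s \<in> {a..b}"
    then show "\<bar>g s - g r - (s - r) * 0\<bar> \<le> c * \<bar>s - r\<bar> powr (1 + \<beta>)"
      using assms(1)[of s r] assms(1)[of r s] that by (cases "r \<le> s") (auto simp: abs_minus_commute)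
  qed
  then obtain k where "\<And>x. x \<in> {a..b} \<Longrightarrow> g x = k"
    using has_field_derivative_zero_constant[of "{a..b}" g] by auto
  then show ?thesis using assms(3) by auto
qed

lemma continuous_on_dist_sqrt:
  fixes f :: "real \<Rightarrow> 'b::metric_space" and g :: "real \<Rightarrow> 'c::metric_space"
  assumes "continuous_on S f" "\<And>s r. s \<in> S \<Longrightarrow> r \<in> S \<Longrightarrow> dist (g s) (g r) \<le> dist (f s) (f r) + c * sqrt \<bar>s - r\<bar>"
  shows "continuous_on S g"
  unfolding continuous_on_def
proof
  fix r assume r: "r \<in> S"
  show "(g \<longlongrightarrow> g r) (at r within S)"
  proof (rule tendsto_dist_iff[THEN iffD2], rule Lim_null_comparison)
    show "\<forall>\<^sub>F s in at r within S. norm (dist (g s) (g r)) \<le> dist (f s) (f r) + c * sqrt \<bar>s - r\<bar>"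
      unfolding eventually_at using assms(2) r by (intro exI[of _ 1]) auto
    have 1: "((\<lambda>s. dist (f s) (f r)) \<longlongrightarrow> 0) (at r within S)"
      using assms(1) r unfolding continuous_on_def by (intro tendsto_dist_iff[THEN iffD1]) auto
    have "((\<lambda>s. c * sqrt \<bar>s - r\<bar>) \<longlongrightarrow> c * sqrt \<bar>r - r\<bar>) (at r within S)"
      by (intro tendsto_intros)
    from tendsto_add[OF 1 this] show "((\<lambda>s. dist (f s) (f r) + c * sqrt \<bar>s - r\<bar>) \<longlongrightarrow> 0) (at r within S)" by simp
  qed
qed

section \<open>Continuity in time and the Duhamel integral\<close>

context diffusion
begin

text \<open>On bounded continuous functions the evolution need not be norm continuous in time; the
  common Lipschitz bound supplies the modulus. The difference is pulled under the evolution up to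
  the earlier of the two times, where it splits into a displacement and a change of f.\<close>

lemma P_dist:
  assumes "lipschitz_by L (apply_bcontfun (f r))" "lipschitz_by L (apply_bcontfun (f s))" "0 \<le> L" "0 \<le> t" "t \<le> s" "t \<le> r" "s \<le> T1" "r \<le> T1"
  shows "dist (P t s (f s)) (P t r (f r)) \<le> dist (f s) (f r) + L * cS * sqrt \<bar>s - r\<bar>"
proof -
  have *: "dist (P t s (f s)) (P t r (f r)) \<le> dist (f s) (f r) + L * cS * sqrt (s - r)"
    if "t \<le> r" "r \<le> s" "s \<le> T1" "lipschitz_by L (apply_bcontfun (f s))" for r s
  proof -
    have "P t s (f s) - P t r (f r) = P t r ((P r s (f s) - f s) + (f s - f r))"
      using that assms by (simp add: evol_add evol_diff P_semi)
    also have "norm \<dots> \<le> norm ((P r s (f s) - f s) + (f s - f r))" by (rule evol_norm)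
    also have "\<dots> \<le> L * cS * sqrt (s - r) + norm (f s - f r)"
      using that assms by (intro norm_triangle_mono P_small) auto
    finally show ?thesis by (simp add: dist_norm)
  qed
  show ?thesis
  proof (cases "r \<le> s")
    case True then show ?thesis using *[of r s] assms by simp
  next
    case False then show ?thesis using *[of s r] assms by (simp add: dist_commute)
  qed
qed

lemma P_continuous:
  assumes "continuous_on {t..T} f" "\<And>s. s \<in> {t..T} \<Longrightarrow> lipschitz_by L (apply_bcontfun (f s))" "0 \<le> L" "0 \<le> t" "T \<le> T1"
  shows "continuous_on {t..T} (\<lambda>s. P t s (f s))"
  by (rule continuous_on_dist_sqrt[OF assms(1), of _ "L * cS"]) (use assms in \<open>auto intro!: P_dist\<close>)

text \<open>Continuity is local, and near r > t the smoothing can be done on the fixed interval from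
  t to m = (t + r)/2. What depends on s is then the norm continuous path \<open>P m s (f s)\<close>,
  to which one continuous operator is applied.\<close>

lemma smoothed_continuous:
  fixes \<psi> :: "real \<Rightarrow> 'c::metric_space"
  assumes f: "continuous_on {t..T} f" "\<And>s. s \<in> {t..T} \<Longrightarrow> lipschitz_by L (apply_bcontfun (f s))" "0 \<le> L" "0 \<le> t" "T \<le> T1"
    and \<psi>: "\<And>m. t < m \<Longrightarrow> m < T \<Longrightarrow> \<exists>\<Lambda>. continuous_on UNIV \<Lambda> \<and> (\<forall>s\<in>{m<..T}. \<psi> s = \<Lambda> (P m s (f s)))"
  shows "continuous_on {t<..T} \<psi>"
  unfolding continuous_on_eq_continuous_within
proof
  fix r assume r: "r \<in> {t<..T}"
  define m where "m = (t + r) / 2"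
  have m: "t < m" "m < r" "m < T" using r by (auto simp: m_def)
  obtain \<Lambda> where \<Lambda>: "continuous_on UNIV \<Lambda>" "\<forall>s\<in>{m<..T}. \<psi> s = \<Lambda> (P m s (f s))" using \<psi>[OF m(1,3)] by blast
  have "continuous_on {m..T} (\<lambda>s. P m s (f s))"
    by (rule P_continuous[where L=L]) (use f m in \<open>auto intro: continuous_on_subset\<close>)
  then have "continuous_on {m..T} (\<lambda>s. \<Lambda> (P m s (f s)))"
    by (intro continuous_on_compose2[OF \<Lambda>(1)]) auto
  then have "continuous_on {m<..T} (\<lambda>s. \<Lambda> (P m s (f s)))" by (rule continuous_on_subset) auto
  then have "continuous_on {m<..T} \<psi>" by (rule continuous_on_eq) (use \<Lambda>(2) in auto)
  then have "continuous (at r within {m<..T}) \<psi>" using r m by (auto simp: continuous_on_eq_continuous_within)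
  moreover have "at r within {t<..T} = at r within {m<..T}"
    by (rule at_within_nhd[where S="{m<..}"]) (use m in auto)
  ultimately show "continuous (at r within {t<..T}) \<psi>" by simp
qed

lemma R_continuous: "0 \<le> t \<Longrightarrow> t < s \<Longrightarrow> s \<le> T1 \<Longrightarrow> continuous_on UNIV (R i t s)"
proof -
  assume a: "0 \<le> t" "t < s" "s \<le> T1"
  have *: "dist (R i t s f) (R i t s g) \<le> (2 / sqrt (s - t)) * dist f g powr 1" for f g
    using R_norm[OF a, of i "f - g"] R_diff[OF a, of i f g] by (simp add: dist_norm)
  show ?thesis by (rule holder_continuous_on[OF *]) auto
qed

context
  fixes t T L :: real and f :: "real \<Rightarrow> (real^'d) \<Rightarrow>\<^sub>C real"
  assumes tT: "0 \<le> t" "t \<le> T" "T \<le> T1"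
    and fc: "continuous_on {t..T} f"
    and fL: "\<And>s. s \<in> {t..T} \<Longrightarrow> norm (f s) \<le> L" "\<And>s. s \<in> {t..T} \<Longrightarrow> lipschitz_by L (apply_bcontfun (f s))"
begin

lemma L_nonneg: "0 \<le> L" using fL(1)[of t] tT norm_ge_zero[of "f t"] by (smt (verit) atLeastAtMost_iff)

lemma R_continuous_time: "continuous_on {t<..T} (\<lambda>s. R i t s (f s))"
proof (rule smoothed_continuous[OF fc fL(2) L_nonneg tT(1,3)])
  fix m assume m: "t < m" "m < T"
  show "\<exists>\<Lambda>. continuous_on UNIV \<Lambda> \<and> (\<forall>s\<in>{m<..T}. R i t s (f s) = \<Lambda> (P m s (f s)))"
    by (rule exI[of _ "R i t m"]) (use m tT in \<open>auto simp: R_P intro!: R_continuous\<close>)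
qed auto

lemma R2_continuous_time: "continuous_on {t<..T} (\<lambda>s. R2 i j t s (f s))"
proof (rule smoothed_continuous[OF fc fL(2) L_nonneg tT(1,3)])
  fix m assume m: "t < m" "m < T"
  \<comment> \<open>A further time between t and m leaves room for both derivatives to be taken
    before m.\<close>
  define m' where "m' = (t + m) / 2"
  have m': "t < m'" "m' < m" using m by (auto simp: m'_def)
  have "R2 i j t s (f s) = R i t m' (R j m' m (P m s (f s)))" if "s \<in> {m<..T}" for s
    using that m m' tT by (simp add: R_P R2_split)
  then show "\<exists>\<Lambda>. continuous_on UNIV \<Lambda> \<and> (\<forall>s\<in>{m<..T}. R2 i j t s (f s) = \<Lambda> (P m s (f s)))"
    using m m' tT by (intro exI[of _ "\<lambda>x. R i t m' (R j m' m x)"] conjI continuous_on_compose2[OF R_continuous[of t m' i] R_continuous[of m' m j]]) auto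
qed auto

lemma grd_continuous_time: "continuous_on {t<..T} (\<lambda>s. grd t s (f s) y)"
  unfolding grd_def
  by (intro continuous_intros bounded_linear.continuous_on[OF bounded_linear_apply_bcontfun] R_continuous_time)

lemma hes_continuous_time: "continuous_on {t<..T} (\<lambda>s. hes t s (f s) y)"
  unfolding hes_def
  by (intro continuous_intros bounded_linear.continuous_on[OF bounded_linear_apply_bcontfun] R2_continuous_time)

end

text \<open>\<open>V\<close> is an integral in the Banach space of bounded continuous functions, so
  that evolution operators can be taken out of it. The integrands of \<open>gV\<close> and
  \<open>hV\<close> are singular at s = t and are integrated pointwise over the open
  interval.\<close>

definition V :: "real \<Rightarrow> (real \<Rightarrow> (real^'d) \<Rightarrow>\<^sub>C real) \<Rightarrow> real \<Rightarrow> (real^'d) \<Rightarrow>\<^sub>C real" where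
  "V T f t = integral {t..T} (\<lambda>s. P t s (f s))"
definition gV :: "real \<Rightarrow> (real \<Rightarrow> (real^'d) \<Rightarrow>\<^sub>C real) \<Rightarrow> real \<Rightarrow> real^'d \<Rightarrow> real^'d" where
  "gV T f t y = integral {t<..<T} (\<lambda>s. grd t s (f s) y)"
definition hV :: "real \<Rightarrow> (real \<Rightarrow> (real^'d) \<Rightarrow>\<^sub>C real) \<Rightarrow> real \<Rightarrow> real^'d \<Rightarrow> real^'d^'d" where
  "hV T f t y = integral {t<..<T} (\<lambda>s. hes t s (f s) y)"

text \<open>The factor 2 / (1 - \<alpha>) is the integral of s^(-(1 + \<alpha>)/2) over an interval
  of length 1.\<close>

definition cD :: real where "cD = cC * (2 / (1 - \<alpha>))"

lemma cD_pos: "0 < cD" using cC_pos alpha by (auto simp: cD_def)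

context
  fixes t T L :: real and f :: "real \<Rightarrow> (real^'d) \<Rightarrow>\<^sub>C real"
  assumes tT: "0 \<le> t" "t \<le> T" "T \<le> T1"
    and fc: "continuous_on {t..T} f"
    and fL: "\<And>s. s \<in> {t..T} \<Longrightarrow> norm (f s) \<le> L" "\<And>s. s \<in> {t..T} \<Longrightarrow> lipschitz_by L (apply_bcontfun (f s))"
begin

lemma P_integrable: "t \<le> r \<Longrightarrow> r' \<le> T \<Longrightarrow> (\<lambda>s. P t s (f s)) integrable_on {r..r'}"
proof -
  assume r: "t \<le> r" "r' \<le> T"
  have "continuous_on {t..T} (\<lambda>s. P t s (f s))"
    by (rule P_continuous[OF fc fL(2) L_nonneg[OF tT fc fL] tT(1,3)])
  then show ?thesis by (intro integrable_continuous_real) (use r in \<open>auto intro: continuous_on_subset\<close>)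
qed

lemma V_apply: "V T f t y = integral {t<..<T} (\<lambda>s. P t s (f s) y)"
  and P_integrable_at: "(\<lambda>s. P t s (f s) y) integrable_on {t<..<T}"
proof -
  note i = P_integrable[OF order_refl order_refl]
  show "V T f t y = integral {t<..<T} (\<lambda>s. P t s (f s) y)"
    using integral_linear[OF i bounded_linear_apply_bcontfun[of y]] unfolding V_def integral_open_interval_real[symmetric] by (simp add: o_def)
  show "(\<lambda>s. P t s (f s) y) integrable_on {t<..<T}"
    using integrable_linear[OF i bounded_linear_apply_bcontfun[of y]] unfolding integrable_on_Icc_iff_Ioo[symmetric] by (simp add: o_def)
qed

lemma singular_half:
  fixes g :: "real \<Rightarrow> 'b::euclidean_space"
  assumes "continuous_on {t<..T} g" "\<And>s. s \<in> {t<..<T} \<Longrightarrow> norm (g s) \<le> c / sqrt (s - t)"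
  shows "g integrable_on {t<..<T}" "norm (integral {t<..<T} g) \<le> 2 * c * sqrt (T - t)"
proof -
  have b: "norm (g s) \<le> c * (s - t) powr (-(1/2))" if "s \<in> {t<..<T}" for s
  proof -
    have "(s - t) powr (-(1/2)) = 1 / sqrt (s - t)" using that by (simp add: powr_minus_divide powr_half_sqrt)
    then show ?thesis using assms(2)[OF that] by simp
  qed
  show "g integrable_on {t<..<T}" by (rule singular_integrable(1)[OF assms(1) b]) (use tT in auto)
  show "norm (integral {t<..<T} g) \<le> 2 * c * sqrt (T - t)"
    using singular_integrable(2)[OF assms(1) b] tT by (simp add: powr_half_sqrt)
qed

text \<open>One derivative costs (s - t)^(-1/2), whose integral is 2 sqrt(T - t). The estimate
  involves only the sup norms M of the source; this is the form that the contractions use.\<close>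

lemma grd_integrable: "(\<lambda>s. grd t s (f s) y) integrable_on {t<..<T}"
  and gV_norm: "(\<And>s. s \<in> {t..T} \<Longrightarrow> norm (f s) \<le> M) \<Longrightarrow> norm (gV T f t y) \<le> 4 * cW * M * sqrt (T - t)"
proof -
  have b: "norm (grd t s (f s) y) \<le> 2 * cW * M / sqrt (s - t)" if "s \<in> {t<..<T}" "\<And>s. s \<in> {t..T} \<Longrightarrow> norm (f s) \<le> M" for s M
  proof -
    have "norm (grd t s (f s) y) \<le> 2 * cW * norm (f s) / sqrt (s - t)" by (rule grd_norm) (use that tT in auto)
    also have "\<dots> \<le> 2 * cW * M / sqrt (s - t)" using that c_nonneg by (intro divide_right_mono mult_left_mono) auto
    finally show ?thesis .
  qed
  show "(\<lambda>s. grd t s (f s) y) integrable_on {t<..<T}"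
    by (rule singular_half(1)[OF grd_continuous_time[OF tT fc fL] b]) (use fL in auto)
  show "norm (gV T f t y) \<le> 4 * cW * M * sqrt (T - t)" if "\<And>s. s \<in> {t..T} \<Longrightarrow> norm (f s) \<le> M"
    using singular_half(2)[OF grd_continuous_time[OF tT fc fL] b[OF _ that]] unfolding gV_def by simp
qed

text \<open>The gain sqrt(T - t) allows a Lipschitz bound to be reproduced on short intervals, hence
  to be part of the invariant set.\<close>

lemma gV_lip: "lipschitz_by (4 * cP * cV * cW * L * sqrt (T - t)) (gV T f t)"
  unfolding lipschitz_by_def
proof clarify
  fix x h
  have "norm (integral {t<..<T} (\<lambda>s. grd t s (f s) (x + h) - grd t s (f s) x)) \<le> 2 * (2 * cP * cV * cW * L * norm h) * sqrt (T - t)"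
  proof (rule singular_half(2))
    show "continuous_on {t<..T} (\<lambda>s. grd t s (f s) (x + h) - grd t s (f s) x)"
      by (intro continuous_intros grd_continuous_time[OF tT fc fL])
    fix s assume s: "s \<in> {t<..<T}"
    show "norm (grd t s (f s) (x + h) - grd t s (f s) x) \<le> 2 * cP * cV * cW * L * norm h / sqrt (s - t)"
      using lipschitz_byD[OF grd_lip[OF fL(2)[of s] L_nonneg[OF tT fc fL] tT(1), of s], of x h] s tT by (simp add: mult_ac)
  qed
  then show "norm (gV T f t (x + h) - gV T f t x) \<le> 4 * cP * cV * cW * L * sqrt (T - t) * norm h"
    unfolding gV_def using grd_integrable by (simp add: integral_diff mult_ac)
qed

lemma V_C2: "C2 \<alpha> (cD * L) (apply_bcontfun (V T f t)) (gV T f t) (hV T f t)"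
proof -
  let ?k = "\<lambda>s. cC * L * (s - t) powr (-(1 + \<alpha>) / 2)"
  have L: "0 \<le> L" by (rule L_nonneg[OF tT fc fL])
  have a1: "(1 + \<alpha>) / 2 < 1" using alpha by simp
  have hi: "(?k has_integral cC * L * ((T - t) powr (1 - (1 + \<alpha>) / 2) / (1 - (1 + \<alpha>) / 2))) {t<..<T}"
    using has_integral_mult_right[OF singular_has_integral[OF tT(2) a1], of "cC * L"] by (simp add: minus_divide_left)
  have "(T - t) powr (1 - (1 + \<alpha>) / 2) \<le> 1 powr (1 - (1 + \<alpha>) / 2)" using tT T1 alpha by (intro powr_mono2) auto
  then have "(T - t) powr (1 - (1 + \<alpha>) / 2) / (1 - (1 + \<alpha>) / 2) \<le> 1 / (1 - (1 + \<alpha>) / 2)" using alpha by (intro divide_right_mono) auto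
  also have "\<dots> = 2 / (1 - \<alpha>)" using alpha by (simp add: field_simps)
  finally have "cC * L * ((T - t) powr (1 - (1 + \<alpha>) / 2) / (1 - (1 + \<alpha>) / 2)) \<le> cC * L * (2 / (1 - \<alpha>))"
    using cC_pos L by (intro mult_left_mono) auto
  then have le: "integral {t<..<T} ?k \<le> cD * L" unfolding integral_unique[OF hi] by (simp add: cD_def mult_ac)
  have c: "C2 \<alpha> (?k s) (apply_bcontfun (P t s (f s))) (grd t s (f s)) (hes t s (f s))" if "s \<in> {t<..<T}" for s
    by (rule C2_P) (use that fL tT in auto)
  have h: "(\<lambda>s. hes t s (f s) y) integrable_on {t<..<T}" for y
  proof (rule singular_integrable(1)[OF hes_continuous_time[OF tT fc fL] _ a1 tT(2)])
    fix s assume "s \<in> {t<..<T}"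
    then show "norm (hes t s (f s) y) \<le> (cC * L) * (s - t) powr (-((1 + \<alpha>) / 2))"
      using C2_bounds(3)[OF c, of s y] by (simp add: minus_divide_left)
  qed
  show ?thesis unfolding V_apply gV_def[abs_def] hV_def[abs_def]
    by (rule C2_integral[OF c has_integral_integrable[OF hi] le P_integrable_at grd_integrable h])
qed

text \<open>The integral is cut at r; on the later piece \<open>P t r\<close> is a bounded linear
  operator and leaves the integral.\<close>

lemma V_semigroup:
  assumes "t \<le> r" "r \<le> T"
  shows "V T f t = V r f t + P t r (V T f r)"
proof -
  have "V T f t = integral {t..r} (\<lambda>s. P t s (f s)) + integral {r..T} (\<lambda>s. P t s (f s))"
    unfolding V_def using assms P_integrable by (intro Henstock_Kurzweil_Integration.integral_combine[symmetric]) auto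
  moreover have "integral {r..T} (\<lambda>s. P t s (f s)) = integral {r..T} (P t r \<circ> (\<lambda>s. P r s (f s)))"
    by (rule integral_cong) (use assms tT in \<open>simp add: P_semi\<close>)
  moreover have "\<dots> = P t r (integral {r..T} (\<lambda>s. P r s (f s)))"
  proof (rule integral_linear[OF _ bounded_linear_evol])
    have "continuous_on {r..T} (\<lambda>s. P r s (f s))"
      by (rule P_continuous[where L=L]) (use fc fL assms tT L_nonneg[OF tT fc fL] in \<open>auto intro: continuous_on_subset\<close>)
    then show "(\<lambda>s. P r s (f s)) integrable_on {r..T}" by (rule integrable_continuous_real)
  qed
  ultimately show ?thesis by (simp add: V_def)
qed

end

end

section \<open>Generator and time regularity\<close>

text \<open>1 + |z|^3 dominates |z|^p for every p between 0 and 3; the exponents that occur are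
  \<alpha> and 2 + \<alpha>.\<close>

definition gauss_c :: real where "gauss_c = (\<integral>z. 1 + \<bar>z\<bar> ^ 3 \<partial>gaussM)"

lemma gauss_c_integrable: "integrable gaussM (\<lambda>z. 1 + \<bar>z\<bar> ^ 3)"
  using gauss_moments(2)[of 3] by auto

lemma gauss_c_nonneg: "0 \<le> gauss_c"
  unfolding gauss_c_def by (rule integral_nonneg_AE) auto

lemma gauss_abs_powr:
  assumes "0 \<le> p" "p \<le> 3" and F: "\<And>z. \<bar>F z\<bar> \<le> c * \<bar>z\<bar> powr p" "0 \<le> c" "integrable gaussM F"
  shows "\<bar>\<integral>z. F z \<partial>gaussM\<bar> \<le> c * gauss_c"
proof -
  have p: "\<bar>z\<bar> powr p \<le> 1 + \<bar>z\<bar> ^ 3" for z :: real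
  proof (cases "\<bar>z\<bar> \<le> 1")
    case True
    then have "\<bar>z\<bar> powr p \<le> 1 powr p" using assms by (intro powr_mono2) auto
    then show ?thesis by (simp add: add_increasing2)
  next
    case False
    then have "\<bar>z\<bar> powr p \<le> \<bar>z\<bar> powr 3" using assms by (intro powr_mono) auto
    also have "\<dots> = \<bar>z\<bar> ^ 3" using False by (simp add: powr_numeral)
    finally show ?thesis by simp
  qed
  have "\<bar>\<integral>z. F z \<partial>gaussM\<bar> \<le> (\<integral>z. \<bar>F z\<bar> \<partial>gaussM)" by (rule integral_abs_bound)
  also have "\<dots> \<le> (\<integral>z. c * (1 + \<bar>z\<bar> ^ 3) \<partial>gaussM)"
  proof (rule integral_mono)
    fix z show "\<bar>F z\<bar> \<le> c * (1 + \<bar>z\<bar> ^ 3)" using F(1)[of z] mult_left_mono[OF p F(2), of z] by linarith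
  qed (use F(3) gauss_c_integrable in auto)
  also have "\<dots> = c * gauss_c" unfolding gauss_c_def using gauss_c_integrable by simp
  finally show ?thesis .
qed

text \<open>The second order expansion is averaged with step sqrt(\<sigma>) z v: the first moment
  vanishes, the second is 1, and the remainder scales like \<sigma>^(1 + \<alpha>/2). The bound is
  given in terms of a common \<Delta> above the variances of all directions.\<close>

lemma gauss_op_generator:
  fixes f :: "(real^'d) \<Rightarrow>\<^sub>C real"
  assumes C: "C2 \<alpha> K (apply_bcontfun f) q Q" and a: "0 < \<alpha>" "\<alpha> < 1" and s: "0 \<le> \<sigma>" "\<sigma> \<le> \<Delta>"
  shows "\<bar>gauss_op v \<sigma> f y - f y - \<sigma> / 2 * (v \<bullet> (Q y *v v))\<bar> \<le> (gauss_c * norm v powr (2 + \<alpha>)) * K * \<Delta> powr (1 + \<alpha> / 2)"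
proof -
  let ?r = "sqrt \<sigma>"
  have K: "0 \<le> K" by (rule C2_nonneg[OF C])
  define F where "F z = f (y + (?r * z) *\<^sub>R v) - f y - z * (?r * (q y \<bullet> v)) - z\<^sup>2 * (\<sigma> / 2 * (v \<bullet> (Q y *v v)))" for z
  have i: "integrable gaussM F" unfolding F_def using gauss_moments(1)[of 2] by auto
  have "(\<integral>z. F z \<partial>gaussM) = gauss_op v \<sigma> f y - f y - \<sigma> / 2 * (v \<bullet> (Q y *v v))"
    unfolding F_def using gauss_moments(1)[of 2] gauss_moments(3,4) gauss.prob_space by (simp add: gauss_op_apply)
  moreover have "\<bar>\<integral>z. F z \<partial>gaussM\<bar> \<le> (K * \<Delta> powr (1 + \<alpha> / 2) * norm v powr (2 + \<alpha>)) * gauss_c"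
  proof (rule gauss_abs_powr[OF _ _ _ _ i])
    fix z
    let ?h = "(?r * z) *\<^sub>R v"
    have e: "F z = f (y + ?h) - f y - q y \<bullet> ?h - (?h \<bullet> (Q y *v ?h)) / 2"
      using s by (simp add: F_def matrix_vector_mult_scaleR power2_eq_square mult_ac)
    have "\<bar>F z\<bar> \<le> K * norm ?h powr (2 + \<alpha>)" unfolding e by (rule C2_taylor[OF C a(1)])
    also have "norm ?h powr (2 + \<alpha>) = ?r powr (2 + \<alpha>) * \<bar>z\<bar> powr (2 + \<alpha>) * norm v powr (2 + \<alpha>)"
      using s by (simp add: powr_mult abs_mult)
    also have "?r powr (2 + \<alpha>) = \<sigma> powr (1 + \<alpha> / 2)"
    proof -
      have "?r powr (2 + \<alpha>) = \<sigma> powr ((1/2) * (2 + \<alpha>))" using s by (simp only: powr_half_sqrt[symmetric] powr_powr)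
      then show ?thesis by (simp add: field_simps)
    qed
    also have "K * (\<sigma> powr (1 + \<alpha> / 2) * \<bar>z\<bar> powr (2 + \<alpha>) * norm v powr (2 + \<alpha>)) \<le> K * (\<Delta> powr (1 + \<alpha> / 2) * \<bar>z\<bar> powr (2 + \<alpha>) * norm v powr (2 + \<alpha>))"
      using s a K by (intro mult_left_mono mult_right_mono powr_mono2) auto
    finally show "\<bar>F z\<bar> \<le> (K * \<Delta> powr (1 + \<alpha> / 2) * norm v powr (2 + \<alpha>)) * \<bar>z\<bar> powr (2 + \<alpha>)" by (simp add: mult_ac)
  qed (use a K in auto)
  ultimately show ?thesis by (simp add: mult_ac)
qed

lemma gauss_op_holder:
  fixes X :: "'a::real_normed_vector \<Rightarrow>\<^sub>C real"
  assumes X: "\<And>y h. \<bar>X (y + h) - X y\<bar> \<le> H * norm h powr \<alpha>" and a: "0 < \<alpha>" "\<alpha> < 1" and s: "0 \<le> \<sigma>" "\<sigma> \<le> \<Delta>" "0 \<le> H"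
  shows "\<bar>gauss_op v \<sigma> X y - X y\<bar> \<le> gauss_c * norm v powr \<alpha> * H * \<Delta> powr (\<alpha> / 2)"
proof -
  let ?r = "sqrt \<sigma>"
  have "(\<integral>z. X (y + (?r * z) *\<^sub>R v) - X y \<partial>gaussM) = gauss_op v \<sigma> X y - X y" using gauss.prob_space by (simp add: gauss_op_apply)
  moreover have "\<bar>\<integral>z. X (y + (?r * z) *\<^sub>R v) - X y \<partial>gaussM\<bar> \<le> (H * \<Delta> powr (\<alpha> / 2) * norm v powr \<alpha>) * gauss_c"
  proof (rule gauss_abs_powr[where p=\<alpha>])
    fix z
    let ?h = "(?r * z) *\<^sub>R v"
    have "\<bar>X (y + ?h) - X y\<bar> \<le> H * norm ?h powr \<alpha>" by (rule X)
    also have "norm ?h powr \<alpha> = ?r powr \<alpha> * \<bar>z\<bar> powr \<alpha> * norm v powr \<alpha>"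
      using s by (simp add: powr_mult abs_mult)
    also have "?r powr \<alpha> = \<sigma> powr (\<alpha> / 2)"
    proof -
      have "?r powr \<alpha> = \<sigma> powr ((1/2) * \<alpha>)" using s by (simp only: powr_half_sqrt[symmetric] powr_powr)
      then show ?thesis by simp
    qed
    also have "H * (\<sigma> powr (\<alpha> / 2) * \<bar>z\<bar> powr \<alpha> * norm v powr \<alpha>) \<le> H * (\<Delta> powr (\<alpha> / 2) * \<bar>z\<bar> powr \<alpha> * norm v powr \<alpha>)"
      using s a by (intro mult_left_mono mult_right_mono powr_mono2) auto
    finally show "\<bar>X (y + ?h) - X y\<bar> \<le> (H * \<Delta> powr (\<alpha> / 2) * norm v powr \<alpha>) * \<bar>z\<bar> powr \<alpha>" by (simp add: mult_ac)
  qed (use a s in auto)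
  ultimately show ?thesis by (simp add: mult_ac)
qed

lemma abs_quadratic_form_le: "\<bar>v \<bullet> (M *v v)\<bar> \<le> norm M * (norm v)\<^sup>2" for M :: "real^'d^'d"
proof -
  have "\<bar>v \<bullet> (M *v v)\<bar> \<le> norm v * norm (M *v v)" by (rule Cauchy_Schwarz_ineq2)
  also have "\<dots> \<le> norm v * (norm M * norm v)" by (intro mult_left_mono norm_matrix_vector_le) auto
  finally show ?thesis by (simp add: power2_eq_square mult_ac)
qed

text \<open>Induction over the directions. If X is the leading term of the remaining ones, the outer
  average acts on their error, on f and on X; since X is \<Delta> times an \<alpha>-Hoelder
  function, averaging it changes it only by order \<Delta>^(1 + \<alpha>/2). The constant depends on
  the list of directions and \<alpha>, not on the times, f or K.\<close>

lemma evol_generator: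
  fixes ks :: "((real^'d) \<times> (real \<Rightarrow> real)) list"
  assumes a: "0 < \<alpha>" "\<alpha> < 1"
  shows "\<exists>c\<ge>0. \<forall>t s \<Delta> (f :: (real^'d) \<Rightarrow>\<^sub>C real) q Q K. (\<forall>(v,b)\<in>set ks. 0 \<le> integral {t..s} b \<and> integral {t..s} b \<le> \<Delta>) \<longrightarrow> 0 \<le> \<Delta> \<longrightarrow>
    C2 \<alpha> K (apply_bcontfun f) q Q \<longrightarrow>
    (\<forall>y. \<bar>evol ks t s f y - f y - (\<Sum>(v,b)\<leftarrow>ks. integral {t..s} b / 2 * (v \<bullet> (Q y *v v)))\<bar> \<le> c * K * \<Delta> powr (1 + \<alpha> / 2))"
proof (induction ks)
  case Nil then show ?case by (intro exI[of _ 0]) auto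
next
  case (Cons k ks)
  obtain v b where k: "k = (v,b)" by (cases k)
  obtain c where c: "c \<ge> 0" "\<And>t s \<Delta> (f :: (real^'d) \<Rightarrow>\<^sub>C real) q Q K y. (\<forall>(v,b)\<in>set ks. 0 \<le> integral {t..s} b \<and> integral {t..s} b \<le> \<Delta>) \<Longrightarrow> 0 \<le> \<Delta> \<Longrightarrow>
    C2 \<alpha> K (apply_bcontfun f) q Q \<Longrightarrow>
    \<bar>evol ks t s f y - f y - (\<Sum>(v,b)\<leftarrow>ks. integral {t..s} b / 2 * (v \<bullet> (Q y *v v)))\<bar> \<le> c * K * \<Delta> powr (1 + \<alpha> / 2)"
    using Cons.IH by blast
  define S where "S = (\<Sum>(v,b)\<leftarrow>ks. (norm v)\<^sup>2) / 2"
  have S: "0 \<le> S" unfolding S_def by (auto intro!: sum_list_nonneg)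
  define c' where "c' = c + gauss_c * norm v powr (2 + \<alpha>) + gauss_c * norm v powr \<alpha> * S"
  have "\<bar>evol (k # ks) t s f y - f y - (\<Sum>(v,b)\<leftarrow>k # ks. integral {t..s} b / 2 * (v \<bullet> (Q y *v v)))\<bar> \<le> c' * K * \<Delta> powr (1 + \<alpha> / 2)"
    if B: "\<forall>(v,b)\<in>set (k # ks). 0 \<le> integral {t..s} b \<and> integral {t..s} b \<le> \<Delta>" and \<Delta>: "0 \<le> \<Delta>"
      and C: "C2 \<alpha> K (apply_bcontfun f) q Q" for t s \<Delta> and f :: "(real^'d) \<Rightarrow>\<^sub>C real" and q Q K y
  proof -
    have K: "0 \<le> K" by (rule C2_nonneg[OF C])
    let ?s = "integral {t..s} b"
    have s: "0 \<le> ?s" "?s \<le> \<Delta>" using B k by auto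
    define x where "x y = (\<Sum>(v,b)\<leftarrow>ks. integral {t..s} b / 2 * (v \<bullet> (Q y *v v)))" for y
    have xle: "\<bar>\<Sum>(v,b)\<leftarrow>ks. integral {t..s} b / 2 * (v \<bullet> (M *v v))\<bar> \<le> \<Delta> * S * norm M" for M :: "real^'d^'d"
    proof -
      have "\<bar>\<Sum>(v,b)\<leftarrow>ks'. integral {t..s} b / 2 * (v \<bullet> (M *v v))\<bar> \<le> \<Delta> * ((\<Sum>(v,b)\<leftarrow>ks'. (norm v)\<^sup>2) / 2) * norm M"
        if "set ks' \<subseteq> set ks" for ks'
        using that
      proof (induction ks')
        case (Cons j js)
        obtain v b where j: "j = (v,b)" by (cases j)
        have jb: "0 \<le> integral {t..s} b" "integral {t..s} b \<le> \<Delta>" using B Cons.prems j by auto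
        have "\<bar>integral {t..s} b / 2 * (v \<bullet> (M *v v))\<bar> = integral {t..s} b / 2 * \<bar>v \<bullet> (M *v v)\<bar>" using jb by (simp add: abs_mult)
        also have "\<dots> \<le> \<Delta> / 2 * (norm M * (norm v)\<^sup>2)" using jb \<Delta> by (intro mult_mono abs_quadratic_form_le) auto
        finally have 1: "\<bar>integral {t..s} b / 2 * (v \<bullet> (M *v v))\<bar> \<le> \<Delta> / 2 * (norm M * (norm v)\<^sup>2)" .
        have "\<bar>\<Sum>(v,b)\<leftarrow>js. integral {t..s} b / 2 * (v \<bullet> (M *v v))\<bar> \<le> \<Delta> * ((\<Sum>(v,b)\<leftarrow>js. (norm v)\<^sup>2) / 2) * norm M" using Cons by auto
        with 1 show ?case by (simp add: j algebra_simps add_divide_distrib)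
      qed auto
      from this[of ks] show ?thesis by (simp add: S_def)
    qed
    have xdiff: "x y - x z = (\<Sum>(v,b)\<leftarrow>ks. integral {t..s} b / 2 * (v \<bullet> ((Q y - Q z) *v v)))" for y z
      unfolding x_def by (induction ks) (auto simp: matrix_vector_mult_diff_rdistrib inner_diff_right algebra_simps)
    have xh: "\<bar>x (y + h) - x y\<bar> \<le> (\<Delta> * S * K) * norm h powr \<alpha>" for y h
    proof -
      have "\<bar>x (y + h) - x y\<bar> \<le> \<Delta> * S * norm (Q (y + h) - Q y)" unfolding xdiff by (rule xle)
      also have "\<dots> \<le> \<Delta> * S * (K * norm h powr \<alpha>)" using \<Delta> S by (intro mult_left_mono C2_bounds[OF C]) auto
      finally show ?thesis by (simp add: mult_ac)
    qed
    have xc: "continuous_on UNIV x"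
    proof (rule holder_continuous_on[OF _ a(1)])
      fix s' t' show "dist (x s') (x t') \<le> (\<Delta> * S * K) * dist s' t' powr \<alpha>" using xh[of t' "s' - t'"] by (simp add: dist_norm dist_real_def)
    qed
    have xb: "norm (x y) \<le> \<Delta> * S * K" for y
    proof -
      have "\<bar>x y\<bar> \<le> \<Delta> * S * norm (Q y)" unfolding x_def by (rule xle)
      also have "\<dots> \<le> \<Delta> * S * K" using \<Delta> S by (intro mult_left_mono C2_bounds[OF C]) auto
      finally show ?thesis by simp
    qed
    define X where "X = Bcontfun x"
    have X: "apply_bcontfun X = x" unfolding X_def by (rule apply_Bcontfun[OF xc xb])
    let ?e = "evol ks t s f"
    have 1: "\<bar>gauss_op v ?s (?e - f - X) y\<bar> \<le> c * K * \<Delta> powr (1 + \<alpha> / 2)"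
    proof -
      have "norm (gauss_op v ?s (?e - f - X) y) \<le> norm (?e - f - X)" by (rule order_trans[OF norm_bounded gauss_op_norm])
      also have "\<dots> \<le> c * K * \<Delta> powr (1 + \<alpha> / 2)"
        by (rule norm_bound) (use c(2)[OF _ \<Delta> C, of t s] B in \<open>auto simp: X x_def\<close>)
      finally show ?thesis by simp
    qed
    have 2: "\<bar>gauss_op v ?s f y - f y - ?s / 2 * (v \<bullet> (Q y *v v))\<bar> \<le> (gauss_c * norm v powr (2 + \<alpha>)) * K * \<Delta> powr (1 + \<alpha> / 2)"
      by (rule gauss_op_generator[OF C a s])
    have "\<bar>gauss_op v ?s X y - X y\<bar> \<le> gauss_c * norm v powr \<alpha> * (\<Delta> * S * K) * \<Delta> powr (\<alpha> / 2)"
      by (rule gauss_op_holder[OF _ a s]) (use xh X \<Delta> S K in auto)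
    also have "\<dots> = (gauss_c * norm v powr \<alpha> * S) * K * (\<Delta> * \<Delta> powr (\<alpha> / 2))" by (simp only: mult_ac)
    also have "\<Delta> * \<Delta> powr (\<alpha> / 2) = \<Delta> powr (1 + \<alpha> / 2)" using \<Delta> by (simp add: powr_add)
    finally have 3: "\<bar>gauss_op v ?s X y - x y\<bar> \<le> (gauss_c * norm v powr \<alpha> * S) * K * \<Delta> powr (1 + \<alpha> / 2)" by (simp add: X)
    have "evol (k # ks) t s f y - f y - (\<Sum>(v,b)\<leftarrow>k # ks. integral {t..s} b / 2 * (v \<bullet> (Q y *v v)))
        = gauss_op v ?s (?e - f - X) y + (gauss_op v ?s f y - f y - ?s / 2 * (v \<bullet> (Q y *v v))) + (gauss_op v ?s X y - x y)"
      by (simp add: k gauss_op_diff x_def)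
    also have "\<bar>\<dots>\<bar> \<le> c * K * \<Delta> powr (1 + \<alpha> / 2) + (gauss_c * norm v powr (2 + \<alpha>)) * K * \<Delta> powr (1 + \<alpha> / 2) + (gauss_c * norm v powr \<alpha> * S) * K * \<Delta> powr (1 + \<alpha> / 2)"
      using 1 2 3 by linarith
    also have "\<dots> = c' * K * \<Delta> powr (1 + \<alpha> / 2)" by (simp only: c'_def distrib_right)
    finally show ?thesis .
  qed
  moreover have "c' \<ge> 0" using c S gauss_c_nonneg by (auto simp: c'_def)
  ultimately show ?case by (intro exI[of _ c'] conjI allI impI) auto
qed

context diffusion
begin

text \<open>The generator at time t as a linear function of the Hessian; for the decomposition of
  C(t) C(t)^T it equals half the trace of M C(t) C(t)^T.\<close>

definition LA :: "real \<Rightarrow> real^'d^'d \<Rightarrow> real" where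
  "LA t M = (\<Sum>(v,b)\<leftarrow>ks. b t / 2 * (v \<bullet> (M *v v)))"

definition cA :: real where "cA = K0 * (\<Sum>(v,b)\<leftarrow>ks. (norm v)\<^sup>2)"

text \<open>\<open>\<beta>\<close> is a functional of the weight, so that one bound covers b t, the
  increment b s - b t, and the error of freezing b under the integral.\<close>

lemma weighted_form_bound:
  fixes \<beta> :: "(real \<Rightarrow> real) \<Rightarrow> real"
  assumes "\<And>x b. (x,b) \<in> set ks \<Longrightarrow> \<bar>\<beta> b\<bar> \<le> B" "0 \<le> B"
  shows "\<bar>\<Sum>(v,b)\<leftarrow>ks. \<beta> b / 2 * (v \<bullet> (M *v v))\<bar> \<le> B * (\<Sum>(v,b)\<leftarrow>ks. (norm v)\<^sup>2) * norm M"
proof -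
  have "\<bar>\<Sum>(v,b)\<leftarrow>ks'. \<beta> b / 2 * (v \<bullet> (M *v v))\<bar> \<le> B * (\<Sum>(v,b)\<leftarrow>ks'. (norm v)\<^sup>2) * norm M" if "set ks' \<subseteq> set ks" for ks'
    using that
  proof (induction ks')
    case (Cons j js)
    obtain v b where j: "j = (v,b)" by (cases j)
    have jb: "\<bar>\<beta> b\<bar> \<le> B" using assms(1)[of v b] Cons.prems j by auto
    have "\<bar>\<beta> b / 2 * (v \<bullet> (M *v v))\<bar> = \<bar>\<beta> b\<bar> / 2 * \<bar>v \<bullet> (M *v v)\<bar>" by (simp add: abs_mult)
    also have "\<dots> \<le> B * (norm M * (norm v)\<^sup>2)" using jb assms(2) by (intro mult_mono abs_quadratic_form_le) auto
    finally have 1: "\<bar>\<beta> b / 2 * (v \<bullet> (M *v v))\<bar> \<le> B * (norm M * (norm v)\<^sup>2)" .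
    have "\<bar>\<Sum>(v,b)\<leftarrow>js. \<beta> b / 2 * (v \<bullet> (M *v v))\<bar> \<le> B * (\<Sum>(v,b)\<leftarrow>js. (norm v)\<^sup>2) * norm M" using Cons by auto
    with 1 show ?case by (simp add: j algebra_simps)
  qed auto
  then show ?thesis by simp
qed

lemma cA_nonneg: "0 \<le> cA" unfolding cA_def using K0_nonneg by (auto intro!: mult_nonneg_nonneg sum_list_nonneg)

lemma LA_bound: "t \<in> {0..T1} \<Longrightarrow> \<bar>LA t M\<bar> \<le> cA * norm M"
  unfolding LA_def cA_def by (rule weighted_form_bound) (use b_nonneg b_bound K0_nonneg in \<open>auto simp: abs_of_nonneg\<close>)

lemma LA_diff: "LA t (M - N) = LA t M - LA t N"
  unfolding LA_def by (induction ks) (auto simp: matrix_vector_mult_diff_rdistrib inner_diff_right algebra_simps)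

lemma LA_time:
  assumes "s \<in> {0..T1}" "t \<in> {0..T1}"
  shows "\<bar>LA s M - LA t M\<bar> \<le> cA * norm M * \<bar>s - t\<bar> powr (\<alpha> / 2)"
proof -
  have "LA s M - LA t M = (\<Sum>(v,b)\<leftarrow>ks. (b s - b t) / 2 * (v \<bullet> (M *v v)))"
    unfolding LA_def by (induction ks) (auto simp: algebra_simps diff_divide_distrib)
  also have "\<bar>\<dots>\<bar> \<le> (K0 * \<bar>s - t\<bar> powr (\<alpha> / 2)) * (\<Sum>(v,b)\<leftarrow>ks. (norm v)\<^sup>2) * norm M"
    by (rule weighted_form_bound[where \<beta>="\<lambda>b. b s - b t"]) (use b_holder K0_nonneg assms in auto)
  finally show ?thesis by (simp add: cA_def mult_ac)
qed

text \<open>This is \<open>evol_generator\<close> with variances up to K0 (s - t), followed by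
  freezing the weights at s, the time at which f is given.\<close>

lemma P_generator:
  "\<exists>c\<ge>0. \<forall>t s (f :: (real^'d) \<Rightarrow>\<^sub>C real) q Q K y. 0 \<le> t \<longrightarrow> t \<le> s \<longrightarrow> s \<le> T1 \<longrightarrow> C2 \<alpha> K (apply_bcontfun f) q Q \<longrightarrow>
    \<bar>P t s f y - f y - (s - t) * LA s (Q y)\<bar> \<le> c * K * (s - t) powr (1 + \<alpha> / 2)"
proof -
  obtain c where c: "c \<ge> 0" "\<And>t s \<Delta> (f :: (real^'d) \<Rightarrow>\<^sub>C real) q Q K y. (\<forall>(v,b)\<in>set ks. 0 \<le> integral {t..s} b \<and> integral {t..s} b \<le> \<Delta>) \<Longrightarrow> 0 \<le> \<Delta> \<Longrightarrow>
    C2 \<alpha> K (apply_bcontfun f) q Q \<Longrightarrow>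
    \<bar>evol ks t s f y - f y - (\<Sum>(v,b)\<leftarrow>ks. integral {t..s} b / 2 * (v \<bullet> (Q y *v v)))\<bar> \<le> c * K * \<Delta> powr (1 + \<alpha> / 2)"
    using evol_generator[OF alpha, of ks] by blast
  define c' where "c' = c * K0 powr (1 + \<alpha> / 2) + cA"
  have "\<bar>P t s f y - f y - (s - t) * LA s (Q y)\<bar> \<le> c' * K * (s - t) powr (1 + \<alpha> / 2)"
    if h: "0 \<le> t" "t \<le> s" "s \<le> T1" and C: "C2 \<alpha> K (apply_bcontfun f) q Q" for t s K q Q y and f :: "(real^'d) \<Rightarrow>\<^sub>C real"
  proof -
    have K: "0 \<le> K" by (rule C2_nonneg[OF C])
    have "\<bar>P t s f y - f y - (\<Sum>(v,b)\<leftarrow>ks. integral {t..s} b / 2 * (v \<bullet> (Q y *v v)))\<bar> \<le> c * K * (K0 * (s - t)) powr (1 + \<alpha> / 2)"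
      by (rule c(2)[OF _ _ C]) (use b_integral(1,2) h K0_nonneg in auto)
    also have "\<dots> = c * K0 powr (1 + \<alpha> / 2) * K * (s - t) powr (1 + \<alpha> / 2)" using h K0_nonneg by (simp add: powr_mult)
    finally have 1: "\<bar>P t s f y - f y - (\<Sum>(v,b)\<leftarrow>ks. integral {t..s} b / 2 * (v \<bullet> (Q y *v v)))\<bar> \<le> \<dots>" .
    have "(\<Sum>(v,b)\<leftarrow>ks. integral {t..s} b / 2 * (v \<bullet> (Q y *v v))) - (s - t) * LA s (Q y)
        = (\<Sum>(v,b)\<leftarrow>ks. (integral {t..s} b - (s - t) * b s) / 2 * (v \<bullet> (Q y *v v)))"
      unfolding LA_def by (induction ks) (auto simp: algebra_simps diff_divide_distrib)
    also have "\<bar>\<dots>\<bar> \<le> (K0 * (s - t) powr (1 + \<alpha> / 2)) * (\<Sum>(v,b)\<leftarrow>ks. (norm v)\<^sup>2) * norm (Q y)"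
      by (rule weighted_form_bound[where \<beta>="\<lambda>b. integral {t..s} b - (s - t) * b s"]) (use b_integral(3) h K0_nonneg in auto)
    also have "\<dots> = cA * norm (Q y) * (s - t) powr (1 + \<alpha> / 2)" by (simp add: cA_def mult_ac)
    also have "\<dots> \<le> cA * K * (s - t) powr (1 + \<alpha> / 2)"
      using cA_nonneg C2_bounds(3)[OF C] by (intro mult_right_mono mult_left_mono) auto
    finally show ?thesis using 1 unfolding c'_def distrib_right by linarith
  qed
  moreover have "c' \<ge> 0" using c cA_nonneg by (auto simp: c'_def)
  ultimately show ?thesis by blast
qed

end

lemma lip_holder:
  fixes f :: "'a::real_normed_vector \<Rightarrow> 'b::real_normed_vector"
  assumes "\<And>y. norm (f y) \<le> K" "lipschitz_by K f" "0 < \<alpha>" "\<alpha> < 1"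
  shows "norm (f (y + h) - f y) \<le> 2 * K * norm h powr \<alpha>"
proof -
  have K: "0 \<le> K" using assms(1) norm_ge_zero order_trans by blast
  show ?thesis
  proof (cases "norm h \<le> 1")
    case True
    have "norm (f (y + h) - f y) \<le> K * norm h" by (rule lipschitz_byD[OF assms(2)])
    also have "\<dots> \<le> K * norm h powr \<alpha>"
    proof (cases "h = 0")
      case False
      then have "norm h powr 1 \<le> norm h powr \<alpha>" using True assms by (intro powr_mono') auto
      then show ?thesis using K by (intro mult_left_mono) auto
    qed simp
    also have "\<dots> \<le> 2 * K * norm h powr \<alpha>" using K by (intro mult_right_mono) auto
    finally show ?thesis .
  next
    case False
    have "norm (f (y + h) - f y) \<le> 2 * K * 1" using norm_triangle_ineq4[of "f (y + h)" "f y"] assms(1)[of "y + h"] assms(1)[of y] by linarith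
    also have "\<dots> \<le> 2 * K * norm h powr \<alpha>" using False K assms by (intro mult_left_mono ge_one_powr_ge_zero) auto
    finally show ?thesis .
  qed
qed

section \<open>Mild solutions and their time regularity\<close>

context diffusion
begin

context
  fixes t r K :: real and f :: "real \<Rightarrow> (real^'d) \<Rightarrow>\<^sub>C real"
  assumes tr: "0 \<le> t" "t \<le> r" "r \<le> T1"
    and fc: "continuous_on {t..r} f"
    and fK: "\<And>s. s \<in> {t..r} \<Longrightarrow> norm (f s) \<le> K" "\<And>s. s \<in> {t..r} \<Longrightarrow> lipschitz_by K (apply_bcontfun (f s))"
begin

lemma V_norm: "norm (V r f t) \<le> K * (r - t)"
proof -
  have "norm (integral {t..r} (\<lambda>s. P t s (f s))) \<le> integral {t..r} (\<lambda>_. K)"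
  proof (rule integral_norm_bound_integral)
    show "(\<lambda>s. P t s (f s)) integrable_on {t..r}" by (rule P_integrable[OF tr fc fK]) auto
    show "norm (P t s (f s)) \<le> K" if "s \<in> {t..r}" for s using fK(1)[OF that] evol_norm order_trans by blast
  qed (rule integrable_const_ivl)
  then show ?thesis using tr by (simp add: V_def mult.commute)
qed

text \<open>The evolution displaces a Lipschitz source by order sqrt(s - t), which is at most (r -
  t)^(\<alpha>/2) on times up to 1; the source itself varies by the same order. Integration over
  length r - t gives the exponent 1 + \<alpha>/2.\<close>

lemma V_first_order:
  assumes "\<And>s. s \<in> {t..r} \<Longrightarrow> norm (f s - f r) \<le> K * (r - s) powr (\<alpha> / 2)"
  shows "norm (V r f t - (r - t) *\<^sub>R f r) \<le> (cS + 1) * K * (r - t) powr (1 + \<alpha> / 2)"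
proof -
  have K: "0 \<le> K" by (rule L_nonneg[OF tr fc fK])
  have i: "(\<lambda>s. P t s (f s)) integrable_on {t..r}" by (rule P_integrable[OF tr fc fK]) auto
  have "norm (integral {t..r} (\<lambda>s. P t s (f s) - f r)) \<le> integral {t..r} (\<lambda>_. (cS + 1) * K * (r - t) powr (\<alpha> / 2))"
  proof (rule integral_norm_bound_integral)
    show "(\<lambda>s. P t s (f s) - f r) integrable_on {t..r}" using i by (intro integrable_diff integrable_const_ivl)
    fix s assume s: "s \<in> {t..r}"
    have "norm (P t s (f s) - f s) \<le> K * cS * sqrt (s - t)" by (rule P_small[OF fK(2)[OF s] K]) (use s tr in auto)
    also have "\<dots> \<le> K * cS * (r - t) powr (\<alpha> / 2)"
    proof (rule mult_left_mono)
      have "sqrt (s - t) = (s - t) powr (1/2)" using s by (simp add: powr_half_sqrt)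
      also have "\<dots> \<le> (r - t) powr (1/2)" using s by (intro powr_mono2) auto
      also have "\<dots> \<le> (r - t) powr (\<alpha> / 2)"
      proof (cases "r = t")
        case False then show ?thesis using tr T1 alpha by (intro powr_mono') auto
      qed simp
      finally show "sqrt (s - t) \<le> (r - t) powr (\<alpha> / 2)" .
    qed (use K cS_nonneg in auto)
    finally have 1: "norm (P t s (f s) - f s) \<le> K * cS * (r - t) powr (\<alpha> / 2)" .
    have "norm (f s - f r) \<le> K * (r - s) powr (\<alpha> / 2)" by (rule assms[OF s])
    also have "\<dots> \<le> K * (r - t) powr (\<alpha> / 2)" using s K alpha by (intro mult_left_mono powr_mono2) auto
    finally have "norm ((P t s (f s) - f s) + (f s - f r)) \<le> K * cS * (r - t) powr (\<alpha> / 2) + K * (r - t) powr (\<alpha> / 2)"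
      using 1 by (intro norm_triangle_mono)
    then show "norm (P t s (f s) - f r) \<le> (cS + 1) * K * (r - t) powr (\<alpha> / 2)" by (simp add: algebra_simps)
  qed (rule integrable_const_ivl)
  moreover have "integral {t..r} (\<lambda>s. P t s (f s) - f r) = V r f t - (r - t) *\<^sub>R f r"
    using i tr by (simp add: V_def integral_diff integrable_const_ivl)
  moreover have "integral {t..r} (\<lambda>_. (cS + 1) * K * (r - t) powr (\<alpha> / 2)) = (cS + 1) * K * ((r - t) * (r - t) powr (\<alpha> / 2))"
    using tr by (simp add: mult_ac)
  moreover have "(r - t) * (r - t) powr (\<alpha> / 2) = (r - t) powr (1 + \<alpha> / 2)" using tr by (simp add: powr_add)
  ultimately show ?thesis by metis
qed

end

text \<open>Duhamel's formula is required between any two times, so that time increments can be read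
  off without going through the terminal value.\<close>

definition mild :: "real \<Rightarrow> (real \<Rightarrow> (real^'d) \<Rightarrow>\<^sub>C real) \<Rightarrow> (real \<Rightarrow> (real^'d) \<Rightarrow>\<^sub>C real) \<Rightarrow> bool" where
  "mild T u f \<longleftrightarrow> (\<forall>t r. 0 \<le> t \<longrightarrow> t \<le> r \<longrightarrow> r \<le> T \<longrightarrow> u t = V r f t + P t r (u r))"

lemma small_powr: "0 \<le> x \<Longrightarrow> x \<le> 1 \<Longrightarrow> x powr (1 + \<alpha> / 2) \<le> x"
proof (cases "x = 0")
  case False
  assume "0 \<le> x" "x \<le> 1"
  then have "x powr (1 + \<alpha> / 2) \<le> x powr 1" using False alpha by (intro powr_mono') auto
  then show ?thesis using \<open>0 \<le> x\<close> by simp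
qed simp

text \<open>Bundled so that the constants of the next two lemmas are chosen before the horizon, the
  solution and K.\<close>

definition mild_data where
  "mild_data T u f q Q K \<longleftrightarrow> T \<le> T1 \<and> mild T u f \<and> continuous_on {0..T} f \<and>
     (\<forall>t\<in>{0..T}. C2 \<alpha> K (apply_bcontfun (u t)) (q t) (Q t) \<and> norm (f t) \<le> K \<and> lipschitz_by K (apply_bcontfun (f t)))"

text \<open>Over a time step the Duhamel term and the displacement of u by the evolution are both of
  order r - t; \<open>gradient_interpolation\<close> turns this into the square root modulus of the
  gradient.\<close>

lemma mild_first_order:
  "\<exists>c\<ge>1. \<forall>T u f q Q K t r y. mild_data T u f q Q K \<longrightarrow> t \<in> {0..T} \<longrightarrow> r \<in> {0..T} \<longrightarrow>
     \<bar>u t y - u r y\<bar> \<le> c * K * \<bar>t - r\<bar> \<and> norm (q t y - q r y) \<le> c * K * sqrt \<bar>t - r\<bar>"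
proof -
  obtain c where c: "c \<ge> 0" "\<And>t s (f :: (real^'d) \<Rightarrow>\<^sub>C real) q Q K y. 0 \<le> t \<Longrightarrow> t \<le> s \<Longrightarrow> s \<le> T1 \<Longrightarrow> C2 \<alpha> K (apply_bcontfun f) q Q \<Longrightarrow>
    \<bar>P t s f y - f y - (s - t) * LA s (Q y)\<bar> \<le> c * K * (s - t) powr (1 + \<alpha> / 2)" using P_generator by blast
  define c1 where "c1 = 1 + cA + c"
  have c1: "1 \<le> c1" using c cA_nonneg by (simp add: c1_def)
  then have c4: "1 \<le> 4 * c1" by simp
  show ?thesis
  proof (rule exI[of _ "4 * c1"], rule conjI[OF c4], intro allI impI)
    fix T u f q Q K t r and y :: "real^'d"
    assume md: "mild_data T u f q Q K" and t0: "t \<in> {0..T}" and r0: "r \<in> {0..T}"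
    have T: "T \<le> T1" and m: "mild T u f" and fc: "continuous_on {0..T} f"
      and C: "\<And>t. t \<in> {0..T} \<Longrightarrow> C2 \<alpha> K (apply_bcontfun (u t)) (q t) (Q t)"
      and fK: "\<And>t. t \<in> {0..T} \<Longrightarrow> norm (f t) \<le> K" "\<And>t. t \<in> {0..T} \<Longrightarrow> lipschitz_by K (apply_bcontfun (f t))"
      using md unfolding mild_data_def by blast+
    have K: "0 \<le> K" by (rule C2_nonneg[OF C[OF t0]])
    have u: "\<bar>u t y - u r y\<bar> \<le> c1 * K * (r - t)" if "0 \<le> t" "t \<le> r" "r \<le> T" for t r y
    proof -
      have e: "u t y = V r f t y + P t r (u r) y" using m that unfolding mild_def by (metis plus_bcontfun.rep_eq)
      have "norm (V r f t) \<le> K * (r - t)"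
        by (rule V_norm) (use that T fc fK in \<open>auto intro: continuous_on_subset\<close>)
      then have 1: "\<bar>V r f t y\<bar> \<le> K * (r - t)" using norm_bounded[of "V r f t" y] by simp
      have 2: "\<bar>P t r (u r) y - u r y - (r - t) * LA r (Q r y)\<bar> \<le> c * K * (r - t)"
      proof -
        have "\<bar>P t r (u r) y - u r y - (r - t) * LA r (Q r y)\<bar> \<le> c * K * (r - t) powr (1 + \<alpha> / 2)"
          by (rule c(2)[OF _ _ _ C]) (use that T in auto)
        also have "\<dots> \<le> c * K * (r - t)" using that T T1 c K by (intro mult_left_mono small_powr) auto
        finally show ?thesis .
      qed
      have "\<bar>LA r (Q r y)\<bar> \<le> cA * norm (Q r y)" by (rule LA_bound) (use that T in auto)
      also have "\<dots> \<le> cA * K" using cA_nonneg C2_bounds(3)[OF C] that by (intro mult_left_mono) auto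
      finally have "\<bar>(r - t) * LA r (Q r y)\<bar> \<le> (r - t) * (cA * K)" using that by (simp add: abs_mult mult_left_mono)
      then show ?thesis using 1 2 unfolding e by (simp add: c1_def algebra_simps)
    qed
    have u': "\<bar>u t y - u r y\<bar> \<le> c1 * K * \<bar>t - r\<bar>" for y
      using u[of t r y] u[of r t y] t0 r0 by (cases "t \<le> r") (auto simp: abs_minus_commute)
    have K1: "K \<le> c1 * K" using mult_right_mono[OF c1 K] by simp
    have "norm (q t y - q r y) \<le> 4 * (c1 * K) * sqrt \<bar>t - r\<bar>"
    proof (cases "t = r")
      case False
      show ?thesis
        by (rule gradient_interpolation[OF C2_mono[OF C[OF t0] K1] C2_mono[OF C[OF r0] K1] u']) (use False in auto)
    qed simp
    moreover have "c1 * K * \<bar>t - r\<bar> \<le> 4 * c1 * K * \<bar>t - r\<bar>" using c1 K by (intro mult_right_mono) auto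
    ultimately show "\<bar>u t y - u r y\<bar> \<le> 4 * c1 * K * \<bar>t - r\<bar> \<and> norm (q t y - q r y) \<le> 4 * c1 * K * sqrt \<bar>t - r\<bar>"
      using u'[of y] by (simp add: mult.assoc)
  qed
qed

text \<open>The increment of u is (r - t) X r up to order 1 + \<alpha>/2, where X is the generator
  applied to the Hessian plus the source. X is \<alpha>-Hoelder in space, so
  \<open>hessian_interpolation\<close> gives the time modulus of Q. This in turn makes X Hoelder in
  time, and the expansion becomes a two-sided derivative.\<close>

lemma mild_second_order:
  "\<exists>c\<ge>1. \<forall>T u f q Q K t r y. mild_data T u f q Q K \<longrightarrow>
      (\<forall>t\<in>{0..T}. \<forall>r\<in>{0..T}. norm (f t - f r) \<le> K * \<bar>t - r\<bar> powr (\<alpha> / 2)) \<longrightarrow> t \<in> {0..T} \<longrightarrow> r \<in> {0..T} \<longrightarrow>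
         norm (Q t y - Q r y) \<le> c * K * \<bar>t - r\<bar> powr (\<alpha> / 2) \<and>
         ((\<lambda>s. u s y) has_real_derivative - (LA t (Q t y) + f t y)) (at t within {0..T})"
proof -
  obtain c where c: "c \<ge> 0" "\<And>t s (f :: (real^'d) \<Rightarrow>\<^sub>C real) q Q K y. 0 \<le> t \<Longrightarrow> t \<le> s \<Longrightarrow> s \<le> T1 \<Longrightarrow> C2 \<alpha> K (apply_bcontfun f) q Q \<Longrightarrow>
    \<bar>P t s f y - f y - (s - t) * LA s (Q y)\<bar> \<le> c * K * (s - t) powr (1 + \<alpha> / 2)" using P_generator by blast
  define c1 where "c1 = (cS + 1) + c + cA + 2"
  have c1: "1 \<le> c1" using c cA_nonneg cS_nonneg by (simp add: c1_def)
  define c2 where "c2 = real (CARD('d) * CARD('d)) * (10 * c1) + 1"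
  have c2: "1 \<le> c2" using c1 by (simp add: c2_def)
  define c3 where "c3 = cA + cA * c2 + 1"
  have c3: "0 \<le> c3" using c2 cA_nonneg by (simp add: c3_def)
  show ?thesis
  proof (rule exI[of _ c2], rule conjI[OF c2], intro allI impI)
    fix T u f q Q K t r and y :: "real^'d"
    assume md: "mild_data T u f q Q K" and fH': "\<forall>t\<in>{0..T}. \<forall>r\<in>{0..T}. norm (f t - f r) \<le> K * \<bar>t - r\<bar> powr (\<alpha> / 2)"
      and t0: "t \<in> {0..T}" and r0: "r \<in> {0..T}"
    have T: "T \<le> T1" and m: "mild T u f" and fc: "continuous_on {0..T} f"
      and C: "\<And>t. t \<in> {0..T} \<Longrightarrow> C2 \<alpha> K (apply_bcontfun (u t)) (q t) (Q t)"
      and fK: "\<And>t. t \<in> {0..T} \<Longrightarrow> norm (f t) \<le> K" "\<And>t. t \<in> {0..T} \<Longrightarrow> lipschitz_by K (apply_bcontfun (f t))"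
      using md unfolding mild_data_def by blast+
    have fH: "\<And>t r. t \<in> {0..T} \<Longrightarrow> r \<in> {0..T} \<Longrightarrow> norm (f t - f r) \<le> K * \<bar>t - r\<bar> powr (\<alpha> / 2)" using fH' by blast
    have K: "0 \<le> K" by (rule C2_nonneg[OF C[OF t0]])
    have K1: "K \<le> c1 * K" using mult_right_mono[OF c1 K] by simp
    define X where "X t y = LA t (Q t y) + f t y" for t y
    have u: "\<bar>u t y - u r y - (r - t) * X r y\<bar> \<le> c1 * K * (r - t) powr (1 + \<alpha> / 2)" if "0 \<le> t" "t \<le> r" "r \<le> T" for t r y
    proof -
      have e: "u t y = V r f t y + P t r (u r) y" using m that unfolding mild_def by (metis plus_bcontfun.rep_eq)
      have "norm (V r f t - (r - t) *\<^sub>R f r) \<le> (cS + 1) * K * (r - t) powr (1 + \<alpha> / 2)"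
      proof (rule V_first_order)
        fix s assume "s \<in> {t..r}"
        then show "norm (f s - f r) \<le> K * (r - s) powr (\<alpha> / 2)" using fH[of s r] that by (simp add: abs_minus_commute[of s])
      qed (use that T fc fK in \<open>auto intro: continuous_on_subset\<close>)
      then have 1: "\<bar>V r f t y - (r - t) * f r y\<bar> \<le> (cS + 1) * K * (r - t) powr (1 + \<alpha> / 2)"
        using norm_bounded[of "V r f t - (r - t) *\<^sub>R f r" y] by simp
      have 2: "\<bar>P t r (u r) y - u r y - (r - t) * LA r (Q r y)\<bar> \<le> c * K * (r - t) powr (1 + \<alpha> / 2)"
        by (rule c(2)[OF _ _ _ C]) (use that T in auto)
      have "\<bar>u t y - u r y - (r - t) * X r y\<bar> \<le> (cS + 1) * K * (r - t) powr (1 + \<alpha> / 2) + c * K * (r - t) powr (1 + \<alpha> / 2)"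
        using 1 2 unfolding e X_def distrib_left by linarith
      also have "\<dots> = ((cS + 1) + c) * K * (r - t) powr (1 + \<alpha> / 2)" by (simp only: distrib_right)
      also have "\<dots> \<le> c1 * K * (r - t) powr (1 + \<alpha> / 2)"
        using K cA_nonneg by (intro mult_right_mono) (auto simp: c1_def)
      finally show ?thesis .
    qed
    have Xh: "\<bar>X r (y + h) - X r y\<bar> \<le> c1 * K * norm h powr \<alpha>" if "r \<in> {0..T}" for r y h
    proof -
      have "\<bar>LA r (Q r (y + h)) - LA r (Q r y)\<bar> \<le> cA * norm (Q r (y + h) - Q r y)"
        unfolding LA_diff[symmetric] by (rule LA_bound) (use that T in auto)
      also have "\<dots> \<le> cA * (K * norm h powr \<alpha>)" using cA_nonneg by (intro mult_left_mono C2_bounds(6)[OF C[OF that]]) auto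
      finally have 1: "\<bar>LA r (Q r (y + h)) - LA r (Q r y)\<bar> \<le> cA * (K * norm h powr \<alpha>)" .
      have 2: "norm (f r (y + h) - f r y) \<le> 2 * K * norm h powr \<alpha>"
        by (rule lip_holder[OF _ fK(2)[OF that] alpha]) (use norm_bounded[of "f r"] fK(1)[OF that] order_trans in blast)
      have "\<bar>X r (y + h) - X r y\<bar> \<le> (cA + 2) * K * norm h powr \<alpha>" using 1 2 by (simp add: X_def algebra_simps)
      also have "\<dots> \<le> c1 * K * norm h powr \<alpha>" using K c cS_nonneg by (intro mult_right_mono) (auto simp: c1_def)
      finally show ?thesis .
    qed
    have Q1: "norm (Q t y - Q r y) \<le> (real (CARD('d) * CARD('d)) * (10 * c1)) * K * (r - t) powr (\<alpha> / 2)" if "0 \<le> t" "t \<le> r" "r \<le> T" for t r y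
    proof (cases "t = r")
      case False
      have "norm (Q t y - Q r y) \<le> real (CARD('d) * CARD('d)) * (10 * (c1 * K) * (r - t) powr (\<alpha> / 2))"
        by (rule hessian_interpolation[OF C2_mono[OF C K1] C2_mono[OF C K1] u Xh]) (use that False alpha in auto)
      then show ?thesis by (simp add: mult_ac)
    qed simp
    have Q2: "norm (Q t y - Q r y) \<le> c2 * K * \<bar>t - r\<bar> powr (\<alpha> / 2)" if "t \<in> {0..T}" "r \<in> {0..T}" for t r
    proof -
      have "norm (Q t y - Q r y) \<le> (real (CARD('d) * CARD('d)) * (10 * c1)) * K * \<bar>t - r\<bar> powr (\<alpha> / 2)"
        using Q1[of t r y] Q1[of r t y] that by (cases "t \<le> r") (auto simp: abs_minus_commute norm_minus_commute)
      also have "\<dots> \<le> c2 * K * \<bar>t - r\<bar> powr (\<alpha> / 2)" using K by (intro mult_right_mono) (auto simp: c2_def)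
      finally show ?thesis .
    qed
    have Xt: "\<bar>X s y - X t y\<bar> \<le> c3 * K * \<bar>s - t\<bar> powr (\<alpha> / 2)" if "s \<in> {0..T}" "t \<in> {0..T}" for s t
    proof -
      have "\<bar>LA s (Q s y) - LA t (Q s y)\<bar> \<le> cA * norm (Q s y) * \<bar>s - t\<bar> powr (\<alpha> / 2)" by (rule LA_time) (use that T in auto)
      also have "\<dots> \<le> cA * K * \<bar>s - t\<bar> powr (\<alpha> / 2)" using cA_nonneg C2_bounds(3)[OF C[OF that(1)]] by (intro mult_right_mono mult_left_mono) auto
      finally have 1: "\<bar>LA s (Q s y) - LA t (Q s y)\<bar> \<le> cA * K * \<bar>s - t\<bar> powr (\<alpha> / 2)" .
      have "\<bar>LA t (Q s y) - LA t (Q t y)\<bar> \<le> cA * norm (Q s y - Q t y)" unfolding LA_diff[symmetric] by (rule LA_bound) (use that T in auto)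
      also have "\<dots> \<le> cA * (c2 * K * \<bar>s - t\<bar> powr (\<alpha> / 2))" using cA_nonneg Q2[OF that] by (intro mult_left_mono) auto
      finally have 2: "\<bar>LA t (Q s y) - LA t (Q t y)\<bar> \<le> cA * (c2 * K * \<bar>s - t\<bar> powr (\<alpha> / 2))" .
      have 3: "\<bar>f s y - f t y\<bar> \<le> K * \<bar>s - t\<bar> powr (\<alpha> / 2)" using norm_bounded[of "f s - f t" y] fH[OF that] by simp
      have "\<bar>X s y - X t y\<bar> \<le> cA * K * \<bar>s - t\<bar> powr (\<alpha> / 2) + cA * (c2 * K * \<bar>s - t\<bar> powr (\<alpha> / 2)) + K * \<bar>s - t\<bar> powr (\<alpha> / 2)"
        using 1 2 3 unfolding X_def by linarith
      then show ?thesis by (simp add: c3_def algebra_simps)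
    qed
    have "((\<lambda>s. u s y) has_real_derivative - X t y) (at t within {0..T})"
    proof (rule derivative_of_remainder_within[where \<beta>="\<alpha> / 2" and c="(c1 + c3) * K"])
      fix s assume s: "s \<in> {0..T}"
      have nn: "0 \<le> c3 * K * \<bar>s - t\<bar> powr (1 + \<alpha> / 2)" using c3 K by auto
      show "\<bar>u s y - u t y - (s - t) * - X t y\<bar> \<le> (c1 + c3) * K * \<bar>s - t\<bar> powr (1 + \<alpha> / 2)"
      proof (cases "s \<le> t")
        case True
        then have "\<bar>u s y - u t y - (t - s) * X t y\<bar> \<le> c1 * K * \<bar>s - t\<bar> powr (1 + \<alpha> / 2)" using u[of s t y] s t0 by (simp add: abs_minus_commute)
        moreover have "(s - t) * - X t y = (t - s) * X t y" by (simp add: algebra_simps)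
        ultimately show ?thesis using nn by (simp add: distrib_right)
      next
        case False
        \<comment> \<open>For s > t the expansion is anchored at the later time s; \<open>Xt\<close>
          moves its slope to t at the cost of a term of the same order.\<close>
        then have 1: "\<bar>u t y - u s y - (s - t) * X s y\<bar> \<le> c1 * K * \<bar>s - t\<bar> powr (1 + \<alpha> / 2)" using u[of t s y] s t0 by simp
        have "\<bar>(s - t) * X s y - (s - t) * X t y\<bar> = \<bar>s - t\<bar> * \<bar>X s y - X t y\<bar>" by (simp add: right_diff_distrib[symmetric] abs_mult)
        also have "\<dots> \<le> \<bar>s - t\<bar> * (c3 * K * \<bar>s - t\<bar> powr (\<alpha> / 2))" by (intro mult_left_mono Xt s t0) auto
        also have "\<dots> = c3 * K * \<bar>s - t\<bar> powr (1 + \<alpha> / 2)" using False by (simp add: powr_add)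
        finally have 2: "\<bar>(s - t) * X s y - (s - t) * X t y\<bar> \<le> \<dots>" .
        have "u s y - u t y - (s - t) * - X t y = - (u t y - u s y - (s - t) * X s y) - ((s - t) * X s y - (s - t) * X t y)" by simp
        then show ?thesis using 1 2 unfolding distrib_right by linarith
      qed
    qed (use alpha in auto)
    then show "norm (Q t y - Q r y) \<le> c2 * K * \<bar>t - r\<bar> powr (\<alpha> / 2) \<and>
         ((\<lambda>s. u s y) has_real_derivative - (LA t (Q t y) + f t y)) (at t within {0..T})"
      using Q2[OF t0 r0] by (simp add: X_def)
  qed
qed

text \<open>The path s \<mapsto> V s f t + P t s (u s) joins u t to the right-hand side of Duhamel's
  formula. Its increments are of order 1 + \<alpha>/2, so it is constant. Hypothesis
  \<open>eq\<close> is the differential equation in integrated form, anchored at the later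
  time.\<close>

lemma classical_mild:
  assumes T: "T \<le> T1" and fc: "continuous_on {0..T} f"
      and C: "\<And>t. t \<in> {0..T} \<Longrightarrow> C2 \<alpha> K (apply_bcontfun (u t)) (q t) (Q t)"
      and fK: "\<And>t. t \<in> {0..T} \<Longrightarrow> norm (f t) \<le> K" "\<And>t. t \<in> {0..T} \<Longrightarrow> lipschitz_by K (apply_bcontfun (f t))"
      and fH: "\<And>t r. t \<in> {0..T} \<Longrightarrow> r \<in> {0..T} \<Longrightarrow> norm (f t - f r) \<le> K * \<bar>t - r\<bar> powr (\<alpha> / 2)"
      and eq: "\<And>t r y. 0 \<le> t \<Longrightarrow> t \<le> r \<Longrightarrow> r \<le> T \<Longrightarrow>
          \<bar>u r y - u t y + (r - t) * (LA r (Q r y) + f r y)\<bar> \<le> K * (r - t) powr (1 + \<alpha> / 2)"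
  shows "mild T u f"
  unfolding mild_def
proof (intro allI impI)
  fix t r assume tr: "0 \<le> t" "t \<le> r" "r \<le> T"
  obtain c where c: "c \<ge> 0" "\<And>t s (f :: (real^'d) \<Rightarrow>\<^sub>C real) q Q K y. 0 \<le> t \<Longrightarrow> t \<le> s \<Longrightarrow> s \<le> T1 \<Longrightarrow> C2 \<alpha> K (apply_bcontfun f) q Q \<Longrightarrow>
    \<bar>P t s f y - f y - (s - t) * LA s (Q y)\<bar> \<le> c * K * (s - t) powr (1 + \<alpha> / 2)" using P_generator by blast
  show "u t = V r f t + P t r (u r)"
  proof (rule bcontfun_eqI)
    fix y
    define e where "e s = V s f t + P t s (u s)" for s
    have "e t y = e r y"
    proof (rule constant_of_holder[where g="\<lambda>s. e s y" and \<beta>="\<alpha> / 2" and c="((cS + 1) + c + 1) * K"])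
      fix s s' assume s: "t \<le> s" "s \<le> s'" "s' \<le> r"
      have V1: "V s' f t = V s f t + P t s (V s' f s)"
        by (rule V_semigroup[where L=K]) (use s tr T fc fK in \<open>auto intro: continuous_on_subset\<close>)
      \<comment> \<open>Everything is pulled under \<open>P t s\<close>, so the increment reduces to
        the local defect of the equation between s and s'.\<close>
      have d: "e s' - e s = P t s ((V s' f s - (s' - s) *\<^sub>R f s') + (P s s' (u s') + (s' - s) *\<^sub>R f s' - u s))"
        unfolding e_def V1 using s tr T by (simp add: evol_add evol_diff P_semi)
      have "norm ((V s' f s - (s' - s) *\<^sub>R f s') + (P s s' (u s') + (s' - s) *\<^sub>R f s' - u s)) \<le> (cS + 1) * K * (s' - s) powr (1 + \<alpha> / 2) + (c + 1) * K * (s' - s) powr (1 + \<alpha> / 2)"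
      proof (rule norm_triangle_mono)
        show "norm (V s' f s - (s' - s) *\<^sub>R f s') \<le> (cS + 1) * K * (s' - s) powr (1 + \<alpha> / 2)"
        proof (rule V_first_order)
          fix x assume "x \<in> {s..s'}"
          then show "norm (f x - f s') \<le> K * (s' - x) powr (\<alpha> / 2)" using fH[of x s'] s tr by (simp add: abs_minus_commute[of x])
        qed (use s tr T fc fK in \<open>auto intro: continuous_on_subset\<close>)
        show "norm (P s s' (u s') + (s' - s) *\<^sub>R f s' - u s) \<le> (c + 1) * K * (s' - s) powr (1 + \<alpha> / 2)"
        proof (rule norm_bound)
          fix z
          have 1: "\<bar>P s s' (u s') z - u s' z - (s' - s) * LA s' (Q s' z)\<bar> \<le> c * K * (s' - s) powr (1 + \<alpha> / 2)"
            by (rule c(2)[OF _ _ _ C]) (use s tr T in auto)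
          have 2: "\<bar>u s' z - u s z + (s' - s) * (LA s' (Q s' z) + f s' z)\<bar> \<le> K * (s' - s) powr (1 + \<alpha> / 2)"
            by (rule eq) (use s tr in auto)
          have "\<bar>P s s' (u s') z + (s' - s) * f s' z - u s z\<bar> \<le> c * K * (s' - s) powr (1 + \<alpha> / 2) + K * (s' - s) powr (1 + \<alpha> / 2)"
            using 1 2 unfolding distrib_left by linarith
          then show "norm ((P s s' (u s') + (s' - s) *\<^sub>R f s' - u s) z) \<le> (c + 1) * K * (s' - s) powr (1 + \<alpha> / 2)"
            by (simp add: distrib_right)
        qed
      qed
      also have "\<dots> = ((cS + 1) + c + 1) * K * (s' - s) powr (1 + \<alpha> / 2)" by (simp add: algebra_simps)
      finally have "norm (e s' - e s) \<le> ((cS + 1) + c + 1) * K * (s' - s) powr (1 + \<alpha> / 2)"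
        unfolding d by (rule order_trans[OF evol_norm])
      then show "\<bar>e s' y - e s y\<bar> \<le> ((cS + 1) + c + 1) * K * (s' - s) powr (1 + \<alpha> / 2)"
        using norm_bounded[of "e s' - e s" y] by simp
    qed (use alpha tr in auto)
    then show "u t y = (V r f t + P t r (u r)) y" by (simp add: e_def evol_refl V_def)
  qed
qed

end

lemma gradient_unique:
  fixes f :: "'a::real_inner \<Rightarrow> real"
  assumes "(f has_derivative (\<lambda>h. p \<bullet> h)) (at y)" "(f has_derivative (\<lambda>h. q \<bullet> h)) (at y)"
  shows "p = q"
proof -
  have "(\<lambda>h. p \<bullet> h) = (\<lambda>h. q \<bullet> h)" by (rule has_derivative_unique[OF assms])
  then have "p \<bullet> (p - q) = q \<bullet> (p - q)" by metis
  then have "(p - q) \<bullet> (p - q) = 0" by (simp add: inner_diff_left)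
  then show ?thesis by simp
qed

section \<open>Semilinear systems\<close>

text \<open>\<open>F\<close> stands for all terms that depend on the gradients of the whole system.
  The bounds are asked on balls of gradients, which accommodates quadratic growth.\<close>

locale semilinear = diffusion ks v w T1 K0 \<alpha>
  for ks :: "((real^'d) \<times> (real \<Rightarrow> real)) list" and v w :: "'d::finite \<Rightarrow> real^'d" and T1 K0 \<alpha> :: real +
  fixes I :: nat and F :: "nat \<Rightarrow> real \<Rightarrow> (nat \<Rightarrow> real^'d) \<Rightarrow> real"
  assumes F_lip: "\<And>\<rho>. \<exists>L\<ge>0. \<forall>i<I. \<forall>t\<in>{0..T1}. \<forall>s\<in>{0..T1}. \<forall>p p'. (\<forall>j<I. norm (p j) \<le> \<rho>) \<longrightarrow> (\<forall>j<I. norm (p' j) \<le> \<rho>) \<longrightarrow>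
      \<bar>F i t p\<bar> \<le> L \<and> \<bar>F i t p - F i s p'\<bar> \<le> L * (\<bar>t - s\<bar> powr (\<alpha> / 2) + (\<Sum>j<I. norm (p j - p' j)))"
begin

definition Flip :: "real \<Rightarrow> real \<Rightarrow> bool" where
  "Flip \<rho> L \<longleftrightarrow> 0 \<le> L \<and> (\<forall>i<I. \<forall>t\<in>{0..T1}. \<forall>s\<in>{0..T1}. \<forall>p p'. (\<forall>j<I. norm (p j) \<le> \<rho>) \<longrightarrow> (\<forall>j<I. norm (p' j) \<le> \<rho>) \<longrightarrow>
      \<bar>F i t p\<bar> \<le> L \<and> \<bar>F i t p - F i s p'\<bar> \<le> L * (\<bar>t - s\<bar> powr (\<alpha> / 2) + (\<Sum>j<I. norm (p j - p' j))))"

text \<open>The superposition operator: a family of gradient fields is mapped to a source term. The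
  value is meaningful for \<open>regular\<close> families, for which the composed function is
  continuous and bounded.\<close>

definition Fb :: "nat \<Rightarrow> real \<Rightarrow> (nat \<Rightarrow> real^'d \<Rightarrow> real^'d) \<Rightarrow> (real^'d) \<Rightarrow>\<^sub>C real" where
  "Fb i t p = Bcontfun (\<lambda>y. F i t (\<lambda>j. p j y))"

definition regular :: "real \<Rightarrow> (nat \<Rightarrow> real^'d \<Rightarrow> real^'d) \<Rightarrow> bool" where
  "regular \<rho> p \<longleftrightarrow> 0 \<le> \<rho> \<and> (\<forall>j<I. (\<forall>y. norm (p j y) \<le> \<rho>) \<and> lipschitz_by \<rho> (p j))"

lemma FlipD:
  assumes "Flip \<rho> L" "i < I" "t \<in> {0..T1}" "s \<in> {0..T1}" "\<forall>j<I. norm (p j) \<le> \<rho>" "\<forall>j<I. norm (p' j) \<le> \<rho>"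
  shows "\<bar>F i t p\<bar> \<le> L" "\<bar>F i t p - F i s p'\<bar> \<le> L * (\<bar>t - s\<bar> powr (\<alpha> / 2) + (\<Sum>j<I. norm (p j - p' j)))"
  using assms(1)[unfolded Flip_def, THEN conjunct2, THEN spec, THEN mp, OF assms(2), THEN bspec, OF assms(3),
      THEN bspec, OF assms(4), THEN spec, THEN spec, THEN mp, OF assms(5), THEN mp, OF assms(6)] by auto

lemma F_diff:
  assumes "Flip \<rho> L" "regular \<rho> p" "regular \<rho> p'" "i < I" "t \<in> {0..T1}" "s \<in> {0..T1}" "\<And>j. j < I \<Longrightarrow> norm (p j x - p' j y) \<le> e"
  shows "\<bar>F i t (\<lambda>j. p j x) - F i s (\<lambda>j. p' j y)\<bar> \<le> L * (\<bar>t - s\<bar> powr (\<alpha> / 2) + real I * e)"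
proof -
  have "\<bar>F i t (\<lambda>j. p j x) - F i s (\<lambda>j. p' j y)\<bar> \<le> L * (\<bar>t - s\<bar> powr (\<alpha> / 2) + (\<Sum>j<I. norm (p j x - p' j y)))"
    by (rule FlipD[OF assms(1,4,5,6)]) (use assms(2,3) in \<open>auto simp: regular_def\<close>)
  also have "\<dots> \<le> L * (\<bar>t - s\<bar> powr (\<alpha> / 2) + real I * e)"
  proof (intro mult_left_mono add_left_mono)
    have "(\<Sum>j<I. norm (p j x - p' j y)) \<le> (\<Sum>j<I. e)" using assms(7) by (intro sum_mono) auto
    then show "(\<Sum>j<I. norm (p j x - p' j y)) \<le> real I * e" by simp
  qed (use assms(1) in \<open>auto simp: Flip_def\<close>)
  finally show ?thesis .
qed

lemma Fb_props:
  assumes "Flip \<rho> L" "regular \<rho> p" "i < I" "t \<in> {0..T1}"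
  shows Fb_apply: "Fb i t p y = F i t (\<lambda>j. p j y)"
    and Fb_norm: "norm (Fb i t p) \<le> L"
    and Fb_lip: "lipschitz_by (L * (real I * \<rho>)) (apply_bcontfun (Fb i t p))"
proof -
  have b: "norm (F i t (\<lambda>j. p j y)) \<le> L" for y 
    using FlipD(1)[OF assms(1,3,4,4), of "\<lambda>j. p j y" "\<lambda>j. p j y"] assms(2) by (simp add: regular_def)
  have d: "\<bar>F i t (\<lambda>j. p j x) - F i t (\<lambda>j. p j y)\<bar> \<le> (L * (real I * \<rho>)) * norm (x - y)" for x y
  proof -
    have "\<bar>F i t (\<lambda>j. p j x) - F i t (\<lambda>j. p j y)\<bar> \<le> L * (\<bar>t - t\<bar> powr (\<alpha> / 2) + real I * (\<rho> * norm (x - y)))"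
      by (rule F_diff[OF assms(1,2,2,3,4,4)]) (use assms(2) in \<open>auto simp: regular_def intro!: lipschitz_byD2\<close>)
    then show ?thesis by (simp add: mult_ac)
  qed
  have c: "continuous_on UNIV (\<lambda>y. F i t (\<lambda>j. p j y))"
    by (rule holder_continuous_on[where a=1]) (use d in \<open>auto simp: dist_real_def dist_norm\<close>)
  have e: "apply_bcontfun (Fb i t p) = (\<lambda>y. F i t (\<lambda>j. p j y))" unfolding Fb_def by (rule apply_Bcontfun[OF c b])
  show "Fb i t p y = F i t (\<lambda>j. p j y)" by (simp add: e)
  show "norm (Fb i t p) \<le> L" by (rule norm_bound) (use b in \<open>simp add: e\<close>)
  show "lipschitz_by (L * (real I * \<rho>)) (apply_bcontfun (Fb i t p))" unfolding lipschitz_by_def e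
    using d[of "x + h" x for x h] by (auto simp: real_norm_def)
qed

lemma Fb_diff:
  assumes "Flip \<rho> L" "regular \<rho> p" "regular \<rho> p'" "i < I" "t \<in> {0..T1}" "s \<in> {0..T1}"
    "\<And>j y. j < I \<Longrightarrow> norm (p j y - p' j y) \<le> e"
  shows "norm (Fb i t p - Fb i s p') \<le> L * (\<bar>t - s\<bar> powr (\<alpha> / 2) + real I * e)"
proof (rule norm_bound)
  fix y
  show "norm ((Fb i t p - Fb i s p') y) \<le> L * (\<bar>t - s\<bar> powr (\<alpha> / 2) + real I * e)"
    using F_diff[OF assms(1-6), of y y e] assms(7) by (simp add: Fb_apply[OF assms(1,2,4,5)] Fb_apply[OF assms(1,3,4,6)])
qed

section \<open>Comparison of two solutions\<close>

lemma grd_diff: "0 \<le> t \<Longrightarrow> t < s \<Longrightarrow> s \<le> T1 \<Longrightarrow> grd t s (f - g) y = grd t s f y - grd t s g y"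
  unfolding grd_def by (simp add: R_diff scaleR_diff_left sum_subtractf)

text \<open>The Lipschitz bounds of f and g secure integrability, while the estimate sees only their
  sup distance; this makes the map from gradients to gradients a contraction in the sup
  norm.\<close>

lemma gV_diff_norm:
  assumes "0 \<le> t" "t \<le> T" "T \<le> T1" "continuous_on {t..T} f" "continuous_on {t..T} g"
    and f: "\<And>s. s \<in> {t..T} \<Longrightarrow> norm (f s) \<le> L" "\<And>s. s \<in> {t..T} \<Longrightarrow> lipschitz_by L (apply_bcontfun (f s))"
    and g: "\<And>s. s \<in> {t..T} \<Longrightarrow> norm (g s) \<le> L" "\<And>s. s \<in> {t..T} \<Longrightarrow> lipschitz_by L (apply_bcontfun (g s))"
    and M: "\<And>s. s \<in> {t..T} \<Longrightarrow> norm (f s - g s) \<le> M"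
  shows "norm (gV T f t y - gV T g t y) \<le> 4 * cW * M * sqrt (T - t)"
proof -
  have "gV T (\<lambda>s. f s - g s) t y = integral {t<..<T} (\<lambda>s. grd t s (f s) y - grd t s (g s) y)"
    unfolding gV_def by (rule integral_cong) (use assms(1-3) in \<open>auto simp: grd_diff\<close>)
  also have "\<dots> = gV T f t y - gV T g t y" unfolding gV_def
    by (intro integral_diff grd_integrable[OF assms(1-4) f] grd_integrable[OF assms(1-3,5) g])
  finally have e: "gV T f t y - gV T g t y = gV T (\<lambda>s. f s - g s) t y" by simp
  show ?thesis unfolding e
  proof (rule gV_norm[OF assms(1-3), where L="2 * L"])
    show "continuous_on {t..T} (\<lambda>s. f s - g s)" by (intro continuous_intros assms)
    fix s assume s: "s \<in> {t..T}"
    show "norm (f s - g s) \<le> 2 * L" using norm_triangle_ineq4[of "f s" "g s"] f(1)[OF s] g(1)[OF s] by linarith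
    show "lipschitz_by (2 * L) (apply_bcontfun (f s - g s))" unfolding lipschitz_by_def
    proof clarify
      fix x h
      have "norm ((f s (x + h) - f s x) - (g s (x + h) - g s x)) \<le> L * norm h + L * norm h"
        by (rule order_trans[OF norm_triangle_ineq4 add_mono[OF lipschitz_byD[OF f(2)[OF s]] lipschitz_byD[OF g(2)[OF s]]]])
      then show "norm ((f s - g s) (x + h) - (f s - g s) x) \<le> 2 * L * norm h" by (simp add: algebra_simps)
    qed
  qed (use M in auto)
qed

text \<open>The class in which uniqueness is proved. The equation appears as a bound on time
  increments, without a time derivative, and the square root modulus of the gradient is what makes
  the source Hoelder continuous in time.\<close>

definition solution_at :: "real \<Rightarrow> (nat \<Rightarrow> real \<Rightarrow> real^'d \<Rightarrow> real) \<Rightarrow> (nat \<Rightarrow> real \<Rightarrow> real^'d \<Rightarrow> real^'d) \<Rightarrow> (nat \<Rightarrow> real \<Rightarrow> real^'d \<Rightarrow> real^'d^'d) \<Rightarrow> nat \<Rightarrow> real \<Rightarrow> bool" where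
  "solution_at T u q Q i K \<longleftrightarrow>
     (\<forall>t\<in>{0..T}. C2 \<alpha> K (u i t) (q i t) (Q i t)) \<and>
     (\<forall>t\<in>{0..T}. \<forall>r\<in>{0..T}. \<forall>y. norm (q i t y - q i r y) \<le> K * sqrt \<bar>t - r\<bar>) \<and>
     (\<forall>t r y. 0 \<le> t \<longrightarrow> t \<le> r \<longrightarrow> r \<le> T \<longrightarrow>
        \<bar>u i r y - u i t y + (r - t) * (LA r (Q i r y) + F i r (\<lambda>j. q j r y))\<bar> \<le> K * (r - t) powr (1 + \<alpha> / 2))"

definition solution :: "real \<Rightarrow> real \<Rightarrow> (nat \<Rightarrow> real \<Rightarrow> real^'d \<Rightarrow> real) \<Rightarrow> (nat \<Rightarrow> real \<Rightarrow> real^'d \<Rightarrow> real^'d) \<Rightarrow> (nat \<Rightarrow> real \<Rightarrow> real^'d \<Rightarrow> real^'d^'d) \<Rightarrow> bool" where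
  "solution T K u q Q \<longleftrightarrow> (\<forall>i<I. solution_at T u q Q i K)"

lemma solution_at_mono:
  assumes s: "solution_at T u q Q i K" and K: "K \<le> K'"
  shows "solution_at T u q Q i K'"
  unfolding solution_at_def
proof (intro allI impI conjI ballI)
  show "C2 \<alpha> K' (u i t) (q i t) (Q i t)" if "t \<in> {0..T}" for t using s that K C2_mono unfolding solution_at_def by blast
  show "norm (q i t y - q i r y) \<le> K' * sqrt \<bar>t - r\<bar>" if "t \<in> {0..T}" "r \<in> {0..T}" for t r y
  proof -
    have "norm (q i t y - q i r y) \<le> K * sqrt \<bar>t - r\<bar>" using s that unfolding solution_at_def by blast
    also have "\<dots> \<le> K' * sqrt \<bar>t - r\<bar>" using K by (intro mult_right_mono) auto
    finally show ?thesis .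
  qed
  show "\<bar>u i r y - u i t y + (r - t) * (LA r (Q i r y) + F i r (\<lambda>j. q j r y))\<bar> \<le> K' * (r - t) powr (1 + \<alpha> / 2)"
    if "0 \<le> t" "t \<le> r" "r \<le> T" for t r y
  proof -
    have "\<bar>u i r y - u i t y + (r - t) * (LA r (Q i r y) + F i r (\<lambda>j. q j r y))\<bar> \<le> K * (r - t) powr (1 + \<alpha> / 2)"
      using s that unfolding solution_at_def by blast
    also have "\<dots> \<le> K' * (r - t) powr (1 + \<alpha> / 2)" using K by (intro mult_right_mono) auto
    finally show ?thesis .
  qed
qed

lemma solution_mono: "solution T K u q Q \<Longrightarrow> K \<le> K' \<Longrightarrow> solution T K' u q Q"
  unfolding solution_def using solution_at_mono by blast

lemma sqrt_le_powr: "0 \<le> x \<Longrightarrow> x \<le> 1 \<Longrightarrow> sqrt x \<le> x powr (\<alpha> / 2)"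
proof (cases "x = 0")
  case False
  assume "0 \<le> x" "x \<le> 1"
  then have "x powr (1/2) \<le> x powr (\<alpha> / 2)" using False alpha by (intro powr_mono') auto
  then show ?thesis using \<open>0 \<le> x\<close> by (simp add: powr_half_sqrt)
qed simp

text \<open>On times up to 1 the square root modulus of the gradients is at most a modulus of
  exponent \<alpha>/2; the source inherits it and \<open>classical_mild\<close> applies. The bounds
  are exported for the comparison of two solutions.\<close>

lemma solution_mild:
  assumes T: "0 \<le> T" "T \<le> T1" and sol: "solution T K u q Q" and K: "0 \<le> K"
  obtains L M where "Flip K L" "0 \<le> M" "\<And>t. t \<in> {0..T} \<Longrightarrow> regular K (\<lambda>j. q j t)"
    "\<And>i. i < I \<Longrightarrow> mild T (\<lambda>t. Bcontfun (u i t)) (\<lambda>t. Fb i t (\<lambda>j. q j t))"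
    "\<And>i. i < I \<Longrightarrow> continuous_on {0..T} (\<lambda>t. Fb i t (\<lambda>j. q j t))"
    "\<And>i t. i < I \<Longrightarrow> t \<in> {0..T} \<Longrightarrow> norm (Fb i t (\<lambda>j. q j t)) \<le> M"
    "\<And>i t. i < I \<Longrightarrow> t \<in> {0..T} \<Longrightarrow> lipschitz_by M (apply_bcontfun (Fb i t (\<lambda>j. q j t)))"
proof -
  obtain L where L: "Flip K L" using F_lip[of K] unfolding Flip_def by blast
  then have L0: "0 \<le> L" by (simp add: Flip_def)
  define M where "M = K + L + L * (real I * K)"
  have M: "K \<le> M" "L \<le> M" "L * (real I * K) \<le> M" "0 \<le> M" "L * (1 + real I * K) \<le> M"
    using L0 K by (auto simp: M_def algebra_simps)
  have C: "C2 \<alpha> K (u i t) (q i t) (Q i t)" if "i < I" "t \<in> {0..T}" for i t using sol that unfolding solution_def solution_at_def by blast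
  have reg: "regular K (\<lambda>j. q j t)" if "t \<in> {0..T}" for t
    unfolding regular_def using K C2_bounds(2)[OF C[OF _ that]] C2_lip(2)[OF C[OF _ that] alpha(1)] by blast
  have TT: "t \<in> {0..T1}" if "t \<in> {0..T}" for t using that T by auto
  have n: "norm (Fb i t (\<lambda>j. q j t)) \<le> M" if "i < I" "t \<in> {0..T}" for i t
    using Fb_norm[OF L reg[OF that(2)] that(1) TT[OF that(2)]] M by linarith
  have l: "lipschitz_by M (apply_bcontfun (Fb i t (\<lambda>j. q j t)))" if "i < I" "t \<in> {0..T}" for i t
    using Fb_lip[OF L reg[OF that(2)] that(1) TT[OF that(2)]] M lipschitz_by_mono by blast
  have h: "norm (Fb i t (\<lambda>j. q j t) - Fb i r (\<lambda>j. q j r)) \<le> M * \<bar>t - r\<bar> powr (\<alpha> / 2)" if "i < I" "t \<in> {0..T}" "r \<in> {0..T}" for i t r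
  proof -
    have "norm (Fb i t (\<lambda>j. q j t) - Fb i r (\<lambda>j. q j r)) \<le> L * (\<bar>t - r\<bar> powr (\<alpha> / 2) + real I * (K * \<bar>t - r\<bar> powr (\<alpha> / 2)))"
    proof (rule Fb_diff[OF L reg[OF that(2)] reg[OF that(3)] that(1) TT[OF that(2)] TT[OF that(3)]])
      fix j y assume "j < I"
      then have "norm (q j t y - q j r y) \<le> K * sqrt \<bar>t - r\<bar>" using sol that unfolding solution_def solution_at_def by blast
      also have "\<dots> \<le> K * \<bar>t - r\<bar> powr (\<alpha> / 2)" using K that T T1 by (intro mult_left_mono sqrt_le_powr) auto
      finally show "norm (q j t y - q j r y) \<le> K * \<bar>t - r\<bar> powr (\<alpha> / 2)" .
    qed
    also have "\<dots> = (L * (1 + real I * K)) * \<bar>t - r\<bar> powr (\<alpha> / 2)" by (simp add: algebra_simps)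
    also have "\<dots> \<le> M * \<bar>t - r\<bar> powr (\<alpha> / 2)" using M by (intro mult_right_mono) auto
    finally show ?thesis .
  qed
  have fc: "continuous_on {0..T} (\<lambda>t. Fb i t (\<lambda>j. q j t))" if "i < I" for i
    by (rule holder_continuous_on[where K=M and a="\<alpha> / 2"]) (use h[OF that] alpha in \<open>auto simp: dist_norm dist_real_def\<close>)
  have mild: "mild T (\<lambda>t. Bcontfun (u i t)) (\<lambda>t. Fb i t (\<lambda>j. q j t))" if i: "i < I" for i
  proof (rule classical_mild[where K=M and q="q i" and Q="Q i"])
    fix t assume t: "t \<in> {0..T}"
    show "C2 \<alpha> M (apply_bcontfun (Bcontfun (u i t))) (q i t) (Q i t)"
      unfolding C2_bc(1)[OF C[OF i t] alpha(1)] by (rule C2_mono[OF C[OF i t] M(1)])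
  next
    fix t r y assume tr: "0 \<le> t" "t \<le> r" "r \<le> T"
    then have t: "t \<in> {0..T}" "r \<in> {0..T}" by auto
    have "\<bar>u i r y - u i t y + (r - t) * (LA r (Q i r y) + F i r (\<lambda>j. q j r y))\<bar> \<le> K * (r - t) powr (1 + \<alpha> / 2)"
      using sol i tr unfolding solution_def solution_at_def by blast
    also have "\<dots> \<le> M * (r - t) powr (1 + \<alpha> / 2)" using M by (intro mult_right_mono) auto
    finally show "\<bar>Bcontfun (u i r) y - Bcontfun (u i t) y + (r - t) * (LA r (Q i r y) + Fb i r (\<lambda>j. q j r) y)\<bar> \<le> M * (r - t) powr (1 + \<alpha> / 2)"
      unfolding C2_bc(1)[OF C[OF i t(1)] alpha(1)] C2_bc(1)[OF C[OF i t(2)] alpha(1)] Fb_apply[OF L reg[OF t(2)] i TT[OF t(2)]] .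
  qed (use T n[OF i] l[OF i] h[OF i] fc[OF i] in auto)
  show ?thesis by (rule that[OF L M(4) reg mild fc n l])
qed

text \<open>The comparison is made between the gradients, since the source depends on nothing else.
  Once these agree, the sources agree and Duhamel's formula identifies the solutions.\<close>

lemma solution_unique:
  assumes T: "0 \<le> T" "T \<le> T1" and s1: "solution T K1 u q Q" and s2: "solution T K2 u' q' Q'"
    and fin: "\<And>i. i < I \<Longrightarrow> u i T = u' i T" and "i < I" "t \<in> {0..T}"
  shows "u i t = u' i t"
proof -
  have K1: "0 \<le> K1" using s1 \<open>i < I\<close> \<open>t \<in> {0..T}\<close> C2_nonneg unfolding solution_def solution_at_def by blast
  define K where "K = max K1 K2"
  have K: "0 \<le> K" using K1 by (simp add: K_def)
  have sol: "solution T K u q Q" "solution T K u' q' Q'" using solution_mono[OF s1, of K] solution_mono[OF s2, of K] by (auto simp: K_def)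
  obtain L M where L: "Flip K L" and M0: "0 \<le> M" and reg: "\<And>t. t \<in> {0..T} \<Longrightarrow> regular K (\<lambda>j. q j t)" and
    md: "\<And>i. i < I \<Longrightarrow> mild T (\<lambda>t. Bcontfun (u i t)) (\<lambda>t. Fb i t (\<lambda>j. q j t))" and
    fc: "\<And>i. i < I \<Longrightarrow> continuous_on {0..T} (\<lambda>t. Fb i t (\<lambda>j. q j t))" and
    fn: "\<And>i t. i < I \<Longrightarrow> t \<in> {0..T} \<Longrightarrow> norm (Fb i t (\<lambda>j. q j t)) \<le> M" and
    fl: "\<And>i t. i < I \<Longrightarrow> t \<in> {0..T} \<Longrightarrow> lipschitz_by M (apply_bcontfun (Fb i t (\<lambda>j. q j t)))"
    by (rule solution_mild[OF T sol(1) K], rule that; assumption)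
  obtain L' M' where M0': "0 \<le> M'" and reg': "\<And>t. t \<in> {0..T} \<Longrightarrow> regular K (\<lambda>j. q' j t)" and
    md': "\<And>i. i < I \<Longrightarrow> mild T (\<lambda>t. Bcontfun (u' i t)) (\<lambda>t. Fb i t (\<lambda>j. q' j t))" and
    fc': "\<And>i. i < I \<Longrightarrow> continuous_on {0..T} (\<lambda>t. Fb i t (\<lambda>j. q' j t))" and
    fn': "\<And>i t. i < I \<Longrightarrow> t \<in> {0..T} \<Longrightarrow> norm (Fb i t (\<lambda>j. q' j t)) \<le> M'" and
    fl': "\<And>i t. i < I \<Longrightarrow> t \<in> {0..T} \<Longrightarrow> lipschitz_by M' (apply_bcontfun (Fb i t (\<lambda>j. q' j t)))"
    by (rule solution_mild[OF T sol(2) K], rule that; assumption)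
  have L0: "0 \<le> L" using L by (simp add: Flip_def)
  have C: "C2 \<alpha> K (u i t) (q i t) (Q i t)" "C2 \<alpha> K (u' i t) (q' i t) (Q' i t)" if "i < I" "t \<in> {0..T}" for i t
    using sol that unfolding solution_def solution_at_def by blast+
  note B = C2_bc(1)[OF C(1) alpha(1)] C2_bc(1)[OF C(2) alpha(1)]
  \<comment> \<open>\<open>c\<close> bounds the Lipschitz factor 4 cW L I of the gradient map from
    above and is positive because of the 1; on an interval of length \<eta> the factor times sqrt
    \<eta> is at most 1/2.\<close>
  define c where "c = 4 * cW * (L * real I) + 1"
  have c: "c > 0" using c_nonneg L0 by (auto simp: c_def intro!: add_nonneg_pos)
  define \<eta> where "\<eta> = (1 / (2 * c))\<^sup>2"
  have \<eta>: "\<eta> > 0" "sqrt \<eta> = 1 / (2 * c)" using c by (auto simp: \<eta>_def)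
  have step: "u i t = u' i t" if e: "\<And>i. i < I \<Longrightarrow> u i T' = u' i T'" and i: "i < I" and t: "0 \<le> t" "t \<le> T'" "T' \<le> T" "T' - t \<le> \<eta>" for t T' i
  proof -
    define f where "f i t = Fb i t (\<lambda>j. q j t)" for i t
    define f' where "f' i t = Fb i t (\<lambda>j. q' j t)" for i t
    define MM where "MM = max M M'"
    have sub: "s \<in> {0..T}" if "s \<in> {t..T'}" for s using that t by auto
    have repr: "Bcontfun (u i s) = V T' (f i) s + P s T' (Bcontfun (u i T'))" "Bcontfun (u' i s) = V T' (f' i) s + P s T' (Bcontfun (u' i T'))"
      if "i < I" "s \<in> {t..T'}" for i s
      using md[OF that(1)] md'[OF that(1)] that(2) t unfolding mild_def f_def f'_def by auto
    have fcs: "continuous_on {s..T'} (f i)" "continuous_on {s..T'} (f' i)" if "i < I" "s \<in> {t..T'}" for i s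
      using continuous_on_subset[OF fc[OF that(1)], of "{s..T'}"] continuous_on_subset[OF fc'[OF that(1)], of "{s..T'}"] that t
      unfolding f_def f'_def by auto
    have fb: "norm (f i s) \<le> MM" "norm (f' i s) \<le> MM" "lipschitz_by MM (apply_bcontfun (f i s))" "lipschitz_by MM (apply_bcontfun (f' i s))"
      if "i < I" "s \<in> {t..T'}" for i s
      using fn[OF that(1) sub[OF that(2)]] fn'[OF that(1) sub[OF that(2)]] lipschitz_by_mono[OF fl[OF that(1) sub[OF that(2)]], of MM] lipschitz_by_mono[OF fl'[OF that(1) sub[OF that(2)]], of MM]
      unfolding f_def f'_def MM_def by auto
    \<comment> \<open>The terminal terms cancel, so both sides are the gradient of u - u' at the
      same point.\<close>
    have qe: "q i s y - q' i s y = gV T' (f i) s y - gV T' (f' i) s y" if i: "i < I" and s: "s \<in> {t..T'}" for i s y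
    proof (rule gradient_unique)
      have s': "0 \<le> s" "s \<le> T'" "T' \<le> T1" using s t T by auto
      have "u i s z - u' i s z = V T' (f i) s z - V T' (f' i) s z" for z
        using repr[OF i s] e[OF i] B[OF i sub[OF s]] by (metis add_diff_cancel_right plus_bcontfun.rep_eq)
      then have ee: "(\<lambda>z. u i s z - u' i s z) = (\<lambda>z. V T' (f i) s z - V T' (f' i) s z)" by auto
      show "((\<lambda>z. u i s z - u' i s z) has_derivative (\<lambda>h. (q i s y - q' i s y) \<bullet> h)) (at y)"
        unfolding inner_diff_left by (intro has_derivative_diff C2_deriv(1)[OF C(1) alpha(1)] C2_deriv(1)[OF C(2) alpha(1)] i sub s)
      have c1: "C2 \<alpha> (cD * MM) (apply_bcontfun (V T' (f i) s)) (gV T' (f i) s) (hV T' (f i) s)"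
        by (rule V_C2[OF s' fcs(1)[OF i s]]) (use fb[OF i] s in auto)
      have c2: "C2 \<alpha> (cD * MM) (apply_bcontfun (V T' (f' i) s)) (gV T' (f' i) s) (hV T' (f' i) s)"
        by (rule V_C2[OF s' fcs(2)[OF i s]]) (use fb[OF i] s in auto)
      show "((\<lambda>z. u i s z - u' i s z) has_derivative (\<lambda>h. (gV T' (f i) s y - gV T' (f' i) s y) \<bullet> h)) (at y)"
        unfolding ee inner_diff_left by (intro has_derivative_diff C2_deriv(1)[OF c1 alpha(1)] C2_deriv(1)[OF c2 alpha(1)])
    qed
    have fd: "norm (f i s - f' i s) \<le> L * (real I * e)" if "i < I" "s \<in> {t..T'}" "\<And>j y. j < I \<Longrightarrow> norm (q j s y - q' j s y) \<le> e" for i s e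
      using Fb_diff[OF L reg[OF sub[OF that(2)]] reg'[OF sub[OF that(2)]] that(1), of s s e] that sub[OF that(2)] T by (auto simp: f_def f'_def)
    \<comment> \<open>The iteration starts from the a priori distance 2 K of the gradients, and each
      use of \<open>gV_diff_norm\<close> halves it.\<close>
    have bound: "\<forall>i<I. \<forall>s\<in>{t..T'}. \<forall>y. norm (q i s y - q' i s y) \<le> 2 * K * (1/2) ^ n" for n
    proof (induction n)
      case 0
      show ?case
      proof (intro allI impI ballI)
        fix i s y assume i: "i < I" and s: "s \<in> {t..T'}"
        show "norm (q i s y - q' i s y) \<le> 2 * K * (1/2) ^ 0"
          using norm_triangle_ineq4[of "q i s y" "q' i s y"] C2_bounds(2)[OF C(1)[OF i sub[OF s]], of y] C2_bounds(2)[OF C(2)[OF i sub[OF s]], of y] by simp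
      qed
    next
      case (Suc n)
      show ?case
      proof (intro allI impI ballI)
        fix i s y assume i: "i < I" and s: "s \<in> {t..T'}"
        have s': "0 \<le> s" "s \<le> T'" "T' \<le> T1" using s t T by auto
        let ?e = "2 * K * (1/2) ^ n"
        have "norm (gV T' (f i) s y - gV T' (f' i) s y) \<le> 4 * cW * (L * (real I * ?e)) * sqrt (T' - s)"
        proof (rule gV_diff_norm[OF s' fcs[OF i s], where L=MM])
          fix r assume "r \<in> {s..T'}"
          then have r: "r \<in> {t..T'}" using s by auto
          show "norm (f i r) \<le> MM" "lipschitz_by MM (apply_bcontfun (f i r))" "norm (f' i r) \<le> MM" "lipschitz_by MM (apply_bcontfun (f' i r))" using fb[OF i r] by auto
          show "norm (f i r - f' i r) \<le> L * (real I * ?e)" by (rule fd[OF i r]) (use Suc r in blast)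
        qed
        also have "\<dots> \<le> 4 * cW * (L * (real I * ?e)) * sqrt \<eta>"
          using s t c_nonneg L0 K by (intro mult_left_mono real_sqrt_le_mono) auto
        also have "\<dots> = (4 * cW * (L * real I)) / (2 * c) * ?e" unfolding \<eta>(2) by simp
        also have "\<dots> \<le> 1/2 * ?e"
        proof (rule mult_right_mono)
          have "(4 * cW * (L * real I)) / (2 * c) \<le> c / (2 * c)" using c by (intro divide_right_mono) (auto simp: c_def)
          then show "(4 * cW * (L * real I)) / (2 * c) \<le> 1/2" using c by simp
        qed (use K in auto)
        finally show "norm (q i s y - q' i s y) \<le> 2 * K * (1/2) ^ Suc n" unfolding qe[OF i s] by simp
      qed
    qed
    have qq: "q i s y = q' i s y" if "i < I" "s \<in> {t..T'}" for i s y
    proof -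
      have "(\<lambda>n. 2 * K * (1/2) ^ n) \<longlonglongrightarrow> 2 * K * 0" by (intro tendsto_intros LIMSEQ_power_zero) auto
      then have "norm (q i s y - q' i s y) \<le> 2 * K * 0"
        by (rule LIMSEQ_le_const) (use bound that in blast)
      then show ?thesis by simp
    qed
    have "f i s = f' i s" if "s \<in> {t..T'}" for s
      using fd[OF i that, of 0] qq[OF _ that] by simp
    then have "V T' (f i) t = V T' (f' i) t" unfolding V_def by (intro integral_cong) auto
    then have "Bcontfun (u i t) = Bcontfun (u' i t)" using repr[OF i, of t] e[OF i] t by simp
    then have "apply_bcontfun (Bcontfun (u i t)) = apply_bcontfun (Bcontfun (u' i t))" by simp
    moreover have "t \<in> {0..T}" using t by auto
    ultimately show "u i t = u' i t" unfolding B(1)[OF i \<open>t \<in> {0..T}\<close>] B(2)[OF i \<open>t \<in> {0..T}\<close>] by simp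
  qed
  \<comment> \<open>\<open>step\<close> is applied with final time T - n \<eta>, where agreement is
    known from the previous stage.\<close>
  have all: "\<forall>i<I. \<forall>t\<in>{0..T}. T - real n * \<eta> \<le> t \<longrightarrow> u i t = u' i t" for n
  proof (induction n)
    case 0 show ?case using fin by auto
  next
    case (Suc n)
    show ?case
    proof (intro allI impI ballI)
      fix i t assume i: "i < I" and t: "t \<in> {0..T}" "T - real (Suc n) * \<eta> \<le> t"
      show "u i t = u' i t"
      proof (cases "T - real n * \<eta> \<le> t")
        case True then show ?thesis using Suc i t by blast
      next
        case False
        show ?thesis
        proof (rule step[OF _ i, of "T - real n * \<eta>"])
          show "u i (T - real n * \<eta>) = u' i (T - real n * \<eta>)" if "i < I" for i
            using Suc[rule_format, OF that, of "T - real n * \<eta>"] False t \<eta>(1) by auto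
        qed (use False t \<eta>(1) in \<open>auto simp: algebra_simps\<close>)
      qed
    qed
  qed
  obtain n :: nat where n: "T < real n * \<eta>" using reals_Archimedean3[OF \<eta>(1)] by blast
  show ?thesis by (rule all[of n, rule_format, OF assms(6,7)]) (use n assms(7) in auto)
qed

end

section \<open>Existence: the fixed point and its regularity\<close>

context semilinear
begin

context
  fixes G :: real and gb :: "nat \<Rightarrow> (real^'d) \<Rightarrow>\<^sub>C real" and Dg :: "nat \<Rightarrow> (real^'d) \<Rightarrow>\<^sub>C (real^'d)" and Hg :: "nat \<Rightarrow> (real^'d) \<Rightarrow>\<^sub>C (real^'d^'d)"
  assumes gC2: "\<And>i. i < I \<Longrightarrow> C2 \<alpha> G (apply_bcontfun (gb i)) (apply_bcontfun (Dg i)) (apply_bcontfun (Hg i))" and G: "0 \<le> G"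
begin

definition uS :: "real \<Rightarrow> (nat \<Rightarrow> real \<Rightarrow> (real^'d) \<Rightarrow>\<^sub>C real) \<Rightarrow> nat \<Rightarrow> real \<Rightarrow> (real^'d) \<Rightarrow>\<^sub>C real" where
  "uS T f i t = V T (f i) t + P t T (gb i)"
definition qS :: "real \<Rightarrow> (nat \<Rightarrow> real \<Rightarrow> (real^'d) \<Rightarrow>\<^sub>C real) \<Rightarrow> nat \<Rightarrow> real \<Rightarrow> real^'d \<Rightarrow> real^'d" where
  "qS T f i t y = gV T (f i) t y + P t T (Dg i) y"
definition QS :: "real \<Rightarrow> (nat \<Rightarrow> real \<Rightarrow> (real^'d) \<Rightarrow>\<^sub>C real) \<Rightarrow> nat \<Rightarrow> real \<Rightarrow> real^'d \<Rightarrow> real^'d^'d" where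
  "QS T f i t y = hV T (f i) t y + P t T (Hg i) y"

definition source :: "real \<Rightarrow> real \<Rightarrow> (nat \<Rightarrow> real \<Rightarrow> (real^'d) \<Rightarrow>\<^sub>C real) \<Rightarrow> bool" where
  "source T M f \<longleftrightarrow> (\<forall>i<I. continuous_on {0..T} (f i) \<and> (\<forall>t\<in>{0..T}. norm (f i t) \<le> M \<and> lipschitz_by M (apply_bcontfun (f i t))))"

lemma sourceD:
  assumes "source T M f" "i < I" "0 \<le> t"
  shows "continuous_on {t..T} (f i)" "\<And>s. s \<in> {t..T} \<Longrightarrow> norm (f i s) \<le> M" "\<And>s. s \<in> {t..T} \<Longrightarrow> lipschitz_by M (apply_bcontfun (f i s))"
proof -
  have "continuous_on {0..T} (f i)" using assms unfolding source_def by blast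
  then show "continuous_on {t..T} (f i)" by (rule continuous_on_subset) (use assms in auto)
  show "norm (f i s) \<le> M" "lipschitz_by M (apply_bcontfun (f i s))" if "s \<in> {t..T}" for s
    using assms that unfolding source_def by auto
qed

context
  fixes T M f
  assumes T: "0 < T" "T \<le> T1" and src: "source T M f"
begin

lemma uS_C2: "i < I \<Longrightarrow> t \<in> {0..T} \<Longrightarrow> C2 \<alpha> (cD * M + G) (apply_bcontfun (uS T f i t)) (qS T f i t) (QS T f i t)"
proof -
  assume i: "i < I" and t: "t \<in> {0..T}"
  have "C2 \<alpha> (cD * M) (apply_bcontfun (V T (f i) t)) (gV T (f i) t) (hV T (f i) t)"
    by (rule V_C2) (use T t sourceD[OF src i] in auto)
  from C2_add[OF this C2_evol[OF gC2[OF i], of ks t T]]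
  show ?thesis by (simp add: uS_def[abs_def] qS_def[abs_def] QS_def[abs_def])
qed

lemma qS_norm: "i < I \<Longrightarrow> t \<in> {0..T} \<Longrightarrow> norm (qS T f i t y) \<le> 4 * cW * M * sqrt T + G"
proof -
  assume i: "i < I" and t: "t \<in> {0..T}"
  have "norm (gV T (f i) t y) \<le> 4 * cW * M * sqrt (T - t)"
    by (rule gV_norm[where L=M]) (use T t sourceD[OF src i] in auto)
  also have "\<dots> \<le> 4 * cW * M * sqrt T"
  proof (intro mult_left_mono)
    have "0 \<le> M" by (rule order_trans[OF norm_ge_zero sourceD(2)[OF src i order_refl t]])
    then show "0 \<le> 4 * cW * M" using c_nonneg by auto
  qed (use t in auto)
  finally have 1: "norm (gV T (f i) t y) \<le> 4 * cW * M * sqrt T" .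
  have 2: "norm (P t T (Dg i) y) \<le> G" by (rule evol_bound) (rule C2_bounds(2)[OF gC2[OF i]])
  show ?thesis unfolding qS_def by (rule norm_triangle_mono[OF 1 2])
qed

lemma qS_lip: "i < I \<Longrightarrow> t \<in> {0..T} \<Longrightarrow> lipschitz_by (4 * cP * cV * cW * M * sqrt T + G) (qS T f i t)"
proof -
  assume i: "i < I" and t: "t \<in> {0..T}"
  have M: "0 \<le> M" by (rule order_trans[OF norm_ge_zero sourceD(2)[OF src i order_refl t]])
  have "lipschitz_by (4 * cP * cV * cW * M * sqrt (T - t)) (gV T (f i) t)"
    by (rule gV_lip) (use T t sourceD[OF src i] in auto)
  then have 1: "lipschitz_by (4 * cP * cV * cW * M * sqrt T) (gV T (f i) t)"
    by (rule lipschitz_by_mono) (use t M c_nonneg cP_pos in \<open>auto intro!: mult_left_mono\<close>)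
  have 2: "lipschitz_by G (apply_bcontfun (P t T (Dg i)))" by (rule evol_lipb[OF C2_lip(2)[OF gC2[OF i] alpha(1)]])
  show ?thesis unfolding lipschitz_by_def qS_def
  proof clarify
    fix x h
    have "norm ((gV T (f i) t (x + h) - gV T (f i) t x) + (P t T (Dg i) (x + h) - P t T (Dg i) x)) \<le> 4 * cP * cV * cW * M * sqrt T * norm h + G * norm h"
      by (intro norm_triangle_mono lipschitz_byD[OF 1] lipschitz_byD[OF 2])
    then show "norm (gV T (f i) t (x + h) + P t T (Dg i) (x + h) - (gV T (f i) t x + P t T (Dg i) x)) \<le> (4 * cP * cV * cW * M * sqrt T + G) * norm h"
      by (simp add: algebra_simps)
  qed
qed

lemma uS_mild: "i < I \<Longrightarrow> mild T (uS T f i) (f i)"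
  unfolding mild_def
proof (intro allI impI)
  fix t r assume i: "i < I" and tr: "0 \<le> t" "t \<le> r" "r \<le> T"
  have "V T (f i) t = V r (f i) t + P t r (V T (f i) r)"
    by (rule V_semigroup[where L=M]) (use T tr sourceD[OF src i] in auto)
  then show "uS T f i t = V r (f i) t + P t r (uS T f i r)"
    using tr T by (simp add: uS_def evol_add P_semi)
qed

lemma uS_final: "uS T f i T = gb i"
  by (simp add: uS_def V_def evol_refl)

end

text \<open>T0 is fixed by the smallness conditions before T is given, while K may depend on T. The
  conclusion collects the separate moduli in space and time from which
  \<open>regular_is_C2a_par\<close> assembles the parabolic Hoelder norms.\<close>

lemma existence:
  "\<exists>T0. 0 < T0 \<and> T0 \<le> T1 \<and> (\<forall>T. 0 < T \<longrightarrow> T \<le> T0 \<longrightarrow> (\<exists>(u :: nat \<Rightarrow> real \<Rightarrow> (real^'d) \<Rightarrow>\<^sub>C real) q Q K. \<forall>i<I. u i T = gb i \<and>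
     (\<forall>t\<in>{0..T}. C2 \<alpha> K (apply_bcontfun (u i t)) (q i t) (Q i t) \<and>
       (\<forall>r\<in>{0..T}. \<forall>y. \<bar>u i t y - u i r y\<bar> \<le> K * \<bar>t - r\<bar> \<and> norm (q i t y - q i r y) \<le> K * sqrt \<bar>t - r\<bar> \<and>
          norm (Q i t y - Q i r y) \<le> K * \<bar>t - r\<bar> powr (\<alpha> / 2)) \<and>
       (\<forall>y. ((\<lambda>s. u i s y) has_real_derivative - (LA t (Q i t y) + F i t (\<lambda>j. q j t y))) (at t within {0..T})))))"
proof -
  \<comment> \<open>The terminal data contribute G to the size and to the Lipschitz constant of the
    gradients; the Duhamel part is allowed 1.\<close>
  define \<rho> where "\<rho> = G + 1"
  have \<rho>: "0 \<le> \<rho>" using G by (simp add: \<rho>_def)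
  obtain L where L: "Flip \<rho> L" using F_lip[of \<rho>] unfolding Flip_def by blast
  then have L0: "0 \<le> L" by (simp add: Flip_def)
  \<comment> \<open>\<open>M\<close> bounds size and Lipschitz constant of the source for all
    gradients in the invariant set.\<close>
  define M where "M = L + L * (real I * \<rho>)"
  have M: "0 \<le> M" "L \<le> M" "L * (real I * \<rho>) \<le> M" using L0 \<rho> by (auto simp: M_def)
  \<comment> \<open>Three requirements share one constant: the sup bound, the Lipschitz bound and
    the contraction factor. With sqrt T \<le> 1 / (2 c) each product is at most 1/2.\<close>
  define c where "c = 4 * cW * M + 4 * cP * cV * cW * M + 4 * cW * (L * real I) + 1"
  have cc: "0 \<le> 4 * cW * M" "0 \<le> 4 * cP * cV * cW * M" "0 \<le> 4 * cW * (L * real I)" using c_nonneg cP_pos M L0 by auto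
  have c: "c > 0" using cc unfolding c_def by linarith
  define T0 where "T0 = min T1 ((1 / (2 * c))\<^sup>2)"
  have T0: "0 < T0" "T0 \<le> T1" using T1 c by (auto simp: T0_def)
  have main: "\<exists>(u :: nat \<Rightarrow> real \<Rightarrow> (real^'d) \<Rightarrow>\<^sub>C real) q Q K. \<forall>i<I. u i T = gb i \<and>
     (\<forall>t\<in>{0..T}. C2 \<alpha> K (apply_bcontfun (u i t)) (q i t) (Q i t) \<and>
       (\<forall>r\<in>{0..T}. \<forall>y. \<bar>u i t y - u i r y\<bar> \<le> K * \<bar>t - r\<bar> \<and> norm (q i t y - q i r y) \<le> K * sqrt \<bar>t - r\<bar> \<and>
          norm (Q i t y - Q i r y) \<le> K * \<bar>t - r\<bar> powr (\<alpha> / 2)) \<and>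
       (\<forall>y. ((\<lambda>s. u i s y) has_real_derivative - (LA t (Q i t y) + F i t (\<lambda>j. q j t y))) (at t within {0..T})))"
    if T: "0 < T" "T \<le> T0" for T
  proof -
    have TT1: "T \<le> T1" using T T0 by auto
    note TT = T(1) TT1
    have sT: "sqrt T \<le> 1 / (2 * c)"
    proof -
      have "sqrt T \<le> sqrt ((1 / (2 * c))\<^sup>2)" using T by (intro real_sqrt_le_mono) (auto simp: T0_def)
      then show ?thesis using c by simp
    qed
    have small: "x * sqrt T \<le> 1 / 2" if "0 \<le> x" "x \<le> c" for x
    proof -
      have "x * sqrt T \<le> c * (1 / (2 * c))" using that sT T c by (intro mult_mono) auto
      then show ?thesis using c by simp
    qed
    have s1: "4 * cW * M * sqrt T \<le> 1" using small[OF cc(1)] cc by (auto simp: c_def)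
    have s2: "4 * cP * cV * cW * M * sqrt T \<le> 1" using small[OF cc(2)] cc by (auto simp: c_def)
    have s3: "4 * cW * (L * real I) * sqrt T \<le> 1 / 2" using small[OF cc(3)] cc by (auto simp: c_def)
    \<comment> \<open>Times are clamped to [0, T], because the paths of the fixed point space are
      bounded continuous functions on the whole real line.\<close>
    define clT where "clT t = max 0 (min T t)" for t
    have clT: "clT t \<in> {0..T}" "\<bar>clT t - clT s\<bar> \<le> \<bar>t - s\<bar>" "t \<in> {0..T} \<Longrightarrow> clT t = t" for t s using T(1) by (auto simp: clT_def)
    \<comment> \<open>The type \<open>nat discrete\<close> makes bounded sequences a Banach space of bounded continuous functions.\<close>
    define S :: "(real \<Rightarrow>\<^sub>C (nat discrete \<Rightarrow>\<^sub>C ((real^'d) \<Rightarrow>\<^sub>C (real^'d)))) set" where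
      "S = {p :: real \<Rightarrow>\<^sub>C (nat discrete \<Rightarrow>\<^sub>C ((real^'d) \<Rightarrow>\<^sub>C (real^'d))). \<forall>t j y h. norm (p t j y) \<le> \<rho> \<and> norm (p t j (y + h) - p t j y) \<le> \<rho> * norm h}"
    have reg: "regular \<rho> (\<lambda>j. apply_bcontfun (p t (discrete j)))" if "p \<in> S" for p t
      using that \<rho> unfolding S_def regular_def lipschitz_by_def by auto
    define fp :: "(real \<Rightarrow>\<^sub>C (nat discrete \<Rightarrow>\<^sub>C ((real^'d) \<Rightarrow>\<^sub>C (real^'d)))) \<Rightarrow> nat \<Rightarrow> real \<Rightarrow> (real^'d) \<Rightarrow>\<^sub>C real" where
      "fp p i t = Fb i t (\<lambda>j. apply_bcontfun (p t (discrete j)))" for p i t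
    have ev: "norm (p t j y - p' s j y) \<le> norm (p t - p' s)" for p p' :: "real \<Rightarrow>\<^sub>C (nat discrete \<Rightarrow>\<^sub>C ((real^'d) \<Rightarrow>\<^sub>C (real^'d)))" and t s j y
      using norm_bounded[of "(p t - p' s) j" y] norm_bounded[of "p t - p' s" j] by simp
    have src: "source T M (fp p)" if p: "p \<in> S" for p
      unfolding source_def
    proof (intro allI impI conjI ballI)
      fix i assume i: "i < I"
      show "norm (fp p i t) \<le> M" "lipschitz_by M (apply_bcontfun (fp p i t))" if "t \<in> {0..T}" for t
      proof -
        have t: "t \<in> {0..T1}" using that TT1 by auto
        show "norm (fp p i t) \<le> M" unfolding fp_def by (rule order_trans[OF Fb_norm[OF L reg[OF p] i t] M(2)])
        show "lipschitz_by M (apply_bcontfun (fp p i t))" using lipschitz_by_mono[OF Fb_lip[OF L reg[OF p] i t] M(3)] unfolding fp_def .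
      qed
      show "continuous_on {0..T} (fp p i)"
        unfolding continuous_on_def
      proof
        fix r assume r: "r \<in> {0..T}"
        show "(fp p i \<longlongrightarrow> fp p i r) (at r within {0..T})"
        proof (rule Lim_null[THEN iffD2], rule Lim_null_comparison)
          show "\<forall>\<^sub>F s in at r within {0..T}. norm (fp p i s - fp p i r) \<le> L * (\<bar>s - r\<bar> powr (\<alpha> / 2) + real I * norm (p s - p r))"
            unfolding eventually_at
          proof (intro exI[of _ 1] conjI ballI impI, simp)
            fix s assume "s \<in> {0..T}"
            then show "norm (fp p i s - fp p i r) \<le> L * (\<bar>s - r\<bar> powr (\<alpha> / 2) + real I * norm (p s - p r))"
              unfolding fp_def using r TT1 by (intro Fb_diff[OF L reg[OF p] reg[OF p] i] ev) auto
          qed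
          have "((\<lambda>s. \<bar>s - r\<bar>) \<longlongrightarrow> \<bar>r - r\<bar>) (at r within {0..T})" by (intro tendsto_intros)
          then have 1: "((\<lambda>s. \<bar>s - r\<bar> powr (\<alpha> / 2)) \<longlongrightarrow> 0) (at r within {0..T})"
            by (intro tendsto_zero_powrI[OF _ tendsto_const]) (use alpha in simp_all)
          have "((\<lambda>s. p s) \<longlongrightarrow> p r) (at r within {0..T})" using continuous_on_apply_bcontfun[of "{0..T}" p] r unfolding continuous_on_def by blast
          then have "((\<lambda>s. norm (p s - p r)) \<longlongrightarrow> 0) (at r within {0..T})" by (simp add: Lim_null[symmetric] tendsto_norm_zero_iff)
          then have "((\<lambda>s. L * (\<bar>s - r\<bar> powr (\<alpha> / 2) + real I * norm (p s - p r))) \<longlongrightarrow> L * (0 + real I * 0)) (at r within {0..T})"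
            by (intro tendsto_intros 1)
          then show "((\<lambda>s. L * (\<bar>s - r\<bar> powr (\<alpha> / 2) + real I * norm (p s - p r))) \<longlongrightarrow> 0) (at r within {0..T})" by simp
        qed
      qed
    qed
    obtain cm where cm: "cm \<ge> 1"
      "\<And>T u f q Q K t r y. mild_data T u f q Q K \<Longrightarrow> t \<in> {0..T} \<Longrightarrow> r \<in> {0..T} \<Longrightarrow>
         \<bar>u t y - u r y\<bar> \<le> cm * K * \<bar>t - r\<bar> \<and> norm (q t y - q r y) \<le> cm * K * sqrt \<bar>t - r\<bar>"
      using mild_first_order by blast
    define K1 where "K1 = cD * M + G + M"
    have K1: "0 \<le> K1" "M \<le> K1" "cD * M + G \<le> K1" using M G cD_pos by (auto simp: K1_def)
    have mdata: "mild_data T (uS T (fp p) i) (fp p i) (qS T (fp p) i) (QS T (fp p) i) K"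
      if p: "p \<in> S" and i: "i < I" and K: "M \<le> K" "cD * M + G \<le> K" for p i K
      unfolding mild_data_def
    proof (intro conjI ballI TT1 uS_mild[OF TT src[OF p] i])
      show "continuous_on {0..T} (fp p i)" using sourceD(1)[OF src[OF p] i] by auto
      fix s assume s: "s \<in> {0..T}"
      show "C2 \<alpha> K (apply_bcontfun (uS T (fp p) i s)) (qS T (fp p) i s) (QS T (fp p) i s)"
        by (rule C2_mono[OF uS_C2[OF TT src[OF p] i s] K(2)])
      show "norm (fp p i s) \<le> K" using sourceD(2)[OF src[OF p] i order_refl s] K by linarith
      show "lipschitz_by K (apply_bcontfun (fp p i s))" by (rule lipschitz_by_mono[OF sourceD(3)[OF src[OF p] i order_refl s] K(1)])
    qed
    have first: "\<bar>uS T (fp p) i t y - uS T (fp p) i r y\<bar> \<le> cm * K1 * \<bar>t - r\<bar> \<and> norm (qS T (fp p) i t y - qS T (fp p) i r y) \<le> cm * K1 * sqrt \<bar>t - r\<bar>"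
      if p: "p \<in> S" and i: "i < I" and t: "t \<in> {0..T}" "r \<in> {0..T}" for p i t r y
      by (rule cm(2)[OF mdata[OF p i K1(2,3)] t])
    have qb: "norm (qS T (fp p) i t y) \<le> \<rho>" if "p \<in> S" "i < I" "t \<in> {0..T}" for p i t y
      using qS_norm[OF TT src[OF that(1)] that(2,3), of y] s1 by (simp add: \<rho>_def)
    have ql: "lipschitz_by \<rho> (qS T (fp p) i t)" if "p \<in> S" "i < I" "t \<in> {0..T}" for p i t
      using lipschitz_by_mono[OF qS_lip[OF TT src[OF that(1)] that(2,3)], of \<rho>] s2 by (simp add: \<rho>_def)
    have qbc: "apply_bcontfun (Bcontfun (qS T (fp p) i t)) = qS T (fp p) i t" if "p \<in> S" "i < I" "t \<in> {0..T}" for p i t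
      by (rule C2_bc(2)[OF uS_C2[OF TT src[OF that(1)] that(2,3)] alpha(1)])
    \<comment> \<open>The sequence space carries all natural indices; components from I on are set
      to 0.\<close>
    define \<Phi>2 where "\<Phi>2 p t = Bcontfun (\<lambda>j. if of_discrete j < I then Bcontfun (qS T (fp p) (of_discrete j) (clT t)) else 0)" for p t
    define \<Phi> where "\<Phi> p = Bcontfun (\<Phi>2 p)" for p
    have \<Phi>2: "\<Phi>2 p t j y = (if of_discrete j < I then qS T (fp p) (of_discrete j) (clT t) y else 0)" if p: "p \<in> S" for p t j y
    proof -
      have "apply_bcontfun (\<Phi>2 p t) = (\<lambda>j. if of_discrete j < I then Bcontfun (qS T (fp p) (of_discrete j) (clT t)) else 0)"
        unfolding \<Phi>2_def
      proof (rule apply_Bcontfun)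
        show "continuous_on UNIV (\<lambda>j. if of_discrete j < I then Bcontfun (qS T (fp p) (of_discrete j) (clT t)) else 0)"
          by (simp add: continuous_on_open_vimage Discrete_Topology.open_discrete)
        show "norm (if of_discrete j < I then Bcontfun (qS T (fp p) (of_discrete j) (clT t)) else 0) \<le> \<rho>" for j
          using \<rho> by (auto intro!: norm_bound simp: qbc[OF p _ clT(1)] qb[OF p _ clT(1)])
      qed
      then show ?thesis by (simp add: qbc[OF p _ clT(1)])
    qed
    have \<Phi>: "\<Phi> p t = \<Phi>2 p t" if p: "p \<in> S" for p t
    proof -
      have "apply_bcontfun (\<Phi> p) = \<Phi>2 p" unfolding \<Phi>_def
      proof (rule apply_Bcontfun)
        show "norm (\<Phi>2 p t) \<le> \<rho>" for t
          using \<rho> by (intro norm_bound) (simp add: \<Phi>2[OF p] qb[OF p _ clT(1)])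
        \<comment> \<open>Continuity in time with respect to the sup norm comes from the square root
          modulus in \<open>mild_first_order\<close>, available for every p in S since the source is
          continuous in time.\<close>
        show "continuous_on UNIV (\<Phi>2 p)"
        proof (rule holder_continuous_on[where K="cm * K1" and a="1/2"])
          fix s t
          show "dist (\<Phi>2 p s) (\<Phi>2 p t) \<le> cm * K1 * dist s t powr (1/2)"
          proof (intro dist_bound)
            fix d y
            have "norm (qS T (fp p) j (clT s) y - qS T (fp p) j (clT t) y) \<le> cm * K1 * sqrt \<bar>s - t\<bar>" if "j < I" for j
            proof -
              have "norm (qS T (fp p) j (clT s) y - qS T (fp p) j (clT t) y) \<le> cm * K1 * sqrt \<bar>clT s - clT t\<bar>"
                using first[OF p that clT(1) clT(1)] by blast
              also have "\<dots> \<le> cm * K1 * sqrt \<bar>s - t\<bar>" using cm(1) K1(1) clT(2) by (intro mult_left_mono real_sqrt_le_mono) auto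
              finally show ?thesis .
            qed
            from this[of "of_discrete d"] show "dist (\<Phi>2 p s d y) (\<Phi>2 p t d y) \<le> cm * K1 * dist s t powr (1/2)"
              using cm(1) K1(1) by (simp add: \<Phi>2[OF p] dist_norm dist_real_def powr_half_sqrt)
          qed
        qed simp
      qed
      then show ?thesis by simp
    qed
    note \<Phi>a = \<Phi> \<Phi>2
    have bl: "bounded_linear (\<lambda>p :: real \<Rightarrow>\<^sub>C (nat discrete \<Rightarrow>\<^sub>C ((real^'d) \<Rightarrow>\<^sub>C (real^'d))). apply_bcontfun (apply_bcontfun (apply_bcontfun p t) j) y)" for t j y
      by (intro bounded_linear_compose[OF bounded_linear_apply_bcontfun] bounded_linear_apply_bcontfun)
    note ce = bounded_linear.continuous_on[OF bl continuous_on_id]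
    have "closed S" unfolding S_def
      by (intro closed_Collect_all closed_Collect_conj closed_Collect_le continuous_intros ce)
    then have "Topological_Spaces.complete S" by (simp add: complete_eq_closed)
    moreover have "S \<noteq> {}"
    proof -
      have "(0 :: real \<Rightarrow>\<^sub>C (nat discrete \<Rightarrow>\<^sub>C ((real^'d) \<Rightarrow>\<^sub>C (real^'d)))) \<in> S" using \<rho> by (simp add: S_def)
      then show ?thesis by blast
    qed
    moreover have "\<Phi> ` S \<subseteq> S"
    proof clarify
      fix p assume p: "p \<in> S"
      show "\<Phi> p \<in> S" unfolding S_def
        using qb[OF p _ clT(1)] lipschitz_byD[OF ql[OF p _ clT(1)]] \<rho> by (simp add: \<Phi>a[OF p])
    qed
    moreover have "dist (\<Phi> p) (\<Phi> p') \<le> 1/2 * dist p p'" if p: "p \<in> S" "p' \<in> S" for p p'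
    proof (intro dist_bound)
      fix t d y
      have "norm (qS T (fp p) j (clT t) y - qS T (fp p') j (clT t) y) \<le> 1/2 * dist p p'" if j: "j < I" for j
      proof -
        let ?t = "clT t"
        have t: "0 \<le> ?t" "?t \<le> T" using clT(1)[of t] by auto
        have "qS T (fp p) j ?t y - qS T (fp p') j ?t y = gV T (fp p j) ?t y - gV T (fp p' j) ?t y" by (simp add: qS_def)
        also have "norm \<dots> \<le> 4 * cW * (L * (real I * dist p p')) * sqrt (T - ?t)"
        proof (rule gV_diff_norm[OF t TT1 sourceD(1)[OF src[OF p(1)] j t(1)] sourceD(1)[OF src[OF p(2)] j t(1)] sourceD(2,3)[OF src[OF p(1)] j t(1)] sourceD(2,3)[OF src[OF p(2)] j t(1)]])
          fix s assume s: "s \<in> {?t..T}"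
          then have s1: "s \<in> {0..T1}" using t TT1 by auto
          have "norm (Fb j s (\<lambda>k. apply_bcontfun (p s (discrete k))) - Fb j s (\<lambda>k. apply_bcontfun (p' s (discrete k)))) \<le> L * (\<bar>s - s\<bar> powr (\<alpha> / 2) + real I * dist p p')"
          proof (rule Fb_diff[OF L reg[OF p(1)] reg[OF p(2)] j s1 s1])
            fix k z
            show "norm (p s (discrete k) z - p' s (discrete k) z) \<le> dist p p'" using ev[of p s "discrete k" z p' s] norm_bounded[of "p - p'" s] by (simp add: dist_norm)
          qed
          then show "norm (fp p j s - fp p' j s) \<le> L * (real I * dist p p')" by (simp add: fp_def)
        qed auto
        also have "\<dots> \<le> 4 * cW * (L * (real I * dist p p')) * sqrt T"
          using t c_nonneg L0 by (intro mult_left_mono real_sqrt_le_mono) auto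
        also have "\<dots> = (4 * cW * (L * real I) * sqrt T) * dist p p'" by (simp only: mult_ac)
        also have "\<dots> \<le> 1/2 * dist p p'" using s3 by (intro mult_right_mono) auto
        finally show ?thesis .
      qed
      from this[of "of_discrete d"] show "dist (\<Phi> p t d y) (\<Phi> p' t d y) \<le> 1/2 * dist p p'"
        by (simp add: \<Phi>a[OF p(1)] \<Phi>a[OF p(2)] dist_norm[of "qS T (fp p) (of_discrete d) (clT t) y"])
    qed
    ultimately obtain p where p: "p \<in> S" "\<Phi> p = p" using Banach_fix[of S "1/2" \<Phi>] by auto
    define u where "u = uS T (fp p)"
    define q where "q = qS T (fp p)"
    define Q where "Q = QS T (fp p)"
    have pq: "p t (discrete i) y = q i t y" if "i < I" "t \<in> {0..T}" for i t y
    proof -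
      have "p t (discrete i) y = \<Phi> p t (discrete i) y" using p(2) by simp
      also have "\<dots> = q i t y" using that clT(3) by (simp add: \<Phi>a[OF p(1)] q_def discrete_inverse)
      finally show ?thesis .
    qed
    \<comment> \<open>Bootstrapping: an arbitrary p in S is merely continuous in time, but the fixed
      point coincides on [0, T] with the gradients q and inherits their square root modulus. Its
      source is therefore Hoelder continuous in time, with a constant entering \<open>M2\<close>,
      and \<open>mild_second_order\<close> becomes available.\<close>
    define M2 where "M2 = K1 + L * (1 + real I * (cm * K1))"
    have M2: "K1 \<le> M2" "L * (1 + real I * (cm * K1)) \<le> M2" "0 \<le> M2" using K1 L0 cm(1) by (auto simp: M2_def)
    have fh: "norm (fp p i t - fp p i r) \<le> M2 * \<bar>t - r\<bar> powr (\<alpha> / 2)" if i: "i < I" and t: "t \<in> {0..T}" "r \<in> {0..T}" for i t r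
    proof -
      have "norm (fp p i t - fp p i r) \<le> L * (\<bar>t - r\<bar> powr (\<alpha> / 2) + real I * (cm * K1 * \<bar>t - r\<bar> powr (\<alpha> / 2)))"
        unfolding fp_def
      proof (rule Fb_diff[OF L reg[OF p(1)] reg[OF p(1)] i])
        fix j y assume j: "j < I"
        have "norm (q j t y - q j r y) \<le> cm * K1 * sqrt \<bar>t - r\<bar>" unfolding q_def using first[OF p(1) j t] by blast
        also have "\<dots> \<le> cm * K1 * \<bar>t - r\<bar> powr (\<alpha> / 2)" using t TT1 T1 cm(1) K1 by (intro mult_left_mono sqrt_le_powr) auto
        finally show "norm (p t (discrete j) y - p r (discrete j) y) \<le> cm * K1 * \<bar>t - r\<bar> powr (\<alpha> / 2)" using j t by (simp add: pq)
      qed (use t TT1 in auto)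
      also have "\<dots> = L * (1 + real I * (cm * K1)) * \<bar>t - r\<bar> powr (\<alpha> / 2)" by (simp add: algebra_simps)
      also have "\<dots> \<le> M2 * \<bar>t - r\<bar> powr (\<alpha> / 2)" using M2 by (intro mult_right_mono) auto
      finally show ?thesis .
    qed
    obtain cs where cs: "cs \<ge> 1"
      "\<And>T u f q Q K t r y. mild_data T u f q Q K \<Longrightarrow>
         (\<forall>t\<in>{0..T}. \<forall>r\<in>{0..T}. norm (f t - f r) \<le> K * \<bar>t - r\<bar> powr (\<alpha> / 2)) \<Longrightarrow> t \<in> {0..T} \<Longrightarrow> r \<in> {0..T} \<Longrightarrow>
         norm (Q t y - Q r y) \<le> cs * K * \<bar>t - r\<bar> powr (\<alpha> / 2) \<and>
         ((\<lambda>s. u s y) has_real_derivative - (LA t (Q t y) + f t y)) (at t within {0..T})"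
      using mild_second_order by blast
    define K where "K = cs * M2 + cm * K1"
    have "0 \<le> cm * K1" "M2 \<le> cs * M2" using cm(1) K1(1) mult_right_mono[OF cs(1) M2(3)] by auto
    then have K: "cs * M2 \<le> K" "cm * K1 \<le> K" "M2 \<le> K" using M2(3) unfolding K_def by linarith+
    have second: "norm (Q i t y - Q i r y) \<le> cs * M2 * \<bar>t - r\<bar> powr (\<alpha> / 2) \<and>
         ((\<lambda>s. u i s y) has_real_derivative - (LA t (Q i t y) + fp p i t y)) (at t within {0..T})"
      if i: "i < I" and t: "t \<in> {0..T}" "r \<in> {0..T}" for i t r y
      unfolding u_def Q_def
      by (rule cs(2)[OF mdata[OF p(1) i] _ t]) (use fh[OF i] K1 M2 in auto)
    have "u i T = gb i \<and>
     (\<forall>t\<in>{0..T}. C2 \<alpha> K (apply_bcontfun (u i t)) (q i t) (Q i t) \<and>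
       (\<forall>r\<in>{0..T}. \<forall>y. \<bar>u i t y - u i r y\<bar> \<le> K * \<bar>t - r\<bar> \<and> norm (q i t y - q i r y) \<le> K * sqrt \<bar>t - r\<bar> \<and>
          norm (Q i t y - Q i r y) \<le> K * \<bar>t - r\<bar> powr (\<alpha> / 2)) \<and>
       (\<forall>y. ((\<lambda>s. u i s y) has_real_derivative - (LA t (Q i t y) + F i t (\<lambda>j. q j t y))) (at t within {0..T})))" if i: "i < I" for i
    proof (intro conjI ballI allI)
      show "u i T = gb i" unfolding u_def by (rule uS_final[OF TT src[OF p(1)]])
      fix t assume t: "t \<in> {0..T}"
      show "C2 \<alpha> K (apply_bcontfun (u i t)) (q i t) (Q i t)" unfolding u_def q_def Q_def
        by (rule C2_mono[OF uS_C2[OF TT src[OF p(1)] i t]]) (use K1 M2 K in linarith)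
      fix y
      have "fp p i t y = F i t (\<lambda>j. p t (discrete j) y)" unfolding fp_def by (rule Fb_apply[OF L reg[OF p(1)] i]) (use t TT1 in auto)
      also have "\<dots> = F i t (\<lambda>j. q j t y)"
      proof -
        have e: "\<forall>j<I. norm (p t (discrete j) y) \<le> \<rho>" "\<forall>j<I. norm (q j t y) \<le> \<rho>" using reg[OF p(1), of t] qb[OF p(1) _ t] unfolding regular_def q_def by auto
        have t1: "t \<in> {0..T1}" using t TT1 by auto
        \<comment> \<open>The two families agree for indices below I; the Lipschitz bound at
          distance 0 shows that F takes the same value on them.\<close>
        show ?thesis using FlipD(2)[OF L i t1 t1 e] pq[OF _ t] by simp
      qed
      finally show "((\<lambda>s. u i s y) has_real_derivative - (LA t (Q i t y) + F i t (\<lambda>j. q j t y))) (at t within {0..T})"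
        using second[OF i t t, of y] by simp
      fix r y assume r: "r \<in> {0..T}"
      have 1: "\<bar>u i t y - u i r y\<bar> \<le> cm * K1 * \<bar>t - r\<bar> \<and> norm (q i t y - q i r y) \<le> cm * K1 * sqrt \<bar>t - r\<bar>"
        unfolding u_def q_def by (rule first[OF p(1) i t r])
      have 2: "norm (Q i t y - Q i r y) \<le> cs * M2 * \<bar>t - r\<bar> powr (\<alpha> / 2)" using second[OF i t r] by blast
      show "\<bar>u i t y - u i r y\<bar> \<le> K * \<bar>t - r\<bar>" using 1 mult_right_mono[OF K(2), of "\<bar>t - r\<bar>"] by simp
      show "norm (q i t y - q i r y) \<le> K * sqrt \<bar>t - r\<bar>" using 1 mult_right_mono[OF K(2), of "sqrt \<bar>t - r\<bar>"] by simp
      show "norm (Q i t y - Q i r y) \<le> K * \<bar>t - r\<bar> powr (\<alpha> / 2)" using 2 mult_right_mono[OF K(1), of "\<bar>t - r\<bar> powr (\<alpha> / 2)"] by simp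
    qed
    then show ?thesis by blast
  qed
  show ?thesis using T0 main by blast
qed

end

end

text \<open>The way back from genuine derivatives to remainder bounds, by the mean value inequality
  on the segment for f and on a ball for q.\<close>

lemma C2I:
  fixes f :: "real^'d \<Rightarrow> real"
  assumes f: "\<And>y. (f has_derivative (\<lambda>h. q y \<bullet> h)) (at y)" and q: "\<And>y. (q has_derivative (\<lambda>h. Q y *v h)) (at y)"
    and b: "\<And>y. \<bar>f y\<bar> \<le> K" "\<And>y. norm (q y) \<le> K" "\<And>y. norm (Q y) \<le> K"
    and h: "\<And>x y. norm (Q x - Q y) \<le> K * dist x y powr \<alpha>" and \<alpha>: "0 < \<alpha>"
  shows "C2 \<alpha> K f q Q"
  unfolding C2_def
proof (intro conjI allI b)
  fix y h :: "real^'d"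
  have K: "0 \<le> K" using b(2) norm_ge_zero order_trans by blast
  have lq: "norm (q x - q z) \<le> K * norm (x - z)" for x z
  proof (rule differentiable_bound[where S=UNIV and f'="\<lambda>y h. Q y *v h"])
    show "(q has_derivative (\<lambda>h. Q y *v h)) (at y within UNIV)" for y using q by simp
    show "onorm (\<lambda>h. Q y *v h) \<le> K" for y
      by (rule order_trans[OF onorm_bound[where b="norm (Q y)"]]) (use b norm_matrix_vector_le in auto)
  qed auto
  define \<psi> where "\<psi> \<theta> = f (y + \<theta> *\<^sub>R h) - \<theta> * (q y \<bullet> h)" for \<theta>
  have "norm (\<psi> 1 - \<psi> 0) \<le> (K * (norm h)\<^sup>2) * norm (1 - 0 :: real)"
  proof (rule field_differentiable_bound[where S="{0..1}" and f=\<psi> and f'="\<lambda>\<theta>. (q (y + \<theta> *\<^sub>R h) - q y) \<bullet> h"])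
    fix \<theta> :: real assume \<theta>: "\<theta> \<in> {0..1}"
    show "(\<psi> has_field_derivative (q (y + \<theta> *\<^sub>R h) - q y) \<bullet> h) (at \<theta> within {0..1})"
      unfolding \<psi>_def by (rule derivative_eq_intros line_derivative f refl | simp)+ (simp add: inner_diff_left)
    have "\<bar>(q (y + \<theta> *\<^sub>R h) - q y) \<bullet> h\<bar> \<le> norm (q (y + \<theta> *\<^sub>R h) - q y) * norm h" by (rule Cauchy_Schwarz_ineq2)
    also have "\<dots> \<le> (K * norm (\<theta> *\<^sub>R h)) * norm h" using lq[of "y + \<theta> *\<^sub>R h" y] by (intro mult_right_mono) auto
    also have "\<dots> \<le> (K * norm h) * norm h" using \<theta> K by (intro mult_right_mono mult_left_mono) (auto simp: mult_left_le_one_le)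
    finally show "norm ((q (y + \<theta> *\<^sub>R h) - q y) \<bullet> h) \<le> K * (norm h)\<^sup>2" by (simp add: power2_eq_square mult.assoc)
  qed auto
  then show "\<bar>f (y + h) - f y - q y \<bullet> h\<bar> \<le> K * (norm h)\<^sup>2" by (simp add: \<psi>_def algebra_simps)
  \<comment> \<open>The linear part frozen at y is removed; on the ball of radius |h| the remaining
    derivative Q x - Q y is at most K |h|^\<alpha>.\<close>
  define g where "g x = q x - Q y *v x" for x
  have "norm (g (y + h) - g y) \<le> (K * norm h powr \<alpha>) * norm ((y + h) - y)"
  proof (rule differentiable_bound[where S="cball y (norm h)" and f'="\<lambda>x k. Q x *v k - Q y *v k"])
    fix x assume x: "x \<in> cball y (norm h)"
    show "(g has_derivative (\<lambda>k. Q x *v k - Q y *v k)) (at x within cball y (norm h))"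
      unfolding g_def by (intro has_derivative_diff has_derivative_at_withinI[OF q] bounded_linear_imp_has_derivative) auto
    show "onorm (\<lambda>k. Q x *v k - Q y *v k) \<le> K * norm h powr \<alpha>"
    proof (rule order_trans[OF onorm_bound[where b="norm (Q x - Q y)"]])
      show "norm (Q x *v k - Q y *v k) \<le> norm (Q x - Q y) * norm k" for k
        using norm_matrix_vector_le[of "Q x - Q y" k] by (simp add: matrix_vector_mult_diff_rdistrib)
      have "norm (Q x - Q y) \<le> K * dist x y powr \<alpha>" by (rule h)
      also have "\<dots> \<le> K * norm h powr \<alpha>" using x K \<alpha> by (intro mult_left_mono powr_mono2) (auto simp: dist_commute)
      finally show "norm (Q x - Q y) \<le> K * norm h powr \<alpha>" .
    qed auto
  qed (auto simp: dist_norm)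
  also have "\<dots> = K * norm h powr (1 + \<alpha>)" by (simp add: powr_add)
  finally show "norm (q (y + h) - q y - Q y *v h) \<le> K * norm h powr (1 + \<alpha>)"
    by (simp add: g_def matrix_vector_right_distrib algebra_simps)
  show "norm (Q (y + h) - Q y) \<le> K * norm h powr \<alpha>" using h[of "y + h" y] by (simp add: dist_norm)
qed

text \<open>The sum of absolute values takes the place of a maximum; it is nonnegative and also
  covers I = 0.\<close>

lemma uniform_constant:
  fixes Pr :: "nat \<Rightarrow> real \<Rightarrow> bool"
  assumes "\<And>i. i < I \<Longrightarrow> \<exists>K. Pr i K" "\<And>i K K'. Pr i K \<Longrightarrow> K \<le> K' \<Longrightarrow> Pr i K'"
  shows "\<exists>K\<ge>0. \<forall>i<I. Pr i K"
proof -
  obtain k where k: "\<And>i. i < I \<Longrightarrow> Pr i (k i)" using assms(1) by metis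
  have "Pr i (\<Sum>j<I. \<bar>k j\<bar>)" if "i < I" for i
  proof (rule assms(2)[OF k[OF that]])
    have "\<bar>k i\<bar> \<le> (\<Sum>j<I. \<bar>k j\<bar>)" using that by (intro member_le_sum) auto
    then show "k i \<le> (\<Sum>j<I. \<bar>k j\<bar>)" by linarith
  qed
  then show ?thesis by (intro exI[of _ "\<Sum>j<I. \<bar>k j\<bar>"]) (auto intro!: sum_nonneg)
qed

section \<open>Decomposition of the diffusion matrix\<close>

lemma sum_list_product:
  fixes h :: "'d::finite \<Rightarrow> 'd \<Rightarrow> real"
  assumes "set xs = UNIV" "distinct xs"
  shows "(\<Sum>(i,j)\<leftarrow>List.product xs xs. h i j) = (\<Sum>i\<in>UNIV. \<Sum>j\<in>UNIV. h i j)"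
proof -
  have "(\<Sum>(i,j)\<leftarrow>List.product xs xs. h i j) = (\<Sum>(i,j)\<in>set (List.product xs xs). h i j)"
    by (rule sum_list_distinct_conv_sum_set) (simp add: distinct_product assms(2))
  then show ?thesis using assms(1) by (simp add: sum.cartesian_product)
qed

text \<open>Cyclicity of the trace turns the congruence by B into values of the form Q on the
  columns of B, which are the second derivatives in the frame directions.\<close>

lemma trace_congruence:
  fixes B :: "real^'d^'d"
  shows "trace (Q ** (B ** M ** transpose B)) = (\<Sum>j\<in>UNIV. \<Sum>i\<in>UNIV. M $ i $ j * (column j B \<bullet> (Q *v column i B)))"
proof -
  have entry: "(transpose B ** (Q ** B)) $ j $ i = column j B \<bullet> (Q *v column i B)" for j i
    by (simp add: matrix_matrix_mult_def transpose_def inner_vec_def column_def matrix_vector_mult_def)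
  have "trace (Q ** (B ** M ** transpose B)) = trace ((Q ** B ** M) ** transpose B)" by (simp add: matrix_mul_assoc)
  also have "\<dots> = trace (transpose B ** (Q ** B ** M))" by (rule trace_mul_sym)
  also have "\<dots> = trace ((transpose B ** (Q ** B)) ** M)" by (simp add: matrix_mul_assoc)
  also have "\<dots> = (\<Sum>j\<in>UNIV. \<Sum>i\<in>UNIV. (transpose B ** (Q ** B)) $ j $ i * M $ i $ j)"
    by (simp add: trace_def matrix_matrix_mult_def)
  finally show ?thesis unfolding entry by (simp add: mult.commute)
qed

lemma bounded_linear_matrix_mult_left: "bounded_linear (\<lambda>A :: real^'k^'n. B ** A)" for B :: "real^'n^'m"
proof -
  have "linear (\<lambda>A :: real^'k^'n. B ** A)"
    by (rule linearI)
       (simp_all add: matrix_add_ldistrib, simp add: matrix_matrix_mult_def vec_eq_iff sum_distrib_left mult_ac)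
  then show ?thesis by (simp add: linear_conv_bounded_linear)
qed

text \<open>For \<open>\<phi> i j = v\<^sub>i\<^sup>T Q v\<^sub>j\<close> the left-hand side only involves second derivatives along
  \<open>v\<^sub>i + v\<^sub>j\<close>, \<open>v\<^sub>i - v\<^sub>j\<close>, \<open>v\<^sub>i\<close>, with nonnegative weights when \<open>M\<close> is close to the identity.\<close>

lemma frame_sum_identity:
  fixes M \<phi> :: "'d::finite \<Rightarrow> 'd \<Rightarrow> real" and \<epsilon> :: real
  assumes sym: "\<And>i j. M i j = M j i"
  defines "N \<equiv> \<lambda>i j. M i j - (if i = j then 1 else 0)"
  shows "(\<Sum>i\<in>UNIV. \<Sum>j\<in>UNIV. (\<epsilon> + N i j / 2) / 2 * (\<phi> i i + \<phi> j j + \<phi> i j + \<phi> j i))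
     + (\<Sum>i\<in>UNIV. \<Sum>j\<in>UNIV. \<epsilon> / 2 * (\<phi> i i + \<phi> j j - \<phi> i j - \<phi> j i))
     + (\<Sum>i\<in>UNIV. (1 - 4 * real CARD('d) * \<epsilon> - (\<Sum>j\<in>UNIV. N i j)) / 2 * \<phi> i i)
     = 1 / 2 * (\<Sum>j\<in>UNIV. \<Sum>i\<in>UNIV. M i j * \<phi> j i)"
proof -
  let ?S = "\<lambda>h :: 'd \<Rightarrow> 'd \<Rightarrow> real. \<Sum>i\<in>UNIV. \<Sum>j\<in>UNIV. h i j"
  have Nsym: "N i j = N j i" for i j using sym by (simp add: N_def)
  have sw: "?S h = ?S (\<lambda>i j. h j i)" for h by (rule sum.swap)
  have a1: "?S (\<lambda>i j. N i j * \<phi> j j) = ?S (\<lambda>i j. N i j * \<phi> i i)" by (subst sw) (simp add: Nsym)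
  have a2: "?S (\<lambda>i j. N i j * \<phi> j i) = ?S (\<lambda>i j. N i j * \<phi> i j)" by (subst sw) (simp add: Nsym)
  have a3: "?S (\<lambda>i j. \<phi> j j) = ?S (\<lambda>i j. \<phi> i i)" by (subst sw) simp
  have a5: "(\<Sum>i\<in>UNIV. (\<Sum>j\<in>UNIV. N i j) * \<phi> i i) = ?S (\<lambda>i j. N i j * \<phi> i i)" by (simp add: sum_distrib_right)
  have a6: "real CARD('d) * (\<Sum>i\<in>UNIV. \<phi> i i) = ?S (\<lambda>i j. \<phi> i i)" by (simp add: sum_distrib_left)
  have a7: "?S (\<lambda>i j. N i j * \<phi> i j) = ?S (\<lambda>i j. M i j * \<phi> i j) - (\<Sum>i\<in>UNIV. \<phi> i i)"
  proof -
    have "(\<Sum>j\<in>UNIV. (if i = j then 1 else 0) * \<phi> i j) = \<phi> i i" for i by (simp add: if_distrib[of "\<lambda>x. x * _"] cong: if_cong)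
    then show ?thesis by (simp add: N_def left_diff_distrib sum_subtractf)
  qed
  have b1: "?S (\<lambda>i j. (\<epsilon> + N i j / 2) / 2 * (\<phi> i i + \<phi> j j + \<phi> i j + \<phi> j i))
     = \<epsilon> / 2 * (?S (\<lambda>i j. \<phi> i i) + ?S (\<lambda>i j. \<phi> j j) + ?S \<phi> + ?S (\<lambda>i j. \<phi> j i))
     + 1 / 4 * (?S (\<lambda>i j. N i j * \<phi> i i) + ?S (\<lambda>i j. N i j * \<phi> j j) + ?S (\<lambda>i j. N i j * \<phi> i j) + ?S (\<lambda>i j. N i j * \<phi> j i))"
    by (simp only: sum_distrib_left sum.distrib[symmetric]) (intro sum.cong refl, simp add: field_simps)
  have b2: "?S (\<lambda>i j. \<epsilon> / 2 * (\<phi> i i + \<phi> j j - \<phi> i j - \<phi> j i))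
     = \<epsilon> / 2 * (?S (\<lambda>i j. \<phi> i i) + ?S (\<lambda>i j. \<phi> j j) - ?S \<phi> - ?S (\<lambda>i j. \<phi> j i))"
    by (simp only: sum_distrib_left sum.distrib[symmetric] sum_subtractf[symmetric])
  have b3: "(\<Sum>i\<in>UNIV. (1 - 4 * real CARD('d) * \<epsilon> - (\<Sum>j\<in>UNIV. N i j)) / 2 * \<phi> i i)
     = 1 / 2 * (\<Sum>i\<in>UNIV. \<phi> i i) - 2 * \<epsilon> * (real CARD('d) * (\<Sum>i\<in>UNIV. \<phi> i i)) - 1 / 2 * (\<Sum>i\<in>UNIV. (\<Sum>j\<in>UNIV. N i j) * \<phi> i i)"
    by (simp only: sum_distrib_left sum_subtractf[symmetric]) (intro sum.cong refl, simp add: field_simps)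
  have c: "(\<Sum>j\<in>UNIV. \<Sum>i\<in>UNIV. M i j * \<phi> j i) = ?S (\<lambda>i j. M i j * \<phi> i j)" by (simp add: sym)
  show ?thesis unfolding b1 b2 b3 c a1 a2 a3 a5 a6 a7 by (simp add: algebra_simps)
qed

lemma holder_01_bounded:
  fixes C :: "real \<Rightarrow> real^'d^'d"
  assumes "holder_01 \<alpha> C" "0 < \<alpha>"
  obtains K where "0 \<le> K" "\<And>s t. s \<in> {0..1} \<Longrightarrow> t \<in> {0..1} \<Longrightarrow> norm (C s - C t) \<le> K * \<bar>s - t\<bar> powr \<alpha>"
    "\<And>t. t \<in> {0..1} \<Longrightarrow> norm (C t) \<le> K"
proof -
  obtain K where K: "\<And>s t. s \<in> {0..1} \<Longrightarrow> t \<in> {0..1} \<Longrightarrow> norm (C s - C t) \<le> K * \<bar>s - t\<bar> powr \<alpha>"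
    using assms(1) unfolding holder_01_def by blast
  have K0: "0 \<le> K" using order_trans[OF norm_ge_zero K[of 0 1]] by simp
  show ?thesis
  proof (rule that[of "K + norm (C 0)"])
    show "norm (C s - C t) \<le> (K + norm (C 0)) * \<bar>s - t\<bar> powr \<alpha>" if "s \<in> {0..1}" "t \<in> {0..1}" for s t
      by (rule order_trans[OF K[OF that] mult_right_mono]) auto
    fix t :: real assume t: "t \<in> {0..1}"
    have "norm (C t - C 0) \<le> K * \<bar>t - 0\<bar> powr \<alpha>" by (rule K) (use t in auto)
    also have "\<dots> \<le> K * 1"
    proof (rule mult_left_mono[OF _ K0])
      have "\<bar>t - 0\<bar> powr \<alpha> \<le> 1 powr \<alpha>" using t assms(2) by (intro powr_mono2) auto
      then show "\<bar>t - 0\<bar> powr \<alpha> \<le> 1" by simp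
    qed
    finally show "norm (C t) \<le> K + norm (C 0)" using norm_triangle_ineq2[of "C t" "C 0"] by simp
  qed (use K0 in simp)
qed

lemma abs_inner_diff_le:
  fixes x y x' y' :: "'a::real_inner"
  assumes "norm y \<le> R" "norm x' \<le> R" "norm (x - x') \<le> e" "norm (y - y') \<le> e" "0 \<le> R"
  shows "\<bar>x \<bullet> y - x' \<bullet> y'\<bar> \<le> 2 * R * e"
proof -
  have "x \<bullet> y - x' \<bullet> y' = (x - x') \<bullet> y + x' \<bullet> (y - y')" by (simp add: inner_diff_left inner_diff_right)
  also have "\<bar>\<dots>\<bar> \<le> norm (x - x') * norm y + norm x' * norm (y - y')"
    using Cauchy_Schwarz_ineq2[of "x - x'" y] Cauchy_Schwarz_ineq2[of x' "y - y'"] by linarith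
  also have "\<dots> \<le> e * R + R * e" using assms by (intro add_mono mult_mono) (auto intro: order_trans[OF norm_ge_zero])
  finally show ?thesis by simp
qed

lemma powr_half_le: "0 \<le> x \<Longrightarrow> x \<le> 1 \<Longrightarrow> 0 < \<alpha> \<Longrightarrow> x powr \<alpha> \<le> x powr (\<alpha> / 2)" for x \<alpha> :: real
  by (cases "x = 0") (auto intro!: powr_mono')

text \<open>In the frame of the columns of C(0) the diffusion matrix is close to the identity for
  small t by Hoelder continuity. Ellipticity at time 0 makes C(0) invertible, so that this frame is
  a basis.\<close>

lemma diffusion_decomposition:
  fixes C :: "real \<Rightarrow> real^'d^'d"
  assumes \<alpha>: "0 < \<alpha>" "\<alpha> < 1" and hol: "holder_01 \<alpha> C" and "0 < \<delta>"
    and ell: "\<And>y. \<delta> * (norm y)\<^sup>2 \<le> y \<bullet> ((C 0 ** transpose (C 0)) *v y)"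
  obtains ks v w T1 K0 where "diffusion ks v w T1 K0 \<alpha>"
    "\<And>t Q. t \<in> {0..T1} \<Longrightarrow> (\<Sum>(v,b)\<leftarrow>ks. b t / 2 * (v \<bullet> (Q *v v))) = 1 / 2 * trace (Q ** C t ** transpose (C t))"
proof -
  obtain K where K: "0 \<le> K" "\<And>s t. s \<in> {0..1} \<Longrightarrow> t \<in> {0..1} \<Longrightarrow> norm (C s - C t) \<le> K * \<bar>s - t\<bar> powr \<alpha>"
    "\<And>t. t \<in> {0..1} \<Longrightarrow> norm (C t) \<le> K" by (rule holder_01_bounded[OF hol \<alpha>(1)]) blast
  have inj: "y = z" if "transpose (C 0) *v y = transpose (C 0) *v z" for y z
  proof -
    have "transpose (C 0) *v (y - z) = 0" using that by (simp add: matrix_vector_mult_diff_distrib)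
    then have "(C 0 ** transpose (C 0)) *v (y - z) = 0" by (simp add: matrix_vector_mul_assoc[symmetric])
    then have "\<delta> * (norm (y - z))\<^sup>2 \<le> 0" using ell[of "y - z"] by simp
    then show ?thesis using \<open>0 < \<delta>\<close> by (simp add: mult_le_0_iff)
  qed
  then obtain B' where B': "B' ** transpose (C 0) = mat 1" unfolding matrix_left_invertible_injective[symmetric] inj_on_def
    using matrix_left_invertible_injective[of "transpose (C 0)"] by (auto simp: inj_def)
  define B where "B = transpose B'"
  have CB: "C 0 ** B = mat 1"
  proof -
    have "transpose (B' ** transpose (C 0)) = mat 1" using B' by simp
    then show ?thesis by (simp add: B_def matrix_transpose_mul)
  qed
  then have BC: "B ** C 0 = mat 1" by (rule matrix_left_right_inverse[THEN iffD1])
  \<comment> \<open>The columns of C(0) and the rows of its inverse B are dual bases.\<close>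
  define v where "v i = column i (C 0)" for i
  define w where "w i = B $ i" for i
  have dual: "(\<Sum>i\<in>UNIV. (w i \<bullet> h) *\<^sub>R v i) = h" for h
  proof -
    have "(\<Sum>i\<in>UNIV. (w i \<bullet> h) *\<^sub>R v i) = C 0 *v (B *v h)"
      unfolding matrix_mult_sum[of "C 0"] by (simp add: v_def w_def matrix_vector_mul_component scalar_mult_eq_scaleR)
    then show ?thesis by (simp add: matrix_vector_mul_assoc CB)
  qed
  \<comment> \<open>C(t) = C(0) E(t), hence C(t) C(t)^T = C(0) M(t) C(0)^T with M = E E^T symmetric
    and M(0) the identity.\<close>
  define E where "E t = B ** C t" for t
  define M where "M i j t = E t $ i \<bullet> E t $ j" for i j t
  interpret bl: bounded_linear "\<lambda>A :: real^'d^'d. B ** A" by (rule bounded_linear_matrix_mult_left)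
  obtain KB where KB: "0 \<le> KB" "\<forall>A :: real^'d^'d. norm (B ** A) \<le> norm A * KB" using bl.nonneg_bounded by auto
  define R where "R = K * KB"
  have R: "0 \<le> R" using K KB by (simp add: R_def)
  have En: "norm (E t $ i) \<le> R" if "t \<in> {0..1}" for t i
  proof -
    have "norm (E t $ i) \<le> norm (E t)" by (rule Finite_Cartesian_Product.norm_nth_le)
    also have "\<dots> \<le> norm (C t) * KB" unfolding E_def by (rule KB(2)[rule_format])
    also have "\<dots> \<le> R" unfolding R_def using K(3)[OF that] KB(1) by (rule mult_right_mono)
    finally show ?thesis .
  qed
  have Eh: "norm (E s $ i - E t $ i) \<le> R * \<bar>s - t\<bar> powr \<alpha>" if "s \<in> {0..1}" "t \<in> {0..1}" for s t i
  proof -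
    have "norm (E s $ i - E t $ i) \<le> norm (E s - E t)" using Finite_Cartesian_Product.norm_nth_le[of "E s - E t" i] by simp
    also have "\<dots> = norm (B ** (C s - C t))" by (simp add: E_def bl.diff)
    also have "\<dots> \<le> norm (C s - C t) * KB" by (rule KB(2)[rule_format])
    also have "\<dots> \<le> (K * \<bar>s - t\<bar> powr \<alpha>) * KB" using K(2)[OF that] KB(1) by (rule mult_right_mono)
    finally show ?thesis by (simp add: R_def mult_ac)
  qed
  define H where "H = 2 * R * R + 1"
  have H: "0 < H" using R by (simp add: H_def add_nonneg_pos)
  have Mh: "\<bar>M i j s - M i j t\<bar> \<le> H * \<bar>s - t\<bar> powr \<alpha>" if "s \<in> {0..1}" "t \<in> {0..1}" for s t i j
  proof -
    have "\<bar>M i j s - M i j t\<bar> \<le> 2 * R * (R * \<bar>s - t\<bar> powr \<alpha>)"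
      unfolding M_def by (rule abs_inner_diff_le) (use En Eh that R in auto)
    also have "\<dots> \<le> H * \<bar>s - t\<bar> powr \<alpha>" unfolding H_def by (simp add: algebra_simps)
    finally show ?thesis .
  qed
  define N where "N i j t = M i j t - (if i = j then 1 else 0)" for i j t
  have M0: "N i j 0 = 0" for i j
    by (simp add: N_def M_def E_def BC mat_def inner_vec_def if_distrib[of "\<lambda>x. x * _"] cong: if_cong)
  define D where "D = real CARD('d)"
  have D: "1 \<le> D" by (simp add: D_def Suc_leI)
  \<comment> \<open>With D \<epsilon> = 1/10 and |N| \<le> \<epsilon>, the weights \<epsilon> + N/2
    are at least \<epsilon>/2, and the diagonal weights are at least 1 - 4/10 - 1/10 = 1/2.\<close>
  define \<epsilon> where "\<epsilon> = 1 / (10 * D)"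
  have \<epsilon>: "0 < \<epsilon>" "\<epsilon> \<le> 1 / 10" "D * \<epsilon> = 1 / 10" using D by (auto simp: \<epsilon>_def field_simps)
  \<comment> \<open>Chosen such that H T1^\<alpha> \<le> \<epsilon>, the bound needed for the
    entries of N.\<close>
  define T1 where "T1 = min 1 ((\<epsilon> / H) powr (1 / \<alpha>))"
  have T1: "0 < T1" "T1 \<le> 1" using \<epsilon> H by (auto simp: T1_def)
  have Nb: "\<bar>N i j t\<bar> \<le> \<epsilon>" if t: "t \<in> {0..T1}" for i j t
  proof -
    have "\<bar>N i j t\<bar> = \<bar>M i j t - M i j 0\<bar>" using M0[of i j] by (simp add: N_def)
    also have "\<dots> \<le> H * \<bar>t - 0\<bar> powr \<alpha>" by (rule Mh) (use t T1 in auto)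
    also have "\<dots> \<le> H * ((\<epsilon> / H) powr (1 / \<alpha>)) powr \<alpha>"
      using t H \<alpha> by (intro mult_left_mono powr_mono2) (auto simp: T1_def)
    also have "\<dots> = \<epsilon>" using \<alpha> \<epsilon> H by (simp add: powr_powr)
    finally show ?thesis .
  qed
  \<comment> \<open>The squares along v_i + v_j and v_i - v_j also produce diagonal terms, namely 4
    D \<epsilon> and the row sum of N; they are subtracted here.\<close>
  define \<gamma> where "\<gamma> i t = 1 - 4 * D * \<epsilon> - (\<Sum>j\<in>UNIV. N i j t)" for i t
  obtain xs :: "'d list" where xs: "set xs = UNIV" "distinct xs" using finite_distinct_list[OF finite] by blast
  \<comment> \<open>All ordered pairs are listed, including i = j, where the directions are 2 v_i
    and 0; this keeps the double sums of \<open>frame_sum_identity\<close> free of case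
    distinctions.\<close>
  define ks where "ks = map (\<lambda>(i,j). (v i + v j, \<lambda>t. \<epsilon> + N i j t / 2)) (List.product xs xs)
      @ map (\<lambda>(i,j). (v i - v j, \<lambda>t. \<epsilon>)) (List.product xs xs) @ map (\<lambda>i. (v i, \<gamma> i)) xs"
  \<comment> \<open>The 2 bounds the weights; D H bounds the Hoelder constant of the row sums inside
    \<gamma>.\<close>
  define K0 where "K0 = 2 + D * H"
  have DH: "H \<le> D * H" "0 \<le> D * H" using D H by auto
  have Nsum: "\<bar>\<Sum>j\<in>UNIV. N i j t\<bar> \<le> 1 / 10" if t: "t \<in> {0..T1}" for i t
  proof -
    have "\<bar>\<Sum>j\<in>UNIV. N i j t\<bar> \<le> (\<Sum>j\<in>(UNIV::'d set). \<epsilon>)" by (rule order_trans[OF sum_abs sum_mono]) (use Nb[OF t] in auto)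
    then show ?thesis using \<epsilon>(3) by (simp add: D_def)
  qed
  have g1: "1/2 \<le> \<gamma> i t" "\<gamma> i t \<le> 2" if t: "t \<in> {0..T1}" for i t
    using Nsum[OF t, of i] \<epsilon>(3) unfolding \<gamma>_def by (simp_all add: mult.assoc abs_le_iff)
  have Nh: "\<bar>N i j s - N i j t\<bar> \<le> H * \<bar>s - t\<bar> powr (\<alpha> / 2)" if st: "s \<in> {0..T1}" "t \<in> {0..T1}" for i j s t
  proof -
    have "\<bar>N i j s - N i j t\<bar> \<le> H * \<bar>s - t\<bar> powr \<alpha>" using Mh[of s t i j] st T1 by (simp add: N_def)
    also have "\<dots> \<le> H * \<bar>s - t\<bar> powr (\<alpha> / 2)" using st T1 \<alpha> H by (intro mult_left_mono powr_half_le) auto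
    finally show ?thesis .
  qed
  have props: "(\<forall>t\<in>{0..T1}. 0 \<le> b t \<and> b t \<le> K0) \<and> (\<forall>s\<in>{0..T1}. \<forall>t\<in>{0..T1}. \<bar>b s - b t\<bar> \<le> K0 * \<bar>s - t\<bar> powr (\<alpha> / 2))"
    if xb: "(x,b) \<in> set ks" for x b
  proof -
    have K0: "c * \<bar>s - t\<bar> powr (\<alpha> / 2) \<le> K0 * \<bar>s - t\<bar> powr (\<alpha> / 2)" if "c \<le> D * H" for c s t :: real
      using that by (intro mult_right_mono) (auto simp: K0_def)
    consider (a) i j where "b = (\<lambda>t. \<epsilon> + N i j t / 2)" | (b) "b = (\<lambda>t. \<epsilon>)" | (c) i where "b = \<gamma> i"
      using xb unfolding ks_def by auto
    then show ?thesis
    proof cases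
      case a
      show ?thesis
      proof (intro conjI ballI)
        fix t assume t: "t \<in> {0..T1}"
        show "0 \<le> b t" "b t \<le> K0" using Nb[OF t, of i j] \<epsilon> DH unfolding a K0_def by linarith+
        fix s assume s: "s \<in> {0..T1}"
        show "\<bar>b t - b s\<bar> \<le> K0 * \<bar>t - s\<bar> powr (\<alpha> / 2)"
          using Nh[OF t s, of i j] K0[of H t s] DH(1) unfolding a by linarith
      qed
    next
      case b then show ?thesis using \<epsilon> DH by (auto simp: K0_def)
    next
      case c
      show ?thesis
      proof (intro conjI ballI)
        fix t assume t: "t \<in> {0..T1}"
        show "0 \<le> b t" "b t \<le> K0" using g1[OF t, of i] DH unfolding c K0_def by linarith+
        fix s assume s: "s \<in> {0..T1}"
        have "\<bar>\<gamma> i t - \<gamma> i s\<bar> = \<bar>\<Sum>j\<in>UNIV. (N i j s - N i j t)\<bar>" by (simp add: \<gamma>_def sum_subtractf)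
        also have "\<dots> \<le> (\<Sum>j\<in>(UNIV::'d set). H * \<bar>s - t\<bar> powr (\<alpha> / 2))"
          by (rule order_trans[OF sum_abs sum_mono]) (rule Nh[OF s t])
        also have "\<dots> = (D * H) * \<bar>t - s\<bar> powr (\<alpha> / 2)" by (simp add: D_def abs_minus_commute)
        also have "\<dots> \<le> K0 * \<bar>t - s\<bar> powr (\<alpha> / 2)" by (rule K0) simp
        finally show "\<bar>b t - b s\<bar> \<le> K0 * \<bar>t - s\<bar> powr (\<alpha> / 2)" unfolding c .
      qed
    qed
  qed
  have dif: "diffusion ks v w T1 K0 \<alpha>"
  proof
    fix i show "\<exists>b. (v i, b) \<in> set ks \<and> (\<forall>t\<in>{0..T1}. 1 / 2 \<le> b t)"
      by (rule exI[of _ "\<gamma> i"]) (use g1 xs in \<open>auto simp: ks_def\<close>)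
  qed (use T1 \<alpha> dual props in \<open>blast+\<close>)
  have "(\<Sum>(v,b)\<leftarrow>ks. b t / 2 * (v \<bullet> (Q *v v))) = 1 / 2 * trace (Q ** C t ** transpose (C t))" for t Q
  proof -
    define \<phi> where "\<phi> i j = v i \<bullet> (Q *v v j)" for i j
    have "(\<Sum>(v,b)\<leftarrow>ks. b t / 2 * (v \<bullet> (Q *v v)))
      = (\<Sum>(i,j)\<leftarrow>List.product xs xs. (\<epsilon> + N i j t / 2) / 2 * (\<phi> i i + \<phi> j j + \<phi> i j + \<phi> j i))
      + ((\<Sum>(i,j)\<leftarrow>List.product xs xs. \<epsilon> / 2 * (\<phi> i i + \<phi> j j - \<phi> i j - \<phi> j i)) + (\<Sum>i\<leftarrow>xs. \<gamma> i t / 2 * \<phi> i i))"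
    proof -
      have "(v i + v j) \<bullet> (Q *v (v i + v j)) = \<phi> i i + \<phi> j j + \<phi> i j + \<phi> j i" for i j
        by (simp add: \<phi>_def matrix_vector_right_distrib inner_add_left inner_add_right)
      moreover have "(v i - v j) \<bullet> (Q *v (v i - v j)) = \<phi> i i + \<phi> j j - \<phi> i j - \<phi> j i" for i j
        by (simp add: \<phi>_def matrix_vector_mult_diff_distrib inner_diff_left inner_diff_right)
      ultimately show ?thesis unfolding ks_def by (simp add: comp_def case_prod_unfold \<phi>_def)
    qed
    also have "\<dots> = 1 / 2 * (\<Sum>j\<in>UNIV. \<Sum>i\<in>UNIV. M i j t * \<phi> j i)"
      using frame_sum_identity[of "\<lambda>i j. M i j t" \<epsilon> \<phi>]
      by (simp add: sum_list_product[OF xs] sum_list_distinct_conv_sum_set[OF xs(2)] xs(1) \<gamma>_def N_def D_def M_def inner_commute add.assoc)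
    also have "(\<Sum>j\<in>UNIV. \<Sum>i\<in>UNIV. M i j t * \<phi> j i) = trace (Q ** (C 0 ** (E t ** transpose (E t)) ** transpose (C 0)))"
      unfolding trace_congruence
      by (simp add: M_def \<phi>_def v_def matrix_matrix_mult_def transpose_def inner_vec_def)
    also have "C 0 ** (E t ** transpose (E t)) ** transpose (C 0) = (C 0 ** E t) ** transpose (C 0 ** E t)"
      by (simp add: matrix_transpose_mul matrix_mul_assoc)
    also have "C 0 ** E t = C t" by (simp add: E_def matrix_mul_assoc CB)
    finally show ?thesis by (simp add: matrix_mul_assoc)
  qed
  then show ?thesis using that[OF dif] by blast
qed

lemma norm_transpose: "norm (transpose M) = norm M" for M :: "real^'n^'m"
proof -
  have "transpose M \<bullet> transpose M = M \<bullet> M"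
    by (simp add: inner_vec_def transpose_def) (rule sum.swap)
  then show ?thesis by (simp add: norm_eq_sqrt_inner)
qed

lemma norm_transpose_mult_diff:
  fixes M M' :: "real^'n^'m"
  shows "norm (transpose M *v p - transpose M' *v p') \<le> norm (M - M') * norm p + norm M' * norm (p - p')"
proof -
  have "transpose M *v p - transpose M' *v p' = transpose (M - M') *v p + transpose M' *v (p - p')"
    by (simp add: matrix_vector_mult_diff_distrib vec_eq_iff matrix_vector_mult_def transpose_def sum_subtractf algebra_simps)
  also have "norm \<dots> \<le> norm (M - M') * norm p + norm M' * norm (p - p')"
    by (rule norm_triangle_mono) (use norm_matrix_vector_le[of "transpose (M - M')" p] norm_matrix_vector_le[of "transpose M'" "p - p'"] in \<open>auto simp: norm_transpose\<close>)
  finally show ?thesis .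
qed

text \<open>Padding with zeros makes the passage to the first N columns a coordinate projection of
  \<open>transpose M *v p\<close>, which does not increase norms.\<close>

lemma cbarT_diff_le: "norm (cbarT N M p - cbarT N M' p') \<le> norm (transpose M *v p - transpose M' *v p')"
  by (rule norm_le_componentwise_cart) (simp add: cbarT_def)

lemma cbarT_le: "norm (cbarT N M p) \<le> norm (transpose M *v p)"
  by (rule norm_le_componentwise_cart) (simp add: cbarT_def)

section \<open>The system of the theorem\<close>

text \<open>The lower order part of the equation as a function of time and of all gradients; the
  i-th equation then says that the time derivative is minus the sum of \<open>LA\<close> at the
  Hessian and this term.\<close>

definition hamiltonian :: "(real \<Rightarrow> real^('d::{finite,linorder})^('d::{finite,linorder})) \<Rightarrow> (nat \<Rightarrow> real) \<Rightarrow> nat \<Rightarrow> nat \<Rightarrow> nat \<Rightarrow> real \<Rightarrow> (nat \<Rightarrow> real^('d::{finite,linorder})) \<Rightarrow> real" where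
  "hamiltonian C a I N i t p =
    (let lam = (1 / tauSigma a I) *\<^sub>R cbarT N (C t) (\<Sum>j<I. p j)
     in 1 / (2 * a i) * (norm lam)\<^sup>2 - lam \<bullet> cbarT N (C t) (p i)
        + a i / 2 * ((norm (cbarT N (C t) (p i)))\<^sup>2 - (norm (transpose (C t) *v p i))\<^sup>2))"

text \<open>The expression combines inner products of three vectors: the coupling x, the truncated y
  and the full z. Each is linear in the gradients with Hoelder coefficients in time, so on a ball
  they are bounded by \<open>R\<close> and their increments by \<open>E\<close> times the combined
  distance.\<close>

lemma hamiltonian_lipschitz:
  fixes C :: "real \<Rightarrow> real^('d::{finite,linorder})^('d::{finite,linorder})"
  assumes \<alpha>: "0 < \<alpha>" "\<alpha> < 1" and hol: "holder_01 \<alpha> C" and a: "\<forall>i<I. a i > 0" and T1: "T1 \<le> 1"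
  shows "\<exists>L\<ge>0. \<forall>i<I. \<forall>t\<in>{0..T1}. \<forall>s\<in>{0..T1}. \<forall>p p'. (\<forall>j<I. norm (p j) \<le> \<rho>) \<longrightarrow> (\<forall>j<I. norm (p' j) \<le> \<rho>) \<longrightarrow>
      \<bar>hamiltonian C a I N i t p\<bar> \<le> L \<and>
      \<bar>hamiltonian C a I N i t p - hamiltonian C a I N i s p'\<bar> \<le> L * (\<bar>t - s\<bar> powr (\<alpha> / 2) + (\<Sum>j<I. norm (p j - p' j)))"
proof -
  obtain K where K: "0 \<le> K" "\<And>s t. s \<in> {0..1} \<Longrightarrow> t \<in> {0..1} \<Longrightarrow> norm (C s - C t) \<le> K * \<bar>s - t\<bar> powr \<alpha>"
    "\<And>t. t \<in> {0..1} \<Longrightarrow> norm (C t) \<le> K" by (rule holder_01_bounded[OF hol \<alpha>(1)]) blast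
  \<comment> \<open>The radius \<rho> may be negative, so its positive part is used.\<close>
  define r where "r = max \<rho> 0"
  define c where "c = \<bar>1 / tauSigma a I\<bar>"
  define R where "R = K * r * (1 + c * real I)"
  define E where "E = K * (r + 1) + c * (K * (real I * r + 1))"
  \<comment> \<open>The total weight of the four inner products: 1/(2 a_i), then 1, then a_i/2
    twice.\<close>
  define W where "W i = 1 / (2 * a i) + 1 + a i" for i
  have r: "0 \<le> r" "\<rho> \<le> r" by (auto simp: r_def)
  have c: "0 \<le> c" by (simp add: c_def)
  have R: "0 \<le> R" using K r c by (auto simp: R_def)
  have E: "0 \<le> E" using K r c by (auto simp: E_def)
  have W: "0 \<le> W i" if "i < I" for i
  proof -
    have "0 < a i" using a that by blast
    then have "0 < 1 / (2 * a i)" by simp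
    then show ?thesis using \<open>0 < a i\<close> unfolding W_def by linarith
  qed
  define L where "L = (\<Sum>i<I. W i) * (R * R + 2 * R * E)"
  have L: "0 \<le> L" using W R E by (auto simp: L_def intro!: mult_nonneg_nonneg sum_nonneg)
  have main: "\<bar>hamiltonian C a I N i t p\<bar> \<le> L \<and>
      \<bar>hamiltonian C a I N i t p - hamiltonian C a I N i s p'\<bar> \<le> L * (\<bar>t - s\<bar> powr (\<alpha> / 2) + (\<Sum>j<I. norm (p j - p' j)))"
    if i: "i < I" and t: "t \<in> {0..T1}" and s: "s \<in> {0..T1}" and p: "\<forall>j<I. norm (p j) \<le> \<rho>" and p': "\<forall>j<I. norm (p' j) \<le> \<rho>" for i t s p p'
  proof -
    define d where "d = \<bar>t - s\<bar> powr (\<alpha> / 2) + (\<Sum>j<I. norm (p j - p' j))"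
    have d: "0 \<le> d" unfolding d_def by (auto intro!: add_nonneg_nonneg sum_nonneg)
    have t01: "t \<in> {0..1}" "s \<in> {0..1}" using t s T1 by auto
    have pw: "\<bar>t - s\<bar> powr \<alpha> \<le> d"
    proof -
      have "\<bar>t - s\<bar> powr \<alpha> \<le> \<bar>t - s\<bar> powr (\<alpha> / 2)" using t01 \<alpha> by (intro powr_half_le) auto
      then show ?thesis unfolding d_def by (simp add: add_increasing2 sum_nonneg)
    qed
    have pd: "(\<Sum>j<I. norm (p j - p' j)) \<le> d" unfolding d_def by simp
    have pr: "norm (p j) \<le> r" "norm (p' j) \<le> r" if "j < I" for j using p p' that r(2) order_trans by blast+
    have sp: "norm (\<Sum>j<I. q j) \<le> real I * r" if "\<And>j. j < I \<Longrightarrow> norm (q j) \<le> r" for q :: "nat \<Rightarrow> real^('d::{finite,linorder})"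
    proof -
      have "norm (\<Sum>j<I. q j) \<le> (\<Sum>j<I. r)" by (rule order_trans[OF norm_sum sum_mono]) (use that in auto)
      then show ?thesis by simp
    qed
    have ct: "norm (transpose (C t') *v q) \<le> K * norm q" if "t' \<in> {0..1}" for t' q
      using norm_matrix_vector_le[of "transpose (C t')" q] mult_right_mono[OF K(3)[OF that] norm_ge_zero[of q]] by (simp add: norm_transpose)
    have ctd: "norm (transpose (C t) *v q - transpose (C s) *v q') \<le> K * (m + 1) * d"
      if "norm q \<le> m" "norm (q - q') \<le> d" for q q' m
    proof -
      have m: "0 \<le> m" using that(1) norm_ge_zero order_trans by blast
      have "norm (transpose (C t) *v q - transpose (C s) *v q') \<le> norm (C t - C s) * norm q + norm (C s) * norm (q - q')"
        by (rule norm_transpose_mult_diff)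
      also have "\<dots> \<le> (K * d) * m + K * d"
      proof (intro add_mono mult_mono)
        show "norm (C t - C s) \<le> K * d" using K(2)[OF t01] mult_left_mono[OF pw K(1)] by linarith
        show "norm (C s) \<le> K" by (rule K(3)[OF t01(2)])
      qed (use that K d m in auto)
      finally show ?thesis by (simp add: algebra_simps)
    qed
    have di: "norm (p i - p' i) \<le> d"
    proof -
      have "norm (p i - p' i) \<le> (\<Sum>j<I. norm (p j - p' j))" using i by (intro member_le_sum) auto
      then show ?thesis using pd by linarith
    qed
    have ds: "norm ((\<Sum>j<I. p j) - (\<Sum>j<I. p' j)) \<le> d"
    proof -
      have "norm ((\<Sum>j<I. p j) - (\<Sum>j<I. p' j)) \<le> (\<Sum>j<I. norm (p j - p' j))"
        unfolding sum_subtractf[symmetric] by (rule norm_sum)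
      then show ?thesis using pd by linarith
    qed
    define x where "x t p = (1 / tauSigma a I) *\<^sub>R cbarT N (C t) (\<Sum>j<I. p j)" for t and p :: "nat \<Rightarrow> real^('d::{finite,linorder})"
    define y where "y t p = cbarT N (C t) (p i)" for t and p :: "nat \<Rightarrow> real^('d::{finite,linorder})"
    define z where "z t p = transpose (C t) *v p i" for t and p :: "nat \<Rightarrow> real^('d::{finite,linorder})"
    have KrR: "K * r \<le> R" "c * (K * (real I * r)) \<le> R" using K r c by (auto simp: R_def algebra_simps)
    have bz: "norm (z t' q) \<le> R" "norm (y t' q) \<le> R" if "t' \<in> {0..1}" "norm (q i) \<le> r" for t' q
    proof -
      show "norm (z t' q) \<le> R" unfolding z_def using ct[OF that(1), of "q i"] mult_left_mono[OF that(2) K(1)] KrR by linarith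
      then show "norm (y t' q) \<le> R" unfolding y_def z_def using cbarT_le order_trans by blast
    qed
    have bx: "norm (x t' q) \<le> R" if "t' \<in> {0..1}" "\<And>j. j < I \<Longrightarrow> norm (q j) \<le> r" for t' q
    proof -
      have "norm (cbarT N (C t') (\<Sum>j<I. q j)) \<le> K * (real I * r)"
        using cbarT_le[of N "C t'" "\<Sum>j<I. q j"] ct[OF that(1), of "\<Sum>j<I. q j"] mult_left_mono[OF sp[of q] K(1)] that(2) by fastforce
      then have "c * norm (cbarT N (C t') (\<Sum>j<I. q j)) \<le> c * (K * (real I * r))" using c by (rule mult_left_mono)
      then show ?thesis using KrR by (simp add: x_def c_def)
    qed
    have E1: "K * (r + 1) \<le> E" "c * (K * (real I * r + 1)) \<le> E" using K r c by (auto simp: E_def)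
    have dz: "norm (z t p - z s p') \<le> E * d"
      unfolding z_def using ctd[OF pr(1)[OF i] di] mult_right_mono[OF E1(1) d] by linarith
    have dy: "norm (y t p - y s p') \<le> E * d"
      using dz unfolding y_def z_def by (rule order_trans[OF cbarT_diff_le])
    have dx: "norm (x t p - x s p') \<le> E * d"
    proof -
      have "norm (cbarT N (C t) (\<Sum>j<I. p j) - cbarT N (C s) (\<Sum>j<I. p' j)) \<le> K * (real I * r + 1) * d"
        by (rule order_trans[OF cbarT_diff_le ctd]) (use sp[of p] pr ds in auto)
      then have "c * norm (cbarT N (C t) (\<Sum>j<I. p j) - cbarT N (C s) (\<Sum>j<I. p' j)) \<le> c * (K * (real I * r + 1) * d)" using c by (rule mult_left_mono)
      also have "\<dots> \<le> E * d" using mult_right_mono[OF E1(2) d] by (simp add: mult_ac)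
      finally show ?thesis unfolding x_def scaleR_diff_right[symmetric] by (simp add: c_def)
    qed
    have h: "hamiltonian C a I N i t p = 1 / (2 * a i) * (x t p \<bullet> x t p) - x t p \<bullet> y t p + a i / 2 * (y t p \<bullet> y t p - z t p \<bullet> z t p)" for t p
      by (simp add: hamiltonian_def Let_def x_def y_def z_def power2_norm_eq_inner)
    have ai: "0 < a i" using a i by auto
    have comb: "\<bar>1 / (2 * a i) * A1 - A2 + a i / 2 * (A3 - A4)\<bar> \<le> W i * m" if "\<bar>A1\<bar> \<le> m" "\<bar>A2\<bar> \<le> m" "\<bar>A3\<bar> \<le> m" "\<bar>A4\<bar> \<le> m" for A1 A2 A3 A4 m :: real
    proof -
      have "\<bar>1 / (2 * a i) * A1\<bar> \<le> 1 / (2 * a i) * m" using ai that(1) by (simp add: abs_mult divide_right_mono)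
      moreover have "\<bar>a i / 2 * (A3 - A4)\<bar> \<le> a i / 2 * (2 * m)"
        unfolding abs_mult using ai that(3,4) by (intro mult_mono) auto
      ultimately have "\<bar>1 / (2 * a i) * A1 - A2 + a i / 2 * (A3 - A4)\<bar> \<le> 1 / (2 * a i) * m + m + a i / 2 * (2 * m)" using that(2) by linarith
      then show ?thesis by (simp add: W_def distrib_right)
    qed
    have WL: "W i * m \<le> (\<Sum>i<I. W i) * m" if "0 \<le> m" for m
      using W i that by (intro mult_right_mono member_le_sum) auto
    have bip: "\<bar>g \<bullet> h\<bar> \<le> R * R" if "norm g \<le> R" "norm h \<le> R" for g h :: "real^('d::{finite,linorder})"
      by (rule order_trans[OF Cauchy_Schwarz_ineq2 mult_mono]) (use that R in auto)
    have "\<bar>hamiltonian C a I N i t p\<bar> \<le> W i * (R * R)"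
      unfolding h by (intro comb bip bx bz t01 pr i)
    also have "\<dots> \<le> L" unfolding L_def using WL[of "R * R"] R E W by (auto simp: distrib_left intro!: add_increasing2 mult_nonneg_nonneg sum_nonneg)
    finally have 1: "\<bar>hamiltonian C a I N i t p\<bar> \<le> L" .
    have "hamiltonian C a I N i t p - hamiltonian C a I N i s p' = 1 / (2 * a i) * (x t p \<bullet> x t p - x s p' \<bullet> x s p')
        - (x t p \<bullet> y t p - x s p' \<bullet> y s p') + a i / 2 * ((y t p \<bullet> y t p - y s p' \<bullet> y s p') - (z t p \<bullet> z t p - z s p' \<bullet> z s p'))"
      unfolding h by (simp add: algebra_simps diff_divide_distrib)
    also have "\<bar>\<dots>\<bar> \<le> W i * (2 * R * (E * d))"
      by (intro comb abs_inner_diff_le dx dy dz bx bz t01 pr i R)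
    also have "\<dots> \<le> (\<Sum>i<I. W i) * (2 * R * (E * d))" using R E d by (intro WL) auto
    also have "\<dots> = ((\<Sum>i<I. W i) * (2 * R * E)) * d" by (simp only: mult_ac)
    also have "\<dots> \<le> L * d" unfolding L_def using R E W d
      by (intro mult_right_mono mult_left_mono) (auto intro!: sum_nonneg)
    finally show ?thesis using 1 by (simp add: d_def)
  qed
  show ?thesis using L main by blast
qed

section \<open>Passage between the classical and the integrated formulation\<close>

lemma parabolic_continuous_on:
  fixes f :: "real \<Rightarrow> 'a::metric_space \<Rightarrow> 'b::real_normed_vector"
  assumes "\<And>t s x y. t \<in> {0..T} \<Longrightarrow> s \<in> {0..T} \<Longrightarrow> norm (f t x - f s y) \<le> c * (sqrt \<bar>t - s\<bar> + dist x y) powr \<beta>" "0 < \<beta>"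
  shows "continuous_on ({0..T} \<times> UNIV) (\<lambda>(t,y). f t y)"
  unfolding continuous_on_def
proof clarify
  fix s and y :: 'a assume s: "s \<in> {0..T}"
  let ?F = "at (s, y) within {0..T} \<times> UNIV"
  have "((\<lambda>z. case z of (t, x) \<Rightarrow> f t x) \<longlongrightarrow> f s y) ?F"
  proof (rule Lim_null[THEN iffD2], rule Lim_null_comparison)
    show "\<forall>\<^sub>F z in ?F. norm ((case z of (t, x) \<Rightarrow> f t x) - f s y) \<le> c * (sqrt \<bar>fst z - s\<bar> + dist (snd z) y) powr \<beta>"
      unfolding eventually_at by (intro exI[of _ 1]) (use assms(1)[OF _ s] in auto)
    have "((\<lambda>z. sqrt \<bar>fst z - s\<bar> + dist (snd z) y) \<longlongrightarrow> sqrt \<bar>fst (s,y) - s\<bar> + dist (snd (s,y)) y) ?F"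
      by (intro tendsto_intros)
    then have "((\<lambda>z. (sqrt \<bar>fst z - s\<bar> + dist (snd z) y) powr \<beta>) \<longlongrightarrow> 0) ?F"
      by (intro tendsto_zero_powrI[OF _ tendsto_const]) (use assms(2) in simp_all)
    from tendsto_mult_left[OF this, of c] show "((\<lambda>z. c * (sqrt \<bar>fst z - s\<bar> + dist (snd z) y) powr \<beta>) \<longlongrightarrow> 0) ?F" by simp
  qed
  then show "((\<lambda>(t, y). f t y) \<longlongrightarrow> f s y) ?F" .
qed

context semilinear
begin

text \<open>A bounded time derivative makes u Lipschitz in time, whence the square root modulus of
  the gradient by interpolation. The Hoelder bound of the time derivative gives the integrated
  equation. The constant 4 K is that of \<open>gradient_interpolation\<close>.\<close>

lemma classical_solution_at:
  assumes T: "0 \<le> T" "T \<le> T1" and C: "is_C2a_par \<alpha> T (u i) ut (q i) (Q i)"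
    and eq: "\<And>t y. t \<in> {0..T} \<Longrightarrow> ut t y = - (LA t (Q i t y) + F i t (\<lambda>j. q j t y))"
  shows "\<exists>K. solution_at T u q Q i K"
proof -
  note D = C[unfolded is_C2a_par_def]
  have "bounded ((\<lambda>(t,y). u i t y) ` ({0..T} \<times> UNIV))" using D by (elim conjE)
  moreover have "bounded ((\<lambda>(t,y). ut t y) ` ({0..T} \<times> UNIV))" using D by (elim conjE)
  moreover have "bounded ((\<lambda>(t,y). q i t y) ` ({0..T} \<times> UNIV))" using D by (elim conjE)
  moreover have "bounded ((\<lambda>(t,y). Q i t y) ` ({0..T} \<times> UNIV))" using D by (elim conjE)
  ultimately obtain k0 k1 k2 k3 where k0: "\<And>t y. t \<in> {0..T} \<Longrightarrow> \<bar>u i t y\<bar> \<le> k0" and k1: "\<And>t y. t \<in> {0..T} \<Longrightarrow> \<bar>ut t y\<bar> \<le> k1"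
    and k2: "\<And>t y. t \<in> {0..T} \<Longrightarrow> norm (q i t y) \<le> k2" and k3: "\<And>t y. t \<in> {0..T} \<Longrightarrow> norm (Q i t y) \<le> k3"
    unfolding bounded_iff by fastforce
  have "\<exists>K. \<forall>t\<in>{0..T}. \<forall>s\<in>{0..T}. \<forall>x y. \<bar>ut t x - ut s y\<bar> \<le> K * (sqrt \<bar>t - s\<bar> + dist x y) powr \<alpha>"
    using D by (elim conjE)
  moreover have "\<exists>K. \<forall>t\<in>{0..T}. \<forall>s\<in>{0..T}. \<forall>x y. norm (Q i t x - Q i s y) \<le> K * (sqrt \<bar>t - s\<bar> + dist x y) powr \<alpha>"
    using D by (elim conjE)
  ultimately obtain k4 k5 where k4: "\<And>t s x y. t \<in> {0..T} \<Longrightarrow> s \<in> {0..T} \<Longrightarrow> \<bar>ut t x - ut s y\<bar> \<le> k4 * (sqrt \<bar>t - s\<bar> + dist x y) powr \<alpha>"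
    and k5: "\<And>t s x y. t \<in> {0..T} \<Longrightarrow> s \<in> {0..T} \<Longrightarrow> norm (Q i t x - Q i s y) \<le> k5 * (sqrt \<bar>t - s\<bar> + dist x y) powr \<alpha>"
    by blast
  have dt: "((\<lambda>s. u i s y) has_real_derivative ut t y) (at t within {0..T})" if "t \<in> {0..T}" for t y using D that by blast
  have dy: "(u i t has_derivative (\<lambda>h. q i t y \<bullet> h)) (at y)" "(q i t has_derivative (\<lambda>h. Q i t y *v h)) (at y)" if "t \<in> {0..T}" for t y
    using D that by blast+
  define K where "K = \<bar>k0\<bar> + \<bar>k1\<bar> + \<bar>k2\<bar> + \<bar>k3\<bar> + \<bar>k4\<bar> + \<bar>k5\<bar>"
  have K: "0 \<le> K" "k0 \<le> K" "k1 \<le> K" "k2 \<le> K" "k3 \<le> K" "k4 \<le> K" "k5 \<le> K" by (auto simp: K_def)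
  have C2: "C2 \<alpha> K (u i t) (q i t) (Q i t)" if t: "t \<in> {0..T}" for t
  proof (rule C2I[OF dy[OF t]])
    show "\<bar>u i t y\<bar> \<le> K" "norm (q i t y) \<le> K" "norm (Q i t y) \<le> K" for y
      using k0[OF t, of y] k2[OF t, of y] k3[OF t, of y] K by linarith+
    show "norm (Q i t x - Q i t y) \<le> K * dist x y powr \<alpha>" for x y
      using k5[OF t t, of x y] mult_right_mono[OF K(7), of "dist x y powr \<alpha>"] by simp
  qed (rule alpha)
  have ul: "\<bar>u i t y - u i r y\<bar> \<le> K * \<bar>t - r\<bar>" if "t \<in> {0..T}" "r \<in> {0..T}" for t r y
  proof -
    have "norm (u i t y - u i r y) \<le> K * norm (t - r)"
      by (rule field_differentiable_bound[where S="{0..T}" and f'="\<lambda>t. ut t y"])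
         (use dt k1[of _ y] K that in \<open>auto intro: order_trans\<close>)
    then show ?thesis by simp
  qed
  have ql: "norm (q i t y - q i r y) \<le> 4 * K * sqrt \<bar>t - r\<bar>" if "t \<in> {0..T}" "r \<in> {0..T}" for t r y
  proof (cases "t = r")
    case False
    show ?thesis by (rule gradient_interpolation[OF C2[OF that(1)] C2[OF that(2)] ul[OF that]]) (use False in auto)
  qed simp
  have rem: "\<bar>u i r y - u i t y + (r - t) * (LA r (Q i r y) + F i r (\<lambda>j. q j r y))\<bar> \<le> K * (r - t) powr (1 + \<alpha> / 2)"
    if tr: "0 \<le> t" "t \<le> r" "r \<le> T" for t r y
  proof -
    have r: "r \<in> {0..T}" using tr by auto
    \<comment> \<open>A line with the slope at the later time r is subtracted; what remains has
      derivative ut \<theta> y - ut r y, which is small of order \<alpha>/2.\<close>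
    have "norm ((u i r y - r * ut r y) - (u i t y - t * ut r y)) \<le> (K * (r - t) powr (\<alpha> / 2)) * norm (r - t)"
    proof (rule field_differentiable_bound[where S="{t..r}" and f="\<lambda>\<theta>. u i \<theta> y - \<theta> * ut r y" and f'="\<lambda>\<theta>. ut \<theta> y - ut r y"])
      fix \<theta> assume \<theta>: "\<theta> \<in> {t..r}"
      then have \<theta>': "\<theta> \<in> {0..T}" using tr by auto
      have "((\<lambda>s. u i s y) has_real_derivative ut \<theta> y) (at \<theta> within {t..r})"
        by (rule DERIV_subset[OF dt[OF \<theta>']]) (use tr in auto)
      then show "((\<lambda>\<theta>. u i \<theta> y - \<theta> * ut r y) has_field_derivative ut \<theta> y - ut r y) (at \<theta> within {t..r})"
        by (auto intro!: derivative_eq_intros)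
      have "\<bar>ut \<theta> y - ut r y\<bar> \<le> k4 * (sqrt \<bar>\<theta> - r\<bar> + dist y y) powr \<alpha>" by (rule k4[OF \<theta>' r])
      also have "\<dots> = k4 * \<bar>\<theta> - r\<bar> powr (\<alpha> / 2)" by (simp add: powr_half_sqrt[symmetric] powr_powr)
      also have "\<dots> \<le> K * (r - t) powr (\<alpha> / 2)" using \<theta> K alpha by (intro mult_mono powr_mono2) auto
      finally show "norm (ut \<theta> y - ut r y) \<le> K * (r - t) powr (\<alpha> / 2)" by simp
    qed (use tr in auto)
    moreover have "(K * (r - t) powr (\<alpha> / 2)) * norm (r - t) = K * (r - t) powr (1 + \<alpha> / 2)" using tr by (simp add: powr_add)
    moreover have "(u i r y - r * ut r y) - (u i t y - t * ut r y) = u i r y - u i t y + (r - t) * (LA r (Q i r y) + F i r (\<lambda>j. q j r y))"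
      unfolding eq[OF r] by (simp add: algebra_simps)
    ultimately show ?thesis by (metis real_norm_def)
  qed
  have K4: "K \<le> 4 * K" using K by simp
  have "solution_at T u q Q i (4 * K)"
    unfolding solution_at_def
  proof (intro conjI ballI allI impI)
    show "C2 \<alpha> (4 * K) (u i t) (q i t) (Q i t)" if "t \<in> {0..T}" for t by (rule C2_mono[OF C2[OF that] K4])
    show "norm (q i t y - q i r y) \<le> 4 * K * sqrt \<bar>t - r\<bar>" if "t \<in> {0..T}" "r \<in> {0..T}" for t r y by (rule ql[OF that])
    show "\<bar>u i r y - u i t y + (r - t) * (LA r (Q i r y) + F i r (\<lambda>j. q j r y))\<bar> \<le> 4 * K * (r - t) powr (1 + \<alpha> / 2)"
      if "0 \<le> t" "t \<le> r" "r \<le> T" for t r y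
      by (rule order_trans[OF rem[OF that] mult_right_mono[OF K4]]) simp
  qed
  then show ?thesis by blast
qed

text \<open>Separate moduli in time and space add up to moduli in the parabolic distance. The time
  derivative is given by the equation, so its Hoelder bound is inherited from the Hessian, the
  weights and the nonlinearity.\<close>

lemma regular_is_C2a_par:
  fixes u :: "nat \<Rightarrow> real \<Rightarrow> real^'d \<Rightarrow> real"
  assumes T: "0 \<le> T" "T \<le> T1" and i: "i < I"
    and C: "\<And>i t. i < I \<Longrightarrow> t \<in> {0..T} \<Longrightarrow> C2 \<alpha> K (u i t) (q i t) (Q i t)"
    and ul: "\<And>i t r y. i < I \<Longrightarrow> t \<in> {0..T} \<Longrightarrow> r \<in> {0..T} \<Longrightarrow> \<bar>u i t y - u i r y\<bar> \<le> K * \<bar>t - r\<bar>"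
    and ql: "\<And>i t r y. i < I \<Longrightarrow> t \<in> {0..T} \<Longrightarrow> r \<in> {0..T} \<Longrightarrow> norm (q i t y - q i r y) \<le> K * sqrt \<bar>t - r\<bar>"
    and Ql: "\<And>i t r y. i < I \<Longrightarrow> t \<in> {0..T} \<Longrightarrow> r \<in> {0..T} \<Longrightarrow> norm (Q i t y - Q i r y) \<le> K * \<bar>t - r\<bar> powr (\<alpha> / 2)"
    and dt: "\<And>t y. t \<in> {0..T} \<Longrightarrow> ((\<lambda>s. u i s y) has_real_derivative - (LA t (Q i t y) + F i t (\<lambda>j. q j t y))) (at t within {0..T})"
  shows "is_C2a_par \<alpha> T (u i) (\<lambda>t y. - (LA t (Q i t y) + F i t (\<lambda>j. q j t y))) (q i) (Q i)"
proof -
  have K: "0 \<le> K" using C2_nonneg[OF C[OF i, of 0]] T by auto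
  obtain L where L: "Flip K L" using F_lip[of K] unfolding Flip_def by blast
  then have L0: "0 \<le> L" by (simp add: Flip_def)
  have TT: "t \<in> {0..T1}" if "t \<in> {0..T}" for t using that T by auto
  have reg: "regular K (\<lambda>j. q j t)" if "t \<in> {0..T}" for t
    unfolding regular_def using K C2_bounds(2)[OF C[OF _ that]] C2_lip(2)[OF C[OF _ that] alpha(1)] by blast
  define X where "X t s x y = sqrt \<bar>t - s\<bar> + dist x y" for t s and x y :: "real^'d"
  have X0: "0 \<le> X t s x y" for t s x y by (simp add: X_def)
  have sq: "\<bar>t - s\<bar> powr (\<alpha> / 2) \<le> X t s x y powr \<alpha>" for t s x y
  proof -
    have "\<bar>t - s\<bar> powr (\<alpha> / 2) = sqrt \<bar>t - s\<bar> powr \<alpha>" by (simp add: powr_half_sqrt[symmetric] powr_powr)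
    also have "\<dots> \<le> X t s x y powr \<alpha>" using alpha by (intro powr_mono2) (auto simp: X_def)
    finally show ?thesis .
  qed
  have dq: "dist x y powr \<alpha> \<le> X t s x y powr \<alpha>" for t s x y using alpha by (intro powr_mono2) (auto simp: X_def)
  have uH: "norm (u i t x - u i s y) \<le> K * X t s x y powr 1" if ts: "t \<in> {0..T}" "s \<in> {0..T}" for t s x y
  proof -
    have "\<bar>t - s\<bar> \<le> 1" using ts T T1 by auto
    \<comment> \<open>Times are at most 1, so a Lipschitz bound in time is also one in the parabolic
      distance.\<close>
    then have "\<bar>t - s\<bar> \<le> sqrt \<bar>t - s\<bar>"
      using mult_right_mono[of "\<bar>t - s\<bar>" 1 "\<bar>t - s\<bar>"] by (intro real_le_rsqrt) (simp add: power2_eq_square)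
    then have 1: "K * \<bar>t - s\<bar> \<le> K * sqrt \<bar>t - s\<bar>" using K by (rule mult_left_mono)
    have "norm ((u i t x - u i t y) + (u i t y - u i s y)) \<le> K * dist x y + K * \<bar>t - s\<bar>"
      by (intro norm_triangle_mono) (use lipschitz_byD2[OF C2_lip(1)[OF C[OF i ts(1)] alpha(1)], of x y] ul[OF i ts] in \<open>auto simp: dist_norm\<close>)
    then show ?thesis using 1 X0[of t s x y] by (simp add: X_def algebra_simps)
  qed
  have qH: "norm (q j t x - q j s y) \<le> K * X t s x y" if j: "j < I" and ts: "t \<in> {0..T}" "s \<in> {0..T}" for j t s x y
  proof -
    have "norm ((q j t x - q j t y) + (q j t y - q j s y)) \<le> K * dist x y + K * sqrt \<bar>t - s\<bar>"
      by (intro norm_triangle_mono) (use lipschitz_byD2[OF C2_lip(2)[OF C[OF j ts(1)] alpha(1)], of x y] ql[OF j ts] in \<open>auto simp: dist_norm\<close>)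
    then show ?thesis by (simp add: X_def algebra_simps)
  qed
  \<comment> \<open>A Lipschitz bound in the parabolic distance is used up to distance 1, the sup
    bound beyond it; together they give exponent \<alpha>.\<close>
  have qa: "norm (q j t x - q j s y) \<le> 2 * K * X t s x y powr \<alpha>" if j: "j < I" and ts: "t \<in> {0..T}" "s \<in> {0..T}" for j t s x y
  proof (cases "X t s x y \<le> 1")
    case True
    have "X t s x y \<le> X t s x y powr \<alpha>"
    proof (cases "X t s x y = 0")
      case False
      then have "X t s x y powr 1 \<le> X t s x y powr \<alpha>" using True X0[of t s x y] alpha by (intro powr_mono') auto
      then show ?thesis using X0[of t s x y] by simp
    qed simp
    then have "K * X t s x y \<le> 2 * K * X t s x y powr \<alpha>" using K X0[of t s x y] by (intro mult_mono) auto
    then show ?thesis using qH[OF j ts, of x y] by linarith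
  next
    case False
    have "norm (q j t x - q j s y) \<le> 2 * K * 1"
      using norm_triangle_ineq4[of "q j t x" "q j s y"] C2_bounds(2)[OF C[OF j ts(1)], of x] C2_bounds(2)[OF C[OF j ts(2)], of y] by simp
    also have "\<dots> \<le> 2 * K * X t s x y powr \<alpha>" using False K alpha by (intro mult_left_mono ge_one_powr_ge_zero) auto
    finally show ?thesis .
  qed
  have QH: "norm (Q i t x - Q i s y) \<le> (2 * K) * X t s x y powr \<alpha>" if ts: "t \<in> {0..T}" "s \<in> {0..T}" for t s x y
  proof -
    have "norm (Q i t x - Q i t y) \<le> K * dist x y powr \<alpha>" using C2_bounds(6)[OF C[OF i ts(1)], of y "x - y"] by (simp add: dist_norm)
    also have "\<dots> \<le> K * X t s x y powr \<alpha>" using K dq by (intro mult_left_mono)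
    finally have 1: "norm (Q i t x - Q i t y) \<le> K * X t s x y powr \<alpha>" .
    have 2: "norm (Q i t y - Q i s y) \<le> K * X t s x y powr \<alpha>"
      by (rule order_trans[OF Ql[OF i ts] mult_left_mono[OF sq K]])
    show ?thesis using norm_triangle_mono[OF 1 2] by simp
  qed
  define c where "c = cA * K + cA * (2 * K) + L * (1 + real I * (2 * K))"
  let ?ut = "\<lambda>t y. - (LA t (Q i t y) + F i t (\<lambda>j. q j t y))"
  have tH: "\<bar>?ut t x - ?ut s y\<bar> \<le> c * X t s x y powr \<alpha>" if ts: "t \<in> {0..T}" "s \<in> {0..T}" for t s x y
  proof -
    let ?Z = "X t s x y powr \<alpha>"
    have "\<bar>LA t (Q i t x) - LA s (Q i t x)\<bar> \<le> cA * norm (Q i t x) * \<bar>t - s\<bar> powr (\<alpha> / 2)" by (rule LA_time) (use TT ts in auto)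
    also have "\<dots> \<le> cA * K * ?Z" using cA_nonneg K sq C2_bounds(3)[OF C[OF i ts(1)], of x] by (intro mult_mono mult_left_mono) auto
    finally have 1: "\<bar>LA t (Q i t x) - LA s (Q i t x)\<bar> \<le> cA * K * ?Z" .
    have "\<bar>LA s (Q i t x) - LA s (Q i s y)\<bar> \<le> cA * norm (Q i t x - Q i s y)" unfolding LA_diff[symmetric] by (rule LA_bound) (use TT ts in auto)
    also have "\<dots> \<le> cA * ((2 * K) * ?Z)" using cA_nonneg QH[OF ts] by (intro mult_left_mono) auto
    finally have 2: "\<bar>LA s (Q i t x) - LA s (Q i s y)\<bar> \<le> cA * ((2 * K) * ?Z)" .
    have "\<bar>F i t (\<lambda>j. q j t x) - F i s (\<lambda>j. q j s y)\<bar> \<le> L * (\<bar>t - s\<bar> powr (\<alpha> / 2) + real I * (2 * K * ?Z))"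
      by (rule F_diff[OF L reg[OF ts(1)] reg[OF ts(2)] i TT[OF ts(1)] TT[OF ts(2)]]) (rule qa[OF _ ts])
    also have "\<dots> \<le> L * (?Z + real I * (2 * K * ?Z))" using L0 sq by (intro mult_left_mono add_right_mono) auto
    also have "\<dots> = L * (1 + real I * (2 * K)) * ?Z" by (simp add: algebra_simps)
    finally have 3: "\<bar>F i t (\<lambda>j. q j t x) - F i s (\<lambda>j. q j s y)\<bar> \<le> L * (1 + real I * (2 * K)) * ?Z" .
    have "\<bar>?ut t x - ?ut s y\<bar> \<le> cA * K * ?Z + cA * ((2 * K) * ?Z) + L * (1 + real I * (2 * K)) * ?Z" using 1 2 3 by linarith
    also have "\<dots> = c * ?Z" by (simp add: c_def algebra_simps)
    finally show ?thesis .
  qed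
  have tb: "\<bar>?ut t y\<bar> \<le> cA * K + L" if t: "t \<in> {0..T}" for t y
  proof -
    have "\<bar>LA t (Q i t y)\<bar> \<le> cA * norm (Q i t y)" by (rule LA_bound[OF TT[OF t]])
    also have "\<dots> \<le> cA * K" using cA_nonneg C2_bounds(3)[OF C[OF i t]] by (intro mult_left_mono) auto
    finally have 1: "\<bar>LA t (Q i t y)\<bar> \<le> cA * K" .
    have 2: "\<bar>F i t (\<lambda>j. q j t y)\<bar> \<le> L"
      by (rule FlipD(1)[OF L i TT[OF t] TT[OF t], where p'="\<lambda>j. q j t y"]) (use reg[OF t] in \<open>auto simp: regular_def\<close>)
    show ?thesis using 1 2 by linarith
  qed
  have bd: "bounded ((\<lambda>(t,y). h t y) ` ({0..T} \<times> UNIV))" if "\<And>t y. t \<in> {0..T} \<Longrightarrow> norm (h t y) \<le> m"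
    for h :: "real \<Rightarrow> real^'d \<Rightarrow> 'z::real_normed_vector" and m
    by (rule boundedI[where B=m]) (use that in auto)
  show ?thesis unfolding is_C2a_par_def
  proof (intro conjI ballI allI)
    show "((\<lambda>s. u i s y) has_real_derivative ?ut t y) (at t within {0..T})" if "t \<in> {0..T}" for t y by (rule dt[OF that])
    show "(u i t has_derivative (\<lambda>h. q i t y \<bullet> h)) (at y)" "(q i t has_derivative (\<lambda>h. Q i t y *v h)) (at y)" if "t \<in> {0..T}" for t y
      using C2_deriv[OF C[OF i that] alpha(1)] by auto
    show "continuous_on ({0..T} \<times> UNIV) (\<lambda>(t,y). u i t y)"
      by (rule parabolic_continuous_on[where \<beta>=1]) (use uH in \<open>auto simp: X_def\<close>)
    show "continuous_on ({0..T} \<times> UNIV) (\<lambda>(t,y). ?ut t y)"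
      by (rule parabolic_continuous_on[where \<beta>=\<alpha> and c=c]) (use tH alpha in \<open>auto simp: X_def\<close>)
    show "continuous_on ({0..T} \<times> UNIV) (\<lambda>(t,y). q i t y)"
      by (rule parabolic_continuous_on[where \<beta>=1 and c=K]) (use qH[OF i] in \<open>auto simp: X_def\<close>)
    show "continuous_on ({0..T} \<times> UNIV) (\<lambda>(t,y). Q i t y)"
      by (rule parabolic_continuous_on[where \<beta>=\<alpha> and c="2 * K"]) (use QH alpha in \<open>auto simp: X_def\<close>)
    show "bounded ((\<lambda>(t,y). u i t y) ` ({0..T} \<times> UNIV))" by (rule bd[of _ K]) (use C2_bounds(1)[OF C[OF i]] in auto)
    show "bounded ((\<lambda>(t,y). ?ut t y) ` ({0..T} \<times> UNIV))" by (rule bd[of _ "cA * K + L"]) (use tb in auto)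
    show "bounded ((\<lambda>(t,y). q i t y) ` ({0..T} \<times> UNIV))" by (rule bd[of _ K]) (use C2_bounds(2)[OF C[OF i]] in auto)
    show "bounded ((\<lambda>(t,y). Q i t y) ` ({0..T} \<times> UNIV))" by (rule bd[of _ K]) (use C2_bounds(3)[OF C[OF i]] in auto)
    show "\<exists>K. \<forall>t\<in>{0..T}. \<forall>s\<in>{0..T}. \<forall>x y. \<bar>?ut t x - ?ut s y\<bar> \<le> K * (sqrt \<bar>t - s\<bar> + dist x y) powr \<alpha>"
      using tH unfolding X_def by blast
    show "\<exists>K. \<forall>t\<in>{0..T}. \<forall>s\<in>{0..T}. \<forall>x y. norm (Q i t x - Q i s y) \<le> K * (sqrt \<bar>t - s\<bar> + dist x y) powr \<alpha>"
      using QH unfolding X_def by blast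
  qed
qed

end

theorem theoremA5:
  fixes \<alpha> \<delta>l \<delta>u :: real
    and C :: "real \<Rightarrow> real^('d::{finite,linorder})^('d::{finite,linorder})"
    and a :: "nat \<Rightarrow> real" and I N :: nat
    and g :: "nat \<Rightarrow> real^('d::{finite,linorder}) \<Rightarrow> real"
  assumes "0 < \<alpha>" "\<alpha> < 1"
    and "1 \<le> N" "N \<le> CARD('d)" "1 \<le> I"
    and "\<forall>i<I. a i > 0"
    and "0 < \<delta>l" "\<delta>l < \<delta>u"
    and "holder_01 \<alpha> C"
    and "\<forall>t\<in>{0..1}. \<forall>y. \<delta>l * (norm y)\<^sup>2 \<le> y \<bullet> ((C t ** transpose (C t)) *v y)
                          \<and> y \<bullet> ((C t ** transpose (C t)) *v y) \<le> \<delta>u * (norm y)\<^sup>2"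
    and "\<forall>i<I. g i \<in> C2a_space \<alpha>"
  shows "\<exists>T0. 0 < T0 \<and> T0 \<le> 1 \<and>
           (\<forall>T. 0 < T \<and> T < T0 \<longrightarrow>
              (\<exists>u. (\<forall>i<I. u i \<in> C2a_par \<alpha> T) \<and> solves_system \<alpha> T C a I N g u \<and>
                   (\<forall>v. (\<forall>i<I. v i \<in> C2a_par \<alpha> T) \<and> solves_system \<alpha> T C a I N g v \<longrightarrow>
                        (\<forall>i<I. \<forall>t\<in>{0..T}. \<forall>y. v i t y = u i t y))))"
proof -
  note \<alpha> = assms(1,2)
  have ell: "\<delta>l * (norm y)\<^sup>2 \<le> y \<bullet> ((C 0 ** transpose (C 0)) *v y)" for y using assms(10) by auto
  obtain ks v w T1 K0 where dif: "diffusion ks v w T1 K0 \<alpha>" and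
    tr: "\<And>t Q. t \<in> {0..T1} \<Longrightarrow> (\<Sum>(v,b)\<leftarrow>ks. b t / 2 * (v \<bullet> (Q *v v))) = 1 / 2 * trace (Q ** C t ** transpose (C t))"
    by (rule diffusion_decomposition[OF \<alpha> assms(9,7) ell], rule that; assumption)
  interpret diffusion ks v w T1 K0 \<alpha> by (rule dif)
  interpret semilinear ks v w T1 K0 \<alpha> I "hamiltonian C a I N"
    by unfold_locales (rule hamiltonian_lipschitz[OF \<alpha> assms(9,6) T1(2)])
  have LA: "LA t Q = 1 / 2 * trace (Q ** C t ** transpose (C t))" if "t \<in> {0..T1}" for t Q
    unfolding LA_def by (rule tr[OF that])
  \<comment> \<open>Any classical solution, with whatever derivatives witness it, lies in the
    uniqueness class; the constant may depend on the solution.\<close>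
  have sys: "\<exists>K q Q. solution T K u q Q \<and> (\<forall>i<I. u i T = g i)" if sol: "solves_system \<alpha> T C a I N g u" and T: "0 < T" "T \<le> T1" for T u
  proof -
    obtain ut q Q where r: "\<And>i. i < I \<Longrightarrow> is_C2a_par \<alpha> T (u i) (ut i) (q i) (Q i)" and fin: "\<And>i y. i < I \<Longrightarrow> u i T y = g i y"
      and e: "\<And>i t y. i < I \<Longrightarrow> t \<in> {0..T} \<Longrightarrow>
         (let lam = (1 / tauSigma a I) *\<^sub>R cbarT N (C t) (\<Sum>j<I. q j t y)
          in ut i t y + 1 / (2 * a i) * (norm lam)\<^sup>2
             - lam \<bullet> cbarT N (C t) (q i t y)
             + a i / 2 * ((norm (cbarT N (C t) (q i t y)))\<^sup>2
                          - (norm (transpose (C t) *v q i t y))\<^sup>2)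
             + 1 / 2 * trace (Q i t y ** C t ** transpose (C t)) = 0)"
      using sol unfolding solves_system_def by blast
    have eq: "ut i t y = - (LA t (Q i t y) + hamiltonian C a I N i t (\<lambda>j. q j t y))" if "i < I" "t \<in> {0..T}" for i t y
    proof -
      have "t \<in> {0..T1}" using that T by auto
      then show ?thesis using e[OF that, of y] by (simp add: LA hamiltonian_def Let_def)
    qed
    have ex1: "\<exists>K. solution_at T u q Q i K" if "i < I" for i
    proof (rule classical_solution_at[where ut="ut i"])
      show "is_C2a_par \<alpha> T (u i) (ut i) (q i) (Q i)" by (rule r[OF that])
      show "ut i t y = - (LA t (Q i t y) + hamiltonian C a I N i t (\<lambda>j. q j t y))" if "t \<in> {0..T}" for t y
        by (rule eq[OF \<open>i < I\<close> that])
    qed (use T in auto)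
    have "\<exists>K\<ge>0. \<forall>i<I. solution_at T u q Q i K"
      by (rule uniform_constant) (use ex1 solution_at_mono in blast)+
    then obtain K where "solution T K u q Q" unfolding solution_def by blast
    moreover have "\<forall>i<I. u i T = g i" using fin by auto
    ultimately show ?thesis by blast
  qed
  \<comment> \<open>Both derivatives of a terminal function are packed into one pair, so that a
    single choice over i supplies them.\<close>
  have "\<exists>DH K. C2 \<alpha> K (g i) (fst DH) (snd DH)" if i: "i < I" for i
  proof -
    have "g i \<in> C2a_space \<alpha>" using assms(11) i by blast
    then obtain Dg Hg k where d: "\<And>y. (g i has_derivative (\<lambda>h. Dg y \<bullet> h)) (at y)" "\<And>y. (Dg has_derivative (\<lambda>h. Hg y *v h)) (at y)"
      and b: "bounded (range (g i))" "bounded (range Dg)" "bounded (range Hg)" and k: "\<And>x y. norm (Hg x - Hg y) \<le> k * dist x y powr \<alpha>"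
      unfolding C2a_space_def by blast
    obtain k0 k1 k2 where kk: "\<And>y. \<bar>g i y\<bar> \<le> k0" "\<And>y. norm (Dg y) \<le> k1" "\<And>y. norm (Hg y) \<le> k2"
      using b unfolding bounded_iff by auto
    define K where "K = \<bar>k\<bar> + \<bar>k0\<bar> + \<bar>k1\<bar> + \<bar>k2\<bar>"
    have K: "k0 \<le> K" "k1 \<le> K" "k2 \<le> K" "k \<le> K" by (auto simp: K_def)
    have "C2 \<alpha> K (g i) Dg Hg"
    proof (rule C2I[OF d])
      show "\<bar>g i y\<bar> \<le> K" "norm (Dg y) \<le> K" "norm (Hg y) \<le> K" for y
        using kk(1)[of y] kk(2)[of y] kk(3)[of y] K by linarith+
      show "norm (Hg x - Hg y) \<le> K * dist x y powr \<alpha>" for x y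
        by (rule order_trans[OF k mult_right_mono[OF K(4)]]) simp
    qed (rule \<alpha>)
    then show ?thesis by (intro exI[of _ "(Dg, Hg)"]) auto
  qed
  then have "\<forall>i\<in>{..<I}. \<exists>DH. \<exists>K. C2 \<alpha> K (g i) (fst DH) (snd DH)" by blast
  from bchoice[OF this] obtain DH where DH: "\<And>i. i < I \<Longrightarrow> \<exists>K. C2 \<alpha> K (g i) (fst (DH i)) (snd (DH i))" by blast
  define Dg Hg where "Dg i = fst (DH i)" and "Hg i = snd (DH i)" for i
  have "\<exists>K\<ge>0. \<forall>i<I. C2 \<alpha> K (g i) (Dg i) (Hg i)"
    unfolding Dg_def Hg_def by (rule uniform_constant) (use DH C2_mono in blast)+
  then obtain G where G: "0 \<le> G" "\<And>i. i < I \<Longrightarrow> C2 \<alpha> G (g i) (Dg i) (Hg i)" by blast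
  note bc = C2_bc[OF G(2) \<alpha>(1)]
  have gC: "C2 \<alpha> G (apply_bcontfun (Bcontfun (g i))) (apply_bcontfun (Bcontfun (Dg i))) (apply_bcontfun (Bcontfun (Hg i)))" if "i < I" for i
    unfolding bc[OF that] by (rule G(2)[OF that])
  obtain T0 where T0: "0 < T0" "T0 \<le> T1" and ex: "\<And>T. 0 < T \<Longrightarrow> T \<le> T0 \<Longrightarrow>
     (\<exists>u q Q K. \<forall>i<I. u i T = Bcontfun (g i) \<and>
     (\<forall>t\<in>{0..T}. C2 \<alpha> K (apply_bcontfun (u i t)) (q i t) (Q i t) \<and>
       (\<forall>r\<in>{0..T}. \<forall>y. \<bar>apply_bcontfun (u i t) y - apply_bcontfun (u i r) y\<bar> \<le> K * \<bar>t - r\<bar> \<and> norm (q i t y - q i r y) \<le> K * sqrt \<bar>t - r\<bar> \<and>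
          norm (Q i t y - Q i r y) \<le> K * \<bar>t - r\<bar> powr (\<alpha> / 2)) \<and>
       (\<forall>y. ((\<lambda>s. apply_bcontfun (u i s) y) has_real_derivative - (LA t (Q i t y) + hamiltonian C a I N i t (\<lambda>j. q j t y))) (at t within {0..T}))))"
    using existence[where gb="\<lambda>i. Bcontfun (g i)" and Dg="\<lambda>i. Bcontfun (Dg i)" and Hg="\<lambda>i. Bcontfun (Hg i)" and G=G, OF gC G(1)] by blast
  have "\<exists>u. (\<forall>i<I. u i \<in> C2a_par \<alpha> T) \<and> solves_system \<alpha> T C a I N g u \<and>
                   (\<forall>v. (\<forall>i<I. v i \<in> C2a_par \<alpha> T) \<and> solves_system \<alpha> T C a I N g v \<longrightarrow>
                        (\<forall>i<I. \<forall>t\<in>{0..T}. \<forall>y. v i t y = u i t y))" if T: "0 < T" "T < T0" for T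
  proof -
    have T': "0 \<le> T" "T \<le> T1" "T \<le> T0" using T T0 by auto
    obtain ub q Q K where u: "\<forall>i<I. ub i T = Bcontfun (g i) \<and>
     (\<forall>t\<in>{0..T}. C2 \<alpha> K (apply_bcontfun (ub i t)) (q i t) (Q i t) \<and>
       (\<forall>r\<in>{0..T}. \<forall>y. \<bar>apply_bcontfun (ub i t) y - apply_bcontfun (ub i r) y\<bar> \<le> K * \<bar>t - r\<bar> \<and> norm (q i t y - q i r y) \<le> K * sqrt \<bar>t - r\<bar> \<and>
          norm (Q i t y - Q i r y) \<le> K * \<bar>t - r\<bar> powr (\<alpha> / 2)) \<and>
       (\<forall>y. ((\<lambda>s. apply_bcontfun (ub i s) y) has_real_derivative - (LA t (Q i t y) + hamiltonian C a I N i t (\<lambda>j. q j t y))) (at t within {0..T})))"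
      using ex[OF T(1) T'(3)] by blast
    define u where "u i t = apply_bcontfun (ub i t)" for i t
    define ut where "ut i t y = - (LA t (Q i t y) + hamiltonian C a I N i t (\<lambda>j. q j t y))" for i t y
    have reg: "is_C2a_par \<alpha> T (u i) (ut i) (q i) (Q i)" if i: "i < I" for i
      unfolding ut_def[abs_def] by (rule regular_is_C2a_par[OF T'(1,2) i, where K=K]) (use u i in \<open>auto simp: u_def\<close>)
    have fin: "u i T y = g i y" if "i < I" for i y using u that bc(1)[OF that] by (simp add: u_def)
    have eq: "(let lam = (1 / tauSigma a I) *\<^sub>R cbarT N (C t) (\<Sum>j<I. q j t y)
          in ut i t y + 1 / (2 * a i) * (norm lam)\<^sup>2
             - lam \<bullet> cbarT N (C t) (q i t y)
             + a i / 2 * ((norm (cbarT N (C t) (q i t y)))\<^sup>2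
                          - (norm (transpose (C t) *v q i t y))\<^sup>2)
             + 1 / 2 * trace (Q i t y ** C t ** transpose (C t)) = 0)" if "i < I" "t \<in> {0..T}" for i t y
    proof -
      have "t \<in> {0..T1}" using that T' by auto
      then show ?thesis by (simp add: ut_def LA hamiltonian_def Let_def)
    qed
    have sol: "solves_system \<alpha> T C a I N g u" unfolding solves_system_def using reg fin eq by blast
    have mem: "\<forall>i<I. u i \<in> C2a_par \<alpha> T" using reg unfolding C2a_par_def by blast
    \<comment> \<open>The constructed solution also passes through \<open>sys\<close>, so that both
      enter \<open>solution_unique\<close> on equal terms, each with its own witnesses and
      constant.\<close>
    have "z i t y = u i t y" if z: "solves_system \<alpha> T C a I N g z" and it: "i < I" "t \<in> {0..T}" for z i t y
    proof -
      obtain K1 q1 Q1 where 1: "solution T K1 z q1 Q1" "\<forall>i<I. z i T = g i" using sys[OF z T(1) T'(2)] by blast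
      obtain K2 q2 Q2 where 2: "solution T K2 u q2 Q2" "\<forall>i<I. u i T = g i" using sys[OF sol T(1) T'(2)] by blast
      have "z i t = u i t" by (rule solution_unique[OF T'(1,2) 1(1) 2(1) _ it]) (use 1(2) 2(2) in auto)
      then show ?thesis by simp
    qed
    then show ?thesis using sol mem by blast
  qed
  then show ?thesis using T0 T1 by (intro exI[of _ T0]) auto
qed

end
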